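(* Let $n\ge1$, let $\kappa_0,\kappa_1>0$, and for $i=0,1$ let $\mu_i$ be a $\kappa_i$-strongly log-concave probability measure on $\mathbb{R}^n$. Let $(\mu_t)_{t\in[0,1]}$ be the constant-speed quadratic Wasserstein geodesic from $\mu_0$ to $\mu_1$, and set $m_i=\int x\,\mathrm d\mu_i$. Fix $t\in(0,1)$. Then $$C_P(\mu_t)=\left(\frac{1-t}{\sqrt{\kappa_0}}+\frac{t}{\sqrt{\kappa_1}}\right)^2$$ if and only if there exists a unit vector $e\in\mathbb{R}^n$ such that, under the orthogonal decomposition $\mathbb{R}^n=\mathbb{R}e\oplus e^\perp$, the coordinate map $\mathcal C_e(x)=(e\cdot x,P_{e^\perp}x)$ satisfies, for some $\nu_0,\nu_1\in\mathcal P(e^\perp)$, $$(\mathcal C_e)_\#\mu_i=N\big(\langle e,m_i\rangle,\kappa_i^{-1}\big)\otimes\nu_i,\qquad i=0,1.$$ In this case the optimal transport between $\mu_0$ and $\mu_1$ splits along the same decomposition, and $$C_P(\mu_s)=\left(\frac{1-s}{\sqrt{\kappa_0}}+\frac{s}{\sqrt{\kappa_1}}\right)^2\qquad\text{for every } s\in[0,1].$$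
   Context: A probability measure $\mu$ on $\mathbb{R}^n$ is $\kappa$-strongly log-concave ($\kappa>0$) if $\mathrm d\mu=e^{-V}\,\mathrm dx$ with $V:\mathbb{R}^n\to(-\infty,+\infty]$ proper and lower semicontinuous and $V-\kappa|x|^2/2$ convex. $\operatorname{Var}_\mu(f)=\int|f-\int f\,\mathrm d\mu|^2\,\mathrm d\mu$. The Poincaré constant $C_P(\mu)$ is the least $C\in[0,\infty]$ such that $\operatorname{Var}_\mu(f)\le C\int|\nabla f|^2\,\mathrm d\mu$ for every $f\in C_c^\infty(\mathbb{R}^n)$. Geodesic: let $T$ be the Brenier map, i.e. the ($\mu_0$-a.e. unique) optimal transport map from $\mu_0$ to $\mu_1$ for the cost $|x-y|^2$; then $\mu_t=(F_t)_\#\mu_0$ with $F_t=(1-t)I+tT$, $t\in[0,1]$, $I$ the identity map. $N(m,\sigma^2)$ is the Gaussian law with mean $m$ and variance $\sigma^2$; $P_{e^\perp}$ is the orthogonal projection onto $e^\perp$; $\mathcal P(e^\perp)$ is the set of Borel probability measures on $e^\perp$. "The optimal transport splits along $\mathbb{R}e\oplus e^\perp$" means: the unique quadratic optimal plan between $\mu_0$ and $\mu_1$ is, in these coordinates, the product of an optimal plan between the two one-dimensional Gaussian factors and an optimal plan between $\nu_0$ and $\nu_1$. *)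

theory Defs
  imports "HOL-Probability.Probability"
begin

section \<open>Strong log-concavity\<close>

definition lower_semicontinuous :: "('a::topological_space \<Rightarrow> ereal) \<Rightarrow> bool" where
  "lower_semicontinuous V \<longleftrightarrow> (\<forall>x. V x \<le> Liminf (at x) V)"

text \<open>Functions with values in \<open>(-\<infinity>, \<infinity>]\<close> that are finite somewhere.\<close>

definition proper :: "('a \<Rightarrow> ereal) \<Rightarrow> bool" where
  "proper V \<longleftrightarrow> (\<forall>x. V x \<noteq> -\<infinity>) \<and> (\<exists>x. V x \<noteq> \<infinity>)"

text \<open>The analogue of \<^const>\<open>convex_on\<close>, on the whole space, for functions that avoid \<open>-\<infinity>\<close>; note
  that \<open>0 * \<infinity> = 0\<close> in \<^typ>\<open>ereal\<close>, so the end points \<open>u = 0\<close> and \<open>v = 0\<close> are harmless.\<close>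

definition ereal_convex :: "('a::real_vector \<Rightarrow> ereal) \<Rightarrow> bool" where
  "ereal_convex W \<longleftrightarrow>
     (\<forall>x y. \<forall>u\<ge>0. \<forall>v\<ge>0. u + v = 1 \<longrightarrow>
        W (u *\<^sub>R x + v *\<^sub>R y) \<le> ereal u * W x + ereal v * W y)"

definition exp_minus :: "ereal \<Rightarrow> ennreal" where
  "exp_minus v = (case v of ereal r \<Rightarrow> ennreal (exp (- r)) | PInfty \<Rightarrow> 0 | MInfty \<Rightarrow> \<infinity>)"

definition strongly_log_concave :: "real \<Rightarrow> 'a::euclidean_space measure \<Rightarrow> bool" where
  "strongly_log_concave \<kappa> \<mu> \<longleftrightarrow>
     prob_space \<mu> \<and>
     (\<exists>V. proper V \<and> lower_semicontinuous V \<and>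
          ereal_convex (\<lambda>x. V x - ereal (\<kappa> * (norm x)\<^sup>2 / 2)) \<and>
          \<mu> = density lborel (\<lambda>x. exp_minus (V x)))"


section \<open>The Poincare constant\<close>

primrec Ck :: "nat \<Rightarrow> ('a::euclidean_space \<Rightarrow> real) \<Rightarrow> bool" where
  "Ck 0 f \<longleftrightarrow> continuous_on UNIV f"
| "Ck (Suc k) f \<longleftrightarrow>
     (\<forall>x. f differentiable (at x)) \<and> (\<forall>v. Ck k (\<lambda>x. frechet_derivative f (at x) v))"

definition test_function :: "('a::euclidean_space \<Rightarrow> real) \<Rightarrow> bool" where
  "test_function f \<longleftrightarrow> (\<forall>k. Ck k f) \<and> compact (closure {x. f x \<noteq> 0})"

definition gradient :: "('a::real_inner \<Rightarrow> real) \<Rightarrow> 'a \<Rightarrow> 'a" where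
  "gradient f x = (THE D. GDERIV f x :> D)"

definition Var :: "'a measure \<Rightarrow> ('a \<Rightarrow> real) \<Rightarrow> real" where
  "Var \<mu> f = (\<integral>x. \<bar>f x - (\<integral>y. f y \<partial>\<mu>)\<bar>\<^sup>2 \<partial>\<mu>)"

text \<open>The infimum over \<^typ>\<open>ennreal\<close> is attained whenever it is finite, and it is \<open>\<infinity>\<close> if no finite
  constant is admissible (even if \<open>C = \<infinity>\<close> itself fails because \<open>\<infinity> * 0 = 0\<close>).\<close>

definition poincare_constant :: "'a::euclidean_space measure \<Rightarrow> ennreal" where
  "poincare_constant \<mu> =
     Inf {C. \<forall>f. test_function f \<longrightarrow>
               ennreal (Var \<mu> f) \<le> C * (\<integral>\<^sup>+x. ennreal ((norm (gradient f x))\<^sup>2) \<partial>\<mu>)}"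


section \<open>Quadratic optimal transport\<close>

definition coupling :: "'a measure \<Rightarrow> 'b measure \<Rightarrow> ('a \<times> 'b) measure \<Rightarrow> bool" where
  "coupling \<mu> \<nu> \<pi> \<longleftrightarrow>
     sets \<pi> = sets (\<mu> \<Otimes>\<^sub>M \<nu>) \<and> distr \<pi> \<mu> fst = \<mu> \<and> distr \<pi> \<nu> snd = \<nu>"

definition quadratic_cost :: "('a::metric_space \<times> 'a) measure \<Rightarrow> ennreal" where
  "quadratic_cost \<pi> = (\<integral>\<^sup>+z. ennreal ((dist (fst z) (snd z))\<^sup>2) \<partial>\<pi>)"

definition optimal_plan ::
  "'a::metric_space measure \<Rightarrow> 'a measure \<Rightarrow> ('a \<times> 'a) measure \<Rightarrow> bool" where
  "optimal_plan \<mu> \<nu> \<pi> \<longleftrightarrow>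
     coupling \<mu> \<nu> \<pi> \<and> (\<forall>\<pi>'. coupling \<mu> \<nu> \<pi>' \<longrightarrow> quadratic_cost \<pi> \<le> quadratic_cost \<pi>')"

text \<open>\<open>T\<close> is an optimal map if the plan \<open>(id, T)\<^sub>#\<mu>\<close> is optimal; in particular
  \<open>T\<^sub>#\<mu> = \<nu>\<close>.\<close>

definition optimal_map ::
  "'a::metric_space measure \<Rightarrow> 'a measure \<Rightarrow> ('a \<Rightarrow> 'a) \<Rightarrow> bool" where
  "optimal_map \<mu> \<nu> T \<longleftrightarrow>
     T \<in> \<mu> \<rightarrow>\<^sub>M \<nu> \<and> optimal_plan \<mu> \<nu> (distr \<mu> (\<mu> \<Otimes>\<^sub>M \<nu>) (\<lambda>x. (x, T x)))"

definition wasserstein_geodesic ::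
  "'a::euclidean_space measure \<Rightarrow> 'a measure \<Rightarrow> (real \<Rightarrow> 'a measure) \<Rightarrow> bool" where
  "wasserstein_geodesic \<mu>\<^sub>0 \<mu>\<^sub>1 \<mu> \<longleftrightarrow>
     (\<exists>T. optimal_map \<mu>\<^sub>0 \<mu>\<^sub>1 T \<and>
          (\<forall>t\<in>{0..1}. \<mu> t = distr \<mu>\<^sub>0 borel (\<lambda>x. (1 - t) *\<^sub>R x + t *\<^sub>R T x)))"


section \<open>Splitting off a Gaussian factor\<close>

definition gaussian :: "real \<Rightarrow> real \<Rightarrow> real measure" where
  "gaussian m v = density lborel (\<lambda>x. ennreal (normal_density m (sqrt v) x))"

definition perp_borel :: "'a::euclidean_space \<Rightarrow> 'a measure" where
  "perp_borel e = restrict_space borel ({e}\<^sup>\<bottom>)"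

text \<open>For a unit vector \<open>e\<close>, this is the orthogonal projection onto \<open>e\<^sup>\<bottom>\<close>.\<close>

definition perp_proj :: "'a::euclidean_space \<Rightarrow> 'a \<Rightarrow> 'a" where
  "perp_proj e x = x - (e \<bullet> x) *\<^sub>R e"

definition coord :: "'a::euclidean_space \<Rightarrow> 'a \<Rightarrow> real \<times> 'a" where
  "coord e x = (e \<bullet> x, perp_proj e x)"

definition splits_gaussian ::
  "'a::euclidean_space \<Rightarrow> real \<Rightarrow> 'a measure \<Rightarrow> 'a measure \<Rightarrow> bool" where
  "splits_gaussian e \<kappa> \<mu> \<nu> \<longleftrightarrow>
     distr \<mu> (borel \<Otimes>\<^sub>M perp_borel e) (coord e) =
       gaussian (e \<bullet> (\<integral>x. x \<partial>\<mu>)) (inverse \<kappa>) \<Otimes>\<^sub>M \<nu>"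

text \<open>\<open>coord2 e\<close> reads a pair \<open>(x, y)\<close> in the coordinates of \<open>e\<close> and groups the two scalar
  coordinates and the two orthogonal components, so that a plan on \<open>(\<real>e \<oplus> e\<^sup>\<bottom>)\<^sup>2\<close> can be compared
  with a product of a plan on \<open>\<real>\<^sup>2\<close> and a plan on \<open>(e\<^sup>\<bottom>)\<^sup>2\<close>.\<close>

definition coord2 :: "'a::euclidean_space \<Rightarrow> 'a \<times> 'a \<Rightarrow> (real \<times> real) \<times> ('a \<times> 'a)" where
  "coord2 e = (\<lambda>(x, y). ((e \<bullet> x, e \<bullet> y), (perp_proj e x, perp_proj e y)))"

definition optimal_transport_splits ::
  "'a::euclidean_space \<Rightarrow> 'a measure \<Rightarrow> 'a measure \<Rightarrow> real measure \<Rightarrow> real measure \<Rightarrow>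
   'a measure \<Rightarrow> 'a measure \<Rightarrow> bool" where
  "optimal_transport_splits e \<mu>\<^sub>0 \<mu>\<^sub>1 \<gamma>\<^sub>0 \<gamma>\<^sub>1 \<nu>\<^sub>0 \<nu>\<^sub>1 \<longleftrightarrow>
     (\<exists>!\<pi>. optimal_plan \<mu>\<^sub>0 \<mu>\<^sub>1 \<pi>) \<and>
     (\<forall>\<pi>. optimal_plan \<mu>\<^sub>0 \<mu>\<^sub>1 \<pi> \<longrightarrow>
        (\<exists>\<rho> \<sigma>. optimal_plan \<gamma>\<^sub>0 \<gamma>\<^sub>1 \<rho> \<and> optimal_plan \<nu>\<^sub>0 \<nu>\<^sub>1 \<sigma> \<and>
           distr \<pi> ((borel \<Otimes>\<^sub>M borel) \<Otimes>\<^sub>M (perp_borel e \<Otimes>\<^sub>M perp_borel e)) (coord2 e) =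
             \<rho> \<Otimes>\<^sub>M \<sigma>))"

end

theory Submission
 imports Defs "HOL-Library.Diagonal_Subsequence"
begin

text \<open>Let \<open>y\<close> transport \<open>\<mu>\<^sub>0\<close> to its perturbation with density \<open>1 + \<epsilon> (f \<circ> F\<^sub>t - mean)\<close>. Strong log-concavity of \<open>\<mu>\<^sub>0\<close> and
\<open>\<mu>\<^sub>1\<close> (Prekopa--Leindler, transport-entropy inequality) bounds both \<open>sqrt \<kappa>\<^sub>0 (y - id) / \<epsilon>\<close> and \<open>sqrt \<kappa>\<^sub>1 (T \<circ> y - T) / \<epsilon>\<close> in \<open>L\<^sup>2\<close>
by the standard deviation of \<open>f \<circ> F\<^sub>t\<close>, up to \<open>o(1)\<close>; expanding \<open>f \<circ> F\<^sub>t \<circ> y\<close> then yields the upper bound for \<open>C\<^sub>P(\<mu>\<^sub>t)\<close>. For nearly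
extremal \<open>f\<close> both displacements are close to a multiple of \<open>\<nabla>f \<circ> F\<^sub>t\<close>, and a Poincare inequality for \<open>u(x) - u(y)\<close> on the
doubled space forces this field to be almost a constant vector; in the limit it gives a unit vector \<open>e\<close> with
\<open>Var(e \<bullet> x) = 1 / \<kappa>\<^sub>i\<close> under both measures. Perturbing the extremal linear function gives Stein's identity in direction \<open>e\<close>,
which makes \<open>e \<bullet> x\<close> Gaussian and independent of the projection to the complement of \<open>e\<close>.\<close>

text \<open>No regularity of \<open>T\<close> is used, so there is no linearised Monge-Ampere
  equation to work with: everything rests on finite displacements and on convexity inequalities for
  the potentials. An extremal test function need not exist either, so equality is treated
  quantitatively, for nearly extremal ones. An ordinary Poincare inequality for the difference
  \<open>phi - th\<close> of two potentials bounds its variance by \<open>1 / ka0\<close> times the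
  mean square of its gradient and says nothing about the shape of that gradient. The doubled
  inequality replaces this mean square by its average with the squared norm of the mean gradient,
  which is smaller by half the variance of the gradient; near equality therefore makes the gradient
  nearly constant. That near equality does occur is seen from the covariance of
  \<open>phi - th\<close> with the test function, and this covariance is read off from a second,
  much smaller perturbation. The ratio of the two scales is the same small number \<open>r\<close>
  that measures the other errors. As all constants are explicit, the limit only needs compactness of
  the unit sphere.\<close>

notation scaleR (infixr "*." 75) and inner (infixl "<.>" 70) and pair_measure (infixr "><" 80)
 and measurable (infixr "->M" 60)

abbreviation NN where "NN == nn_integral"
abbreviation nnl (binder "NL " 10) where "nnl f == nn_integral lborel f"
abbreviation vol where "vol == emeasure lborel"
abbreviation bm where "bm == borel_measurable"
abbreviation BM where "BM == borel_measurable borel"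
abbreviation dens where "dens f == density lborel (%x. ennreal (f x))"
abbreviation lims (infixr "---->" 60) where "X ----> L == filterlim X (nhds L) sequentially"
lemmas I_bound = Bochner_Integration.integrable_bound and I_cong = Bochner_Integration.integral_cong

section \<open>Brunn-Minkowski on the line and the Prekopa-Leindler inequality\<close>

text \<open>\<open>inner_regular\<close> is for finite measures, so Lebesgue measure is first
  restricted to an interval that already carries more than \<open>c\<close> of
  \<open>A\<close>.\<close>

lemma lborel_inner_compact:
 fixes A :: "real set"
 assumes A: "A : sets borel" and lt: "c < vol A"
 shows "EX K. compact K & K <= A & c < vol K"
proof -
 have "vol A = (SUP n. vol (A Int {-real n..real n}))"
 proof (subst SUP_emeasure_incseq)
  show "incseq (%n. A Int {-real n..real n})" by (auto simp: incseq_def)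
  have "A = (UN n. A Int {-real n..real n})"
  proof safe
   fix x assume "x : A"
   obtain n where "abs x <= real n" using real_arch_simple by blast
   thus "x : (UN n. A Int {-real n..real n})" using `x : A` by (auto intro!: exI[of _ n])
  qed
  thus "vol A = vol (UN n. A Int {-real n..real n})" by simp
 qed (use A in auto)
 then obtain n where n: "c < vol (A Int {-real n..real n})" using lt by (auto simp: less_SUP_iff)
 let ?I = "{-real n..real n}"
 define M where "M = density lborel (indicator ?I)"
 have M: "emeasure M B = vol (?I Int B)" if "B : sets borel" for B
  unfolding M_def using that by (subst emeasure_density)
   (auto simp: nn_integral_indicator indicator_inter_arith[symmetric] mult.commute Int_commute)
 have "emeasure M A = (SUP K\<in>{K. K <= A & compact K}. emeasure M K)"
 proof (rule inner_regular)
  show "emeasure M (space M) ~= \<infinity>" using M[of UNIV] by (simp add: M_def)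
 qed (auto simp: M_def A)
 moreover have "c < emeasure M A" using n M[OF A] by (simp add: Int_commute)
 ultimately obtain K where K: "K <= A" "compact K" "c < emeasure M K" by (auto simp: less_SUP_iff)
 have "emeasure M K <= vol K" using M[of K] K(2) by (auto intro!: emeasure_mono simp: compact_imp_closed borel_closed)
 with K show ?thesis using order_less_le_trans by blast
qed

lemma emeasure_lborel_affine_image:
 fixes K :: "real set"
 assumes "c > 0" "K : sets borel"
 shows "(%x. c * x + t) ` K : sets borel" and "vol ((%x. c * x + t) ` K) = ennreal c * vol K"
proof -
 have eq: "(%x. c * x + t) ` K = (%y. (y - t) / c) -` K Int space borel"
  using assms by (auto simp: image_iff intro!: bexI[of _ "(x - t) / c" for x])
 show *: "(%x. c * x + t) ` K : sets borel" unfolding eq by (rule measurable_sets[OF _ assms(2)]) simp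
 have "vol ((%x. c * x + t) ` K) = (NL x. indicator ((%x. c * x + t) ` K) x)" using * by simp
 also have "... = ennreal (abs c) * (NL x. indicator ((%x. c * x + t) ` K) (t + c * x))"
  by (rule nn_integral_real_affine) (use * assms in auto)
 also have "(NL x. indicator ((%x. c * x + t) ` K) (t + c * x)) = (NL x. indicator K x)"
  using assms by (intro nn_integral_cong) (auto simp: indicator_def)
 finally show "vol ((%x. c * x + t) ` K) = ennreal c * vol K" using assms by simp
qed

text \<open>With \<open>a\<close> the maximum of \<open>K\<close> and \<open>b\<close> the minimum
  of \<open>L\<close>, the set \<open>?K\<close> lies to the left of the point \<open>?p\<close> and
  \<open>?L\<close> to its right. Both are contained in \<open>C\<close> and meet only in
  \<open>?p\<close>, so their lengths add up.\<close>

lemma brunn_minkowski_real_compact: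
 fixes K L C :: "real set"
 assumes "0 < s" "s < 1" "compact K" "compact L" "K ~= {}" "L ~= {}" and C: "C : sets borel"
  and sub: "!!x y. x : K ==> y : L ==> (1 - s) * x + s * y : C"
 shows "ennreal (1 - s) * vol K + ennreal s * vol L <= vol C"
proof -
 obtain a where a: "a : K" "!!x. x : K ==> x <= a" using compact_attains_sup[of K] assms by blast
 obtain b where b: "b : L" "!!x. x : L ==> b <= x" using compact_attains_inf[of L] assms by blast
 let ?K = "(%x. (1 - s) * x + s * b) ` K" and ?L = "(%x. s * x + (1 - s) * a) ` L"
 let ?p = "(1 - s) * a + s * b"
 have bor: "K : sets borel" "L : sets borel" using assms by (auto intro: borel_compact)
 note K = emeasure_lborel_affine_image[of "1 - s" K "s * b", OF _ bor(1)]
 note L = emeasure_lborel_affine_image[of s L "(1 - s) * a", OF _ bor(2)]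
 have "?K Int (?L - {?p}) = {}"
 proof (rule equals0I)
  fix w assume "w : ?K Int (?L - {?p})"
  then obtain x y where xy: "x : K" "y : L" "(1 - s) * x + s * b = s * y + (1 - s) * a"
   "(1 - s) * x + s * b ~= ?p" by auto
  hence "(1 - s) * (a - x) >= 0" "s * (y - b) >= 0" using a b assms by auto
  hence "(1 - s) * x <= (1 - s) * a" "s * b <= s * y" by (auto simp: algebra_simps)
  with xy show False by auto
 qed
 moreover have "vol (?L - {?p}) = vol ?L" by (rule emeasure_Diff_null_set) (use L assms in "auto simp: null_sets_def")
 ultimately have "vol ?K + vol ?L = vol (?K Un (?L - {?p}))"
  using K(1) L(1) assms by (subst plus_emeasure[symmetric]) auto
 also have "... <= vol C" using sub a b C by (intro emeasure_mono) (auto simp: add.commute)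
 finally show ?thesis using K(2) L(2) assms by simp
qed

text \<open>\<open>C\<close> stands for a Borel superset of the Minkowski combination, which itself
  need not be Borel. Exhausting \<open>A\<close> and \<open>B\<close> by nonempty compact subsets
  reduces the claim to the compact case.\<close>

lemma brunn_minkowski_real:
 fixes A B C :: "real set"
 assumes s: "0 < s" "s < 1" and A: "A : sets borel" "A ~= {}" and B: "B : sets borel" "B ~= {}"
  and C: "C : sets borel" and sub: "!!x y. x : A ==> y : B ==> (1 - s) * x + s * y : C"
 shows "ennreal (1 - s) * vol A + ennreal s * vol B <= vol C"
proof -
 have inner: "vol A = (SUP K\<in>{K. compact K & K <= A & K ~= {}}. vol K)"
  if A: "A : sets borel" "A ~= {}" for A :: "real set"
 proof (rule antisym)
  show "(SUP K\<in>{K. compact K & K <= A & K ~= {}}. vol K) <= vol A" using A by (intro SUP_least emeasure_mono) auto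
  show "vol A <= (SUP K\<in>{K. compact K & K <= A & K ~= {}}. vol K)"
  proof (rule dense_le)
   fix c assume "c < vol A"
   then obtain K where K: "compact K" "K <= A" "c < vol K" using lborel_inner_compact[OF A(1)] by blast
   hence "K ~= {}" by auto
   with K show "c <= (SUP K\<in>{K. compact K & K <= A & K ~= {}}. vol K)" by (intro SUP_upper2[of K]) auto
  qed
 qed
 obtain x y where xy: "x : A" "y : B" using A B by auto
 have "ennreal (1 - s) * vol K + ennreal s * vol L <= vol C"
  if "K : {K. compact K & K <= A & K ~= {}}" "L : {K. compact K & K <= B & K ~= {}}" for K L
  using that sub by (intro brunn_minkowski_real_compact s C) auto
 moreover have ne: "{K. compact K & K <= A & K ~= {}} ~= {}" "{K. compact K & K <= B & K ~= {}} ~= {}"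
  using xy by (auto intro!: exI[of _ "{_}"])
 ultimately show ?thesis
  apply (subst inner[OF A], subst inner[OF B])
  apply (subst (1 2) SUP_mult_left_ennreal)
  apply (subst ennreal_SUP_add_left[OF ne(1), symmetric])
  apply (rule SUP_least)
  apply (subst ennreal_SUP_add_right[OF ne(2)])
  apply (rule SUP_least) by blast
qed

lemma nn_integral_layer_cake01:
 fixes f :: "real => real"
 assumes [measurable]: "f : BM" and f: "!!x. 0 <= f x" "!!x. f x <= 1"
 shows "(NL x. ennreal (f x)) = (NL l. indicator {0<..<1} l * vol {x. l < f x})"
proof -
 have "(NL x. ennreal (f x)) = (NL x. (NL l. indicator {0<..<f x} l))" using f by (intro nn_integral_cong) simp
 also have "... = (NL x. (NL l. indicator {0<..<1} l * indicator {x. l < f x} x))"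
 proof (intro nn_integral_cong)
  fix x l :: real
  show "indicator {0<..<f x} l = (indicator {0<..<1} l * indicator {x. l < f x} x :: ennreal)"
   using f(2)[of x] by (auto split: split_indicator)
 qed
 also have "... = (NL l. (NL x. indicator {0<..<1} l * indicator {x. l < f x} x))"
  by (rule lborel_pair.Fubini') (simp add: indicator_def, measurable)
 also have "... = (NL l. indicator {0<..<1} l * vol {x. l < f x})"
  by (intro nn_integral_cong) (subst nn_integral_cmult, auto)
 finally show ?thesis .
qed

text \<open>Only levels in \<open>{0<..<1}\<close> are counted, so values of \<open>k\<close> above
  1 contribute at most 1. This gives an inequality instead of an identity, in the direction that
  Prekopa-Leindler needs.\<close>

lemma nn_integral_layer_cake01_le:
 fixes k :: "real => ennreal"
 assumes [measurable]: "k : BM"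
 shows "(NL l. indicator {0<..<1} l * vol {x. ennreal l <= k x}) <= (NL x. k x)"
proof -
 have "(NL l. indicator {0<..<1} l * vol {x. ennreal l <= k x})
   = (NL l. (NL x. indicator {0<..<1} l * indicator {x. ennreal l <= k x} x))"
  by (intro nn_integral_cong) (subst nn_integral_cmult, auto)
 also have "... = (NL x. (NL l. indicator {0<..<1} l * indicator {x. ennreal l <= k x} x))"
  by (rule lborel_pair.Fubini') (simp add: indicator_def, measurable)
 also have "... <= (NL x. k x)"
 proof (intro nn_integral_mono)
  fix x :: real
  have "(NL l. indicator {0<..<1} l * indicator {x. ennreal l <= k x} x)
    <= (NL l. indicator {0..enn2real (min 1 (k x))} l)"
  proof (intro nn_integral_mono)
   fix l :: real
   show "indicator {0<..<1} l * indicator {x. ennreal l <= k x} x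
    <= (indicator {0..enn2real (min 1 (k x))} l :: ennreal)"
   proof (cases "l : {0<..<1} & ennreal l <= k x")
    case True
    hence "ennreal l <= min 1 (k x)" by (auto simp: ennreal_le_1)
    hence "l <= enn2real (min 1 (k x))" using True
     by (metis enn2real_ennreal enn2real_mono greaterThanLessThan_iff less_imp_le min.cobounded1
       order_le_less_trans ennreal_one_less_top)
    thus ?thesis using True by (auto split: split_indicator)
   qed (auto split: split_indicator)
  qed
  also have "... = ennreal (enn2real (min 1 (k x)))" by (simp add: enn2real_nonneg)
  also have "... = min 1 (k x)"
   by (rule ennreal_enn2real) (metis min.cobounded1 ennreal_one_less_top order_le_less_trans)
  finally show "(NL l. indicator {0<..<1} l * indicator {x. ennreal l <= k x} x) <= k x" by simp
 qed
 finally show ?thesis .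
qed

text \<open>Suprema normalised to 1 make the superlevel sets of \<open>f\<close> and
  \<open>g\<close> nonempty at each level below 1, so Brunn-Minkowski applies level by level. Under
  this normalisation even the arithmetic mean of the two integrals is controlled.\<close>

lemma prekopa_leindler_real_normalized:
 fixes f g :: "real => real" and k :: "real => ennreal"
 assumes s: "0 < s" "s < 1" and [measurable]: "f : BM" "g : BM" "k : BM"
  and f: "!!x. 0 <= f x" "!!x. f x <= 1" "!!l. l < 1 ==> EX x. l < f x"
  and g: "!!x. 0 <= g x" "!!x. g x <= 1" "!!l. l < 1 ==> EX x. l < g x"
  and k: "!!x y. ennreal (min (f x) (g y)) <= k ((1 - s) * x + s * y)"
 shows "ennreal (1 - s) * (NL x. ennreal (f x)) + ennreal s * (NL x. ennreal (g x)) <= (NL x. k x)"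
proof -
 have meas [measurable]: "(%l. vol {x. l < u x}) : BM" if [measurable]: "u : BM" for u :: "real => real"
 proof -
  have "(%l. vol {x. l < u x}) = (%l. (NL x. indicator {x. l < u x} x))"
   by (intro ext, subst nn_integral_indicator) auto
  also have "... : BM" by (rule lborel.borel_measurable_nn_integral) (simp add: indicator_def, measurable)
  finally show ?thesis .
 qed
 have "ennreal (1 - s) * (NL x. ennreal (f x)) + ennreal s * (NL x. ennreal (g x))
  = (NL l. ennreal (1 - s) * (indicator {0<..<1} l * vol {x. l < f x})
     + ennreal s * (indicator {0<..<1} l * vol {x. l < g x}))"
  using f g by (subst (1 2) nn_integral_layer_cake01) (auto simp: nn_integral_add nn_integral_cmult)
 also have "... <= (NL l. indicator {0<..<1} l * vol {x. ennreal l <= k x})"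
 proof (intro nn_integral_mono)
  fix l :: real
  show "ennreal (1 - s) * (indicator {0<..<1} l * vol {x. l < f x})
     + ennreal s * (indicator {0<..<1} l * vol {x. l < g x}) <= indicator {0<..<1} l * vol {x. ennreal l <= k x}"
  proof (cases "l : {0<..<1}")
   case True
   have "ennreal (1 - s) * vol {x. l < f x} + ennreal s * vol {x. l < g x} <= vol {x. ennreal l <= k x}"
   proof (rule brunn_minkowski_real[OF s])
    fix x y assume "x : {x. l < f x}" "y : {x. l < g x}"
    hence "ennreal l <= ennreal (min (f x) (g y))" by (intro ennreal_leI) auto
    also note k
    finally show "(1 - s) * x + s * y : {x. ennreal l <= k x}" by simp
   qed (use f(3)[of l] g(3)[of l] True in auto)
   with True show ?thesis by simp
  qed simp
 qed
 also have "... <= (NL x. k x)" by (rule nn_integral_layer_cake01_le) simp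
 finally show ?thesis .
qed

text \<open>The usual hypothesis \<open>f x powr (1 - s) * g y powr s <= k (c x y)\<close>, with
  \<open>ennreal\<close> values tested through the reals below them because \<open>powr\<close> acts
  on reals. The carrier \<open>S\<close> and the combination \<open>c\<close> are parameters so that
  one notion serves the line and finite product spaces.\<close>

definition pl_triple ::
 "real => 'a set => ('a => 'a => 'a) => ('a => ennreal) => ('a => ennreal) => ('a => ennreal) => bool" where
 "pl_triple s S c f g k \<longleftrightarrow> (ALL x:S. ALL y:S. ALL A>=0. ALL B>=0. ennreal A <= f x --> ennreal B <= g y -->
   ennreal (A powr (1 - s) * B powr s) <= k (c x y))"

lemma nn_integral_truncate:
 fixes f :: "'a => ennreal"
 assumes [measurable]: "f : bm M" and lt: "c < (NN M (%x. f x))"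
 shows "EX n::nat. c < (NN M (%x. min (f x) (of_nat n)))"
proof -
 have "(NN M (%x. f x)) = (NN M (%x. (SUP n::nat. min (f x) (of_nat n))))"
 proof (intro nn_integral_cong)
  fix x
  have "(SUP n::nat. min (f x) (of_nat n)) = min (f x) (SUP n::nat. of_nat n)"
   by (simp add: inf_min[symmetric] inf_SUP)
  thus "f x = (SUP n::nat. min (f x) (of_nat n))" by (simp add: ennreal_SUP_of_nat_eq_top)
 qed
 also have "... = (SUP n::nat. (NN M (%x. min (f x) (of_nat n))))" by (intro nn_integral_monotone_convergence_SUP)
    (auto simp: incseq_def le_fun_def intro: min.coboundedI2)
 finally show ?thesis using lt by (auto simp: less_SUP_iff)
qed

text \<open>Truncation at a level \<open>n\<close> that keeps the integral above \<open>A\<close>,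
  followed by division by the supremum \<open>a\<close> of the truncation.\<close>

lemma bounded_minorant_normalized:
 fixes f :: "real => ennreal"
 assumes [measurable]: "f : BM" and "A > 0" and lt: "ennreal A < (NL x. f x)"
 obtains F a where "F : BM" "a > 0" "!!x. 0 <= F x" "!!x. F x <= (1::real)"
  "!!l. l < 1 ==> EX x. l < F x" "!!x. ennreal (a * F x) <= f x"
  "ennreal (A / a) <= (NL x. ennreal (F x))"
proof -
 obtain n :: nat where n: "ennreal A < (NL x. min (f x) (of_nat n))" using nn_integral_truncate[OF _ lt] by auto
 define F where "F x = enn2real (min (f x) (of_nat n))" for x
 have fin: "min (f x) (of_nat n) < top" for x
  by (metis ennreal_of_nat_eq_real_of_nat ennreal_less_top min.cobounded2 order_le_less_trans)
 have F: "ennreal (F x) = min (f x) (of_nat n)" for x unfolding F_def by (rule ennreal_enn2real) (rule fin)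
 have F0: "0 <= F x" for x by (simp add: F_def enn2real_nonneg)
 have Fn: "F x <= n" for x
 proof -
  have "ennreal (F x) <= ennreal (real n)" by (simp add: F ennreal_of_nat_eq_real_of_nat)
  thus ?thesis by simp
 qed
 have bdd: "bdd_above (range F)" using Fn by (auto intro!: bdd_aboveI)
 define a where "a = (SUP x. F x)"
 have le: "F x <= a" for x unfolding a_def by (rule cSUP_upper[OF _ bdd]) simp
 have a0: "a > 0"
 proof (rule ccontr)
  assume "~ a > 0"
  hence "F x = 0" for x using F0[of x] le[of x] by auto
  hence "(NL x. min (f x) (of_nat n)) = 0" by (simp add: F[symmetric])
  with n show False by simp
 qed
 show thesis
 proof (rule that[of "%x. F x / a" a])
  show "EX x. l < F x / a" if "l < 1" for l
  proof -
   have "l * a < a" using that a0 by simp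
   then obtain x where "l * a < F x" unfolding a_def using less_cSUP_iff[OF _ bdd] by auto
   thus ?thesis using a0 by (auto simp: field_simps)
  qed
  have [measurable]: "F : BM" unfolding F_def[abs_def] by measurable
  show "(%x. F x / a) : BM" by measurable
  show "ennreal (a * (F x / a)) <= f x" for x using a0 F[of x] by simp
  have "ennreal (A / a) = ennreal A * ennreal (1 / a)" using a0 assms by (simp add: ennreal_mult[symmetric])
  also have "... <= (NL x. min (f x) (of_nat n)) * ennreal (1 / a)" using n by (intro mult_right_mono) auto
  also have "... = (NL x. ennreal (F x) * ennreal (1 / a))"
   unfolding F by (rule nn_integral_multc[symmetric]) measurable
  also have "... = (NL x. ennreal (F x / a))"
   using F0 a0 by (intro nn_integral_cong) (simp add: ennreal_mult[symmetric])
  finally show "ennreal (A / a) <= (NL x. ennreal (F x / a))" .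
 qed (use F0 le a0 in "auto simp: field_simps")
qed

lemma ennreal_le_mult_one_interval:
 assumes "0 <= x" "!!q. 0 < q ==> q < 1 ==> ennreal (q * x) <= K"
 shows "ennreal x <= K"
proof (cases K rule: ennreal_cases)
 case (real r)
 have "x <= r" by (rule field_le_mult_one_interval) (use assms real in "auto simp: ennreal_le_iff2")
 thus ?thesis using real by (simp add: ennreal_leI)
qed simp

lemma prekopa_leindler_real:
 fixes f g k :: "real => ennreal"
 assumes s: "0 < s" "s < 1" and [measurable]: "f : BM" "g : BM" "k : BM"
  and k: "pl_triple s UNIV (%x y. (1 - s) * x + s * y) f g k"
  and A: "0 <= A" "ennreal A <= (NL x. f x)" and B: "0 <= B" "ennreal B <= (NL x. g x)"
 shows "ennreal (A powr (1 - s) * B powr s) <= (NL x. k x)"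
proof (cases "A = 0 | B = 0")
 case True
 thus ?thesis using s by auto
next
 case False
 hence AB: "A > 0" "B > 0" using A B by auto
 show ?thesis
 proof (rule ennreal_le_mult_one_interval)
  \<comment> \<open>The factor \<open>q\<close> turns the weak bounds on the integrals into strict
    ones, which truncation requires; it is sent to 1 at the end.\<close>
  fix q :: real assume q: "0 < q" "q < 1"
  have "ennreal (q * A) < ennreal A" "ennreal (q * B) < ennreal B" using AB q by (auto simp: ennreal_less_iff)
  hence lt: "ennreal (q * A) < (NL x. f x)" "ennreal (q * B) < (NL x. g x)" using A B by auto
  obtain F a where F: "F : BM" "a > 0" "!!x. 0 <= F x" "!!x. F x <= (1::real)"
    "!!l. l < 1 ==> EX x. l < F x" "!!x. ennreal (a * F x) <= f x"
    "ennreal (q * A / a) <= (NL x. ennreal (F x))"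
   by (rule bounded_minorant_normalized[OF _ _ lt(1)]) (use q AB in auto)
  obtain G b where G: "G : BM" "b > 0" "!!x. 0 <= G x" "!!x. G x <= (1::real)"
    "!!l. l < 1 ==> EX x. l < G x" "!!x. ennreal (b * G x) <= g x"
    "ennreal (q * B / b) <= (NL x. ennreal (G x))"
   by (rule bounded_minorant_normalized[OF _ _ lt(2)]) (use q AB in auto)
  note [measurable] = F(1) G(1)
  \<comment> \<open>The inequality is homogeneous: dividing \<open>f\<close> by \<open>a\<close> and
    \<open>g\<close> by \<open>b\<close> amounts to dividing \<open>k\<close> by
    \<open>c\<close>.\<close>
  define c where "c = a powr (1 - s) * b powr s"
  have c: "c > 0" using F G by (simp add: c_def)
  have "ennreal (1 - s) * (NL x. ennreal (F x)) + ennreal s * (NL x. ennreal (G x)) <= (NL x. ennreal (1 / c) * k x)"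
  proof (rule prekopa_leindler_real_normalized[OF s])
   fix x y
   have "min (F x) (G y) = min (F x) (G y) powr (1 - s) * min (F x) (G y) powr s"
    using F(3)[of x] G(3)[of y] by (auto simp flip: powr_add)
   also have "... <= F x powr (1 - s) * G y powr s" using s F(3)[of x] G(3)[of y] by (intro mult_mono powr_mono2) auto
   also have "... = 1 / c * ((a * F x) powr (1 - s) * (b * G y) powr s)" using F G c s by (auto simp: powr_mult c_def)
   finally have "ennreal (min (F x) (G y)) <= ennreal (1 / c * ((a * F x) powr (1 - s) * (b * G y) powr s))"
    by (rule ennreal_leI)
   also have "... = ennreal (1 / c) * ennreal ((a * F x) powr (1 - s) * (b * G y) powr s)"
    using c by (subst ennreal_mult) auto
   also have "... <= ennreal (1 / c) * k ((1 - s) * x + s * y)"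
    using k F G unfolding pl_triple_def by (intro mult_left_mono) auto
   finally show "ennreal (min (F x) (G y)) <= ennreal (1 / c) * k ((1 - s) * x + s * y)" .
  qed (use F G in auto)
  also have "... = ennreal (1 / c) * (NL x. k x)" by (rule nn_integral_cmult) simp
  finally have 1: "ennreal (1 - s) * (NL x. ennreal (F x)) + ennreal s * (NL x. ennreal (G x))
    <= ennreal (1 / c) * (NL x. k x)" .
  \<comment> \<open>Arithmetic-geometric mean inequality: the additive bound found after
    normalisation implies the multiplicative one.\<close>
  have "(q * A / a) powr (1 - s) * (q * B / b) powr s <= (1 - s) * (q * A / a) + s * (q * B / b)"
   using s AB F G q by (intro Youngs_inequality_0) auto
  hence "ennreal ((q * A / a) powr (1 - s) * (q * B / b) powr s)
    <= ennreal (1 - s) * ennreal (q * A / a) + ennreal s * ennreal (q * B / b)"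
   using s AB F G q by (auto simp: ennreal_mult[symmetric] ennreal_plus[symmetric] simp del: ennreal_plus intro!: ennreal_leI)
  also have "... <= ennreal (1 - s) * (NL x. ennreal (F x)) + ennreal s * (NL x. ennreal (G x))"
   using F G by (intro add_mono mult_left_mono) auto
  also note 1
  finally have "ennreal c * ennreal ((q * A / a) powr (1 - s) * (q * B / b) powr s)
    <= ennreal c * (ennreal (1 / c) * (NL x. k x))" by (rule mult_left_mono) simp
  also have "... = (NL x. k x)" using c by (simp add: mult.assoc[symmetric] ennreal_mult[symmetric])
  also have "ennreal c * ennreal ((q * A / a) powr (1 - s) * (q * B / b) powr s)
    = ennreal (q * (A powr (1 - s) * B powr s))"
  proof -
   have "q = q powr (1 - s) * q powr s" using q by (simp flip: powr_add)
   hence "c * ((q * A / a) powr (1 - s) * (q * B / b) powr s) = q * (A powr (1 - s) * B powr s)"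
    using q AB F(2) G(2) by (simp add: c_def powr_mult powr_divide)
   thus ?thesis using c by (subst ennreal_mult[symmetric]) auto
  qed
  finally show "ennreal (q * (A powr (1 - s) * B powr s)) <= (NL x. k x)" .
 qed (simp add: AB)
qed

text \<open>Induction on coordinates: for fixed \<open>x\<close> and \<open>y\<close> the
  one-dimensional inequality in the new coordinate says exactly that the partial integrals of
  \<open>f\<close>, \<open>g\<close>, \<open>k\<close> form a \<open>pl_triple\<close> on the
  remaining coordinates.\<close>

lemma prekopa_leindler_PiM:
 fixes f g k :: "('i => real) => ennreal"
 assumes s: "0 < s" "s < 1" and "finite I" and "f : bm (PiM I (%_. lborel))" "g : bm (PiM I (%_. lborel))"
   "k : bm (PiM I (%_. lborel))"
  and "pl_triple s (space (PiM I (%_. lborel :: real measure))) (%x y. \<lambda>i\<in>I. (1 - s) * x i + s * y i) f g k"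
  and "0 <= A" "ennreal A <= (NN ((PiM I (%_. lborel))) (%x. f x))"
  and "0 <= B" "ennreal B <= (NN ((PiM I (%_. lborel))) (%x. g x))"
 shows "ennreal (A powr (1 - s) * B powr s) <= (NN ((PiM I (%_. lborel))) (%x. k x))" using assms(3-)
proof (induction I arbitrary: f g k A B rule: finite_induct)
 case empty
 interpret product_sigma_finite "%_. lborel :: real measure" ..
 show ?case using empty by (simp add: PiM_empty nn_integral_count_space_finite pl_triple_def)
next
 case (insert i I)
 interpret product_sigma_finite "%_. lborel :: real measure" ..
 let ?M = "PiM I (%_. lborel :: real measure)" and ?Mi = "PiM (insert i I) (%_. lborel :: real measure)"
 note [measurable] = insert.prems(1-3)
 have upd: "(%t. x(i := t)) : borel ->M ?Mi" if "x : space ?M" for x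
  using measurable_component_update[OF that insert.hyps(2)] by simp
 have meas1: "(%t. u (x(i := t))) : BM"
  if "u : borel_measurable ?Mi" "x : space ?M" for u :: "('i => real) => ennreal" and x
  using measurable_compose[OF upd[OF that(2)] that(1)] .
 have meas2: "(%x. (NL t. u (x(i := t)))) : borel_measurable ?M"
  if "u : borel_measurable ?Mi" for u :: "('i => real) => ennreal"
 proof (rule lborel.borel_measurable_nn_integral)
  have "(%(x, t). x(i := t)) : ?M >< lborel ->M ?Mi"
   using measurable_add_dim[of i I "%_. lborel :: real measure"] by simp
  from measurable_compose[OF this that] show "(%(x, t). u (x(i := t))) : borel_measurable (?M >< lborel)"
   by (simp add: split_def)
 qed
 note split = product_nn_integral_insert[OF insert.hyps(1,2)]
 show ?case unfolding split[OF insert.prems(3)]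
 proof (rule insert.IH)
  show "pl_triple s (space ?M) (%x y. \<lambda>i\<in>I. (1 - s) * x i + s * y i)
    (%x. (NL t. f (x(i := t)))) (%x. (NL t. g (x(i := t)))) (%x. (NL t. k (x(i := t))))" unfolding pl_triple_def
  proof (intro ballI allI impI)
   fix x y A B
   assume xy: "x : space ?M" "y : space ?M" and AB: "0 <= A" "0 <= B"
    "ennreal A <= (NL t. f (x(i := t)))" "ennreal B <= (NL t. g (y(i := t)))"
   let ?z = "\<lambda>i\<in>I. (1 - s) * x i + s * y i"
   have z: "?z : space ?M" by (auto simp: space_PiM)
   show "ennreal (A powr (1 - s) * B powr s) <= (NL t. k (?z(i := t)))"
   proof (rule prekopa_leindler_real[OF s, of "%t. f (x(i := t))" "%t. g (y(i := t))"])
    show "pl_triple s UNIV (%x y. (1 - s) * x + s * y) (%t. f (x(i := t))) (%t. g (y(i := t))) (%t. k (?z(i := t)))"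
     unfolding pl_triple_def
    proof (intro ballI allI impI)
     fix a b A B :: real
     assume AB: "0 <= A" "0 <= B" "ennreal A <= f (x(i := a))" "ennreal B <= g (y(i := b))"
     have sp: "x(i := a) : space ?Mi" "y(i := b) : space ?Mi"
      using measurable_space[OF upd[OF xy(1)]] measurable_space[OF upd[OF xy(2)]] by auto
     have eq: "?z(i := (1 - s) * a + s * b)
       = (\<lambda>j\<in>insert i I. (1 - s) * (x(i := a)) j + s * (y(i := b)) j)"
      using insert.hyps by (auto simp: fun_eq_iff)
     show "ennreal (A powr (1 - s) * B powr s) <= k (?z(i := (1 - s) * a + s * b))"
      unfolding eq by (rule insert.prems(4)[unfolded pl_triple_def, rule_format, OF sp AB])
    qed
   qed (use AB meas1 insert.prems xy z in auto)
  qed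
  show "ennreal A <= (NN ?M (%x. (NL t. f (x(i := t)))))" using insert.prems(6) unfolding split[OF insert.prems(1)] .
  show "ennreal B <= (NN ?M (%x. (NL t. g (x(i := t)))))" using insert.prems(8) unfolding split[OF insert.prems(2)] .
 qed (rule meas2 insert.prems)+
qed

theorem prekopa_leindler:
 fixes f g k :: "'a::euclidean_space => ennreal"
 assumes s: "0 < s" "s < 1" and meas: "f : BM" "g : BM" "k : BM"
  and k: "!!x y A B. 0 <= A ==> 0 <= B ==> ennreal A <= f x ==> ennreal B <= g y ==>
       ennreal (A powr (1 - s) * B powr s) <= k ((1 - s) *. x + s *. y)"
  and A: "0 <= A" "ennreal A <= (NL x. f x)" and B: "0 <= B" "ennreal B <= (NL x. g x)"
 shows "ennreal (A powr (1 - s) * B powr s) <= (NL x. k x)"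
proof -
 let ?P = "\<Pi>\<^sub>M b\<in>Basis. (lborel :: real measure)" and ?e = "%f::'a => real. \<Sum>b\<in>Basis. f b *. b"
 have e [measurable]: "?e : ?P ->M borel" by measurable
 have int: "(NL x. u x) = (NN ?P (%x. u (?e x)))" if "u : BM" for u :: "'a => ennreal"
  by (subst lborel_eq, subst nn_integral_distr) (use that in auto)
 show ?thesis unfolding int[OF meas(3)]
 proof (rule prekopa_leindler_PiM[OF s finite_Basis])
  show "pl_triple s (space ?P) (%x y. \<lambda>i\<in>Basis. (1 - s) * x i + s * y i)
    (%x. f (?e x)) (%x. g (?e x)) (%x. k (?e x))" unfolding pl_triple_def
  proof (intro ballI allI impI)
   fix x y A B assume "0 <= A" "0 <= B" "ennreal A <= f (?e x)" "ennreal B <= g (?e y)"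
   from k[OF this] show "ennreal (A powr (1 - s) * B powr s) <= k (?e (\<lambda>i\<in>Basis. (1 - s) * x i + s * y i))"
    by (simp add: scaleR_add_left scaleR_sum_right sum.distrib)
  qed
 qed (use A B int meas in auto)
qed

section \<open>Strongly log-concave densities and their regularity\<close>

text \<open>Convexity of \<open>V - ka * (norm x)^2 / 2\<close> after exponentiation, for
  \<open>rho = exp (- V)\<close>; the exponential gain is the convexity defect computed in
  \<open>norm_sq_convex_comb\<close>. The multiplicative form covers points with
  \<open>rho = 0\<close> and is what Prekopa-Leindler consumes.\<close>

definition slc_weight :: "real => ('a::euclidean_space => real) => bool" where
 "slc_weight ka rho \<longleftrightarrow> rho : BM & (ALL x. 0 <= rho x) & (ALL x y s. 0 < s --> s < 1 -->
    rho x powr (1 - s) * rho y powr s * exp (ka * s * (1 - s) / 2 * (norm (x - y))^2) <= rho ((1 - s) *. x + s *. y))"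

lemma slc_weightD:
 assumes "slc_weight ka rho"
 shows slc_weight_measurable: "rho : BM" and slc_weight_nonneg: "0 <= rho x" and slc_weight_ineq: "0 < s ==> s < 1 ==>
    rho x powr (1 - s) * rho y powr s * exp (ka * s * (1 - s) / 2 * (norm (x - y))^2) <= rho ((1 - s) *. x + s *. y)"
 using assms by (auto simp: slc_weight_def)

lemma norm_sq_convex_comb:
 fixes x y :: "'a::real_inner"
 shows "(1 - s) * (norm x)^2 + s * (norm y)^2 - (norm ((1 - s) *. x + s *. y))^2 = s * (1 - s) * (norm (x - y))^2"
 unfolding power2_norm_eq_inner
 by (simp add: inner_add_left inner_add_right inner_diff_left inner_diff_right inner_commute algebra_simps power2_eq_square)

lemma lower_semicontinuous_measurable:
 fixes V :: "'a::metric_space => ereal"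
 assumes "lower_semicontinuous V"
 shows "V : BM"
proof (rule borel_measurableI_greater)
 fix a
 have "open {x. a < V x}" unfolding open_dist
 proof safe
  fix x assume x: "a < V x"
  hence "a < Liminf (at x) V" using assms unfolding lower_semicontinuous_def by (meson order_less_le_trans)
  hence "eventually (%y. a < V y) (at x)" by (rule less_LiminfD)
  then obtain d where "d > 0" "!!y. y ~= x ==> dist y x < d ==> a < V y" unfolding eventually_at by auto
  thus "EX e>0. ALL y. dist y x < e --> y : {x. a < V x}" using x by (metis mem_Collect_eq)
 qed
 thus "{x : space borel. a < V x} : sets borel" by simp
qed

lemma strongly_log_concave_weight:
 fixes mu :: "'a::euclidean_space measure"
 assumes "strongly_log_concave ka mu"
 obtains rho where "slc_weight ka rho" "mu = dens rho" "prob_space mu"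
proof -
 obtain V where V: "proper V" "lower_semicontinuous V"
  "ereal_convex (%x. V x - ereal (ka * (norm x)^2 / 2))" "mu = density lborel (%x. exp_minus (V x))"
  and prob: "prob_space mu" using assms unfolding strongly_log_concave_def by blast
 define rho where "rho x = enn2real (exp_minus (V x))" for x
 have Vm: "V x ~= -\<infinity>" for x using V by (auto simp: proper_def)
 have rho_eq: "rho x = (if V x = \<infinity> then 0 else exp (- real_of_ereal (V x)))" for x
  using Vm[of x] by (cases "V x") (auto simp: rho_def exp_minus_def)
 have rho_enn: "exp_minus (V x) = ennreal (rho x)" for x
  using Vm[of x] by (cases "V x") (auto simp: rho_eq exp_minus_def)
 have [measurable]: "V : BM" by (rule lower_semicontinuous_measurable) fact
 have meas: "rho : BM" unfolding rho_eq[abs_def] by measurable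
 have "rho x powr (1 - s) * rho y powr s * exp (ka * s * (1 - s) / 2 * (norm (x - y))^2)
     <= rho ((1 - s) *. x + s *. y)" if s: "0 < s" "s < 1" for x y s
 proof (cases "V x = \<infinity> | V y = \<infinity>")
  case True
  thus ?thesis using s by (auto simp: rho_eq)
 next
  case False
  then obtain a b where ab: "V x = ereal a" "V y = ereal b" using Vm[of x] Vm[of y] by (cases "V x"; cases "V y") auto
  let ?z = "(1 - s) *. x + s *. y"
  have "V ?z - ereal (ka * (norm ?z)^2 / 2)
    <= ereal (1 - s) * (V x - ereal (ka * (norm x)^2 / 2)) + ereal s * (V y - ereal (ka * (norm y)^2 / 2))"
   using V(3) s unfolding ereal_convex_def by auto
  hence le: "V ?z - ereal (ka * (norm ?z)^2 / 2)
    <= ereal ((1 - s) * (a - ka * (norm x)^2 / 2) + s * (b - ka * (norm y)^2 / 2))" by (simp add: ab)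
  obtain c where c: "V ?z = ereal c" using le Vm[of ?z] by (cases "V ?z") auto
  have "c - ka * (norm ?z)^2 / 2 <= (1 - s) * (a - ka * (norm x)^2 / 2) + s * (b - ka * (norm y)^2 / 2)"
   using le by (simp add: c)
  hence "c <= (1 - s) * a + s * b - ka / 2 * ((1 - s) * (norm x)^2 + s * (norm y)^2 - (norm ?z)^2)"
   by (simp add: algebra_simps add_divide_distrib diff_divide_distrib)
  hence "- a * (1 - s) + - b * s + ka * s * (1 - s) / 2 * (norm (x - y))^2 <= - c"
   unfolding norm_sq_convex_comb by (simp add: algebra_simps diff_divide_distrib add_divide_distrib)
  thus ?thesis by (simp add: rho_eq ab c powr_def exp_add[symmetric] mult.commute)
 qed
 hence "slc_weight ka rho" using meas by (auto simp: slc_weight_def rho_def enn2real_nonneg)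
 moreover have "mu = dens rho" using V(4) by (simp add: rho_enn)
 ultimately show thesis using that prob by blast
qed

lemma slc_weight_convex_support:
 fixes rho :: "'a::euclidean_space => real"
 assumes w: "slc_weight ka rho" and k: "ka >= 0"
 shows "convex {x. rho x > 0}" and "convex_on {x. rho x > 0} (%x. - ln (rho x))"
proof -
 have *: "rho ((1 - s) *. x + s *. y) > 0 &
   - ln (rho ((1 - s) *. x + s *. y)) <= (1 - s) * (- ln (rho x)) + s * (- ln (rho y))"
  if "rho x > 0" "rho y > 0" "0 < s" "s < 1" for x y s
 proof -
  have "rho x powr (1 - s) * rho y powr s * 1
    <= rho x powr (1 - s) * rho y powr s * exp (ka * s * (1 - s) / 2 * (norm (x - y))^2)"
   using that k by (intro mult_left_mono) auto
  also note slc_weight_ineq[OF w that(3,4)]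
  finally have 1: "rho x powr (1 - s) * rho y powr s <= rho ((1 - s) *. x + s *. y)" by simp
  have pos: "rho x powr (1 - s) * rho y powr s > 0" using that by simp
  hence "ln (rho x powr (1 - s) * rho y powr s) <= ln (rho ((1 - s) *. x + s *. y))" using 1 by (intro ln_mono) auto
  thus ?thesis using order_less_le_trans[OF pos 1] that by (simp add: ln_mult ln_powr)
 qed
 show conv: "convex {x. rho x > 0}" unfolding convex_alt
 proof (intro ballI allI impI)
  fix x y and s :: real assume "x : {x. rho x > 0}" "y : {x. rho x > 0}" "0 <= s & s <= 1"
  thus "(1 - s) *. x + s *. y : {x. rho x > 0}" using *[of x y s] by (cases "s = 0"; cases "s = 1") auto
 qed
 show "convex_on {x. rho x > 0} (%x. - ln (rho x))" by (rule convex_onI[OF _ conv]) (use * in auto)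
qed

text \<open>What duality and stability of transport ask of a measure. The last clause is a local
  lower bound on the density, phrased through measures of Borel sets; it turns integral bounds on
  convex functions into pointwise ones. All clauses survive multiplication by a normalised density
  lying between two positive constants (\<open>nice_density\<close>).\<close>

definition nice :: "'a::euclidean_space set => 'a measure => bool" where
 "nice Om nu \<longleftrightarrow> prob_space nu & sets nu = sets borel & open Om & convex Om & emeasure nu (-Om) = 0 &
   absolutely_continuous lborel nu & integrable nu (%x. (norm x)^2) & (ALL z:Om. EX r>0. EX c>0. ball z r <= Om &
    (ALL A:sets borel. A <= ball z r --> ennreal c * vol A <= emeasure nu A))"

text \<open>Prekopa-Leindler with \<open>s = 1/2\<close> for \<open>rho\<close> on a ball of mass
  \<open>p > 0\<close> and for \<open>rho\<close> times \<open>exp (ka / 4 * d^2)\<close>, where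
  \<open>d\<close> is the distance to that ball: the square root of the extra factor is
  \<open>exp (ka / 8 * d^2)\<close>, exactly what the curvature of \<open>rho\<close> pays for. The
  outcome is \<open>sqrt (p * B) <= 1\<close>.\<close>

lemma slc_gaussian_tail:
 fixes rho :: "'a::euclidean_space => real"
 assumes w: "slc_weight ka rho" and k: "ka > 0" and prob: "prob_space (dens rho)"
 shows "EX n::nat. (NL x. ennreal (rho x * exp (ka / 4 * (max 0 (norm x - n))^2))) < \<infinity>"
proof -
 note [measurable] = slc_weight_measurable[OF w]
 let ?mu = "dens rho"
 interpret prob_space ?mu by fact
 have int1: "(NL x. ennreal (rho x)) = 1" using emeasure_space_1 by (subst (asm) emeasure_density) auto
 have "EX n::nat. emeasure ?mu (cball 0 (real n)) > 0"
 proof (rule ccontr)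
  assume "~ ?thesis"
  hence "!!n::nat. cball 0 (real n) : null_sets ?mu" by (auto simp: null_sets_def)
  hence "(\<Union>n::nat. cball 0 (real n)) : null_sets ?mu" by (intro null_sets_UN) auto
  moreover have "(\<Union>n::nat. cball 0 (real n)) = (UNIV :: 'a set)"
   using real_arch_simple by (auto simp: mem_cball)
  ultimately show False using emeasure_space_1 by (auto simp: null_sets_def)
 qed
 then obtain n :: nat where n: "emeasure ?mu (cball 0 (real n)) > 0" by auto
 define p where "p = measure ?mu (cball 0 (real n))"
 have p: "p > 0" using n by (simp add: p_def emeasure_eq_measure)
 have [measurable]: "cball 0 (real n) : sets (borel :: 'a measure)" by simp
 let ?f = "%x. ennreal (rho x * indicator (cball 0 (real n)) x)"
 let ?g = "%x. ennreal (rho x * exp (ka / 4 * (max 0 (norm x - n))^2))"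
 have f: "ennreal p <= (NL x. ?f x)" unfolding p_def by (subst emeasure_eq_measure[symmetric], subst emeasure_density)
   (auto simp: ennreal_mult' ennreal_indicator slc_weight_nonneg[OF w] intro!: nn_integral_mono)
 have "(NL x. ?g x) <= ennreal (1 / p)"
 proof (rule dense_le)
  fix c assume c: "c < (NL x. ?g x)"
  hence "c < top" by (metis less_top order_less_imp_not_less top.not_eq_extremum)
  then obtain B where B: "0 <= B" "c = ennreal B" by (cases c rule: ennreal_cases) auto
  have "ennreal (p powr (1 - 1/2) * B powr (1/2)) <= (NL x. ennreal (rho x))"
  proof (rule prekopa_leindler[of "1/2" ?f ?g])
   fix x y :: 'a and A B :: real
   assume AB: "0 <= A" "0 <= B" "ennreal A <= ?f x" "ennreal B <= ?g y"
   have B: "B <= rho y * exp (ka / 4 * (max 0 (norm y - n))^2)"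
    using AB slc_weight_nonneg[OF w] by (simp add: ennreal_le_iff)
   have A: "A <= rho x * indicator (cball 0 (real n)) x"
    using AB slc_weight_nonneg[OF w] by (simp add: ennreal_le_iff)
   have "A powr (1 - 1/2) * B powr (1/2) <= rho ((1 - 1/2) *. x + (1/2) *. y)"
   proof (cases "x : cball 0 (real n)")
    case True
    have "max 0 (norm y - n) <= norm (x - y)"
     using True norm_triangle_ineq2[of y x] by (auto simp: norm_minus_commute)
    hence "(max 0 (norm y - n))^2 <= (norm (x - y))^2" by (intro power_mono) auto
    hence e: "exp (ka / 4 * (max 0 (norm y - n))^2) <= exp (ka / 4 * (norm (x - y))^2)" using k by simp
    have "A powr (1 - 1/2) * B powr (1/2)
      <= rho x powr (1 - 1/2) * (rho y * exp (ka / 4 * (norm (x - y))^2)) powr (1/2)"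
     using A B AB True order_trans[OF B mult_left_mono[OF e slc_weight_nonneg[OF w]]]
     by (intro mult_mono powr_mono2) auto
    also have "... = rho x powr (1 - 1/2) * rho y powr (1/2) * exp (ka * (1/2) * (1 - 1/2) / 2 * (norm (x - y))^2)"
     using slc_weight_nonneg[OF w] by (simp add: powr_mult exp_powr_real)
    also have "... <= rho ((1 - 1/2) *. x + (1/2) *. y)" by (rule slc_weight_ineq[OF w]) auto
    finally show ?thesis .
   qed (use A AB slc_weight_nonneg[OF w] in auto)
   thus "ennreal (A powr (1 - 1/2) * B powr (1/2)) <= ennreal (rho ((1 - 1/2) *. x + (1/2) *. y))"
    by (rule ennreal_leI)
  next
   show "?f : BM" "?g : BM" by measurable
  qed (use p f B c in auto)
  hence "p powr (1/2) * B powr (1/2) <= 1" unfolding int1 by (simp add: ennreal_le_1)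
  hence "sqrt (p * B) <= 1" using p B by (simp add: powr_half_sqrt real_sqrt_mult)
  hence "B <= 1 / p" using p by (simp add: field_simps)
  thus "c <= ennreal (1 / p)" using B by (simp add: ennreal_leI)
 qed
 thus ?thesis by (intro exI[of _ n]) (auto simp: order_le_less_trans)
qed

lemma convex_null_diff_interior:
 fixes D :: "'a::euclidean_space set"
 assumes "convex D" "D : sets borel"
 shows "vol (D - interior D) = 0"
proof -
 have "negligible (frontier D)" by (rule negligible_convex_frontier) fact
 hence "negligible (D - interior D)"
  by (rule negligible_subset) (auto simp: frontier_def closure_subset[THEN subsetD])
 hence "D - interior D : null_sets lebesgue" by (simp add: negligible_iff_null_sets)
 thus ?thesis using assms by (simp add: null_sets_def)
qed

lemma slc_weight_pos_ball:
 fixes rho :: "'a::euclidean_space => real"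
 assumes w: "slc_weight ka rho" and k: "ka >= 0" and z: "z : interior {x. rho x > 0}"
 obtains r c where "r > 0" "c > 0" "ball z r <= interior {x. rho x > 0}" "!!x. x : ball z r ==> c <= rho x"
proof -
 let ?O = "interior {x. rho x > 0}"
 have "convex_on ?O (%x. - ln (rho x))"
  by (rule convex_on_subset[OF slc_weight_convex_support(2)[OF w k] interior_subset])
    (simp add: convex_interior slc_weight_convex_support(1)[OF w k])
 hence "continuous_on ?O (%x. - ln (rho x))" by (intro convex_on_continuous) auto
 hence "continuous (at z) (%x. - ln (rho x))" using z by (simp add: continuous_on_eq_continuous_at)
 then obtain d where d: "d > 0" "!!x. dist x z < d ==> dist (- ln (rho x)) (- ln (rho z)) < 1"
  unfolding continuous_at_eps_delta by (metis zero_less_one)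
 obtain e where e: "e > 0" "ball z e <= ?O" using z open_contains_ball by blast
 show thesis
 proof (rule that[of "min d e" "exp (ln (rho z) - 1)"])
  fix x assume x: "x : ball z (min d e)"
  hence "x : ?O" using e by auto
  hence "rho x > 0" using interior_subset by blast
  moreover have "ln (rho z) - 1 <= ln (rho x)" using d(2)[of x] x by (auto simp: dist_real_def dist_commute)
  ultimately show "exp (ln (rho z) - 1) <= rho x" by (metis exp_le_cancel_iff exp_ln)
 qed (use d e in auto)
qed

lemma nice_slc:
 fixes rho :: "'a::euclidean_space => real"
 assumes w: "slc_weight ka rho" and k: "ka > 0" and prob: "prob_space (dens rho)"
 shows "nice (interior {x. rho x > 0}) (dens rho)"
proof -
 note [measurable] = slc_weight_measurable[OF w]
 let ?mu = "dens rho" and ?O = "interior {x. rho x > 0}"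
 note nn = slc_weight_nonneg[OF w]
 have conv: "convex {x. rho x > 0}" using slc_weight_convex_support[OF w] k by auto
 have null: "AE x in lborel. x ~: {x. rho x > 0} - ?O"
  by (rule AE_not_in) (use convex_null_diff_interior[OF conv] in "auto simp: null_sets_def")
 have "emeasure ?mu (-?O) = (NL x. ennreal (rho x) * indicator (-?O) x)" by (rule emeasure_density) auto
 also have "... = (NN ((lborel :: 'a measure)) (%x. 0))"
 proof (rule nn_integral_cong_AE, use null in eventually_elim)
  fix x assume "x ~: {x. rho x > 0} - ?O"
  thus "ennreal (rho x) * indicator (-?O) x = 0" using nn[of x]
   by (auto split: split_indicator simp: order.order_iff_strict)
 qed
 finally have 1: "emeasure ?mu (-?O) = 0" by simp
 obtain n :: nat where n: "(NL x. ennreal (rho x * exp (ka / 4 * (max 0 (norm x - n))^2))) < \<infinity>"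
  using slc_gaussian_tail[OF w k prob] by blast
 have 2: "integrable ?mu (%x. (norm x)^2)"
 proof (rule I_bound)
  let ?h = "%x. (2 * (real n)^2 + 8 / ka) * exp (ka / 4 * (max 0 (norm x - n))^2)"
  have "integrable ?mu (%x. exp (ka / 4 * (max 0 (norm x - n))^2))"
  proof (rule integrableI_nonneg)
   show "(NN ?mu (%x. ennreal (exp (ka / 4 * (max 0 (norm x - n))^2)))) < \<infinity>"
    using n nn by (subst nn_integral_density) (auto simp: ennreal_mult')
  qed auto
  thus "integrable ?mu ?h" by simp
  show "AE x in ?mu. norm ((norm x)^2) <= norm (?h x)"
  proof (rule AE_I2)
   fix x :: 'a
   let ?m = "max 0 (norm x - n)"
   have "norm x <= n + ?m" by auto
   hence "(norm x)^2 <= (n + ?m)^2" by (intro power_mono) auto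
   also have "... <= 2 * (real n)^2 + 2 * ?m^2"
    using zero_le_power2[of "real n - ?m"] by (simp add: power2_eq_square algebra_simps)
   also have "2 * ?m^2 = 8 / ka * (ka / 4 * ?m^2)" using k by simp
   also have "... <= 8 / ka * exp (ka / 4 * ?m^2)"
   proof (rule mult_left_mono)
    show "ka / 4 * ?m^2 <= exp (ka / 4 * ?m^2)" using exp_ge_add_one_self[of "ka / 4 * ?m^2"] by linarith
   qed (use k in simp)
   also have "2 * (real n)^2 <= 2 * (real n)^2 * exp (ka / 4 * ?m^2)"
    using k mult_left_mono[of 1 "exp (ka / 4 * ?m^2)" "2 * (real n)^2"] by simp
   finally show "norm ((norm x)^2) <= norm (?h x)" using k by (simp add: algebra_simps)
  qed
 qed auto
 have 3: "EX r>0. EX c>0. ball z r <= ?O &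
    (ALL A:sets borel. A <= ball z r --> ennreal c * vol A <= emeasure ?mu A)" if "z : ?O" for z
 proof -
  obtain r c where rc: "r > 0" "c > 0" "ball z r <= ?O" "!!x. x : ball z r ==> c <= rho x"
   using slc_weight_pos_ball[OF w _ `z : ?O`] k by auto
  have "ennreal c * vol A <= emeasure ?mu A" if A: "A : sets borel" "A <= ball z r" for A
  proof -
   have "ennreal c * vol A = (NL x. ennreal c * indicator A x)" using A by (subst nn_integral_cmult) auto
   also have "... <= (NL x. ennreal (rho x) * indicator A x)"
   proof (intro nn_integral_mono)
    fix x show "ennreal c * indicator A x <= ennreal (rho x) * indicator A x"
     using subsetD[OF A(2), of x] rc(4)[of x] by (cases "x : A") (auto intro: ennreal_leI)
   qed
   also have "... = emeasure ?mu A" using A by (subst emeasure_density) auto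
   finally show ?thesis .
  qed
  with rc show ?thesis by blast
 qed
 show ?thesis unfolding nice_def using prob 1 2 3 conv by (auto simp: convex_interior absolutely_continuousI_density)
qed

lemma nice_density:
 fixes nu :: "'a::euclidean_space measure"
 assumes n: "nice Om nu" and h [measurable]: "h : BM"
  and ab: "0 < a" "!!x. a <= h x" "!!x. h x <= b" and int: "(LINT x|nu. h x) = 1"
 shows "nice Om (density nu (%x. ennreal (h x)))"
proof -
 let ?eta = "density nu (%x. ennreal (h x))"
 interpret prob_space nu using n by (simp add: nice_def)
 have sets [measurable_cong, simp]: "sets nu = sets borel" using n by (simp add: nice_def)
 have sp: "space nu = UNIV" using sets_eq_imp_space_eq[OF sets] by simp
 have h0: "0 <= h x" for x using ab(1) ab(2)[of x] by simp
 have ih: "integrable nu h" by (rule integrable_const_bound[of _ b]) (use ab h0 in auto)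
 have "emeasure ?eta (space ?eta) = (NN nu (%x. ennreal (h x)))"
  using sp by (subst emeasure_density) (auto intro!: nn_integral_cong)
 hence 1: "prob_space ?eta" using int h0 nn_integral_eq_integral[OF ih] by (intro prob_spaceI) simp
 have ac: "absolutely_continuous nu ?eta" by (rule absolutely_continuousI_density) simp
 have 2: "absolutely_continuous lborel ?eta" using ac n unfolding absolutely_continuous_def nice_def by auto
 have "-Om : null_sets nu" using n by (auto simp: nice_def null_sets_def)
 hence 3: "emeasure ?eta (-Om) = 0" using ac unfolding absolutely_continuous_def by (auto simp: null_sets_def)
 have i2: "integrable nu (%x. (norm x)^2)" using n by (simp add: nice_def)
 have 4: "integrable ?eta (%x. (norm x)^2)"
 proof (subst integrable_density)
  show "integrable nu (%x. h x *. (norm x)^2)"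
  proof (rule I_bound)
   show "integrable nu (%x. b * (norm x)^2)" using i2 by simp
   show "AE x in nu. norm (h x *. (norm x)^2) <= norm (b * (norm x)^2)"
    using ab h0 by (intro AE_I2) (auto simp: abs_mult intro!: mult_right_mono order_trans[OF _ abs_ge_self])
  qed simp
 qed (use h0 in auto)
 have 5: "ennreal a * emeasure nu A <= emeasure ?eta A" if "A : sets borel" for A
 proof -
  have "ennreal a * emeasure nu A = (NN nu (%x. ennreal a * indicator A x))"
   using that by (subst nn_integral_cmult) auto
  also have "... <= (NN nu (%x. ennreal (h x) * indicator A x))"
   using ab by (intro nn_integral_mono) (auto split: split_indicator intro: ennreal_leI)
  also have "... = emeasure ?eta A" using that by (subst emeasure_density) auto
  finally show ?thesis .
 qed
 have 6: "EX r>0. EX c>0. ball z r <= Om &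
    (ALL A:sets borel. A <= ball z r --> ennreal c * vol A <= emeasure ?eta A)" if z: "z : Om" for z
 proof -
  obtain r c where rc: "r > 0" "c > 0" "ball z r <= Om"
   "!!A. A : sets borel ==> A <= ball z r ==> ennreal c * vol A <= emeasure nu A"
   using n z unfolding nice_def by meson
  have "ennreal (a * c) * vol A <= emeasure ?eta A" if A: "A : sets borel" "A <= ball z r" for A
  proof -
   have "ennreal (a * c) * vol A = ennreal a * (ennreal c * vol A)" using ab rc by (simp add: ennreal_mult mult.assoc)
   also have "... <= ennreal a * emeasure nu A" using rc A by (intro mult_left_mono) auto
   finally show ?thesis using 5[OF A(1)] by simp
  qed
  with rc ab show ?thesis by (intro exI[of _ r] conjI exI[of _ "a * c"]) auto
 qed
 show ?thesis using 1 2 3 4 6 n unfolding nice_def by auto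
qed

section \<open>Almost everywhere differentiability of convex functions\<close>

text \<open>Slopes of a convex function are monotone in the increment, so the steps
  \<open>1 / Suc n\<close> already produce the right derivative \<open>m2\<close> and the left
  derivative \<open>m1\<close>. From \<open>N\<close> on, both sample points lie in
  \<open>I\<close>.\<close>

lemma convex_on_real_one_sided_limits:
 fixes g :: "real => real"
 assumes "open I" and g: "convex_on I g" and s: "s : I"
 obtains m1 m2 N where "m1 <= m2"
  "(%n. real (Suc n) * (g (s + 1 / Suc n) - g s)) ----> m2"
  "(%n. real (Suc n) * (g s - g (s - 1 / Suc n))) ----> m1"
  "!!n. n >= N ==> s + 1 / Suc n : I & s - 1 / Suc n : I &
    real (Suc n) * (g s - g (s - 1 / Suc n)) <= m1 & m2 <= real (Suc n) * (g (s + 1 / Suc n) - g s)"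
proof -
 obtain r where r: "r > 0" "ball s r <= I" using assms open_contains_ball by blast
 obtain N where N: "1 / real (Suc N) < r" using reals_Archimedean[OF r(1)] by (auto simp: inverse_eq_divide)
 have le: "1 / real (Suc n) <= 1 / real (Suc N)" if "n >= N" for n using that by (simp add: frac_le)
 have mem: "s + t : I" if "abs t <= 1 / Suc N" for t
  using r that N by (auto simp: dist_real_def intro!: subsetD[OF r(2)])
 define a where "a n = real (Suc (n + N)) * (g (s + 1 / Suc (n + N)) - g s)" for n
 define b where "b n = real (Suc (n + N)) * (g s - g (s - 1 / Suc (n + N)))" for n
 have slope: "(g (s + u) - g s) / u <= (g (s + v) - g s) / v"
  if uv: "u < v" "abs u <= 1 / Suc N" "abs v <= 1 / Suc N" "u ~= 0" "v ~= 0" for u v :: real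
 proof -
  consider "0 < u" | "u < 0" "0 < v" | "v < 0"
   using uv linorder_less_linear[of u 0] linorder_less_linear[of v 0] by auto
  thus ?thesis
  proof cases
   case 1
   from convex_on_slope_le(1)[OF g, of s "s + v" "s + u"] s mem that 1
   have "(g s - g (s + u)) / - u <= (g s - g (s + v)) / - v" by simp
   thus ?thesis by (simp add: minus_divide_right[symmetric] minus_divide_left)
  next
   case 2
   from order_trans[OF convex_on_slope_le(1,2)[OF g, of "s + u" "s + v" s]] s mem that 2
   have "(g (s + u) - g s) / u <= (g s - g (s + v)) / - v" by simp
   thus ?thesis by (simp add: minus_divide_right[symmetric] minus_divide_left)
  next
   case 3
   from convex_on_slope_le(2)[OF g, of "s + u" s "s + v"] s mem that 3
   show ?thesis by simp
  qed
 qed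
 have sm: "1 / real (Suc (n + N)) <= 1 / real (Suc N)" for n by (rule le) simp
 have a_eq: "a n = (g (s + 1 / Suc (n + N)) - g s) / (1 / Suc (n + N))" for n by (simp add: a_def)
 have b_eq: "b n = (g (s + - (1 / Suc (n + N))) - g s) / - (1 / Suc (n + N))" for n by (simp add: b_def field_simps)
 have dec: "decseq a"
 proof (rule decseq_SucI)
  fix n show "a (Suc n) <= a n"
   unfolding a_eq by (rule slope) (use sm[of n] sm[of "Suc n"] in "auto intro!: divide_strict_left_mono")
 qed
 have inc: "incseq b"
 proof (rule incseq_SucI)
  fix n show "b n <= b (Suc n)"
   unfolding b_eq by (rule slope) (use sm[of n] sm[of "Suc n"] in "auto intro!: divide_strict_left_mono")
 qed
 have ba: "b m <= a n" for m n
  unfolding a_eq b_eq by (rule slope) (use sm[of n] sm[of m] in "auto intro: order_less_trans[of _ 0]")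
 obtain m2 where m2: "a ----> m2" "!!n. m2 <= a n" using decseq_convergent[OF dec, of "b 0"] ba by blast
 obtain m1 where m1: "b ----> m1" "!!n. b n <= m1" using incseq_convergent[OF inc, of "a 0"] ba by blast
 have m12: "m1 <= m2" using m1(1) m2(1) ba by (intro LIMSEQ_le[OF m1(1) m2(1)]) auto
 show thesis
 proof (rule that[OF m12, of N])
  show "(%n. real (Suc n) * (g (s + 1 / Suc n) - g s)) ----> m2" using m2(1) unfolding a_def by (rule LIMSEQ_offset)
  show "(%n. real (Suc n) * (g s - g (s - 1 / Suc n))) ----> m1" using m1(1) unfolding b_def by (rule LIMSEQ_offset)
  fix n assume n: "N <= n"
  hence nN: "n - N + N = n" by simp
  have "s + 1 / Suc n : I" by (rule mem) (use le[OF n] in simp)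
  moreover have "s - 1 / Suc n : I" using mem[of "- (1 / Suc n)"] le[OF n] by simp
  moreover have "real (Suc n) * (g s - g (s - 1 / Suc n)) <= m1" using m1(2)[of "n - N"] nN by (simp add: b_def)
  moreover have "m2 <= real (Suc n) * (g (s + 1 / Suc n) - g s)" using m2(2)[of "n - N"] nN by (simp add: a_def)
  ultimately show "s + 1 / Suc n : I & s - 1 / Suc n : I &
    real (Suc n) * (g s - g (s - 1 / Suc n)) <= m1 & m2 <= real (Suc n) * (g (s + 1 / Suc n) - g s)" by blast
 qed
qed

lemma convex_on_real_second_difference:
 fixes g :: "real => real"
 assumes "open I" and g: "convex_on I g" and s: "s : I"
  and bad: "~ (%n. real (Suc n) * (g (s + 1 / Suc n) + g (s - 1 / Suc n) - 2 * g s)) ----> 0"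
 shows "EX q:\<rat>. EX N. ALL n>=N. s + 1 / Suc n : I & s - 1 / Suc n : I &
   real (Suc n) * (g s - g (s - 1 / Suc n)) < q & q < real (Suc n) * (g (s + 1 / Suc n) - g s)"
proof -
 obtain m1 m2 N where m: "m1 <= m2"
  "(%n. real (Suc n) * (g (s + 1 / Suc n) - g s)) ----> m2"
  "(%n. real (Suc n) * (g s - g (s - 1 / Suc n))) ----> m1"
  "!!n. n >= N ==> s + 1 / Suc n : I & s - 1 / Suc n : I &
    real (Suc n) * (g s - g (s - 1 / Suc n)) <= m1 & m2 <= real (Suc n) * (g (s + 1 / Suc n) - g s)"
  by (rule convex_on_real_one_sided_limits[OF assms(1-3)]) blast
 have "m1 ~= m2"
 proof
  assume "m1 = m2"
  with tendsto_diff[OF m(2,3)] bad show False by (simp add: algebra_simps)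
 qed
 then obtain q where q: "q : \<rat>" "m1 < q" "q < m2" using Rats_dense_in_real[of m1 m2] m(1) by auto
 show ?thesis by (intro bexI[OF _ q(1)] exI[of _ N]) (use m(4) q in fastforce)
qed

text \<open>At a bad point the left derivative is smaller than the right one, and a rational fits in
  between. Monotonicity of slopes makes these rationals strictly increasing along the bad points, so
  the bad set injects into the rationals.\<close>

lemma convex_on_real_second_difference_countable:
 fixes g :: "real => real"
 assumes "open I" and g: "convex_on I g"
 shows "countable {s\<in>I. ~ (%n. real (Suc n) * (g (s + 1 / Suc n) + g (s - 1 / Suc n) - 2 * g s)) ----> 0}"
  (is "countable ?B")
proof -
 define P where "P s q N \<longleftrightarrow> (ALL n>=N. s + 1 / Suc n : I & s - 1 / Suc n : I &
   real (Suc n) * (g s - g (s - 1 / Suc n)) < q & q < real (Suc n) * (g (s + 1 / Suc n) - g s))"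
  for s :: real and q :: real and N :: nat
 have "ALL s:?B. EX qN. fst qN : \<rat> & P s (fst qN) (snd qN)"
  using convex_on_real_second_difference[OF assms] unfolding P_def by fastforce
 from bchoice[OF this] obtain h where h: "ALL s:?B. fst (h s) : \<rat> & P s (fst (h s)) (snd (h s))" ..
 define q where "q s = fst (h s)" for s
 define N where "N s = snd (h s)" for s
 have q: "!!s. s : ?B ==> q s : \<rat>"
  "!!s n. s : ?B ==> n >= N s ==> s + 1 / Suc n : I & s - 1 / Suc n : I &
   real (Suc n) * (g s - g (s - 1 / Suc n)) < q s & q s < real (Suc n) * (g (s + 1 / Suc n) - g s)"
  using h unfolding P_def q_def N_def by blast+
 have "q s < q s'" if s: "s : ?B" "s' : ?B" "s < s'" for s s'
 proof -
  obtain M where M: "1 / real (Suc M) < s' - s"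
   using reals_Archimedean[of "s' - s"] s(3) by (auto simp: inverse_eq_divide)
  define n where "n = max M (max (N s) (N s'))"
  have "1 / real (Suc n) <= 1 / real (Suc M)" by (simp add: n_def frac_le)
  hence n1: "1 / real (Suc n) < s' - s" using M by (rule order_le_less_trans)
  let ?d = "1 / real (Suc n)"
  have d: "?d > 0" by simp
  note 1 = q(2)[OF s(1), of n] and 2 = q(2)[OF s(2), of n]
  have "q s < real (Suc n) * (g (s + ?d) - g s)" using 1 by (simp add: n_def)
  also have "... = (g s - g (s + ?d)) / (s - (s + ?d))" by (simp add: field_simps)
  also have "... <= (g s - g s') / (s - s')" using s n1 d by (intro convex_on_slope_le(1)[OF g]) auto
  also have "... <= (g (s' - ?d) - g s') / ((s' - ?d) - s')" using s n1 d by (intro convex_on_slope_le(2)[OF g]) auto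
  also have "... = real (Suc n) * (g s' - g (s' - ?d))" by (simp add: field_simps)
  also have "... < q s'" using 2 by (simp add: n_def)
  finally show ?thesis .
 qed
 note lt = this
 have "inj_on q ?B"
 proof (rule inj_onI, rule ccontr)
  fix s s' assume s: "s : ?B" "s' : ?B" "q s = q s'" "s ~= s'"
  then consider "s < s'" | "s' < s" by linarith
  thus False
  proof cases
   case 1 from lt[OF s(1,2) 1] s(3) show False by simp
  next
   case 2 from lt[OF s(2,1) 2] s(3) show False by simp
  qed
 qed
 thus ?thesis by (rule countable_image_inj_on[rotated]) (rule countable_subset[OF _ countable_rat], use q(1) in blast)
qed

text \<open>The volume of \<open>A\<close> is the average over \<open>s\<close> in
  \<open>{0..1}\<close> of the volumes of its translates along \<open>e\<close>; Fubini turns this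
  into an integral over \<open>z\<close> of lengths of countable sets. This avoids coordinates
  adapted to \<open>e\<close>.\<close>

lemma null_set_countable_on_lines:
 fixes A :: "'a::euclidean_space set"
 assumes A [measurable]: "A : sets borel" and lines: "!!z. countable {s::real. z + s *. e : A}"
 shows "vol A = 0"
proof -
 let ?f = "%z s. indicator A (z + s *. e) * indicator {0..1::real} s :: ennreal"
 have [measurable]: "(%(z, s). ?f z s) : bm (lborel >< lborel)" by measurable
 have z: "(NL s. ?f z s) = 0" for z
 proof -
  have "{s. z + s *. e : A} : null_sets lborel" using lines[of z] by (rule countable_imp_null_set_lborel)
  hence "AE s in lborel. s ~: {s. z + s *. e : A}" by (rule AE_not_in)
  hence "AE s in lborel. ?f z s = 0" by eventually_elim auto
  thus ?thesis by (subst nn_integral_0_iff_AE) auto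
 qed
 have "vol A = (NL s. vol A * indicator {0..1::real} s)" by (subst nn_integral_cmult) auto
 also have "... = (NL s. (NL z. ?f z s))"
 proof (intro nn_integral_cong)
  fix s :: real
  have "(NL z. indicator A (z + s *. e)) = (NN (distr lborel borel ((+) (s *. e))) (%z. indicator A z))"
   by (subst nn_integral_distr) (auto simp: add.commute)
  also have "... = vol A" by (subst lborel_distr_plus) simp
  finally show "vol A * indicator {0..1} s = (NL z. ?f z s)" by (simp add: nn_integral_multc)
 qed
 also have "... = (NL z. (NL s. ?f z s))" by (rule lborel_pair.Fubini') simp
 also have "... = 0" by (simp add: z)
 finally show ?thesis .
qed

text \<open>For the remainder \<open>g v = phi (z + v) - phi z - v <.> R\<close>, convexity bounds
  \<open>g v\<close> from above by remainders on the axes. The lower bound then comes for free from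
  \<open>g v + g (- v) >= 2 * g 0 = 0\<close>.\<close>

lemma convex_has_gradient_from_axes:
 fixes phi :: "'a::euclidean_space => real"
 assumes Om: "open Om" "convex Om" "convex_on Om phi" "z : Om"
  and ax: "!!e. e : Basis ==> (%n. real (Suc n) * (phi (z + (1 / Suc n) *. e) - phi z)) ----> R <.> e"
      "!!e. e : Basis ==> (%n. real (Suc n) * (phi z - phi (z - (1 / Suc n) *. e))) ----> R <.> e"
 shows "GDERIV phi z :> R"
proof -
 define g where "g v = phi (z + v) - phi z - v <.> R" for v
 obtain r where r: "r > 0" "ball z r <= Om" using Om open_contains_ball by blast
 have gconv: "g ((1 - t) *. v + t *. w) <= (1 - t) * g v + t * g w"
  if "norm v < r" "norm w < r" "0 <= t" "t <= 1" for v w t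
 proof -
  have "z + v : Om" "z + w : Om" using that r by (auto simp: dist_norm)
  hence "phi ((1 - t) *. (z + v) + t *. (z + w)) <= (1 - t) * phi (z + v) + t * phi (z + w)"
   using that Om(3) by (intro convex_onD) auto
  moreover have "(1 - t) *. (z + v) + t *. (z + w) = z + ((1 - t) *. v + t *. w)" by (simp add: algebra_simps)
  ultimately show ?thesis by (simp add: g_def inner_add_left algebra_simps)
 qed
 have cong: "convex_on (ball 0 r) g" by (rule convex_onI) (use gconv in auto)
 let ?D = "real DIM('a)"
 have D: "?D >= 1" using DIM_positive[where 'a='a] by (simp del: DIM_positive)
 have up: "EX d>0. ALL v. norm v < d --> g v <= eps * ?D * norm v" if "eps > 0" for eps
 proof -
  have "ALL e:Basis. \<forall>\<^sub>F n in sequentially. abs (real (Suc n) * g ((1 / Suc n) *. e)) < eps &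
    abs (real (Suc n) * g (- ((1 / Suc n) *. e))) < eps"
  proof
   fix e :: 'a assume e: "e : Basis"
   have "(%n. real (Suc n) * g ((1 / Suc n) *. e)) ----> 0"
    using tendsto_diff[OF ax(1)[OF e] tendsto_const[of "R <.> e"]]
    by (simp add: g_def right_diff_distrib inner_commute)
   moreover have "(%n. real (Suc n) * g (- ((1 / Suc n) *. e))) ----> 0"
   proof -
    have "real (Suc n) * g (- ((1 / Suc n) *. e)) = R <.> e - real (Suc n) * (phi z - phi (z - (1 / Suc n) *. e))" for n
     by (simp add: g_def inner_commute field_simps)
    thus ?thesis using tendsto_diff[OF tendsto_const[of "R <.> e"] ax(2)[OF e]] by simp
   qed
   ultimately show "\<forall>\<^sub>F n in sequentially. abs (real (Suc n) * g ((1 / Suc n) *. e)) < eps &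
    abs (real (Suc n) * g (- ((1 / Suc n) *. e))) < eps"
    using that unfolding tendsto_iff by (intro eventually_conj) (auto simp: dist_real_def)
  qed
  hence "\<forall>\<^sub>F n in sequentially. ALL e:Basis. abs (real (Suc n) * g ((1 / Suc n) *. e)) < eps &
    abs (real (Suc n) * g (- ((1 / Suc n) *. e))) < eps" by (intro eventually_ball_finite) auto
  moreover have "\<forall>\<^sub>F n in sequentially. 1 / real (Suc n) < r"
   using order_tendstoD(2)[OF LIMSEQ_Suc[OF lim_1_over_n] r(1)] by simp
  ultimately have "\<forall>\<^sub>F n in sequentially. 1 / real (Suc n) < r & (ALL e:Basis.
    abs (real (Suc n) * g ((1 / Suc n) *. e)) < eps & abs (real (Suc n) * g (- ((1 / Suc n) *. e))) < eps)"
   by eventually_elim simp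
  then obtain n where n: "1 / real (Suc n) < r"
   "!!e. e : Basis ==> abs (real (Suc n) * g ((1 / Suc n) *. e)) < eps & abs (real (Suc n) * g (- ((1 / Suc n) *. e))) < eps"
   by (auto dest!: eventually_happens'[OF sequentially_bot])
  have axis: "g (t *. e) <= eps * abs t" if e: "e : Basis" and t: "abs t <= 1 / Suc n" for t e
  proof -
   define w where "w = (if t >= 0 then (1 / real (Suc n)) *. e else - ((1 / real (Suc n)) *. e))"
   define l where "l = abs t * Suc n"
   have l: "0 <= l" "l <= 1" using t by (auto simp: l_def field_simps)
   have tw: "t *. e = (1 - l) *. 0 + l *. w" by (auto simp: w_def l_def)
   have "g (t *. e) <= (1 - l) * g 0 + l * g w" unfolding tw by (rule gconv) (use r n e l in "auto simp: w_def")
   also have "... = abs t * (real (Suc n) * g w)" by (simp add: g_def l_def)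
   also have "... <= abs t * eps" using n(2)[OF e] by (intro mult_left_mono) (auto simp: w_def)
   finally show ?thesis by (simp add: mult.commute)
  qed
  show ?thesis
  proof (intro exI[of _ "1 / (Suc n * ?D)"] conjI allI impI)
   show "0 < 1 / (real (Suc n) * ?D)" using D by simp
   fix v :: 'a assume v: "norm v < 1 / (Suc n * ?D)"
   have small: "abs (?D * (v <.> e)) <= 1 / Suc n" if "e : Basis" for e
   proof -
    have "abs (?D * (v <.> e)) = ?D * abs (v <.> e)" by (simp add: abs_mult)
    also have "... <= ?D * norm v" using Basis_le_norm[OF that] by (intro mult_left_mono) auto
    also have "... <= ?D * (1 / (Suc n * ?D))" using v by (intro mult_left_mono) auto
    also have "... = 1 / Suc n" using D by simp
    finally show ?thesis .
   qed
   \<comment> \<open>\<open>v\<close> is the average of \<open>?D\<close> points on the axes, each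
     stretched by the factor \<open>?D\<close>; hence the additional \<open>?D\<close> in the
     radius.\<close>
   have "v = (SUM e:Basis. (1 / ?D) *. ((?D * (v <.> e)) *. e))" using D by (simp add: euclidean_representation)
   hence "g v = g (SUM e:Basis. (1 / ?D) *. ((?D * (v <.> e)) *. e))" by simp
   also have "... <= (SUM e:Basis. (1 / ?D) * g ((?D * (v <.> e)) *. e))"
   proof (rule convex_on_sum[OF _ _ cong])
    fix e :: 'a assume e: "e : Basis"
    show "(?D * (v <.> e)) *. e : ball 0 r" using small[OF e] n(1) e by (auto simp: abs_mult)
   qed (use D in auto)
   also have "... <= (SUM e:(Basis::'a set). (1 / ?D) * (eps * (?D * norm v)))"
   proof (intro sum_mono mult_left_mono)
    fix e :: 'a assume e: "e : Basis"
    have "g ((?D * (v <.> e)) *. e) <= eps * abs (?D * (v <.> e))" using axis[OF e small[OF e]] .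
    also have "... <= eps * (?D * norm v)"
     using Basis_le_norm[OF e, of v] that by (intro mult_left_mono) (auto simp: abs_mult)
    finally show "g ((?D * (v <.> e)) *. e) <= eps * (?D * norm v)" .
   qed (use D in auto)
   also have "... = eps * ?D * norm v" using D by simp
   finally show "g v <= eps * ?D * norm v" .
  qed
 qed
 show ?thesis unfolding gderiv_def has_derivative_at_alt
 proof (intro conjI allI impI)
  show "bounded_linear (%h. h <.> R)" by (rule bounded_linear_inner_left)
  fix eps :: real assume "eps > 0"
  then obtain d where d: "d > 0" "!!v. norm v < d ==> g v <= eps / ?D * ?D * norm v"
   using up[of "eps / ?D"] D by (auto simp del: times_divide_eq_left)
  show "EX d>0. ALL y. norm (y - z) < d --> norm (phi y - phi z - (y - z) <.> R) <= eps * norm (y - z)"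
  proof (intro exI[of _ "min d r"] conjI allI impI)
   fix y assume y: "norm (y - z) < min d r"
   let ?v = "y - z"
   have 1: "g ?v <= eps * norm ?v" "g (- ?v) <= eps * norm ?v"
    using d(2)[of ?v] d(2)[of "- ?v"] y D by (auto simp: norm_minus_commute)
   have "g ((1 - 1/2) *. ?v + (1/2) *. (- ?v)) <= (1 - 1/2) * g ?v + 1/2 * g (- ?v)"
    by (rule gconv) (use y in "auto simp: norm_minus_commute")
   hence "0 <= g ?v + g (- ?v)" by (simp add: g_def algebra_simps)
   with 1 have "abs (g ?v) <= eps * norm ?v" by linarith
   thus "norm (phi y - phi z - (y - z) <.> R) <= eps * norm (y - z)" by (simp add: g_def)
  qed (use d r in auto)
 qed
qed

lemma convex_on_line:
 fixes phi :: "'a::real_vector => real"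
 assumes "convex Om" "convex_on Om phi"
 shows "convex_on {s. z + s *. e : Om} (%s. phi (z + s *. e))"
proof -
 have eq: "z + ((1 - t) * a + t * b) *. e = (1 - t) *. (z + a *. e) + t *. (z + b *. e)" for a b t
  by (simp add: algebra_simps)
 show ?thesis
 proof (rule convex_onI)
  show "convex {s. z + s *. e : Om}" unfolding convex_alt by (auto simp: eq convexD_alt[OF assms(1)])
 qed (auto simp: eq intro!: convex_onD[OF assms(2)])
qed

lemma open_line_vimage:
 fixes z :: "'a::real_normed_vector"
 assumes "open Om" shows "open {s::real. z + s *. e : Om}"
proof -
 have "open ((%s::real. z + s *. e) -` Om)" by (rule continuous_open_vimage[OF assms]) (intro allI continuous_intros)
 thus ?thesis by (simp add: vimage_def)
qed

text \<open>On every line parallel to a basis vector the kinks are countable, hence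
  \<open>A e\<close> is null. Off these finitely many null sets all partial derivatives exist from
  both sides, which suffices for a convex function.\<close>

lemma convex_gradient_AE:
 fixes phi :: "'a::euclidean_space => real"
 assumes Om: "open Om" "convex Om" "convex_on Om phi"
 obtains R where "R : BM" "AE z in lborel. z : Om --> GDERIV phi z :> R z"
proof -
 define f where "f z = (if z : Om then phi z else 0)" for z
 have [measurable]: "Om : sets borel" using Om by auto
 have "continuous_on Om phi" using convex_on_continuous Om by blast
 hence [measurable]: "f : BM" unfolding f_def by (intro borel_measurable_continuous_on_if) auto
 \<comment> \<open>Limits of difference quotients of the Borel extension \<open>f\<close> are Borel,
   including at points where the sequence diverges; on \<open>Om\<close>, outside a null set, they
   are the partial derivatives.\<close>
 define R where "R z = (SUM e:Basis. lim (%n. real (Suc n) * (f (z + (1 / Suc n) *. e) - f z)) *. e)" for z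
 have Rm: "R : BM" unfolding R_def by measurable
 define A where "A e = {z\<in>Om. ~ (%n. real (Suc n) * (f (z + (1 / Suc n) *. e) + f (z - (1 / Suc n) *. e) - 2 * f z)) ----> 0}" for e
 have ev: "\<forall>\<^sub>F n in sequentially. z + (1 / Suc n) *. e : Om & z - (1 / Suc n) *. e : Om"
  if "z : Om" for z e
 proof -
  have "(%n. z + (1 / Suc n) *. e) ----> z + 0 *. e" "(%n. z - (1 / Suc n) *. e) ----> z - 0 *. e"
   by (intro tendsto_intros LIMSEQ_Suc[OF lim_1_over_n])+
  thus ?thesis using that Om(1) by (intro eventually_conj; auto dest: topological_tendstoD)
 qed
 have A_eq: "A e = {z\<in>Om. ~ (%n. real (Suc n) * (phi (z + (1 / Suc n) *. e) + phi (z - (1 / Suc n) *. e) - 2 * phi z)) ----> 0}" for e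
 proof -
  have "(%n. real (Suc n) * (f (z + (1 / Suc n) *. e) + f (z - (1 / Suc n) *. e) - 2 * f z)) ----> 0
   \<longleftrightarrow> (%n. real (Suc n) * (phi (z + (1 / Suc n) *. e) + phi (z - (1 / Suc n) *. e) - 2 * phi z)) ----> 0"
   if "z : Om" for z by (rule tendsto_cong, rule eventually_mono[OF ev[OF that]]) (use that in "auto simp: f_def")
  thus ?thesis unfolding A_def by blast
 qed
 have Ae: "A e : null_sets lborel" for e
 proof -
  have m: "A e : sets borel" unfolding A_def by measurable
  have "countable {s::real. z + s *. e : A e}" for z
  proof -
   let ?I = "{s. z + s *. e : Om}" and ?g = "%s. phi (z + s *. e)"
   have "{s. z + s *. e : A e}
    = {s\<in>?I. ~ (%n. real (Suc n) * (?g (s + 1 / Suc n) + ?g (s - 1 / Suc n) - 2 * ?g s)) ----> 0}"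
    unfolding A_eq by (auto simp: algebra_simps)
   thus ?thesis
    using convex_on_real_second_difference_countable[OF open_line_vimage[OF Om(1)] convex_on_line[OF Om(2,3)], of z e]
    by simp
  qed
  from null_set_countable_on_lines[OF m this] show ?thesis using m by (auto simp: null_sets_def)
 qed
 have "AE z in lborel. ALL e:Basis. z ~: A e" using Ae by (intro AE_finite_allI AE_not_in) auto
 hence "AE z in lborel. z : Om --> GDERIV phi z :> R z"
 proof (eventually_elim, intro impI)
  fix z assume good: "ALL e:Basis. z ~: A e" and z: "z : Om"
  have *: "(%n. real (Suc n) * (phi (z + (1 / Suc n) *. e) - phi z)) ----> R z <.> e &
       (%n. real (Suc n) * (phi z - phi (z - (1 / Suc n) *. e))) ----> R z <.> e" if e: "e : Basis" for e
  proof -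
   let ?g = "%s. phi (z + s *. e)"
   obtain m1 m2 where m: 
    "(%n. real (Suc n) * (?g (0 + 1 / Suc n) - ?g 0)) ----> m2"
    "(%n. real (Suc n) * (?g 0 - ?g (0 - 1 / Suc n))) ----> m1"
    by (rule convex_on_real_one_sided_limits[OF open_line_vimage[OF Om(1)] convex_on_line[OF Om(2,3)], of 0 z e])
      (use z in auto)
   hence m': "(%n. real (Suc n) * (phi (z + (1 / Suc n) *. e) - phi z)) ----> m2"
    "(%n. real (Suc n) * (phi z - phi (z - (1 / Suc n) *. e))) ----> m1" by auto
   have "(%n. real (Suc n) * (phi (z + (1 / Suc n) *. e) + phi (z - (1 / Suc n) *. e) - 2 * phi z)) ----> m2 - m1"
    using tendsto_diff[OF m'] by (simp add: algebra_simps)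
   moreover have "(%n. real (Suc n) * (phi (z + (1 / Suc n) *. e) + phi (z - (1 / Suc n) *. e) - 2 * phi z)) ----> 0"
    using good e z unfolding A_eq by blast
   ultimately have "m2 - m1 = 0" by (rule LIMSEQ_unique)
   moreover have "R z <.> e = m2"
   proof -
    have "(%n. real (Suc n) * (f (z + (1 / Suc n) *. e) - f z)) ----> m2" using m'(1)
     by (rule Lim_transform_eventually) (rule eventually_mono[OF ev[OF z, of e]], use z in "auto simp: f_def")
    hence "lim (%n. real (Suc n) * (f (z + (1 / Suc n) *. e) - f z)) = m2" by (rule limI)
    thus ?thesis unfolding R_def using e by simp
   qed
   ultimately show ?thesis using m' by simp
  qed
  show "GDERIV phi z :> R z" by (rule convex_has_gradient_from_axes[OF Om z]) (use * in auto)
 qed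
 with Rm show thesis by (rule that)
qed

lemma gderivE:
 assumes "GDERIV phi z :> R" "eps > 0"
 obtains d where "d > 0" "!!y. norm (y - z) < d ==> abs (phi y - phi z - (y - z) <.> R) <= eps * norm (y - z)"
 using assms unfolding gderiv_def has_derivative_at_alt by (metis real_norm_def)

lemma convex_gderiv_subgradient:
 fixes phi :: "'a::euclidean_space => real"
 assumes c: "convex_on Om phi" and z: "z : Om" "z' : Om" and g: "GDERIV phi z :> R"
 shows "phi z' >= phi z + R <.> (z' - z)"
proof (rule field_le_epsilon)
 fix e :: real assume "e > 0"
 define eps where "eps = e / (norm (z' - z) + 1)"
 have n: "norm (z' - z) + 1 > 0" using norm_ge_zero[of "z' - z"] by linarith
 have eps: "eps > 0" using `e > 0` n by (simp add: eps_def)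
 obtain d where d: "d > 0" "!!y. norm (y - z) < d ==> abs (phi y - phi z - (y - z) <.> R) <= eps * norm (y - z)"
  by (rule gderivE[OF g eps]) blast
 define t where "t = min 1 (d / (2 * (norm (z' - z) + 1)))"
 have t: "0 < t" "t <= 1" using d n by (auto simp: t_def)
 have "t * norm (z' - z) <= d / (2 * (norm (z' - z) + 1)) * (norm (z' - z) + 1)"
  using d n by (intro mult_mono) (auto simp: t_def)
 also have "... = d / 2" using n by (simp add: field_simps)
 also have "... < d" using d by simp
 finally have small: "t * norm (z' - z) < d" .
 have "phi ((1 - t) *. z + t *. z') <= (1 - t) * phi z + t * phi z'" using t by (intro convex_onD[OF c] z) auto
 moreover have eq: "(1 - t) *. z + t *. z' = z + t *. (z' - z)" by (simp add: algebra_simps)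
 moreover have "abs (phi (z + t *. (z' - z)) - phi z - t * ((z' - z) <.> R)) <= eps * (t * norm (z' - z))"
  using d(2)[of "z + t *. (z' - z)"] small t by simp
 ultimately have "t * (phi z + R <.> (z' - z)) <= t * (phi z' + eps * norm (z' - z))"
  by (simp add: algebra_simps inner_commute abs_le_iff)
 hence "phi z + R <.> (z' - z) <= phi z' + eps * norm (z' - z)" using t by simp
 also have "eps * norm (z' - z) <= eps * (norm (z' - z) + 1)" using eps by simp
 also have "... = e" using n by (simp add: eps_def)
 finally show "phi z + R <.> (z' - z) <= phi z' + e" by simp
qed

text \<open>Testing the approximate inequality at \<open>z + p *. u\<close>, with \<open>u\<close>
  the direction of \<open>x - R\<close>, against the first-order expansion at \<open>z\<close> gives
  \<open>p * norm (x - R) <= p * eps / 2 + eta\<close>; this dictates the choice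
  \<open>eta = p * eps / 2\<close>. The limits in \<open>dual_pair_perturbation\<close> and
  \<open>barycenter_converges\<close> identify gradients in this way.\<close>

lemma approximate_subgradient_close:
 fixes phi :: "'a::euclidean_space => real"
 assumes "open Om" "z : Om" and g: "GDERIV phi z :> R" and eps: "eps > 0"
 obtains eta where "eta > 0" "!!x. (ALL z':Om. phi z' >= phi z + x <.> (z' - z) - eta) ==> norm (x - R) <= eps"
proof -
 have "eps / 2 > 0" using eps by simp
 from gderivE[OF g this] obtain d where d: "d > 0" "!!y. norm (y - z) < d ==> abs (phi y - phi z - (y - z) <.> R) <= eps / 2 * norm (y - z)"
  by blast
 obtain r where r: "r > 0" "ball z r <= Om" using assms open_contains_ball by blast
 define p where "p = min d r / 2"
 have p: "p > 0" "p < d" "p < r" using d r by (auto simp: p_def)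
 show thesis
 proof (rule that[of "p * eps / 2"])
  fix x assume x: "ALL z':Om. phi z' >= phi z + x <.> (z' - z) - p * eps / 2"
  show "norm (x - R) <= eps"
  proof (cases "x = R")
   case False
   define u where "u = (1 / norm (x - R)) *. (x - R)"
   have u: "norm u = 1" "u <.> (x - R) = norm (x - R)"
    using False by (auto simp: u_def dot_square_norm power2_eq_square)
   let ?y = "z + p *. u"
   have "?y : Om" using r p u by (intro subsetD[OF r(2)]) (auto simp: dist_norm)
   hence 1: "phi ?y >= phi z + p * (x <.> u) - p * eps / 2" using x by fastforce
   have 2: "phi ?y - phi z - p * (u <.> R) <= eps / 2 * p" using abs_le_D1[OF d(2)[of ?y]] p u by simp
   have "p * norm (x - R) = p * (x <.> u) - p * (u <.> R)"
    using u(2) by (simp add: inner_diff_right inner_commute algebra_simps)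
   also have "... <= p * eps" using 1 2 by (simp add: algebra_simps)
   finally show ?thesis using p by simp
  qed (use eps in simp)
 qed (use p eps in simp)
qed

lemma subgradient_unique:
 fixes phi :: "'a::euclidean_space => real"
 assumes "open Om" "z : Om" and g: "GDERIV phi z :> R" and x: "!!z'. z' : Om ==> phi z' >= phi z + x <.> (z' - z)"
 shows "x = R"
proof -
 have "norm (x - R) <= 0 + eps" if eps: "eps > 0" for eps
 proof -
  obtain eta where "eta > 0" and eta: "!!x. (ALL z':Om. phi z' >= phi z + x <.> (z' - z) - eta) ==> norm (x - R) <= eps"
   by (rule approximate_subgradient_close[OF assms(1-3) eps]) blast
  show ?thesis using eta[of x] x `eta > 0` by fastforce
 qed
 hence "norm (x - R) <= 0" by (rule field_le_epsilon)
 thus ?thesis by simp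
qed

section \<open>Compactness of sequences of convex functions\<close>

lemma lborel_distr_reflect:
 fixes z :: "'a::euclidean_space"
 shows "distr lborel borel (%x. z - x) = lborel" using lborel_affine[of "-1" z] by (simp add: density_1)

text \<open>Midpoint convexity at \<open>z\<close> shows that for one of \<open>x\<close> and its
  reflection \<open>2 *. z - x\<close> the function \<open>phi - a <.> x\<close> is at least its
  value \<open>L\<close> at \<open>z\<close>. Such points fill at least half of the ball, and
  Markov's inequality with the lower density bound limits \<open>L\<close>. The constant
  \<open>K\<close> is fixed before \<open>phi\<close>.\<close>

lemma nice_pointwise_bound:
 fixes nu :: "'a::euclidean_space measure"
 assumes n: "nice Om nu" and z: "z : Om"
 obtains K where "!!phi. convex_on Om phi ==> phi : BM ==> (!!x. x : Om ==> a <.> x <= phi x) ==>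
   (NN nu (%x. ennreal (phi x - a <.> x))) <= ennreal C ==> phi z <= K"
proof -
 obtain r c where rc: "r > 0" "c > 0" "ball z r <= Om"
  "!!A. A : sets borel ==> A <= ball z r ==> ennreal c * vol A <= emeasure nu A" using n z unfolding nice_def by meson
 define b where "b = measure lborel (ball z r)"
 have b: "vol (ball z r) = ennreal b" "b > 0"
  unfolding b_def using rc(1) emeasure_bounded_finite[OF bounded_ball, of z r]
  by (simp_all add: emeasure_eq_ennreal_measure content_ball_pos)
 have sets [measurable_cong]: "sets nu = sets borel" using n by (simp add: nice_def)
 define K where "K = a <.> z + 2 * max C 0 / (c * b)"
 show thesis
 proof (rule that[of K])
  fix phi :: "'a => real"
  assume conv: "convex_on Om phi" and [measurable]: "phi : BM"
   and lower: "!!x. x : Om ==> a <.> x <= phi x" and C: "(NN nu (%x. ennreal (phi x - a <.> x))) <= ennreal C"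
  define L where "L = phi z - a <.> z"
  have L0: "L >= 0" using lower[OF z] by (simp add: L_def)
  define A where "A = {x\<in>ball z r. L <= phi x - a <.> x}"
  have A [measurable]: "A : sets borel" unfolding A_def by measurable
  have "ball z r <= A Un (%x. 2 *. z - x) -` A"
  proof
   fix x assume x: "x : ball z r"
   have x': "2 *. z - x : ball z r"
   proof -
    have "z - (2 *. z - x) = x - z" by (simp add: scaleR_2)
    thus ?thesis using x unfolding mem_ball dist_norm by (metis norm_minus_commute)
   qed
   have "phi ((1 - 1/2) *. x + (1/2) *. (2 *. z - x)) <= (1 - 1/2) * phi x + 1/2 * phi (2 *. z - x)"
    using x x' rc by (intro convex_onD[OF conv]) auto
   moreover have "(1 - 1/2) *. x + (1/2) *. (2 *. z - x) = z" by (simp add: algebra_simps)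
   ultimately have "2 * phi z <= phi x + phi (2 *. z - x)" by simp
   moreover have "a <.> (2 *. z - x) = 2 * (a <.> z) - a <.> x" by (simp add: inner_diff_right)
   ultimately have "L <= phi x - a <.> x | L <= phi (2 *. z - x) - a <.> (2 *. z - x)" unfolding L_def by linarith
   thus "x : A Un (%x. 2 *. z - x) -` A" using x x' by (auto simp: A_def)
  qed
  hence "vol (ball z r) <= vol (A Un (%x. 2 *. z - x) -` A)"
   by (intro emeasure_mono) (auto intro!: measurable_sets_borel[OF _ A])
  also have "... <= vol A + vol ((%x. 2 *. z - x) -` A)"
   by (intro emeasure_subadditive) (auto intro!: measurable_sets_borel[OF _ A])
  also have "vol ((%x. 2 *. z - x) -` A) = emeasure (distr lborel borel (%x. 2 *. z - x)) A"
   by (subst emeasure_distr) auto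
  also have "... = vol A" by (simp add: lborel_distr_reflect)
  finally have half: "ennreal b <= 2 * vol A" by (simp add: b mult_2)
  have "ennreal L * (ennreal c * ennreal b) <= ennreal L * (ennreal c * (2 * vol A))"
   by (intro mult_left_mono half) auto
  also have "... <= 2 * (ennreal L * emeasure nu A)"
  proof -
   have "ennreal c * vol A <= emeasure nu A" by (rule rc(4)) (auto simp: A_def)
   hence "ennreal L * (ennreal c * vol A) <= ennreal L * emeasure nu A" by (rule mult_left_mono) simp
   hence "2 * (ennreal L * (ennreal c * vol A)) <= 2 * (ennreal L * emeasure nu A)" by (rule mult_left_mono) simp
   thus ?thesis by (simp add: ac_simps)
  qed
  also have "ennreal L * emeasure nu A = (NN nu (%x. ennreal L * indicator A x))"
   by (subst nn_integral_cmult) (auto simp: sets)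
  also have "... <= (NN nu (%x. ennreal (phi x - a <.> x)))"
   by (intro nn_integral_mono) (auto simp: A_def split: split_indicator intro!: ennreal_leI)
  also note C
  finally have "ennreal L * (ennreal c * ennreal b) <= 2 * ennreal C" by (simp add: mult_left_mono)
  moreover have "ennreal L * (ennreal c * ennreal b) = ennreal (L * (c * b))"
   using L0 rc b by (simp add: ennreal_mult)
  moreover have "2 * ennreal C = ennreal (2 * max C 0)" by (cases "C >= 0") (auto simp: ennreal_mult ennreal_neg)
  ultimately have "ennreal (L * (c * b)) <= ennreal (2 * max C 0)" by simp
  hence "L * (c * b) <= 2 * max C 0" by (simp add: ennreal_le_iff)
  hence "L <= 2 * max C 0 / (c * b)" using rc b by (simp add: field_simps)
  thus "phi z <= K" by (simp add: K_def L_def)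
 qed
qed

lemma bounded_sequences_diagonal:
 fixes f :: "nat => 'b => real"
 assumes D: "countable D" and b: "!!d. d : D ==> EX K. ALL n. abs (f n d) <= K"
 obtains r where "strict_mono (r :: nat => nat)" "!!d. d : D ==> convergent (%n. f (r n) d)"
proof (cases "D = {}")
 case False
 define e where "e = from_nat_into D"
 have e: "range e = D" using D False by (simp add: e_def range_from_nat_into)
 interpret S: subseqs "%k s. convergent (%n. f (s n) (e k))"
 proof
  fix k and s :: "nat => nat" assume "strict_mono s"
  obtain K where "ALL n. abs (f n (e k)) <= K" using b[of "e k"] e by blast
  hence "bounded (range (%n. f (s n) (e k)))" by (auto simp: bounded_iff)
  then obtain l r where "strict_mono r" "((%n. f (s n) (e k)) o r) ----> l"
   using bounded_imp_convergent_subsequence by blast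
  thus "EX r'. strict_mono r' & convergent (%n. f ((s o r') n) (e k))" by (auto simp: o_def convergent_def)
 qed
 show thesis
 proof (rule that[OF S.subseq_diagseq])
  fix d assume "d : D"
  then obtain k where k: "d = e k" using e by blast
  have "convergent (%n. f ((S.diagseq o ((+) (Suc k))) n) (e k))"
  proof (rule S.diagseq_holds)
   fix r s :: "nat => nat" and n assume "strict_mono r" "convergent (%k. f (s k) (e n))"
   thus "convergent (%k. f ((s o r) k) (e n))"
    using convergent_subseq_convergent[of "%k. f (s k) (e n)" r] by (simp add: o_def)
  qed
  then obtain L where "(%n. f (S.diagseq (n + Suc k)) (e k)) ----> L" by (auto simp: convergent_def o_def add.commute)
  hence "(%n. f (S.diagseq n) (e k)) ----> L" by (rule LIMSEQ_offset)
  thus "convergent (%n. f (S.diagseq n) d)" unfolding k by (rule convergentI)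
 qed
qed (use that[of id] in "auto simp: strict_mono_def")

text \<open>The limsup \<open>F\<close> is convex and finite, thus continuous, and it is a true
  limit on \<open>D\<close>. At any other \<open>z\<close> the upper estimate is the definition of
  limsup; for the lower one \<open>z\<close> is reflected at a nearby \<open>d\<close> of
  \<open>D\<close>, and \<open>2 * f n d <= f n z + f n (2 *. d - z)\<close> pushes
  \<open>f n z\<close> up.\<close>

lemma convex_limsup_eq_lim:
 fixes f :: "nat => 'a::euclidean_space => real"
 assumes Om: "open Om" "convex Om" and conv: "!!n. convex_on Om (f n)"
  and b: "!!z. z : Om ==> EX K. ALL n. abs (f n z) <= K"
  and D: "D <= Om" "Om <= closure D" "!!d. d : D ==> convergent (%n. f n d)"
 obtains F where "convex_on Om F" "!!z. z : Om ==> (%n. f n z) ----> F z"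
proof -
 define F where "F z = real_of_ereal (limsup (%n. ereal (f n z)))" for z
 have F: "limsup (%n. ereal (f n z)) = ereal (F z)" if z: "z : Om" for z
 proof -
  obtain K where K: "!!n. abs (f n z) <= K" using b[OF z] by auto
  have "limsup (%n. ereal (f n z)) <= ereal K" by (rule Limsup_bounded) (use K in "auto simp: abs_le_iff")
  moreover have "ereal (- K) <= limsup (%n. ereal (f n z))"
   by (rule le_Limsup) (use K in "auto simp: abs_le_iff minus_le_iff")
  ultimately show ?thesis unfolding F_def by (cases "limsup (%n. ereal (f n z))") auto
 qed
 have up: "\<forall>\<^sub>F n in sequentially. f n z < c" if "z : Om" "F z < c" for z c
  using Limsup_lessD[of sequentially "%n. ereal (f n z)" "ereal c"] F[OF that(1)] that(2) by auto
 have low: "F z <= c" if "z : Om" "\<forall>\<^sub>F n in sequentially. f n z <= c" for z c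
  using Limsup_bounded[of "%n. ereal (f n z)" "ereal c" sequentially] F[OF that(1)] that(2) by auto
 have cF: "convex_on Om F"
 proof (rule convex_onI)
  fix t :: real and x y assume t: "0 < t" "t < 1" and xy: "x : Om" "y : Om"
  have w: "(1 - t) *. x + t *. y : Om" using convexD_alt[OF Om(2) xy] t by auto
  show "F ((1 - t) *. x + t *. y) <= (1 - t) * F x + t * F y"
  proof (rule field_le_epsilon)
   fix e :: real assume e: "e > 0"
   have "\<forall>\<^sub>F n in sequentially. f n x < F x + e" "\<forall>\<^sub>F n in sequentially. f n y < F y + e"
    using up xy e by auto
   hence "\<forall>\<^sub>F n in sequentially. f n ((1 - t) *. x + t *. y) <= (1 - t) * F x + t * F y + e"
   proof eventually_elim
    case (elim n)
    have "f n ((1 - t) *. x + t *. y) <= (1 - t) * f n x + t * f n y" using t xy by (intro convex_onD[OF conv]) auto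
    also have "... <= (1 - t) * (F x + e) + t * (F y + e)" using t elim by (intro add_mono mult_left_mono) auto
    finally show ?case by (simp add: algebra_simps)
   qed
   thus "F ((1 - t) *. x + t *. y) <= (1 - t) * F x + t * F y + e" by (rule low[OF w])
  qed
 qed (rule Om(2))
 have cont: "continuous_on Om F" by (rule convex_on_continuous) (use Om cF in auto)
 have "(%n. f n z) ----> F z" if z: "z : Om" for z
 proof (rule LIMSEQ_I)
  fix e :: real assume e: "e > 0"
  \<comment> \<open>At \<open>d\<close> and at the reflected point there are two errors each, one
    from continuity of \<open>F\<close> and one from the limit; those at \<open>d\<close> count
    twice.\<close>
  define e' where "e' = e / 6"
  have e': "e' > 0" using e by (simp add: e'_def)
  have "isCont F z" using cont z Om(1) by (simp add: continuous_on_eq_continuous_at)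
  then obtain s where s: "s > 0" "!!y. dist y z < s ==> dist (F y) (F z) < e'"
   using e' unfolding continuous_at_eps_delta by blast
  obtain r where r: "r > 0" "ball z r <= Om" using Om(1) z open_contains_ball by blast
  have "z : closure D" using z D by auto
  have "EX d:D. dist d z < min s r / 2"
   using `z : closure D` r s unfolding closure_approachable by (metis half_gt_zero min_less_iff_conj)
  then obtain d where d: "d : D" "dist d z < min s r / 2" by blast
  let ?y = "2 *. d - z"
  have "?y - z = 2 *. (d - z)" by (simp add: algebra_simps scaleR_2)
  hence "dist ?y z = 2 * dist d z" by (simp add: dist_norm)
  hence y: "dist ?y z < s" "?y : Om" using d r by (auto simp: dist_commute)
  have dOm: "d : Om" using d D by auto
  obtain l where l: "(%n. f n d) ----> l" using D(3)[OF d(1)] by (auto simp: convergent_def)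
  have "limsup (%n. ereal (f n d)) = ereal l" by (rule lim_imp_Limsup) (use l in auto)
  hence "F d = l" using F[OF dOm] by simp
  hence 1: "\<forall>\<^sub>F n in sequentially. f n d > F d - e'" using l e' by (intro order_tendstoD) auto
  have 2: "\<forall>\<^sub>F n in sequentially. f n ?y < F ?y + e'" using up[OF y(2)] e' by auto
  have 3: "\<forall>\<^sub>F n in sequentially. f n z < F z + e" using up[OF z] e by auto
  have Fd: "abs (F d - F z) < e'" "abs (F ?y - F z) < e'"
  proof -
   have "dist d z < s" using d(2) zero_le_dist[of d z] by linarith
   from s(2)[OF this] s(2)[OF y(1)] show "abs (F d - F z) < e'" "abs (F ?y - F z) < e'"
    by (simp_all add: dist_real_def)
  qed
  from 1 2 3 have "\<forall>\<^sub>F n in sequentially. norm (f n z - F z) < e"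
  proof eventually_elim
   case (elim n)
   have "f n ((1 - 1/2) *. z + (1/2) *. ?y) <= (1 - 1/2) * f n z + 1/2 * f n ?y"
    using z y by (intro convex_onD[OF conv]) auto
   moreover have "(1 - 1/2) *. z + (1/2) *. ?y = d" by (simp add: algebra_simps)
   ultimately have "2 * f n d <= f n z + f n ?y" by simp
   with elim Fd have "f n z > F z - 6 * e'" by linarith
   with elim show ?case by (simp add: e'_def)
  qed
  thus "EX N. ALL n>=N. norm (f n z - F z) < e" by (simp add: eventually_sequentially)
 qed
 with cF show thesis by (rule that)
qed

lemma measure_eqI_bounded_lipschitz:
 fixes M N :: "'a::metric_space measure"
 assumes M: "finite_measure M" "sets M = sets borel" and N: "finite_measure N" "sets N = sets borel"
  and eq: "!!(g :: 'a => real) C. C-lipschitz_on UNIV g ==> (!!x. 0 <= g x) ==> (!!x. g x <= 1) ==>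
    (LINT x|M. g x) = (LINT x|N. g x)"
 shows "M = N"
proof -
 interpret M: finite_measure M by fact
 interpret N: finite_measure N by fact
 have sp: "space M = UNIV" "space N = UNIV" 
  using sets_eq_imp_space_eq[OF M(2)] sets_eq_imp_space_eq[OF N(2)] by simp_all
 have fin: "emeasure M UNIV ~= \<infinity>" by (simp add: M.emeasure_eq_measure)
 have lim: "(%n. (LINT x|K. min 1 (real n * infdist x (- U)))) ----> measure K U"
  if U: "open U" "U ~= UNIV" and K: "finite_measure K" "sets K = sets borel" for U :: "'a set" and K
 proof -
  interpret K: finite_measure K by fact
  have m [measurable_cong]: "sets K = sets borel" by fact
  have "(%n. (LINT x|K. min 1 (real n * infdist x (- U)))) ----> (LINT x|K. indicator U x)"
  proof (rule integral_dominated_convergence[where w = "%_. 1"])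
   show "AE x in K. (%n. min 1 (real n * infdist x (- U))) ----> indicat_real U x"
   proof (rule AE_I2)
    fix x
    show "(%n. min 1 (real n * infdist x (- U))) ----> indicat_real U x"
    proof (cases "x : U")
     case True
     have "infdist x (- U) ~= 0" using in_closed_iff_infdist_zero[of "- U" x] U True by auto
     hence pos: "infdist x (- U) > 0" using infdist_nonneg[of x "- U"] by linarith
     obtain n0 where n0: "1 / infdist x (- U) <= real n0" using real_arch_simple by blast
     have "\<forall>\<^sub>F n in sequentially. min 1 (real n * infdist x (- U)) = 1"
      using eventually_ge_at_top[of n0]
     proof eventually_elim
      case (elim n)
      hence "1 / infdist x (- U) <= real n" using n0 by linarith
      hence "1 <= real n * infdist x (- U)" using pos by (simp add: field_simps)
      thus ?case by simp
     qed
     thus ?thesis using True by (simp add: tendsto_eventually)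
    next
     case False
     hence "infdist x (- U) = 0" by (simp add: infdist_zero)
     thus ?thesis using False by simp
    qed
   qed
   show "AE x in K. norm (min 1 (real n * infdist x (- U))) <= 1" for n by (rule AE_I2) (simp add: infdist_nonneg)
  qed (use U in "auto intro!: borel_measurable_continuous_onI continuous_intros simp: measurable_cong_sets[OF m refl]")
  thus ?thesis using U K by (simp add: m)
 qed
 \<comment> \<open>\<open>infdist\<close> to the empty set is 0, so the approximation by distance
   functions degenerates for \<open>U = UNIV\<close>; that case is settled by the constant function
   1.\<close>
 have op: "measure M U = measure N U" if U: "open U" for U
 proof (cases "U = UNIV")
  case True
  show ?thesis using eq[of 0 "%_. 1"] sp True by (simp add: lipschitz_on_def)
 next
  case False
  have "(LINT x|M. min 1 (real n * infdist x (- U))) = (LINT x|N. min 1 (real n * infdist x (- U)))" for n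
  proof (rule eq)
   show "(real n)-lipschitz_on UNIV (%x. min 1 (real n * infdist x (- U)))"
   proof (rule lipschitz_onI)
    fix x y :: 'a
    have "abs (real n * infdist x (- U) - real n * infdist y (- U)) <= real n * dist x y"
     using mult_left_mono[OF infdist_triangle_abs[of x "- U" y], of "real n"]
     by (simp add: right_diff_distrib[symmetric] abs_mult)
    thus "dist (min 1 (real n * infdist x (- U))) (min 1 (real n * infdist y (- U))) <= real n * dist x y"
     unfolding dist_real_def by linarith
   qed simp
  qed (auto simp: infdist_nonneg)
  hence "(%n. (LINT x|M. min 1 (real n * infdist x (- U)))) ----> measure N U" using lim[OF U False N] by simp
  with lim[OF U False M] show ?thesis by (rule LIMSEQ_unique)
 qed
 show ?thesis
 proof (rule measure_eqI_generator_eq[where E = "{U. open U}" and \<Omega> = UNIV and A = "%_. UNIV"])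
  show "Int_stable {U. open U}" by (auto intro!: Int_stableI)
  show "emeasure M X = emeasure N X" if "X : {U. open U}" for X
   using op that by (simp add: M.emeasure_eq_measure N.emeasure_eq_measure)
  show "sets M = sigma_sets UNIV {U. open U}" "sets N = sigma_sets UNIV {U. open U}"
   using M N by (auto simp: borel_def)
 qed (use fin in auto)
qed

section \<open>Kantorovich duality and Brenier maps\<close>

text \<open>Admissible potentials for maximising the mean of \<open>z <.> x\<close> over couplings,
  which is equivalent to minimising the quadratic cost. Asking the constraint for every
  \<open>z\<close> of \<open>Om\<close> but only almost every \<open>x\<close> permits any target
  \<open>mu\<close>, in particular a discrete one, while keeping convex analysis in \<open>z\<close>
  pointwise.\<close>

definition dual_pair ::
 "'a::euclidean_space set => 'a measure => 'a measure => ('a => real) => ('a => real) => bool" where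
 "dual_pair Om nu mu phi psi \<longleftrightarrow> convex_on Om phi & integrable nu phi & integrable mu psi &
   (AE x in mu. ALL z:Om. z <.> x <= phi z + psi x)"

lemma niceD:
 assumes "nice Om nu"
 shows nice_prob: "prob_space nu" and nice_sets: "sets nu = sets borel" and nice_open: "open Om"
  and nice_convex: "convex Om" and nice_AE: "AE z in nu. z : Om"
  and nice_ac: "absolutely_continuous lborel nu" and nice_sq: "integrable nu (%x. (norm x)^2)"
  and nice_space: "space nu = UNIV" and nice_nonempty: "Om ~= {}"
proof -
 show "prob_space nu" "sets nu = sets borel" "open Om" "convex Om" "absolutely_continuous lborel nu"
  "integrable nu (%x. (norm x)^2)" using assms by (auto simp: nice_def)
 show sp: "space nu = UNIV" using sets_eq_imp_space_eq[OF `sets nu = sets borel`] by simp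
 have "- Om : null_sets nu" using assms by (auto simp: nice_def null_sets_def)
 hence "AE z in nu. z ~: - Om" by (rule AE_not_in)
 thus "AE z in nu. z : Om" by simp
 have "emeasure nu (-Om) ~= emeasure nu UNIV" 
  using assms prob_space.emeasure_space_1[of nu] sp by (auto simp: nice_def)
 thus "Om ~= {}" by auto
qed

lemma integrable_norm_of_sq:
 fixes mu :: "'a::euclidean_space measure"
 assumes "finite_measure mu" "sets mu = sets borel" "integrable mu (%x. (norm x)^2)"
 shows "integrable mu (%x. x)"
proof -
 interpret finite_measure mu by fact
 have [measurable_cong]: "sets mu = sets borel" by fact
 show ?thesis
 proof (rule I_bound)
  show "integrable mu (%x. 1 + (norm x)^2)" using assms by simp
  show "AE x in mu. norm x <= norm (1 + (norm x)^2)"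
  proof (rule AE_I2)
   fix x :: 'a
   have "0 <= (norm x - 1)^2" by simp
   hence "2 * norm x <= 1 + (norm x)^2" by (simp add: power2_eq_square algebra_simps)
   thus "norm x <= norm (1 + (norm x)^2)" using norm_ge_zero[of x] by (auto simp: abs_if)
  qed
 qed simp
qed

text \<open>Integrating the constraint over \<open>x\<close> yields an affine minorant of
  \<open>phi\<close> whose slope, the mean of \<open>mu\<close>, is the same for all admissible
  pairs. This keeps minimising sequences bounded from below.\<close>

lemma dual_pair_lower:
 fixes nu mu :: "'a::euclidean_space measure"
 assumes n: "nice Om nu" and mu: "prob_space mu" "sets mu = sets borel" "integrable mu (%x. (norm x)^2)"
  and d: "dual_pair Om nu mu phi psi"
 shows "(LINT z|nu. z) <.> (LINT x|mu. x) <= (LINT z|nu. phi z) + (LINT x|mu. psi x)"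
  and "!!z. z : Om ==> z <.> (LINT x|mu. x) <= phi z + (LINT x|mu. psi x)"
proof -
 interpret N: prob_space nu using n by (rule nice_prob)
 interpret M: prob_space mu by fact
 have iz: "integrable nu (%z. z)" by (rule integrable_norm_of_sq) (use niceD[OF n] N.finite_measure_axioms in auto)
 have ix: "integrable mu (%x. x)" by (rule integrable_norm_of_sq) (use mu M.finite_measure_axioms in auto)
 have i: "integrable nu phi" "integrable mu psi" and ae: "AE x in mu. ALL z:Om. z <.> x <= phi z + psi x"
  using d by (auto simp: dual_pair_def)
 have 2: "z <.> (LINT x|mu. x) <= phi z + (LINT x|mu. psi x)" if "z : Om" for z
 proof -
  have "z <.> (LINT x|mu. x) = (LINT x|mu. z <.> x)" using ix by simp
  also have "... <= (LINT x|mu. phi z + psi x)"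
   by (rule integral_mono_AE) (use ix i ae that in "auto elim: eventually_mono")
  also have "... = phi z + (LINT x|mu. psi x)" using i by (simp add: M.prob_space)
  finally show ?thesis .
 qed
 thus "!!z. z : Om ==> z <.> (LINT x|mu. x) <= phi z + (LINT x|mu. psi x)" .
 have "(LINT z|nu. z) <.> (LINT x|mu. x) = (LINT z|nu. z <.> (LINT x|mu. x))" using iz by simp
 also have "... <= (LINT z|nu. phi z + (LINT x|mu. psi x))"
  by (rule integral_mono_AE) (use iz i in "auto intro: eventually_mono[OF nice_AE[OF n] 2]")
 also have "... = (LINT z|nu. phi z) + (LINT x|mu. psi x)" using i by (simp add: N.prob_space)
 finally show "(LINT z|nu. z) <.> (LINT x|mu. x) <= (LINT z|nu. phi z) + (LINT x|mu. psi x)" .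
qed

lemma dual_pair_quadratic:
 fixes nu mu :: "'a::euclidean_space measure"
 assumes n: "nice Om nu" and mu: "integrable mu (%x. (norm x)^2)"
 shows "dual_pair Om nu mu (%z. (norm z)^2 / 2) (%x. (norm x)^2 / 2)"
proof -
 have "convex_on Om (%z. (norm z)^2 / 2)"
 proof (rule convex_onI)
  fix t :: real and x y :: 'a assume t: "0 < t" "t < 1"
  have "0 <= t * (1 - t) * (norm (x - y))^2" using t by simp
  thus "(norm ((1 - t) *. x + t *. y))^2 / 2 <= (1 - t) * ((norm x)^2 / 2) + t * ((norm y)^2 / 2)"
   using norm_sq_convex_comb[of t x y] by (simp add: field_simps)
 qed (rule nice_convex[OF n])
 moreover have "z <.> x <= (norm z)^2 / 2 + (norm x)^2 / 2" for z x :: 'a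
  using zero_le_power2[of "norm (z - x)"] unfolding power2_norm_eq_inner
  by (simp add: inner_diff_left inner_diff_right inner_commute)
 ultimately show ?thesis using nice_sq[OF n] mu by (simp add: dual_pair_def)
qed

lemma dual_pair_shift:
 assumes "finite_measure nu" "finite_measure mu" "dual_pair Om nu mu phi psi"
 shows "dual_pair Om nu mu (%z. phi z + c) (%x. psi x - c)"
proof -
 interpret N: finite_measure nu by fact
 interpret M: finite_measure mu by fact
 have "convex_on Om (%z. phi z + c)"
  using assms(3) convex_on_add[of Om phi "%_. c"] by (auto simp: dual_pair_def convex_on_imp_convex convex_on_const)
 thus ?thesis using assms(3) by (auto simp: dual_pair_def)
qed

lemma dual_pair_minimizing_sequence:
 fixes nu mu :: "'a::euclidean_space measure"
 assumes n: "nice Om nu" and mu: "prob_space mu" "sets mu = sets borel" "integrable mu (%x. (norm x)^2)"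
 obtains M f g where "!!phi psi. dual_pair Om nu mu phi psi ==> M <= (LINT z|nu. phi z) + (LINT x|mu. psi x)"
  "!!k. dual_pair Om nu mu (f k) (g k)" "!!k. (LINT x|mu. g k x) = 0" "!!k::nat. (LINT z|nu. f k z) < M + 1 / Suc k"
proof -
 interpret N: prob_space nu using n by (rule nice_prob)
 interpret M: prob_space mu by fact
 define S where "S = {(LINT z|nu. phi z) + (LINT x|mu. psi x) | phi psi. dual_pair Om nu mu phi psi}"
 have ne: "S ~= {}" using dual_pair_quadratic[OF n mu(3)] by (auto simp: S_def)
 have bdd: "bdd_below S" using dual_pair_lower(1)[OF n mu] by (auto simp: S_def bdd_below_def)
 define M where "M = Inf S"
 have M: "M <= (LINT z|nu. phi z) + (LINT x|mu. psi x)" if "dual_pair Om nu mu phi psi" for phi psi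
  unfolding M_def by (rule cInf_lower[OF _ bdd]) (use that in "auto simp: S_def")
 have "EX p. dual_pair Om nu mu (fst p) (snd p) & (LINT x|mu. snd p x) = 0 & (LINT z|nu. fst p z) < M + 1 / Suc k" for k :: nat
 proof -
  have "Inf S < M + 1 / Suc k" by (simp add: M_def)
  then obtain phi psi where d: "dual_pair Om nu mu phi psi" "(LINT z|nu. phi z) + (LINT x|mu. psi x) < M + 1 / Suc k"
   using cInf_less_iff[OF ne bdd] by (auto simp: S_def)
  let ?c = "(LINT x|mu. psi x)"
  have i: "integrable nu phi" "integrable mu psi" using d by (auto simp: dual_pair_def)
  show ?thesis
  proof (intro exI[of _ "(%z. phi z + ?c, %x. psi x - ?c)"] conjI)
   show "dual_pair Om nu mu (fst (%z. phi z + ?c, %x. psi x - ?c)) (snd (%z. phi z + ?c, %x. psi x - ?c))"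
    unfolding fst_conv snd_conv by (rule dual_pair_shift[OF N.finite_measure_axioms M.finite_measure_axioms d(1)])
  qed (use i d in "auto simp: M.prob_space N.prob_space")
 qed
 then obtain p where p: "!!k. dual_pair Om nu mu (fst (p k)) (snd (p k)) & (LINT x|mu. snd (p k) x) = 0 &
   (LINT z|nu. fst (p k) z) < M + 1 / Suc k" by metis
 show thesis by (rule that[OF M, of "%k. fst (p k)" "%k. snd (p k)"]) (use p in auto)
qed

text \<open>The first potentials have a convergent subsequence by convexity and local bounds,
  whereas the second ones have no compactness; \<open>psi\<close> is therefore rebuilt as the
  Legendre transform of the limit, and Fatou's lemma controls both integrals. The last clause
  records that \<open>psi\<close> does not exceed this transform.\<close>

theorem dual_pair_minimizer:
 fixes nu mu :: "'a::euclidean_space measure"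
 assumes n: "nice Om nu" and mu: "prob_space mu" "sets mu = sets borel" "integrable mu (%x. (norm x)^2)"
 obtains phi psi where "dual_pair Om nu mu phi psi"
  "!!phi' psi'. dual_pair Om nu mu phi' psi' ==>
    (LINT z|nu. phi z) + (LINT x|mu. psi x) <= (LINT z|nu. phi' z) + (LINT x|mu. psi' x)"
  "AE x in mu. ALL c. (ALL z:Om. z <.> x - phi z <= c) --> psi x <= c"
proof -
 interpret N: prob_space nu using n by (rule nice_prob)
 interpret P: prob_space mu by fact
 note [measurable_cong] = nice_sets[OF n] mu(2)
 have [measurable]: "Om : sets borel" using nice_open[OF n] by simp
 obtain M f g where M: "!!phi psi. dual_pair Om nu mu phi psi ==> M <= (LINT z|nu. phi z) + (LINT x|mu. psi x)"
  and fg: "!!k. dual_pair Om nu mu (f k) (g k)" "!!k. (LINT x|mu. g k x) = 0"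
   "!!k::nat. (LINT z|nu. f k z) < M + 1 / Suc k" by (rule dual_pair_minimizing_sequence[OF n mu]) blast
 have if_: "integrable nu (f k)" and ig: "integrable mu (g k)" and cf: "convex_on Om (f k)"
  and ae: "AE x in mu. ALL z:Om. z <.> x <= f k z + g k x" for k using fg(1)[of k] by (auto simp: dual_pair_def)
 have [measurable]: "f k : BM" "g k : BM" for k
  using borel_measurable_integrable[OF if_[of k]] borel_measurable_integrable[OF ig[of k]]
  by (simp_all add: measurable_cong_sets[OF nice_sets[OF n] refl] measurable_cong_sets[OF mu(2) refl])
 define a where "a = (LINT x|mu. x)"
 define m where "m = (LINT z|nu. z)"
 have iz: "integrable nu (%z. z)" by (rule integrable_norm_of_sq) (use niceD[OF n] N.finite_measure_axioms in auto)
 have ix: "integrable mu (%x. x)" by (rule integrable_norm_of_sq) (use mu P.finite_measure_axioms in auto)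
 have low: "a <.> z <= f k z" if "z : Om" for k z
  using dual_pair_lower(2)[OF n mu fg(1)[of k] that] fg(2) by (simp add: a_def inner_commute)
 have int_fa: "(NN nu (%x. ennreal (f k x - a <.> x))) = ennreal ((LINT z|nu. f k z) - a <.> m)" for k
 proof -
  have "AE x in nu. 0 <= f k x - a <.> x" using nice_AE[OF n] by eventually_elim (use low in auto)
  hence "(NN nu (%x. ennreal (f k x - a <.> x))) = ennreal (LINT x|nu. f k x - a <.> x)"
   using if_ iz by (intro nn_integral_eq_integral) auto
  thus ?thesis using if_ iz by (simp add: m_def)
 qed
 have bound: "EX K. ALL k. abs (f k z) <= K" if z: "z : Om" for z
 proof -
  obtain K where K: "!!phi. convex_on Om phi ==> phi : BM ==> (!!x. x : Om ==> a <.> x <= phi x) ==>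
   (NN nu (%x. ennreal (phi x - a <.> x))) <= ennreal (M + 1 - a <.> m) ==> phi z <= K"
   by (rule nice_pointwise_bound[OF n z, of a "M + 1 - a <.> m"]) blast
  have "f k z <= K" for k
  proof (rule K[OF cf])
   have "1 / real (Suc k) <= 1" by simp
   hence "(LINT z|nu. f k z) <= M + 1" using fg(3)[of k] by linarith
   thus "(NN nu (%x. ennreal (f k x - a <.> x))) <= ennreal (M + 1 - a <.> m)"
    unfolding int_fa by (intro ennreal_leI) simp
  qed (use low in auto)
  with low[OF z] have "abs (f k z) <= max K (- (a <.> z))" for k by (smt (verit) max.cobounded1 max.cobounded2)
  thus ?thesis by blast
 qed
 obtain D where D: "countable D" "D <= Om" "Om <= closure D" using separable[of Om] by blast
 have Dne: "D ~= {}" using D nice_nonempty[OF n] by auto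
 obtain r where r: "strict_mono r" "!!d. d : D ==> convergent (%k. f (r k) d)"
  by (rule bounded_sequences_diagonal[of D f, OF D(1)]) (use bound D in auto)
 obtain F where F: "convex_on Om F" "!!z. z : Om ==> (%k. f (r k) z) ----> F z"
  by (rule convex_limsup_eq_lim[OF nice_open[OF n] nice_convex[OF n] cf _ D(2,3) r(2)]) (use bound in blast)+
 have lowF: "a <.> z <= F z" if "z : Om" for z by (rule LIMSEQ_le_const[OF F(2)[OF that]]) (use low that in auto)
 have contF: "continuous_on Om F" by (rule convex_on_continuous) (use nice_open[OF n] F in auto)
 define phi where "phi z = (if z : Om then F z else 0)" for z
 have [measurable]: "phi : BM" unfolding phi_def by (intro borel_measurable_continuous_on_if contF) auto
 have cphi: "convex_on Om phi" using F(1) unfolding convex_on_def phi_def by (auto simp: convexD)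
 have limphi: "(%k. f (r k) z) ----> phi z" if "z : Om" for z using F(2)[OF that] that by (simp add: phi_def)
 have r0: "1 / real (Suc (r k)) <= 1 / real (Suc k)" for k using seq_suble[OF r(1), of k] by (simp add: frac_le)
 have int_f: "(LINT z|nu. f (r k) z) <= M + 1 / Suc k" for k using fg(3)[of "r k"] r0[of k] by linarith
 have limM: "(%k. ennreal (M + 1 / Suc k - a <.> m)) ----> ennreal (M - a <.> m)"
  using tendsto_diff[OF tendsto_add[OF tendsto_const LIMSEQ_Suc[OF lim_1_over_n]] tendsto_const, of M "a <.> m"]
  by (intro tendsto_ennrealI) simp
 have M0: "0 <= M - a <.> m"
 proof -
  have "0 <= M + 1 / Suc k - a <.> m" for k
  proof -
   have "a <.> m <= (LINT z|nu. f (r k) z)"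
    using dual_pair_lower(1)[OF n mu fg(1)[of "r k"]] fg(2) by (simp add: a_def m_def inner_commute)
   with int_f[of k] show ?thesis by linarith
  qed
  moreover have "(%k. M + 1 / Suc k - a <.> m) ----> M + 0 - a <.> m"
   by (intro tendsto_intros LIMSEQ_Suc[OF lim_1_over_n])
  ultimately show ?thesis by (intro LIMSEQ_le_const) auto
 qed
 have nnphi: "(NN nu (%z. ennreal (phi z - a <.> z))) <= ennreal (M - a <.> m)"
 proof -
  have "(NN nu (%z. ennreal (phi z - a <.> z))) = (NN nu (%z. liminf (%k. ennreal (f (r k) z - a <.> z))))"
  proof (rule nn_integral_cong_AE, use nice_AE[OF n] in eventually_elim)
   fix z assume "z : Om"
   hence "(%k. ennreal (f (r k) z - a <.> z)) ----> ennreal (phi z - a <.> z)"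
    by (intro tendsto_ennrealI tendsto_diff limphi) auto
   thus "ennreal (phi z - a <.> z) = liminf (%k. ennreal (f (r k) z - a <.> z))"
    by (intro lim_imp_Liminf[symmetric]) auto
  qed
  also have "... <= liminf (%k. (NN nu (%z. ennreal (f (r k) z - a <.> z))))" by (rule nn_integral_liminf) measurable
  also have "... <= liminf (%k. ennreal (M + 1 / Suc k - a <.> m))"
   unfolding int_fa by (intro Liminf_mono always_eventually allI ennreal_leI) (use int_f in auto)
  also have "... = ennreal (M - a <.> m)" by (rule lim_imp_Liminf) (use limM in auto)
  finally show ?thesis .
 qed
 have aephi: "AE z in nu. 0 <= phi z - a <.> z"
  using nice_AE[OF n] by eventually_elim (use lowF in "auto simp: phi_def")
 have iphia: "integrable nu (%z. phi z - a <.> z)"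
  by (rule integrableI_nonneg) (use aephi nnphi in "auto simp: order_le_less_trans")
 have iphi: "integrable nu phi" using Bochner_Integration.integrable_add[OF iphia, of "%z. a <.> z"] iz by simp
 have intphi: "(LINT z|nu. phi z) <= M"
 proof -
  have "ennreal (LINT z|nu. phi z - a <.> z) <= ennreal (M - a <.> m)"
   using nnphi nn_integral_eq_integral[OF iphia aephi] by simp
  hence "(LINT z|nu. phi z - a <.> z) <= M - a <.> m" using M0 by (simp add: ennreal_le_iff)
  thus ?thesis using iphi iz by (simp add: m_def)
 qed
 obtain z0 where z0: "z0 : D" using Dne by blast
 hence z0Om: "z0 : Om" using D by auto
 \<comment> \<open>The supremum over the countable set \<open>D\<close> is measurable. Normalising
   at \<open>z0\<close>, itself a member of \<open>D\<close>, makes it nonnegative, so truncation by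
   \<open>ennreal\<close> is harmless and Fatou applies.\<close>
 define H where "H x = (SUP d\<in>D. ennreal (d <.> x - phi d - z0 <.> x + phi z0))" for x
 have [measurable]: "H : BM" unfolding H_def by (intro borel_measurable_SUP D(1)) auto
 define B where "B = phi z0 - z0 <.> a"
 have HB: "(NN mu (%x. H x)) <= ennreal B"
 proof -
  let ?G = "%k x. ennreal (g (r k) x - z0 <.> x + f (r k) z0)"
  have "AE x in mu. ALL k. ALL z:Om. z <.> x <= f k z + g k x" by (subst AE_all_countable) (use ae in auto)
  hence "AE x in mu. H x <= liminf (%k. ?G k x)"
  proof eventually_elim
   case (elim x)
   have "ennreal (d <.> x - phi d - z0 <.> x + phi z0) <= liminf (%k. ?G k x)" if d: "d : D" for d
   proof -
    have "d : Om" using d D by auto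
    have "(%k. ennreal (d <.> x - f (r k) d - z0 <.> x + f (r k) z0)) ----> ennreal (d <.> x - phi d - z0 <.> x + phi z0)"
     by (intro tendsto_ennrealI tendsto_intros limphi z0Om `d : Om`)
    hence "ennreal (d <.> x - phi d - z0 <.> x + phi z0)
      = liminf (%k. ennreal (d <.> x - f (r k) d - z0 <.> x + f (r k) z0))" by (intro lim_imp_Liminf[symmetric]) auto
    also have "... <= liminf (%k. ?G k x)"
    proof (intro Liminf_mono always_eventually allI ennreal_leI)
     fix k
     have "d <.> x <= f (r k) d + g (r k) x" using elim `d : Om` by blast
     thus "d <.> x - f (r k) d - z0 <.> x + f (r k) z0 <= g (r k) x - z0 <.> x + f (r k) z0" by linarith
    qed
    finally show ?thesis .
   qed
   thus ?case unfolding H_def by (rule SUP_least)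
  qed
  hence "(NN mu (%x. H x)) <= (NN mu (%x. liminf (%k. ?G k x)))" by (rule nn_integral_mono_AE)
  also have "... <= liminf (%k. (NN mu (%x. ?G k x)))" by (rule nn_integral_liminf) measurable
  also have "... = liminf (%k. ennreal (f (r k) z0 - z0 <.> a))"
  proof -
   have "(NN mu (%x. ?G k x)) = ennreal (f (r k) z0 - z0 <.> a)" for k
   proof -
    have "AE x in mu. 0 <= g (r k) x - z0 <.> x + f (r k) z0"
     using ae[of "r k"] by eventually_elim (use z0Om in force)
    hence "(NN mu (%x. ?G k x)) = ennreal (LINT x|mu. g (r k) x - z0 <.> x + f (r k) z0)"
     using ig ix by (intro nn_integral_eq_integral) auto
    thus ?thesis using ig ix fg(2) by (simp add: P.prob_space a_def)
   qed
   thus ?thesis by simp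
  qed
  also have "... = ennreal B"
   unfolding B_def by (rule lim_imp_Liminf) (auto intro!: tendsto_ennrealI tendsto_diff limphi z0Om)
  finally show ?thesis .
 qed
 have B0: "0 <= B" unfolding B_def using lowF[OF z0Om] z0Om by (simp add: phi_def inner_commute)
 have Hfin: "AE x in mu. H x ~= \<infinity>" by (rule nn_integral_PInf_AE) (use HB in "auto simp: top_unique")
 define psi where "psi x = enn2real (H x) + z0 <.> x - phi z0" for x
 have iH: "integrable mu (%x. enn2real (H x))"
 proof (rule integrableI_nonneg)
  have "(NN mu (%x. ennreal (enn2real (H x)))) = (NN mu (%x. H x))"
   by (rule nn_integral_cong_AE, use Hfin in eventually_elim) (simp add: less_top)
  thus "(NN mu (%x. ennreal (enn2real (H x)))) < \<infinity>" using HB by (simp add: order_le_less_trans)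
 qed auto
 have ipsi: "integrable mu psi" unfolding psi_def using iH ix by simp
 have intpsi: "(LINT x|mu. psi x) <= 0"
 proof -
  have "ennreal (LINT x|mu. enn2real (H x)) = (NN mu (%x. ennreal (enn2real (H x))))"
   by (rule nn_integral_eq_integral[symmetric, OF iH]) simp
  also have "... = (NN mu (%x. H x))" by (rule nn_integral_cong_AE, use Hfin in eventually_elim) (simp add: less_top)
  also note HB
  finally have "(LINT x|mu. enn2real (H x)) <= B" using B0 by (simp add: ennreal_le_iff)
  thus ?thesis unfolding psi_def using iH ix by (simp add: P.prob_space B_def a_def)
 qed
 have aepsi: "AE x in mu. (ALL z:Om. z <.> x <= phi z + psi x) & (ALL c. (ALL z:Om. z <.> x - phi z <= c) --> psi x <= c)"
  using Hfin
 proof eventually_elim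
  case (elim x)
  have H: "H x = ennreal (enn2real (H x))" using elim by (simp add: less_top)
  have d: "d <.> x - phi d <= psi x" if "d : D" for d
  proof -
   have "ennreal (d <.> x - phi d - z0 <.> x + phi z0) <= H x" unfolding H_def by (rule SUP_upper[OF that])
   hence "d <.> x - phi d - z0 <.> x + phi z0 <= enn2real (H x)" by (subst (asm) H) (simp add: ennreal_le_iff)
   thus ?thesis by (simp add: psi_def)
  qed
  have "z <.> x <= phi z + psi x" if z: "z : Om" for z
  proof -
   obtain d where d': "!!n. d n : D" "d ----> z" using z D closure_sequential by (metis subsetD)
   have dOm: "d n : Om" for n using d' D by auto
   have "(%n. F (d n)) ----> F z" using continuous_on_tendsto_compose[OF contF d'(2) z] dOm by simp
   hence "(%n. d n <.> x - F (d n)) ----> z <.> x - F z" by (intro tendsto_intros d'(2))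
   hence "z <.> x - F z <= psi x" by (rule LIMSEQ_le_const2) (use d[OF d'(1)] dOm in "auto simp: phi_def")
   thus ?thesis using z by (simp add: phi_def)
  qed
  moreover have "psi x <= c" if c: "ALL z:Om. z <.> x - phi z <= c" for c
  proof -
   have c0: "0 <= c - z0 <.> x + phi z0" using c z0Om by force
   have "H x <= ennreal (c - z0 <.> x + phi z0)" unfolding H_def by (intro SUP_least ennreal_leI) (use c D in force)
   hence "enn2real (H x) <= c - z0 <.> x + phi z0" using c0 by (subst (asm) H) (simp add: ennreal_le_iff)
   thus ?thesis by (simp add: psi_def)
  qed
  ultimately show ?case by blast
 qed
 show thesis
 proof (rule that[of phi psi])
  show "dual_pair Om nu mu phi psi" unfolding dual_pair_def using cphi iphi ipsi aepsi by (auto elim: eventually_mono)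
  show "AE x in mu. ALL c. (ALL z:Om. z <.> x - phi z <= c) --> psi x <= c" using aepsi by (auto elim: eventually_mono)
  show "(LINT z|nu. phi z) + (LINT x|mu. psi x) <= (LINT z|nu. phi' z) + (LINT x|mu. psi' x)" if "dual_pair Om nu mu phi' psi'" for phi' psi'
   using M[OF that] intphi intpsi by linarith
 qed
qed

text \<open>The slackness clause makes this an optimal map together with its dual certificate. That
  \<open>R\<close> is almost everywhere the gradient of \<open>phi\<close> is derived in
  \<open>brenier_subgradient\<close>.\<close>

definition brenier ::
 "'a::euclidean_space set => 'a measure => 'a measure => ('a => 'a) => ('a => real) => ('a => real) => bool" where
 "brenier Om nu mu R phi psi \<longleftrightarrow> dual_pair Om nu mu phi psi & R : BM & distr nu borel R = mu &
   (AE z in nu. phi z + psi (R z) = z <.> R z)"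

lemma borel_measurable_convex_extension:
 fixes f :: "'a::euclidean_space => real"
 assumes "open Om" "convex_on Om f"
 shows "(%z. if z : Om then f z else 0) : BM"
 by (rule borel_measurable_continuous_on_if) (use assms convex_on_continuous in auto)

lemma convex_on_cSUP_affine:
 fixes X :: "'a::euclidean_space set"
 assumes "convex Om" "X ~= {}" and bdd: "!!z. z : Om ==> bdd_above ((%x. z <.> x - c x) ` X)"
 shows "convex_on Om (%z. SUP x\<in>X. z <.> x - c x :: real)"
proof (rule convex_onI)
 fix t :: real and y z assume t: "0 < t" "t < 1" and yz: "y : Om" "z : Om"
 show "(SUP x\<in>X. ((1 - t) *. y + t *. z) <.> x - c x)
   <= (1 - t) * (SUP x\<in>X. y <.> x - c x) + t * (SUP x\<in>X. z <.> x - c x)"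
 proof (rule cSUP_least[OF assms(2)])
  fix x assume x: "x : X"
  have "((1 - t) *. y + t *. z) <.> x - c x = (1 - t) * (y <.> x - c x) + t * (z <.> x - c x)"
   by (simp add: inner_add_left algebra_simps)
  also have "... <= (1 - t) * (SUP x\<in>X. y <.> x - c x) + t * (SUP x\<in>X. z <.> x - c x)"
   using t x yz by (intro add_mono mult_left_mono cSUP_upper bdd) auto
  finally show "((1 - t) *. y + t *. z) <.> x - c x
   <= (1 - t) * (SUP x\<in>X. y <.> x - c x) + t * (SUP x\<in>X. z <.> x - c x)" .
 qed
qed (rule assms(1))

text \<open>First variation of the dual functional: \<open>psi\<close> becomes
  \<open>psi + t * g\<close> and \<open>phi\<close> becomes the Legendre transform
  \<open>Ph t\<close> of that. Near-maximisers in \<open>Ph t z\<close> are approximate subgradients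
  of \<open>phi\<close> at \<open>z\<close>, so the right derivative of \<open>Ph t z\<close> at
  \<open>t = 0\<close> is at most \<open>- g (R z)\<close>, while minimality bounds the mean
  derivative from below.\<close>

lemma dual_pair_perturbation:
 fixes nu mu :: "'a::euclidean_space measure"
 assumes n: "nice Om nu" and mu: "prob_space mu" "sets mu = sets borel" and d: "dual_pair Om nu mu phi psi"
  and min: "!!phi' psi'. dual_pair Om nu mu phi' psi' ==>
    (LINT z|nu. phi z) + (LINT x|mu. psi x) <= (LINT z|nu. phi' z) + (LINT x|mu. psi' x)"
  and R [measurable]: "R : BM" and grad: "AE z in nu. GDERIV phi z :> R z"
  and g: "continuous_on UNIV g" "!!x. abs (g x) <= (1::real)"
 shows "(LINT z|nu. g (R z)) <= (LINT x|mu. g x)"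
proof -
 interpret N: prob_space nu using n by (rule nice_prob)
 interpret P: prob_space mu by fact
 note [measurable_cong] = nice_sets[OF n] mu(2)
 have [measurable]: "g : BM" using g by (intro borel_measurable_continuous_onI)
 have [measurable]: "Om : sets borel" using nice_open[OF n] by simp
 have ig: "integrable mu g" by (rule P.integrable_const_bound[of _ 1]) (use g in auto)
 have igR: "integrable nu (%z. g (R z))" by (rule N.integrable_const_bound[of _ 1]) (use g in auto)
 have i: "integrable nu phi" "integrable mu psi" and c: "convex_on Om phi" and ae: "AE x in mu. ALL z:Om. z <.> x <= phi z + psi x"
  using d by (auto simp: dual_pair_def)
 have [measurable]: "phi : BM" 
  using borel_measurable_integrable[OF i(1)] by (simp add: measurable_cong_sets[OF nice_sets[OF n] refl])
 have iz: "integrable nu (%z. z)" by (rule integrable_norm_of_sq) (use niceD[OF n] N.finite_measure_axioms in auto)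
 define X where "X = {x. ALL z:Om. z <.> x <= phi z + psi x}"
 have aeX: "AE x in mu. x : X" using ae by (simp add: X_def)
 hence "X ~= {}" using P.AE_False by auto
 then obtain x0 where x0: "x0 : X" by blast
 define Ph where "Ph t z = (SUP x\<in>X. z <.> x - (psi x + t * g x))" for t z
 have le: "z <.> x - (psi x + t * g x) <= phi z + t" if "z : Om" "x : X" "t >= 0" for z x t
 proof -
  have "- (t * g x) <= t" using g(2)[of x] that(3) mult_left_mono[of "- g x" 1 t] by (simp add: abs_le_iff)
  thus ?thesis using that by (force simp: X_def)
 qed
 have bdd: "bdd_above ((%x. z <.> x - (psi x + t * g x)) ` X)" if "z : Om" "t >= 0" for z t
  using le[OF that(1) _ that(2)] by (auto simp: bdd_above_def)
 define F where "F t z = (if z : Om then Ph t z else 0)" for t z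
 have cF: "convex_on Om (Ph t)" if "t >= 0" for t
  unfolding Ph_def by (rule convex_on_cSUP_affine[OF nice_convex[OF n] `X ~= {}` bdd[OF _ that]])
 have mF [measurable]: "F t : BM" if "t >= 0" for t
  unfolding F_def by (rule borel_measurable_convex_extension[OF nice_open[OF n] cF[OF that]])
 have upF: "F t z <= phi z + t" if "z : Om" "t >= 0" for t z
  unfolding F_def Ph_def using that le `X ~= {}` by (auto intro: cSUP_least)
 have lowF: "z <.> x - (psi x + t * g x) <= F t z" if "z : Om" "t >= 0" "x : X" for t z x
  unfolding F_def Ph_def using that by (auto intro!: cSUP_upper bdd)
 have iF: "integrable nu (F t)" if t: "t >= 0" for t
 proof (rule I_bound)
  show "integrable nu (%z. abs (phi z) + t + (abs (z <.> x0) + abs (psi x0 + t * g x0)))" using i iz by simp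
  show "AE z in nu. norm (F t z) <= norm (abs (phi z) + t + (abs (z <.> x0) + abs (psi x0 + t * g x0)))"
   using nice_AE[OF n]
  proof eventually_elim
   case (elim z)
   show ?case using upF[OF elim t] lowF[OF elim t x0] t by (auto simp: abs_le_iff)
  qed
 qed (use mF[OF t] in simp)
 have key: "(LINT z|nu. phi z) <= (LINT z|nu. F t z) + t * (LINT x|mu. g x)" if t: "t >= 0" for t
 proof -
  have "dual_pair Om nu mu (F t) (%x. psi x + t * g x)" unfolding dual_pair_def
  proof (intro conjI)
   show "convex_on Om (F t)" using cF[OF t] unfolding convex_on_def F_def by (auto simp: convexD)
   show "AE x in mu. ALL z:Om. z <.> x <= F t z + (psi x + t * g x)"
    using aeX by eventually_elim (use lowF t in fastforce)
  qed (use i ig iF t in auto)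
  from min[OF this] show ?thesis using i ig by simp
 qed
 define t where "t n = 1 / real (Suc n)" for n
 have t: "t n > 0" "t n >= 0" for n by (auto simp: t_def)
 define D where "D n z = (F (t n) z - phi z) / t n" for n z
 have [measurable]: "D n : BM" for n unfolding D_def using mF[OF t(2)[of n]] by measurable
 have D1: "AE z in nu. D n z <= 1" for n
  using nice_AE[OF n] by eventually_elim (use upF[OF _ t(2)] t(1) in "auto simp: D_def field_simps")
 have iD: "integrable nu (D n)" for n unfolding D_def using iF[OF t(2)] i by simp
 have intD: "- (LINT x|mu. g x) <= (LINT z|nu. D n z)" for n
 proof -
  have "(LINT z|nu. D n z) = ((LINT z|nu. F (t n) z) - (LINT z|nu. phi z)) / t n"
   unfolding D_def using iF[OF t(2)] i by simp
  moreover have "- (t n * (LINT x|mu. g x)) <= (LINT z|nu. F (t n) z) - (LINT z|nu. phi z)"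
   using key[OF t(2), of n] by linarith
  ultimately have "t n * (- (LINT x|mu. g x)) <= t n * (LINT z|nu. D n z)" using t(1)[of n] by simp
  thus ?thesis using t(1)[of n] by (rule mult_left_le_imp_le)
 qed
 have lim: "AE z in nu. ennreal (1 + g (R z)) <= liminf (%n. ennreal (1 - D n z))" using nice_AE[OF n] grad
 proof eventually_elim
  case (elim z)
  show ?case
  proof (rule ennreal_le_epsilon)
   fix e :: real assume e: "e > 0"
   have "isCont g (R z)" using g(1) by (simp add: continuous_on_eq_continuous_at)
   then obtain dd where dd: "dd > 0" "!!x. dist x (R z) < dd ==> dist (g x) (g (R z)) < e"
    using e unfolding continuous_at_eps_delta by blast
   have "dd / 2 > 0" using dd by simp
   from approximate_subgradient_close[OF nice_open[OF n] elim(1,2) this] obtain eta where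
    eta: "eta > 0" "!!x. (ALL z':Om. phi z' >= phi z + x <.> (z' - z) - eta) ==> norm (x - R z) <= dd / 2" by blast
   have "\<forall>\<^sub>F n in sequentially. t n < eta / 2"
    unfolding t_def using eta(1) by (intro order_tendstoD(2)[OF LIMSEQ_Suc[OF lim_1_over_n]]) auto
   hence "\<forall>\<^sub>F n in sequentially. ennreal (1 + g (R z)) - ennreal e <= ennreal (1 - D n z)"
   proof eventually_elim
    case n: (elim n)
    have "F (t n) z <= phi z + t n * (- g (R z) + e)" unfolding F_def Ph_def using elim(1)
    proof (simp, intro cSUP_least[OF `X ~= {}`])
     fix x assume x: "x : X"
     \<comment> \<open>A gap of at least \<open>2 * t n\<close> cannot be compensated by the
       perturbation, as \<open>g\<close> is bounded by 1; a smaller gap makes \<open>x\<close> an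
       approximate subgradient, and then \<open>g x\<close> is close to
       \<open>g (R z)\<close>.\<close>
     let ?gap = "phi z + psi x - z <.> x"
     have gap0: "?gap >= 0" using x elim(1) by (auto simp: X_def)
     have main: "z <.> x - (psi x + t n * g x) = phi z - ?gap - t n * g x" by simp
     have "- ?gap - t n * g x <= t n * (- g (R z) + e)"
     proof (cases "?gap >= 2 * t n")
      case True
      have "- g x <= 1" "g (R z) <= 1" using g(2)[of x] g(2)[of "R z"] by (auto simp: abs_le_iff)
      hence "t n * (- g x) <= t n * 1" "t n * g (R z) <= t n * 1" "0 <= t n * e"
       using t(2)[of n] e mult_left_mono[of "- g x" 1 "t n"] mult_left_mono[of "g (R z)" 1 "t n"] by simp_all
      with True show ?thesis by (simp add: algebra_simps)
     next
      case False
      have "norm (x - R z) <= dd / 2"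
      proof (rule eta(2), intro ballI)
       fix z' assume "z' : Om"
       hence "z' <.> x <= phi z' + psi x" using x by (auto simp: X_def)
       with False n show "phi z' >= phi z + x <.> (z' - z) - eta" by (simp add: inner_diff_right inner_commute)
      qed
      hence "dist x (R z) < dd" using dd(1) by (simp add: dist_norm)
      from dd(2)[OF this] have "- g x <= - g (R z) + e" by (simp add: dist_real_def abs_less_iff)
      hence "t n * (- g x) <= t n * (- g (R z) + e)" using t(2) by (rule mult_left_mono)
      with gap0 show ?thesis by simp
     qed
     thus "z <.> x - (psi x + t n * g x) <= phi z + t n * (e - g (R z))" unfolding main by simp
    qed
    hence "D n z <= - g (R z) + e" using t(1)[of n] by (simp add: D_def field_simps)
    hence "ennreal (1 + g (R z) - e) <= ennreal (1 - D n z)" by (intro ennreal_leI) simp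
    thus ?case using e by (simp add: ennreal_minus)
   qed
   hence "ennreal (1 + g (R z)) - ennreal e <= liminf (%n. ennreal (1 - D n z))" by (rule Liminf_bounded)
   thus "ennreal (1 + g (R z)) <= liminf (%n. ennreal (1 - D n z)) + ennreal e"
    by (simp add: ennreal_minus_le_iff add.commute)
  qed
 qed
 have g0: "0 <= 1 + g x" for x using g(2)[of x] by (auto simp: abs_le_iff)
 \<comment> \<open>The bound \<open>D n z <= 1\<close> makes \<open>1 - D n z\<close> nonnegative,
   so Fatou's lemma is available.\<close>
 have "ennreal (LINT z|nu. 1 + g (R z)) = (NN nu (%z. ennreal (1 + g (R z))))"
  by (rule nn_integral_eq_integral[symmetric]) (use igR g0 in auto)
 also have "... <= (NN nu (%z. liminf (%n. ennreal (1 - D n z))))" by (rule nn_integral_mono_AE[OF lim])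
 also have "... <= liminf (%n. (NN nu (%z. ennreal (1 - D n z))))" by (rule nn_integral_liminf) measurable
 also have "... <= liminf (%n::nat. ennreal (1 + (LINT x|mu. g x)))"
 proof (intro Liminf_mono always_eventually allI)
  fix n
  have "(NN nu (%z. ennreal (1 - D n z))) = ennreal (LINT z|nu. 1 - D n z)"
   by (rule nn_integral_eq_integral) (use iD D1[of n] in auto)
  also have "... <= ennreal (1 + (LINT x|mu. g x))"
   using intD[of n] iD by (intro ennreal_leI) (simp add: N.prob_space)
  finally show "(NN nu (%z. ennreal (1 - D n z))) <= ennreal (1 + (LINT x|mu. g x))" .
 qed
 also have "... = ennreal (1 + (LINT x|mu. g x))" by (simp add: Liminf_const)
 finally have 1: "ennreal (LINT z|nu. 1 + g (R z)) <= ennreal (1 + (LINT x|mu. g x))" .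
 have "0 <= (LINT x|mu. 1 + g x)" using g0 by (intro integral_nonneg_AE) auto
 hence "0 <= 1 + (LINT x|mu. g x)" using ig by (simp add: P.prob_space)
 with 1 have "(LINT z|nu. 1 + g (R z)) <= 1 + (LINT x|mu. g x)" by (simp add: ennreal_le_iff)
 thus ?thesis using igR by (simp add: N.prob_space)
qed

lemma nice_AE_lborel:
 assumes "nice Om nu" "AE z in lborel. P z" shows "AE z in nu. P z"
 using absolutely_continuous_AE[of nu lborel P] nice_ac[OF assms(1)] nice_sets[OF assms(1)] assms(2) by simp

text \<open>\<open>dual_pair_perturbation\<close> for \<open>g\<close> and \<open>- g\<close>
  equates the integrals of Lipschitz functions, hence the push-forward. Slackness comes from the
  sharpness clause of \<open>dual_pair_minimizer\<close>, because \<open>z\<close> maximises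
  \<open>z' <.> R z - phi z'\<close> over \<open>z'\<close> when \<open>R z\<close> is the gradient
  at \<open>z\<close>.\<close>

theorem brenier_exists:
 fixes nu mu :: "'a::euclidean_space measure"
 assumes n: "nice Om nu" and mu: "prob_space mu" "sets mu = sets borel" "integrable mu (%x. (norm x)^2)"
 obtains R phi psi where "brenier Om nu mu R phi psi"
proof -
 interpret N: prob_space nu using n by (rule nice_prob)
 interpret P: prob_space mu by fact
 note [measurable_cong] = nice_sets[OF n] mu(2)
 obtain phi psi where d: "dual_pair Om nu mu phi psi" and min: "!!phi' psi'. dual_pair Om nu mu phi' psi' ==>
    (LINT z|nu. phi z) + (LINT x|mu. psi x) <= (LINT z|nu. phi' z) + (LINT x|mu. psi' x)"
  and sharp: "AE x in mu. ALL c. (ALL z:Om. z <.> x - phi z <= c) --> psi x <= c"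
  by (rule dual_pair_minimizer[OF n mu]) blast
 have c: "convex_on Om phi" and ae: "AE x in mu. ALL z:Om. z <.> x <= phi z + psi x" using d by (auto simp: dual_pair_def)
 obtain R where [measurable]: "R : BM" and "AE z in lborel. z : Om --> GDERIV phi z :> R z"
  by (rule convex_gradient_AE[OF nice_open[OF n] nice_convex[OF n] c]) blast
 from nice_AE_lborel[OF n this(2)] nice_AE[OF n] have grad: "AE z in nu. GDERIV phi z :> R z" by eventually_elim simp
 have eq: "distr nu borel R = mu"
 proof (rule measure_eqI_bounded_lipschitz)
  show "finite_measure (distr nu borel R)"
   using N.prob_space_distr[of R borel] by (simp add: prob_space.finite_measure)
  fix g :: "'a => real" and C assume "C-lipschitz_on UNIV g" and g: "!!x. 0 <= g x" "!!x. g x <= 1"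
  hence cg: "continuous_on UNIV g" by (simp add: lipschitz_on_continuous_on)
  have [measurable]: "g : BM" using cg by (intro borel_measurable_continuous_onI)
  have "(LINT z|nu. g (R z)) <= (LINT x|mu. g x)"
   by (rule dual_pair_perturbation[OF n mu(1,2) d min _ grad]) (use g cg in auto)
  moreover have "(LINT z|nu. - g (R z)) <= (LINT x|mu. - g x)"
   by (rule dual_pair_perturbation[OF n mu(1,2) d min _ grad]) (use g cg in "auto intro!: continuous_intros")
  ultimately show "(LINT x|(distr nu borel R). g x) = (LINT x|mu. g x)" by (subst integral_distr) auto
 qed (use mu P.finite_measure_axioms in auto)
 have "AE x in distr nu borel R. (ALL z:Om. z <.> x <= phi z + psi x) & (ALL c. (ALL z:Om. z <.> x - phi z <= c) --> psi x <= c)"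
  unfolding eq using ae sharp by eventually_elim simp
 hence "AE z in nu. (ALL z':Om. z' <.> R z <= phi z' + psi (R z)) & (ALL c. (ALL z':Om. z' <.> R z - phi z' <= c) --> psi (R z) <= c)"
  by (rule AE_distrD[rotated]) measurable
 with nice_AE[OF n] grad have "AE z in nu. phi z + psi (R z) = z <.> R z"
 proof eventually_elim
  case (elim z)
  have "psi (R z) <= z <.> R z - phi z"
  proof (rule elim(3)[THEN conjunct2, rule_format])
   fix z' assume "z' : Om"
   from convex_gderiv_subgradient[OF c elim(1) this elim(2)]
   show "z' <.> R z - phi z' <= z <.> R z - phi z" by (simp add: inner_diff_right inner_commute)
  qed
  thus ?case using elim by force
 qed
 hence "brenier Om nu mu R phi psi" using d eq by (simp add: brenier_def)
 thus thesis by (rule that)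
qed

lemma brenier_AE_dual:
 assumes n: "nice Om nu" and b: "brenier Om nu mu R phi psi"
 shows "AE z in nu. ALL z':Om. z' <.> R z <= phi z' + psi (R z)"
proof -
 have [measurable]: "R : BM" using b by (simp add: brenier_def)
 note [measurable_cong] = nice_sets[OF n]
 have eq: "distr nu borel R = mu" using b by (simp add: brenier_def)
 have "AE x in distr nu borel R. ALL z:Om. z <.> x <= phi z + psi x"
  unfolding eq using b by (simp add: brenier_def dual_pair_def)
 thus ?thesis by (rule AE_distrD[rotated]) measurable
qed

text \<open>Constraint and slackness together make \<open>R z\<close> a subgradient of
  \<open>phi\<close> at \<open>z\<close>; almost everywhere \<open>phi\<close> is differentiable and
  its subgradient unique.\<close>

lemma brenier_subgradient:
 assumes n: "nice Om nu" and b: "brenier Om nu mu R phi psi"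
 shows "AE z in nu. z : Om & GDERIV phi z :> R z & (ALL z':Om. phi z' >= phi z + R z <.> (z' - z))"
proof -
 have c: "convex_on Om phi" using b by (simp add: brenier_def dual_pair_def)
 obtain G where "AE z in lborel. z : Om --> GDERIV phi z :> G z"
  by (rule convex_gradient_AE[OF nice_open[OF n] nice_convex[OF n] c]) blast
 hence "AE z in nu. z : Om --> GDERIV phi z :> G z" by (rule nice_AE_lborel[OF n])
 moreover have "AE z in nu. phi z + psi (R z) = z <.> R z" using b by (simp add: brenier_def)
 ultimately show ?thesis using nice_AE[OF n] brenier_AE_dual[OF assms]
 proof eventually_elim
  case (elim z)
  have sub: "phi z' >= phi z + R z <.> (z' - z)" if "z' : Om" for z'
   using elim that by (force simp: inner_diff_right inner_commute)
  have "GDERIV phi z :> G z" using elim by blast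
  moreover have "R z = G z" by (rule subgradient_unique[OF nice_open[OF n] _ calculation sub]) (use elim in auto)
  ultimately show ?case using elim sub by auto
 qed
qed

lemma integrable_inner_of_sq:
 fixes X Y :: "'b => 'a::euclidean_space"
 assumes [measurable]: "X : bm P" "Y : bm P"
  and "integrable P (%w. (norm (X w))^2)" "integrable P (%w. (norm (Y w))^2)"
 shows "integrable P (%w. X w <.> Y w)"
proof (rule I_bound)
 show "integrable P (%w. (norm (X w))^2 + (norm (Y w))^2)" using assms by simp
 show "AE w in P. norm (X w <.> Y w) <= norm ((norm (X w))^2 + (norm (Y w))^2)"
 proof (rule AE_I2)
  fix w
  have "abs (X w <.> Y w) <= norm (X w) * norm (Y w)" by (rule Cauchy_Schwarz_ineq2)
  also have "... <= (norm (X w))^2 + (norm (Y w))^2" using sum_squares_bound[of "norm (X w)" "norm (Y w)"]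
    mult_nonneg_nonneg[OF norm_ge_zero[of "X w"] norm_ge_zero[of "Y w"]] by linarith
  finally show "norm (X w <.> Y w) <= norm ((norm (X w))^2 + (norm (Y w))^2)" by simp
 qed
qed simp

lemma integrable_norm_sq_diff:
 fixes X Y :: "'b => 'a::euclidean_space"
 assumes [measurable]: "X : bm P" "Y : bm P"
  and "integrable P (%w. (norm (X w))^2)" "integrable P (%w. (norm (Y w))^2)"
 shows "integrable P (%w. (norm (X w - Y w))^2)" and "(LINT w|P. (norm (X w - Y w))^2)
   = (LINT w|P. (norm (X w))^2) + (LINT w|P. (norm (Y w))^2) - 2 * (LINT w|P. X w <.> Y w)"
proof -
 have eq: "(norm (X w - Y w))^2 = (norm (X w))^2 + (norm (Y w))^2 - 2 * (X w <.> Y w)" for w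
  unfolding power2_norm_eq_inner by (simp add: inner_diff_left inner_diff_right inner_commute)
 note i = integrable_inner_of_sq[OF assms]
 show "integrable P (%w. (norm (X w - Y w))^2)" unfolding eq using assms i by simp
 show "(LINT w|P. (norm (X w - Y w))^2)
   = (LINT w|P. (norm (X w))^2) + (LINT w|P. (norm (Y w))^2) - 2 * (LINT w|P. X w <.> Y w)"
  unfolding eq using assms i by simp
qed

lemma integrable_sq_distr:
 fixes X :: "'b => 'a::euclidean_space"
 assumes [measurable]: "X : bm P" and "integrable (distr P borel X) (%x. (norm x)^2)"
 shows "integrable P (%w. (norm (X w))^2)" using assms(2) by (subst (asm) integrable_distr_eq) auto

text \<open>Couplings are given by pairs of random variables on an arbitrary space \<open>P\<close>,
  which later covers maps, plans and product plans alike. The gap in weak duality is the integral of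
  a nonnegative function, so equality forces slackness almost everywhere.\<close>

lemma dual_pair_coupling:
 fixes nu mu :: "'a::euclidean_space measure" and Z X :: "'b => 'a"
 assumes n: "nice Om nu" and mu: "integrable mu (%x. (norm x)^2)" and d: "dual_pair Om nu mu phi psi"
  and [measurable]: "Z : bm P" "X : bm P" and Z: "distr P borel Z = nu" and X: "distr P borel X = mu"
 shows "(LINT w|P. Z w <.> X w) <= (LINT z|nu. phi z) + (LINT x|mu. psi x)"
  and "(LINT z|nu. phi z) + (LINT x|mu. psi x) <= (LINT w|P. Z w <.> X w) ==> AE w in P. phi (Z w) + psi (X w) = Z w <.> X w"
proof -
 have i: "integrable nu phi" "integrable mu psi" and ae: "AE x in mu. ALL z:Om. z <.> x <= phi z + psi x"
  using d by (auto simp: dual_pair_def)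
 have sm: "sets mu = sets borel" using X by (metis sets_distr)
 have [measurable]: "phi : BM" "psi : BM"
  using borel_measurable_integrable[OF i(1)] borel_measurable_integrable[OF i(2)]
  by (simp_all add: measurable_cong_sets[OF nice_sets[OF n] refl] measurable_cong_sets[OF sm refl])
 have iP: "integrable P (%w. phi (Z w))" "integrable P (%w. psi (X w))"
  using i unfolding Z[symmetric] X[symmetric] by (auto simp: integrable_distr_eq)
 have eq: "(LINT w|P. phi (Z w)) = (LINT z|nu. phi z)" "(LINT w|P. psi (X w)) = (LINT x|mu. psi x)"
  unfolding Z[symmetric] X[symmetric] by (auto simp: integral_distr)
 have iZX: "integrable P (%w. Z w <.> X w)"
  by (rule integrable_inner_of_sq) (use nice_sq[OF n] mu Z X in "auto intro!: integrable_sq_distr")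
 have aeZ: "AE w in P. Z w : Om" by (rule AE_distrD[where M' = borel]) (use nice_AE[OF n] Z in auto)
 have aeX: "AE w in P. ALL z:Om. z <.> X w <= phi z + psi (X w)"
  by (rule AE_distrD[where M' = borel]) (use ae X in auto)
 from aeZ aeX have gap: "AE w in P. Z w <.> X w <= phi (Z w) + psi (X w)" by eventually_elim blast
 hence "(LINT w|P. Z w <.> X w) <= (LINT w|P. phi (Z w) + psi (X w))"
  by (intro integral_mono_AE iZX Bochner_Integration.integrable_add iP)
 thus "(LINT w|P. Z w <.> X w) <= (LINT z|nu. phi z) + (LINT x|mu. psi x)" using iP eq by simp
 assume "(LINT z|nu. phi z) + (LINT x|mu. psi x) <= (LINT w|P. Z w <.> X w)"
 with `(LINT w|P. Z w <.> X w) <= (LINT z|nu. phi z) + (LINT x|mu. psi x)`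
 have "(LINT w|P. phi (Z w) + psi (X w) - Z w <.> X w) = 0" using iP iZX eq by simp
 hence "AE w in P. phi (Z w) + psi (X w) - Z w <.> X w = 0"
  by (subst (asm) integral_nonneg_eq_0_iff_AE) (use iP iZX gap in auto)
 thus "AE w in P. phi (Z w) + psi (X w) = Z w <.> X w" by eventually_elim simp
qed

lemma brenier_value:
 assumes b: "brenier Om nu mu R phi psi" and [measurable_cong]: "sets nu = sets borel"
 shows "(LINT z|nu. z <.> R z) = (LINT z|nu. phi z) + (LINT x|mu. psi x)"
proof -
 have [measurable]: "R : BM" and eq: "distr nu borel R = mu"
  and d: "integrable nu phi" "integrable mu psi" and ae: "AE z in nu. phi z + psi (R z) = z <.> R z"
  using b by (auto simp: brenier_def dual_pair_def)
 have [measurable]: "phi : BM" "psi : BM"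
  using borel_measurable_integrable[OF d(1)] borel_measurable_integrable[OF d(2)] 
  by (simp_all add: measurable_cong_sets[OF assms(2) refl] eq[symmetric])
 have "integrable nu (%z. psi (R z))" using d(2) unfolding eq[symmetric] by (simp add: integrable_distr_eq)
 moreover have "(LINT x|mu. psi x) = (LINT z|nu. psi (R z))" unfolding eq[symmetric] by (simp add: integral_distr)
 moreover have "(LINT z|nu. z <.> R z) = (LINT z|nu. phi z + psi (R z))" by (rule integral_cong_AE) (use ae in auto)
 ultimately show ?thesis using d by simp
qed

section \<open>Transport-entropy stability of Brenier maps through Laguerre cells\<close>

text \<open>The open Laguerre (power) cell of \<open>z\<close>: the affine function with slope
  \<open>z\<close> strictly beats the others.\<close>

definition cell :: "('a::real_inner => real) => 'a set => 'a => 'a set" where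
 "cell a I z = {x. ALL z':I - {z}. x <.> z' - a z' < x <.> z - a z}"

lemma open_cell: "finite I ==> open (cell a I z)"
proof -
 assume "finite I"
 have "cell a I z = (\<Inter>z'\<in>I - {z}. {x. x <.> z' - a z' < x <.> z - a z})" by (auto simp: cell_def)
 also have "open ..." using `finite I` by (intro open_INT ballI open_Collect_less continuous_intros) auto
 finally show ?thesis .
qed

text \<open>Sum of the two defining inequalities. The strict sign survives convex combination of
  cells from two tessellations with the same index set, and so separates the Minkowski combinations
  in \<open>cells_barycenter_bound\<close>.\<close>

lemma cell_monotone:
 assumes "x : cell a I z" "x' : cell a I z'" "z : I" "z' : I" "z ~= z'"
 shows "(x - x') <.> (z - z') > 0"
proof -
 have "x <.> z' - a z' < x <.> z - a z" "x' <.> z - a z < x' <.> z' - a z'" using assms by (auto simp: cell_def)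
 thus ?thesis by (simp add: inner_diff_left inner_diff_right)
qed

lemma cell_disjoint: "z : I ==> z' : I ==> z ~= z' ==> cell a I z Int cell a I z' = {}"
 using cell_monotone[of _ a I z _ z'] by force

text \<open>The weights \<open>a\<close> are the target potential of a Brenier map from
  \<open>mu\<close> to the finitely supported law \<open>tau\<close> of \<open>q\<close>. Ties
  between two affine functions lie in hyperplanes, which \<open>mu\<close> does not charge, so
  slackness puts almost every point into an open cell.\<close>

lemma semidiscrete:
 fixes mu nu :: "'a::euclidean_space measure"
 assumes n: "nice Om mu" and nu: "prob_space nu" "sets nu = sets borel"
  and q: "simple_function borel q" and I: "I = {z\<in>range q. measure nu (q -` {z}) > 0}"
 obtains a where "!!z. z : I ==> measure mu (cell a I z) = measure nu (q -` {z})"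
  "AE x in mu. x : (\<Union>z\<in>I. cell a I z)"
proof -
 interpret M: prob_space mu using n by (rule nice_prob)
 interpret N: prob_space nu by fact
 note [measurable_cong] = nice_sets[OF n] nu(2)
 have sp: "space nu = UNIV" "space mu = UNIV" using sets_eq_imp_space_eq[OF nu(2)] nice_space[OF n] by auto
 have [measurable]: "q : BM" using q by (rule borel_measurable_simple_function)
 have fin: "finite (range q)" using q by (simp add: simple_function_def)
 hence finI: "finite I" by (simp add: I)
 have qm: "q -` {z} : sets borel" for z by (rule measurable_sets_borel[of q borel]) auto
 define tau where "tau = distr nu borel q"
 have tau: "prob_space tau" "sets tau = sets borel" unfolding tau_def by (auto intro!: N.prob_space_distr)
 interpret T: prob_space tau by fact
 have "integrable nu (%x. (norm (q x))^2)"
 proof (rule N.integrable_const_bound)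
  show "AE x in nu. norm ((norm (q x))^2) <= Max ((%z. (norm z)^2) ` range q)" using fin by (auto intro!: Max_ge)
 qed simp
 hence "integrable tau (%x. (norm x)^2)" unfolding tau_def by (simp add: integrable_distr_eq)
 then obtain T phi a where b: "brenier Om mu tau T phi a" using brenier_exists[OF n tau] by blast
 have [measurable]: "T : BM" and eq: "distr mu borel T = tau"
  and gap: "AE z in mu. phi z + a (T z) = z <.> T z" using b by (auto simp: brenier_def)
 have taum: "measure tau {z} = measure nu (q -` {z})" for z unfolding tau_def by (subst measure_distr) (auto simp: sp)
 \<comment> \<open>The constraint is only known for \<open>tau\<close>-almost every target point,
   but a null set cannot contain an atom.\<close>
 have atom: "x <.> z <= phi x + a z" if z: "z : I" and x: "x : Om" for x z
 proof -
  have "AE y in tau. ALL z:Om. z <.> y <= phi z + a y" using b by (simp add: brenier_def dual_pair_def)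
  then obtain E where E: "{y. ~ (ALL z:Om. z <.> y <= phi z + a y)} Int space tau <= E" "E : null_sets tau"
   by (auto elim!: AE_E simp: null_sets_def Int_def conj_commute)
  have "z ~: E"
  proof
   assume "z : E"
   hence "emeasure tau {z} <= emeasure tau E" using E by (intro emeasure_mono) (auto simp: null_sets_def)
   hence "measure tau {z} = 0" using E by (simp add: null_sets_def measure_def)
   thus False using z taum[of z] by (simp add: I)
  qed
  moreover have "z : space tau" using sets_eq_imp_space_eq[OF tau(2)] by simp
  ultimately have "z ~: {y. ~ (ALL z:Om. z <.> y <= phi z + a y)}" using E(1) by blast
  thus ?thesis using x by simp
 qed
 have qI: "AE w in nu. q w : I"
 proof -
  have "q -` {z} : null_sets nu" if "z : range q - I" for z using that qm measure_nonneg[of nu "q -` {z}"]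
   by (auto simp: I null_sets_def N.emeasure_eq_measure nu(2) order.order_iff_strict)
  hence "AE w in nu. ALL z:range q - I. w ~: q -` {z}" using fin by (intro AE_finite_allI AE_not_in) auto
  thus ?thesis by eventually_elim auto
 qed
 have TI: "AE x in mu. T x : I"
 proof -
  have [measurable]: "I : sets borel" using finI by (intro borel_closed finite_imp_closed)
  have "AE y in distr nu borel q. y : I" using qI by (subst AE_distr_iff) auto
  hence "AE y in distr mu borel T. y : I" unfolding eq tau_def .
  thus ?thesis by (rule AE_distrD[rotated]) simp
 qed
 have hyp: "AE x in mu. ALL p:(I \<times> I). fst p ~= snd p --> x <.> fst p - a (fst p) ~= x <.> snd p - a (snd p)"
 proof (rule nice_AE_lborel[OF n], rule AE_finite_allI)
  fix p assume "p : I \<times> I"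
  obtain z z' where p: "p = (z, z')" by force
  show "AE x in lborel. fst p ~= snd p --> x <.> fst p - a (fst p) ~= x <.> snd p - a (snd p)"
  proof (cases "z = z'")
   case False
   have "negligible {x. (z - z') <.> x = a z - a z'}" by (rule negligible_hyperplane) (use False in auto)
   moreover have "{x. (z - z') <.> x = a z - a z'} : sets borel" by measurable
   ultimately have "{x. (z - z') <.> x = a z - a z'} : null_sets lborel"
    by (auto simp: negligible_iff_null_sets null_sets_def)
   hence "AE x in lborel. x ~: {x. (z - z') <.> x = a z - a z'}" by (rule AE_not_in)
   thus ?thesis by eventually_elim (auto simp: p inner_diff_left inner_diff_right inner_commute)
  qed (simp add: p)
 qed (use finI in auto)
 have main: "AE x in mu. T x : I & x : cell a I (T x)" using nice_AE[OF n] gap TI hyp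
 proof eventually_elim
  case (elim x)
  have "x : cell a I (T x)" unfolding cell_def
  proof (intro CollectI ballI)
   fix z' assume "z' : I - {T x}"
   hence z': "z' : I" "z' ~= T x" by auto
   have "x <.> z' - a z' <= x <.> T x - a (T x)" using atom[OF z'(1) elim(1)] elim(2) by simp
   moreover have "x <.> z' - a z' ~= x <.> T x - a (T x)" using elim z' by force
   ultimately show "x <.> z' - a z' < x <.> T x - a (T x)" by simp
  qed
  with elim show ?case by simp
 qed
 show thesis
 proof (rule that[of a])
  show "AE x in mu. x : (\<Union>z\<in>I. cell a I z)" using main by eventually_elim auto
  fix z assume z: "z : I"
  have "measure mu (cell a I z) = measure mu (T -` {z} Int space mu)"
  proof (rule measure_eq_AE)
   show "AE x in mu. x : cell a I z \<longleftrightarrow> x : T -` {z} Int space mu" using main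
   proof eventually_elim
    case (elim x)
    thus ?case using cell_disjoint[OF z, of "T x" a] sp by auto
   qed
  qed (use open_cell[OF finI] in "auto simp: nice_sets[OF n]")
  also have "... = measure tau {z}" unfolding eq[symmetric] by (subst measure_distr) auto
  finally show "measure mu (cell a I z) = measure nu (q -` {z})" by (simp add: taum)
 qed
qed

text \<open>Jensen's inequality for the conditional law on \<open>C\<close>, from the tangent to
  \<open>exp\<close> at the conditional mean \<open>E\<close>; the right-hand side may be
  infinite.\<close>

lemma jensen_exp_indicator:
 assumes "finite_measure mu" and C [measurable]: "C : sets mu" and [measurable]: "X : bm mu"
  and i: "integrable mu (%x. indicator C x * X x)" and p: "p = measure mu C" "p > 0"
  and E: "E = (LINT x|mu. indicator C x * X x) / p"
 shows "ennreal (p * exp E) <= (NN mu (%x. ennreal (indicator C x * exp (X x))))"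
proof (cases "(NN mu (%x. ennreal (indicator C x * exp (X x)))) = \<infinity>")
 case False
 interpret finite_measure mu by fact
 have ie: "integrable mu (%x. indicator C x * exp (X x))"
  by (rule integrableI_nonneg) (use False in "auto simp: top.not_eq_extremum")
 have iC: "integrable mu (%x. indicator C x :: real)"
  by (rule integrable_const_bound[of _ 1]) (auto split: split_indicator)
 have "p * exp E = (LINT x|mu. exp E * ((1 - E) * indicator C x + indicator C x * X x))"
 proof -
  have "(LINT x|mu. exp E * ((1 - E) * indicator C x + indicator C x * X x)) = exp E * ((1 - E) * p + p * E)"
   using i iC E p by simp
  thus ?thesis by (simp add: algebra_simps)
 qed
 also have "... <= (LINT x|mu. indicator C x * exp (X x))"
 proof (rule integral_mono)
  fix x
  show "exp E * ((1 - E) * indicator C x + indicator C x * X x) <= indicator C x * exp (X x)"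
  proof (cases "x : C")
   case True
   have "1 + (X x - E) <= exp (X x - E)" by (rule exp_ge_add_one_self)
   hence "exp E * (1 + (X x - E)) <= exp E * exp (X x - E)" by (rule mult_left_mono) simp
   also have "... = exp (X x)" by (simp add: exp_diff)
   finally show ?thesis using True by (simp add: algebra_simps)
  qed simp
 qed (use ie i iC in auto)
 finally have "ennreal (p * exp E) <= ennreal (LINT x|mu. indicator C x * exp (X x))" by (rule ennreal_leI)
 also have "... = (NN mu (%x. ennreal (indicator C x * exp (X x))))"
  by (rule nn_integral_eq_integral[symmetric, OF ie]) simp
 finally show ?thesis .
qed simp

lemma powr_times_exp: "0 <= r ==> (r * exp a) powr t = r powr t * exp (t * a)" for r a t :: real
 by (simp add: powr_mult exp_powr_real mult.commute)

lemma minkowski_combination_open: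
 fixes D :: "'a::real_normed_vector set"
 assumes "open D" "s ~= 0"
 shows "open {(1 - s) *. x + s *. y | x y. x : C & y : D}"
proof -
 have "{(1 - s) *. x + s *. y | x y. x : C & y : D} = (\<Union>x\<in>C. (%y. (1 - s) *. x + s *. y) ` D)" by auto
 also have "open ..." using assms by (intro open_UN ballI open_affinity) auto
 finally show ?thesis .
qed

text \<open>The quadratic gain is linearised by
  \<open>2 * (xi <.> (x - y)) - (norm xi)^2 <= (norm (x - y))^2\<close> for a fixed vector
  \<open>xi\<close>; the linear tilts can then be integrated over \<open>C\<close> and
  \<open>D\<close> separately. Openness of \<open>D\<close> makes the Minkowski combination
  Borel.\<close>

lemma prekopa_leindler_pair:
 fixes rho :: "'a::euclidean_space => real"
 assumes w: "slc_weight ka rho" and k: "ka > 0" and s: "0 < s" "s < 1"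
  and C [measurable]: "C : sets borel" and D: "open D"
  and A: "0 <= A" "ennreal A <= (NL x. ennreal (rho x * (indicator C x * exp (ka * s * (xi <.> x - (norm xi)^2 / 2)))))"
  and B: "0 <= B" "ennreal B <= (NL y. ennreal (rho y * (indicator D y * exp (- ka * (1 - s) * (xi <.> y)))))"
 shows "ennreal (A powr (1 - s) * B powr s) <= emeasure (dens rho) {(1 - s) *. x + s *. y | x y. x : C & y : D}"
proof -
 note [measurable] = slc_weight_measurable[OF w]
 note nn = slc_weight_nonneg[OF w]
 let ?W = "{(1 - s) *. x + s *. y | x y. x : C & y : D}"
 have W [measurable]: "?W : sets borel" using minkowski_combination_open[OF D, of s C] s by auto
 have [measurable]: "D : sets borel" using D by simp
 have "ennreal (A powr (1 - s) * B powr s) <= (NL w. ennreal (rho w * indicator ?W w))"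
 proof (rule prekopa_leindler[OF s _ _ _ _ A B])
  fix x y :: 'a and a b :: real
  assume ab: "0 <= a" "0 <= b" "ennreal a <= ennreal (rho x * (indicator C x * exp (ka * s * (xi <.> x - (norm xi)^2 / 2))))"
   "ennreal b <= ennreal (rho y * (indicator D y * exp (- ka * (1 - s) * (xi <.> y))))"
  have a: "a <= rho x * (indicator C x * exp (ka * s * (xi <.> x - (norm xi)^2 / 2)))"
   and b: "b <= rho y * (indicator D y * exp (- ka * (1 - s) * (xi <.> y)))"
   using ab nn by (simp_all add: ennreal_le_iff)
  show "ennreal (a powr (1 - s) * b powr s)
    <= ennreal (rho ((1 - s) *. x + s *. y) * indicator ?W ((1 - s) *. x + s *. y))"
  proof (cases "x : C & y : D")
   case True
   hence inW: "(1 - s) *. x + s *. y : ?W" by blast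
   let ?a = "ka * s * (xi <.> x - (norm xi)^2 / 2)" and ?b = "- ka * (1 - s) * (xi <.> y)"
   have "a powr (1 - s) * b powr s <= (rho x * exp ?a) powr (1 - s) * (rho y * exp ?b) powr s"
    using a b ab s True by (intro mult_mono powr_mono2) auto
   also have "... = rho x powr (1 - s) * rho y powr s * exp ((1 - s) * ?a + s * ?b)"
    unfolding powr_times_exp[OF nn] exp_add by (simp only: mult.assoc mult.left_commute)
   also have "... <= rho x powr (1 - s) * rho y powr s * exp (ka * s * (1 - s) / 2 * (norm (x - y))^2)"
   proof (intro mult_left_mono)
    have "0 <= (norm (x - y - xi))^2" by simp
    hence "2 * (xi <.> x - (norm xi)^2 / 2 - xi <.> y) <= (norm (x - y))^2"
     unfolding power2_norm_eq_inner by (simp add: inner_diff_left inner_diff_right inner_commute)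
    hence "ka * s * (1 - s) / 2 * (2 * (xi <.> x - (norm xi)^2 / 2 - xi <.> y)) <= ka * s * (1 - s) / 2 * (norm (x - y))^2"
     using k s by (intro mult_left_mono) auto
    moreover have "(1 - s) * ?a + s * ?b = ka * s * (1 - s) / 2 * (2 * (xi <.> x - (norm xi)^2 / 2 - xi <.> y))"
     by (simp add: field_simps)
    ultimately show "exp ((1 - s) * ?a + s * ?b) <= exp (ka * s * (1 - s) / 2 * (norm (x - y))^2)" by simp
   qed auto
   also have "... <= rho ((1 - s) *. x + s *. y)" by (rule slc_weight_ineq[OF w s])
   finally show ?thesis using inW by (intro ennreal_leI) simp
  next
   case False
   hence "a = 0 | b = 0" using a b ab by auto
   thus ?thesis using s by auto
  qed
 qed measurable
 also have "... = (NL w. ennreal (rho w) * indicator ?W w)" by (intro nn_integral_cong) (auto split: split_indicator)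
 also have "... = emeasure (dens rho) ?W" by (rule emeasure_density[symmetric]) measurable
 finally show ?thesis .
qed

text \<open>A discrete transport-entropy inequality. Cells with the same index have equal mass under
  \<open>mu\<close> and \<open>eta\<close>. Their Minkowski combinations are pairwise disjoint and
  have total mass at most 1, while Prekopa-Leindler bounds each from below by \<open>p z\<close>,
  plus the curvature gain, minus the entropy share of the cell.\<close>

lemma cells_barycenter_bound:
 fixes rho h :: "'a::euclidean_space => real" and I :: "'a set"
 assumes w: "slc_weight ka rho" and k: "ka > 0" and mu: "mu = dens rho"
  and prob: "prob_space mu" and sq: "integrable mu (%x. (norm x)^2)"
  and h [measurable]: "h : BM" and lo: "0 < lo" "!!x. lo <= h x" and hi: "!!x. h x <= hi"
  and eta: "eta = density mu (%x. ennreal (h x))" and h1: "(LINT x|mu. h x) = 1"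
  and I: "finite I" and p0: "!!z. z : I ==> p z > 0" and pa: "!!z. z : I ==> measure mu (cell a I z) = p z"
  and pb: "!!z. z : I ==> measure eta (cell b I z) = p z"
  and full: "AE x in eta. x : (\<Union>z\<in>I. cell b I z)" and p1: "(SUM z:I. p z) = 1"
  and m: "!!z. m z = (1 / p z) *. (LINT x|mu. indicator (cell a I z) x *. x)"
  and n: "!!z. n z = (1 / p z) *. (LINT x|eta. indicator (cell b I z) x *. x)"
 shows "(SUM z:I. p z * (norm (m z - n z))^2) <= 2 / ka * (LINT x|mu. h x * ln (h x))"
proof -
 note [measurable] = slc_weight_measurable[OF w]
 note nn = slc_weight_nonneg[OF w]
 interpret M: prob_space mu by fact
 have sm [measurable_cong, simp]: "sets mu = sets borel" by (simp add: mu)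
 have se [measurable_cong, simp]: "sets eta = sets borel" by (simp add: eta)
 have h0: "h x > 0" for x using lo(1) lo(2)[of x] by simp
 have h0': "0 <= h x" for x using h0[of x] by simp
 have niceM: "nice (interior {x. rho x > 0}) mu" unfolding mu by (rule nice_slc[OF w k]) (use prob mu in simp)
 have niceE: "nice (interior {x. rho x > 0}) eta" unfolding eta by (rule nice_density[OF niceM h lo hi h1])
 interpret E: prob_space eta using niceE by (rule nice_prob)
 have ixm: "integrable mu (%x. x)" by (rule integrable_norm_of_sq) (use sq M.finite_measure_axioms in auto)
 have ixe: "integrable eta (%x. x)"
  by (rule integrable_norm_of_sq) (use nice_sq[OF niceE] E.finite_measure_axioms in auto)
 have cm [measurable]: "cell a I z : sets borel" "cell b I z : sets borel" for z using open_cell[OF I] by auto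
 have lnb: "abs (ln (h x)) <= abs (ln lo) + abs (ln hi)" for x
 proof -
  have "ln lo <= ln (h x)" "ln (h x) <= ln hi" using lo hi[of x] h0[of x] by auto
  thus ?thesis by linarith
 qed
 have ilnh: "integrable eta (%x. ln (h x))"
  by (rule E.integrable_const_bound[where B = "abs (ln lo) + abs (ln hi)"]) (use lnb in auto)
 have ind: "integrable mu (%x. indicator (cell a I z) x *. x)" "integrable eta (%x. indicator (cell b I z) x *. x)" for z
  by (rule integrable_mult_indicator[OF _ ixm], simp, rule integrable_mult_indicator[OF _ ixe], simp)
 have iind: "integrable mu (%x. indicat_real (cell a I z) x)" for z
  by (rule M.integrable_const_bound[of _ 1]) (auto split: split_indicator)
 have indln: "integrable eta (%x. indicator (cell b I z) x * ln (h x))" for z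
  using integrable_mult_indicator[OF _ ilnh, of "cell b I z"] by simp
 define L where "L z = (LINT x|eta. indicator (cell b I z) x * ln (h x))" for z
 have sumL: "(SUM z:I. L z) = (LINT x|mu. h x * ln (h x))"
 proof -
  have "(SUM z:I. L z) = (LINT x|eta. (SUM z:I. indicator (cell b I z) x * ln (h x)))"
   unfolding L_def using indln by simp
  also have "... = (LINT x|eta. ln (h x))"
  proof (rule integral_cong_AE)
   show "AE x in eta. (SUM z:I. indicator (cell b I z) x * ln (h x)) = ln (h x)" using full
   proof eventually_elim
    case (elim x)
    then obtain z where z: "z : I" "x : cell b I z" by auto
    have "(\<Sum>z'\<in>I. indicator (cell b I z') x * ln (h x)) = (\<Sum>z'\<in>{z}. indicator (cell b I z') x * ln (h x))"
     using z I cell_disjoint[of _ I z b] by (intro sum.mono_neutral_right) (auto simp: indicator_def)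
    thus ?case using z by simp
   qed
  qed measurable
  also have "... = (LINT x|mu. h x *. ln (h x))" unfolding eta by (rule integral_density) (use h0' in auto)
  finally show ?thesis by simp
 qed
 have ineq: "ka * (1 - s) / 2 * (SUM z:I. p z * (norm (m z - n z))^2) <= (LINT x|mu. h x * ln (h x))"
  if s: "0 < s" "s < 1" for s
 proof -
  define W where "W z = {(1 - s) *. x + s *. y | x y. x : cell a I z & y : cell b I z}" for z
  have Wm: "W z : sets borel" for z unfolding W_def using minkowski_combination_open[OF open_cell[OF I]] s by auto
  have disj: "disjoint_family_on W I" unfolding disjoint_family_on_def
  proof (intro ballI impI)
   fix z z' assume z: "z : I" "z' : I" "z ~= z'"
   show "W z Int W z' = {}"
   proof (rule equals0I)
    fix v assume "v : W z Int W z'"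
    then obtain x y x' y' where v: "v = (1 - s) *. x + s *. y" "x : cell a I z" "y : cell b I z"
     "v = (1 - s) *. x' + s *. y'" "x' : cell a I z'" "y' : cell b I z'" unfolding W_def by blast
    have "0 = ((1 - s) *. x + s *. y - ((1 - s) *. x' + s *. y')) <.> (z - z')" using v(1,4) by simp
    also have "... = (1 - s) * ((x - x') <.> (z - z')) + s * ((y - y') <.> (z - z'))"
     by (simp add: inner_diff_left inner_add_left algebra_simps)
    also have "... > 0"
     using s cell_monotone[OF v(2,5) z] cell_monotone[OF v(3,6) z] by (intro add_pos_pos mult_pos_pos) auto
    finally show False by simp
   qed
  qed
  have cellineq: "p z + (ka * s * (1 - s) / 2 * (p z * (norm (m z - n z))^2) - s * L z) <= measure mu (W z)"
   if z: "z : I" for z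
  proof -
   let ?C = "cell a I z" and ?D = "cell b I z"
   \<comment> \<open>After averaging, the linearised gain is proportional to
     \<open>2 * (xi <.> (m z - n z)) - (norm xi)^2\<close>, which is largest for this
     choice.\<close>
   define xi where "xi = m z - n z"
   define LA where "LA x = ka * s * (xi <.> x - (norm xi)^2 / 2)" for x
   define LB where "LB y = - ka * (1 - s) * (xi <.> y)" for y
   have [measurable]: "LA : BM" "LB : BM" unfolding LA_def LB_def by measurable
   define EA where "EA = ka * s * (xi <.> m z - (norm xi)^2 / 2)"
   \<comment> \<open>The entropy enters here: the integral of \<open>rho * exp LB\<close> over the
     second cell is the \<open>eta\<close>-integral of \<open>exp (LB - ln h)\<close>, and
     \<open>EB\<close> is the conditional mean of that exponent.\<close>
   define EB where "EB = - ka * (1 - s) * (xi <.> n z) - L z / p z"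
   have pz: "p z > 0" using p0[OF z] .
   have mz: "(LINT x|mu. indicator ?C x *. x) = p z *. m z" "(LINT x|eta. indicator ?D x *. x) = p z *. n z"
    using pz m[of z] n[of z] by auto
   have inA: "integrable mu (%x. indicat_real ?C x * (xi <.> x))"
    "(LINT x|mu. indicat_real ?C x * (xi <.> x)) = p z * (xi <.> m z)"
    using integrable_inner_right[of xi mu "%x. indicator ?C x *. x"] integral_inner_right[of xi mu "%x. indicator ?C x *. x"] ind(1)[of z] mz
    by auto
   have inB: "integrable eta (%x. indicat_real ?D x * (xi <.> x))"
    "(LINT x|eta. indicat_real ?D x * (xi <.> x)) = p z * (xi <.> n z)"
    using integrable_inner_right[of xi eta "%x. indicator ?D x *. x"] integral_inner_right[of xi eta "%x. indicator ?D x *. x"] ind(2)[of z] mz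
    by auto
   have eqA: "indicator ?C x * LA x = ka * s * (indicator ?C x * (xi <.> x)) - ka * s * (norm xi)^2 / 2 * indicator ?C x" for x
    by (simp add: LA_def algebra_simps)
   have iA: "integrable mu (%x. indicator ?C x * LA x)"
    unfolding eqA using inA iind by (intro Bochner_Integration.integrable_diff integrable_mult_right) auto
   have A: "ennreal (p z * exp EA) <= (NN mu (%x. ennreal (indicator ?C x * exp (LA x))))"
   proof (rule jensen_exp_indicator[OF M.finite_measure_axioms _ _ iA])
    have "(LINT x|mu. indicator ?C x * LA x) = ka * s * (xi <.> (p z *. m z)) - ka * s * (norm xi)^2 / 2 * p z"
     unfolding eqA using inA iind[of z] pa[OF z] by simp
    thus "EA = (LINT x|mu. indicator ?C x * LA x) / p z" using pz by (simp add: EA_def field_simps)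
   qed (use pa[OF z] pz in auto)
   have eqB: "indicator ?D x * (LB x - ln (h x)) = - ka * (1 - s) * (indicator ?D x * (xi <.> x)) - indicator ?D x * ln (h x)" for x
    by (simp add: LB_def algebra_simps)
   have iB: "integrable eta (%x. indicator ?D x * (LB x - ln (h x)))"
    unfolding eqB using inB indln by (intro Bochner_Integration.integrable_diff integrable_mult_right) auto
   have B: "ennreal (p z * exp EB) <= (NN eta (%x. ennreal (indicator ?D x * exp (LB x - ln (h x)))))"
   proof (rule jensen_exp_indicator[OF E.finite_measure_axioms _ _ iB])
    have "(LINT x|eta. indicator ?D x * (LB x - ln (h x))) = - ka * (1 - s) * (xi <.> (p z *. n z)) - L z"
     unfolding eqB L_def using inB indln by simp
    thus "EB = (LINT x|eta. indicator ?D x * (LB x - ln (h x))) / p z" using pz by (simp add: EB_def field_simps)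
   qed (use pb[OF z] pz in auto)
   have A': "(NN mu (%x. ennreal (indicator ?C x * exp (LA x)))) = (NL x. ennreal (rho x * (indicator ?C x * exp (LA x))))"
    unfolding mu using nn by (subst nn_integral_density) (auto simp: ennreal_mult')
   have B': "(NN eta (%x. ennreal (indicator ?D x * exp (LB x - ln (h x))))) = (NL x. ennreal (rho x * (indicator ?D x * exp (LB x))))"
   proof -
    have "(NN eta (%x. ennreal (indicator ?D x * exp (LB x - ln (h x)))))
     = (NN mu (%x. ennreal (h x) * ennreal (indicator ?D x * exp (LB x - ln (h x)))))"
     unfolding eta by (rule nn_integral_density) auto
    also have "... = (NN mu (%x. ennreal (indicator ?D x * exp (LB x))))"
     using h0 h0' by (intro nn_integral_cong) (simp add: ennreal_mult[symmetric] exp_diff less_imp_neq[symmetric])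
    also have "... = (NL x. ennreal (rho x * (indicator ?D x * exp (LB x))))"
     unfolding mu using nn by (subst nn_integral_density) (auto simp: ennreal_mult')
    finally show ?thesis .
   qed
   note AB = A[unfolded A', unfolded LA_def] B[unfolded B', unfolded LB_def]
   have "ennreal ((p z * exp EA) powr (1 - s) * (p z * exp EB) powr s) <= emeasure mu (W z)" unfolding W_def mu
    by (rule prekopa_leindler_pair[OF w k s _ open_cell[OF I], where xi = xi])
      (use AB pz cm in simp_all)
   hence le: "(p z * exp EA) powr (1 - s) * (p z * exp EB) powr s <= measure mu (W z)"
    by (simp add: M.emeasure_eq_measure)
   have e1: "(p z * exp EA) powr (1 - s) * (p z * exp EB) powr s = p z * exp ((1 - s) * EA + s * EB)"
   proof -
    have "(p z * exp EA) powr (1 - s) * (p z * exp EB) powr s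
     = (p z powr (1 - s) * p z powr s) * (exp ((1 - s) * EA) * exp (s * EB))"
     unfolding powr_times_exp[OF less_imp_le[OF pz]] by (simp only: mult.assoc mult.left_commute)
    also have "p z powr (1 - s) * p z powr s = p z" using pz by (simp flip: powr_add)
    finally show ?thesis by (simp add: exp_add)
   qed
   \<comment> \<open>Only the linear part of the exponential is kept: the terms \<open>p z\<close>
     then sum to 1 and cancel against the total mass, and the rest is divisible by
     \<open>s\<close>.\<close>
   have e2: "p z * (1 + ((1 - s) * EA + s * EB)) <= p z * exp ((1 - s) * EA + s * EB)"
    using pz exp_ge_add_one_self[of "(1 - s) * EA + s * EB"] by (intro mult_left_mono) auto
   have e3: "(1 - s) * EA + s * EB = ka * s * (1 - s) / 2 * (norm xi)^2 - s * (L z / p z)"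
   proof -
    have "(norm xi)^2 = xi <.> m z - xi <.> n z" unfolding power2_norm_eq_inner xi_def by (simp add: inner_diff_left inner_diff_right inner_commute)
    hence x: "xi <.> m z = (norm xi)^2 + xi <.> n z" by simp
    show ?thesis unfolding EA_def EB_def x by (simp add: algebra_simps)
   qed
   have "p z * (1 + (ka * s * (1 - s) / 2 * (norm xi)^2 - s * (L z / p z))) <= measure mu (W z)"
    using order_trans[OF e2 le[unfolded e1]] unfolding e3 .
   moreover have "p z * (1 + (ka * s * (1 - s) / 2 * (norm xi)^2 - s * (L z / p z)))
    = p z + (ka * s * (1 - s) / 2 * (p z * (norm xi)^2) - s * L z)"
    using pz by (simp add: distrib_left right_diff_distrib)
   ultimately show ?thesis by (simp add: xi_def)
  qed
  have "(SUM z:I. p z + (ka * s * (1 - s) / 2 * (p z * (norm (m z - n z))^2) - s * L z)) <= (SUM z:I. measure mu (W z))"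
   by (intro sum_mono cellineq)
  also have "... = measure mu (\<Union>z\<in>I. W z)" using I disj Wm by (subst M.finite_measure_finite_Union) auto
  also have "... <= 1" by (rule M.prob_le_1)
  finally have "s * (ka * (1 - s) / 2 * (SUM z:I. p z * (norm (m z - n z))^2)) <= s * (SUM z:I. L z)"
   unfolding sum.distrib sum_subtractf sum_distrib_left[symmetric] p1 by (simp add: field_simps)
  hence "ka * (1 - s) / 2 * (SUM z:I. p z * (norm (m z - n z))^2) <= (SUM z:I. L z)"
   using s(1) by (rule mult_left_le_imp_le)
  thus ?thesis unfolding sumL .
 qed
 \<comment> \<open>Sending \<open>s\<close> to 0 removes the factor \<open>1 - s\<close> and gives
   the sharp constant.\<close>
 let ?S = "\<Sum>z\<in>I. p z * (norm (m z - n z))^2"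
 have "(%j. ka * (1 - 1 / real (Suc (Suc j))) / 2 * ?S) ----> ka * (1 - 0) / 2 * ?S"
  by (intro tendsto_intros LIMSEQ_Suc[OF LIMSEQ_Suc[OF lim_1_over_n]]) auto
 hence "ka * (1 - 0) / 2 * ?S <= (LINT x|mu. h x * ln (h x))" by (rule LIMSEQ_le_const2) (use ineq in auto)
 thus ?thesis using k by (simp add: field_simps)
qed

definition atoms :: "'b measure => ('b => 'a) => 'a set" where
 "atoms nu q = {z\<in>range q. measure nu (q -` {z}) > 0}"

lemma simple_function_atoms:
 fixes nu :: "'a::euclidean_space measure" and q :: "'a => 'a"
 assumes nu: "prob_space nu" "sets nu = sets borel" and q: "simple_function borel q"
 shows finite_atoms: "finite (atoms nu q)" and AE_atoms: "AE w in nu. q w : atoms nu q"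
  and integrable_atoms: "integrable nu (%w. G (q w) :: 'b::{banach, second_countable_topology})"
  and integral_atoms: "(LINT w|nu. G (q w)) = (SUM z:atoms nu q. measure nu (q -` {z}) *. G z)"
proof -
 interpret N: prob_space nu by fact
 note [measurable_cong] = nu(2)
 have [measurable]: "q : BM" using q by (rule borel_measurable_simple_function)
 have fin: "finite (range q)" using q by (simp add: simple_function_def)
 thus finI: "finite (atoms nu q)" by (simp add: atoms_def)
 have qm [measurable]: "q -` {z} : sets borel" for z by (rule measurable_sets_borel[of q borel]) auto
 have "q -` {z} : null_sets nu" if "z : range q - atoms nu q" for z using that qm measure_nonneg[of nu "q -` {z}"]
  by (auto simp: atoms_def null_sets_def N.emeasure_eq_measure nu(2) order.order_iff_strict)
 hence "AE w in nu. ALL z:range q - atoms nu q. w ~: q -` {z}" using fin by (intro AE_finite_allI AE_not_in) auto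
 thus ae: "AE w in nu. q w : atoms nu q" by eventually_elim auto
 have i: "integrable nu (%w. indicator (q -` {z}) w *. G z)" for z
  by (rule N.integrable_const_bound[of _ "norm (G z)"]) (auto split: split_indicator)
 have eq: "AE w in nu. G (q w) = (SUM z:atoms nu q. indicator (q -` {z}) w *. G z)" using ae
 proof eventually_elim
  case (elim w)
  have "(SUM z:atoms nu q. indicator (q -` {z}) w *. G z) = (SUM z:{q w}. indicator (q -` {z}) w *. G z)"
   using elim finI by (intro sum.mono_neutral_right) (auto simp: indicator_def)
  thus ?case by simp
 qed
 have "simple_function borel (%w. G (q w))" using q by (rule simple_function_compose1)
 hence [measurable]: "(%w. G (q w)) : BM" by (rule borel_measurable_simple_function)
 show "integrable nu (%w. G (q w))"
 proof (rule integrable_cong_AE_imp)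
  show "integrable nu (%w. \<Sum>z\<in>atoms nu q. indicator (q -` {z}) w *. G z)" using i by simp
 qed (use eq in "auto elim: eventually_mono")
 have "(LINT w|nu. G (q w)) = (LINT w|nu. (SUM z:atoms nu q. indicator (q -` {z}) w *. G z))"
  by (rule integral_cong_AE) (use eq in auto)
 also have "... = (SUM z:atoms nu q. measure nu (q -` {z}) *. G z)"
 proof (subst Bochner_Integration.integral_sum[OF i], rule sum.cong)
  fix z
  have "integrable nu (%w. indicat_real (q -` {z}) w)"
   by (rule N.integrable_const_bound[of _ 1]) (auto split: split_indicator)
  hence "(LINT w|nu. indicator (q -` {z}) w *. G z) = (LINT w|nu. indicat_real (q -` {z}) w) *. G z"
   by (intro integral_scaleR_left)
  thus "(LINT w|nu. indicator (q -` {z}) w *. G z) = measure nu (q -` {z}) *. G z"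
   using sets_eq_imp_space_eq[OF nu(2)] by simp
 qed simp
 finally show "(LINT w|nu. G (q w)) = (SUM z:atoms nu q. measure nu (q -` {z}) *. G z)" .
qed

lemma integral_cells:
 fixes mu :: "'a::euclidean_space measure" and f :: "'a => 'b::{banach, second_countable_topology}"
 assumes I: "finite I" and full: "AE x in mu. x : (\<Union>z\<in>I. cell a I z)" and mu: "sets mu = sets borel"
  and f: "integrable mu f"
 shows "(SUM z:I. (LINT x|mu. indicator (cell a I z) x *. f x)) = (LINT x|mu. f x)"
proof -
 note [measurable_cong] = mu
 have [measurable]: "cell a I z : sets borel" for z using open_cell[OF I] by auto
 have i: "integrable mu (%x. indicator (cell a I z) x *. f x)" for z
  by (rule integrable_mult_indicator[OF _ f]) (simp add: mu)
 have "(SUM z:I. (LINT x|mu. indicator (cell a I z) x *. f x)) = (LINT x|mu. (SUM z:I. indicator (cell a I z) x *. f x))"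
  using i by simp
 also have "... = (LINT x|mu. f x)"
 proof (rule integral_cong_AE)
  show "AE x in mu. (SUM z:I. indicator (cell a I z) x *. f x) = f x" using full
  proof eventually_elim
   case (elim x)
   then obtain z where z: "z : I" "x : cell a I z" by auto
   have "(\<Sum>z'\<in>I. indicator (cell a I z') x *. f x) = (\<Sum>z'\<in>{z}. indicator (cell a I z') x *. f x)"
    using z I cell_disjoint[of _ I z a] by (intro sum.mono_neutral_right) (auto simp: indicator_def)
   thus ?case using z by simp
  qed
  show "f : bm mu" using f by (rule borel_measurable_integrable)
  show "(%x. \<Sum>z\<in>I. indicat_real (cell a I z) x *. f x) : bm mu"
   using i by (intro borel_measurable_sum borel_measurable_integrable)
 qed
 finally show ?thesis .
qed

definition barycenter :: "'a::euclidean_space measure => 'a set => 'a" where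
 "barycenter mu C = (1 / measure mu C) *. (LINT x|mu. indicator C x *. x)"

lemma L2_Cauchy_Schwarz:
 fixes X Y :: "'b => 'a::euclidean_space"
 assumes [measurable]: "X : bm P" "Y : bm P"
  and i: "integrable P (%w. (norm (X w))^2)" "integrable P (%w. (norm (Y w))^2)"
 shows "(LINT w|P. X w <.> Y w) <= sqrt (LINT w|P. (norm (X w))^2) * sqrt (LINT w|P. (norm (Y w))^2)"
proof -
 define a where "a = (LINT w|P. (norm (X w))^2)"
 define b where "b = (LINT w|P. X w <.> Y w)"
 define c where "c = (LINT w|P. (norm (Y w))^2)"
 have a0: "a >= 0" and c0: "c >= 0" unfolding a_def c_def by (rule integral_nonneg_AE, simp)+
 have q: "0 <= a - 2 * t * b + t^2 * c" for t
 proof -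
  have "0 <= (LINT w|P. (norm (X w - t *. Y w))^2)" by (rule integral_nonneg_AE) simp
  also have "... = a + (LINT w|P. (norm (t *. Y w))^2) - 2 * (LINT w|P. X w <.> (t *. Y w))"
   unfolding a_def by (rule integrable_norm_sq_diff(2)) (use i in "auto simp: power_mult_distrib")
  also have "... = a - 2 * t * b + t^2 * c" by (simp add: b_def c_def power_mult_distrib)
  finally show ?thesis .
 qed
 have "b^2 <= a * c"
 proof (cases "c = 0")
  case True
  have "b = 0"
  proof (rule ccontr)
   assume "b ~= 0"
   thus False using q[of "(a + 1) / (2 * b)"] True by simp
  qed
  thus ?thesis using True by simp
 next
  case False
  hence "c > 0" using c0 by simp
  have "0 <= a - 2 * (b / c) * b + (b / c)^2 * c" by (rule q)
  also have "... = a - b^2 / c" using `c > 0` by (simp add: power2_eq_square field_simps)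
  finally show ?thesis using `c > 0` by (simp add: field_simps)
 qed
 hence "abs b <= sqrt (a * c)" by (metis real_sqrt_abs real_sqrt_le_mono)
 thus ?thesis unfolding a_def b_def c_def by (simp add: real_sqrt_mult)
qed

definition sqint :: "'b measure => ('b => 'a::euclidean_space) => bool" where
 "sqint P X \<longleftrightarrow> X : bm P & integrable P (%w. (norm (X w))^2)"

definition l2 :: "'b measure => ('b => 'a::euclidean_space) => real" where
 "l2 P X = sqrt (LINT w|P. (norm (X w))^2)"

lemma sqint_measurable [measurable_dest]: "sqint P X ==> X : bm P" by (simp add: sqint_def)

lemma l2_nonneg [simp]: "0 <= l2 P X" by (simp add: l2_def)

lemma l2_square: "(l2 P X)^2 = (LINT w|P. (norm (X w))^2)" by (simp add: l2_def)

lemma sqint_diff: "sqint P X ==> sqint P Y ==> sqint P (%w. X w - Y w)"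
 unfolding sqint_def by (auto intro: integrable_norm_sq_diff)

lemma sqint_scale: "sqint P X ==> sqint P (%w. a *. X w)" by (auto simp: sqint_def power_mult_distrib)

lemma sqint_add:
 assumes "sqint P X" "sqint P Y" shows "sqint P (%w. X w + Y w)"
 using sqint_diff[OF assms(1) sqint_scale[OF assms(2), of "-1"]] by simp

lemma l2_scale: "l2 P (%w. a *. X w) = abs a * l2 P X" by (simp add: l2_def power_mult_distrib real_sqrt_mult)

lemma sqint_inner: "sqint P X ==> sqint P Y ==> integrable P (%w. X w <.> Y w)"
 unfolding sqint_def by (auto intro: integrable_inner_of_sq)

lemma l2_inner: "sqint P X ==> sqint P Y ==> (LINT w|P. X w <.> Y w) <= l2 P X * l2 P Y"
 unfolding sqint_def l2_def by (auto intro: L2_Cauchy_Schwarz)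

lemma l2_inner_abs:
 assumes "sqint P X" "sqint P Y" shows "abs (LINT w|P. X w <.> Y w) <= l2 P X * l2 P Y"
 using l2_inner[OF assms] l2_inner[OF sqint_scale[OF assms(1), of "-1"] assms(2)] l2_scale[of P "-1" X] by simp

lemma l2_diff_square:
 assumes "sqint P X" "sqint P Y"
 shows "(l2 P (%w. X w - Y w))^2 = (l2 P X)^2 + (l2 P Y)^2 - 2 * (LINT w|P. X w <.> Y w)"
 using assms unfolding l2_square sqint_def by (intro integrable_norm_sq_diff(2)) auto

lemma l2_diff:
 assumes "sqint P X" "sqint P Y" shows "l2 P (%w. X w - Y w) <= l2 P X + l2 P Y"
proof (rule power2_le_imp_le)
 show "(l2 P (%w. X w - Y w))^2 <= (l2 P X + l2 P Y)^2"
  unfolding l2_diff_square[OF assms] using l2_inner_abs[OF assms] by (simp add: power2_sum)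
qed simp

lemma l2_triangle:
 assumes "sqint P X" "sqint P Y" shows "l2 P (%w. X w + Y w) <= l2 P X + l2 P Y"
 using l2_diff[OF assms(1) sqint_scale[OF assms(2), of "-1"]] l2_scale[of P "-1" Y] by simp

lemma l2_mono:
 fixes X :: "'b => 'a::euclidean_space" and Y :: "'b => 'c::euclidean_space"
 assumes "X : bm P" "sqint P Y" "!!w. norm (X w) <= norm (Y w)"
 shows "sqint P X" "l2 P X <= l2 P Y"
proof -
 have le: "(norm (X w))^2 <= (norm (Y w))^2" for w using assms(3) by (intro power_mono) auto
 have Y: "integrable P (%w. (norm (Y w))^2)" using assms(2) by (simp add: sqint_def)
 have X: "integrable P (%w. (norm (X w))^2)" by (rule I_bound[OF Y]) (use assms(1) le in auto)
 thus "sqint P X" using assms(1) by (simp add: sqint_def)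
 show "l2 P X <= l2 P Y" unfolding l2_def using X Y le by (intro real_sqrt_le_mono integral_mono) auto
qed

text \<open>Averaging the dual constraint over a cell makes its barycentre an approximate
  subgradient of \<open>phi\<close> at \<open>w\<close>, with error \<open>g N w >= 0\<close>.
  Optimality of the cells for the discretised source bounds the mean of \<open>g N\<close> by that
  of \<open>(w - q N w) <.> (R w - m N (q N w))\<close>, which tends to 0. Along a subsequence the
  errors vanish almost everywhere, and the barycentres converge to the gradient.\<close>

lemma barycenter_converges:
 fixes nu mu :: "'a::euclidean_space measure" and q :: "nat => 'a => 'a"
 assumes n: "nice Om nu" and n': "nice Om' mu" and b: "brenier Om nu mu R phi psi"
  and q: "!!N. simple_function borel (q N)" "!!w. (%N. q N w) ----> w" "!!N w. norm (q N w) <= 2 * norm w"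
  and pa: "!!N z. z : atoms nu (q N) ==> measure mu (cell (a N) (atoms nu (q N)) z) = measure nu (q N -` {z})"
  and full: "!!N. AE x in mu. x : (\<Union>z\<in>atoms nu (q N). cell (a N) (atoms nu (q N)) z)"
  and m: "!!N z. m N z = barycenter mu (cell (a N) (atoms nu (q N)) z)"
 shows "EX r. strict_mono (r :: nat => nat) & (AE w in nu. (%k. m (r k) (q (r k) w)) ----> R w)"
proof -
 interpret N: prob_space nu using n by (rule nice_prob)
 interpret M: prob_space mu using n' by (rule nice_prob)
 note [measurable_cong] = nice_sets[OF n] nice_sets[OF n']
 have d: "dual_pair Om nu mu phi psi" and Rm [measurable]: "R : BM" and eq: "distr nu borel R = mu"
  using b by (auto simp: brenier_def)
 have iphi: "integrable nu phi" and ipsi: "integrable mu psi" and aed: "AE x in mu. ALL z:Om. z <.> x <= phi z + psi x"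
  using d by (auto simp: dual_pair_def)
 have [measurable]: "phi : BM" "psi : BM"
  using borel_measurable_integrable[OF iphi] borel_measurable_integrable[OF ipsi]
  by (simp_all add: measurable_cong_sets[OF nice_sets[OF n] refl] measurable_cong_sets[OF nice_sets[OF n'] refl])
 have ixm: "integrable mu (%x. x)" by (rule integrable_norm_of_sq) (use niceD[OF n'] M.finite_measure_axioms in auto)
 have sqR: "integrable nu (%w. (norm (R w))^2)" by (rule integrable_sq_distr) (use nice_sq[OF n'] eq in auto)
 define K where "K = (LINT x|mu. (norm x)^2)"
 have KR: "(LINT w|nu. (norm (R w))^2) = K" unfolding K_def eq[symmetric] by (simp add: integral_distr)
 define e where "e N = (LINT w|nu. (norm (w - q N w))^2)" for N
 define I where "I N = atoms nu (q N)" for N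
 define p where "p N z = measure nu (q N -` {z})" for N z
 define C where "C N z = cell (a N) (I N) z" for N z
 have finI: "finite (I N)" for N unfolding I_def by (rule finite_atoms) (use N.prob_space_axioms nice_sets[OF n] q in auto)
 have [measurable]: "C N z : sets borel" for N z unfolding C_def using open_cell[OF finI] by auto
 have p0: "p N z > 0" if "z : I N" for N z using that by (simp add: I_def atoms_def p_def)
 have pC: "measure mu (C N z) = p N z" if "z : I N" for N z using pa[of z N] that by (simp add: I_def C_def p_def)
 have [measurable]: "q N : BM" for N using q(1) by (rule borel_measurable_simple_function)
 note at = simple_function_atoms[OF N.prob_space_axioms nice_sets[OF n] q(1), folded I_def p_def]
 have cells: "(SUM z:I N. (LINT x|mu. indicator (C N z) x *. f x)) = (LINT x|mu. f x)" if "integrable mu f"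
  for f :: "'a => real" and N
  unfolding C_def by (rule integral_cells[OF finI _ nice_sets[OF n'] that]) (use full[of N] in "simp add: I_def")
 have ind: "integrable mu (%x. indicator (C N z) x *. f x)" if "integrable mu f" for f :: "'a => 'c::{banach,second_countable_topology}" and N z
  by (rule integrable_mult_indicator[OF _ that]) (simp add: nice_sets[OF n'])
 have iC: "integrable mu (%x. indicat_real (C N z) x)" for N z
  by (rule M.integrable_const_bound[of _ 1]) (auto split: split_indicator)
 have mz: "(LINT x|mu. indicator (C N z) x *. x) = p N z *. m N z" if "z : I N" for N z
  using p0[OF that] pC[OF that] by (simp add: m barycenter_def C_def I_def)
 have inn: "(LINT x|mu. indicator (C N z) x *. (y <.> x)) = p N z * (y <.> m N z)" if "z : I N" for N z y
 proof -
  have "(LINT x|mu. indicator (C N z) x *. (y <.> x)) = (LINT x|mu. y <.> (indicator (C N z) x *. x))" by simp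
  also have "... = y <.> (LINT x|mu. indicator (C N z) x *. x)"
   by (rule integral_inner_right) (use ind[OF ixm] in auto)
  finally show ?thesis using mz[OF that] by simp
 qed
 have iyx: "integrable mu (%x. y <.> x)" for y using ixm by simp
 define c where "c N z = (LINT x|mu. indicator (C N z) x *. psi x) / p N z" for N z
 define g where "g N w = phi w + c N (q N w) - w <.> m N (q N w)" for N w
 have sub: "z' <.> m N z - c N z <= phi z'" if z: "z : I N" and z': "z' : Om" for N z z'
 proof -
  have "(LINT x|mu. indicator (C N z) x *. (z' <.> x) - indicator (C N z) x *. psi x) <= (LINT x|mu. phi z' * indicator (C N z) x)"
  proof (rule integral_mono_AE)
   show "AE x in mu. indicator (C N z) x *. (z' <.> x) - indicator (C N z) x *. psi x <= phi z' * indicator (C N z) x"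
    using aed
   proof eventually_elim
    case (elim x)
    have "z' <.> x <= phi z' + psi x" using elim z' by blast
    thus ?case by (auto split: split_indicator)
   qed
  qed (use ind[OF iyx, of N z z'] ind[OF ipsi, of N z] iC in auto)
  hence "p N z * (z' <.> m N z) - p N z * c N z <= phi z' * p N z"
   using inn[OF z, of z'] ind[OF iyx, of N z z'] ind[OF ipsi, of N z] pC[OF z] p0[OF z] by (simp add: c_def)
  hence "p N z * (z' <.> m N z - c N z) <= p N z * phi z'" by (simp add: algebra_simps)
  thus ?thesis using p0[OF z] by simp
 qed
 have g_sub: "AE w in nu. w : Om & (ALL z':Om. phi z' >= phi w + m N (q N w) <.> (z' - w) - g N w)" for N
  using nice_AE[OF n] at(2)[of N]
 proof eventually_elim
  case (elim w)
  thus ?case using sub[OF elim(2)] by (auto simp: g_def inner_diff_right inner_commute algebra_simps)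
 qed
 have g0: "AE w in nu. 0 <= g N w" for N using g_sub[of N] by eventually_elim (auto dest: bspec)
 have mm [measurable]: "(%w. m N (q N w)) : BM" for N
  using borel_measurable_simple_function[OF simple_function_compose1[OF q(1)]] .
 have cm [measurable]: "(%w. c N (q N w)) : BM" for N
  using borel_measurable_simple_function[OF simple_function_compose1[OF q(1)]] .
 have sqm: "integrable nu (%w. (norm (m N (q N w)))^2)" for N by (rule at(3)[of "%z. (norm (m N z))^2" N])
 have iwm: "integrable nu (%w. w <.> m N (q N w))" for N
  by (rule integrable_inner_of_sq) (use sqm nice_sq[OF n] in auto)
 have ig: "integrable nu (g N)" for N unfolding g_def using iphi iwm at(3)[of "c N" N] by simp
 have sqq: "integrable nu (%w. (norm (q N w))^2)" for N by (rule at(3)[of "%z. (norm z)^2" N])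
 have int_m: "(LINT w|nu. (norm (m N (q N w)))^2) <= K" for N
 proof -
  have "p N z * (norm (m N z))^2 <= (LINT x|mu. indicator (C N z) x *. (norm x)^2)" if z: "z : I N" for z
  proof -
   have "0 <= (LINT x|mu. indicator (C N z) x *. (norm x)^2 - 2 * (indicator (C N z) x *. (m N z <.> x)) + (norm (m N z))^2 * indicator (C N z) x)"
   proof (rule integral_nonneg_AE, rule AE_I2)
    fix x
    have "0 <= (norm (x - m N z))^2" by simp
    hence "0 <= (norm x)^2 - 2 * (m N z <.> x) + (norm (m N z))^2"
     unfolding power2_norm_eq_inner by (simp add: inner_diff_left inner_diff_right inner_commute)
    thus "0 <= indicator (C N z) x *. (norm x)^2 - 2 * (indicator (C N z) x *. (m N z <.> x)) + (norm (m N z))^2 * indicator (C N z) x"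
     by (auto split: split_indicator)
   qed
   also have "... = (LINT x|mu. indicator (C N z) x *. (norm x)^2) - 2 * (p N z * (m N z <.> m N z)) + (norm (m N z))^2 * p N z"
    using ind[OF nice_sq[OF n'], of N z] ind[OF iyx, of N z "m N z"] iC[of N z] inn[OF z, of "m N z"] pC[OF z] by simp
   finally show ?thesis by (simp add: power2_norm_eq_inner algebra_simps)
  qed
  hence "(SUM z:I N. p N z *. (norm (m N z))^2) <= (SUM z:I N. (LINT x|mu. indicator (C N z) x *. (norm x)^2))"
   by (intro sum_mono) simp
  thus ?thesis unfolding at(4)[of "%z. (norm (m N z))^2" N] cells[OF nice_sq[OF n']] K_def .
 qed
 have int_g: "(LINT w|nu. g N w) <= (LINT w|nu. (w - q N w) <.> (R w - m N (q N w)))" for N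
 proof -
  have sumc: "(LINT w|nu. c N (q N w)) = (LINT x|mu. psi x)"
  proof -
   have "(LINT w|nu. c N (q N w)) = (SUM z:I N. (LINT x|mu. indicator (C N z) x *. psi x))"
    unfolding at(4)[of "c N" N] by (rule sum.cong) (use p0 in "force simp: c_def")+
   thus ?thesis using cells[OF ipsi] by simp
  qed
  \<comment> \<open>Almost everywhere this is the maximum of the affine functions
    \<open>z <.> x - a N z\<close>. At \<open>R w\<close> it dominates the one indexed by
    \<open>q N w\<close>, and its integral is the value attained by the cells.\<close>
  define Mx where "Mx x = (SUM z:I N. indicator (C N z) x *. (z <.> x) - a N z * indicator (C N z) x)" for x
  have [measurable]: "Mx : BM" unfolding Mx_def by measurable
  have iMx: "integrable mu Mx" unfolding Mx_def
   by (intro Bochner_Integration.integrable_sum Bochner_Integration.integrable_diff ind[OF iyx] integrable_mult_right iC)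
  have intMx: "(LINT x|mu. Mx x) = (SUM z:I N. p N z * (z <.> m N z) - a N z * p N z)"
  proof -
   have "(LINT x|mu. Mx x) = (SUM z:I N. (LINT x|mu. indicator (C N z) x *. (z <.> x) - a N z * indicator (C N z) x))"
    unfolding Mx_def by (rule Bochner_Integration.integral_sum)
     (intro Bochner_Integration.integrable_diff ind[OF iyx] integrable_mult_right iC)
   also have "... = (SUM z:I N. p N z * (z <.> m N z) - a N z * p N z)"
   proof (rule sum.cong)
    fix z assume z: "z : I N"
    show "(LINT x|mu. indicator (C N z) x *. (z <.> x) - a N z * indicator (C N z) x) = p N z * (z <.> m N z) - a N z * p N z"
     using ind[OF iyx, of N z z] iC[of N z] inn[OF z, of z] pC[OF z] by simp
   qed simp
   finally show ?thesis .
  qed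
  have iRq: "integrable nu (%w. q N w <.> R w)" by (rule integrable_inner_of_sq) (use sqq sqR in auto)
  have iMR: "integrable nu (%w. Mx (R w))" using iMx unfolding eq[symmetric] by (simp add: integrable_distr_eq)
  have "(LINT w|nu. q N w <.> R w - a N (q N w)) <= (LINT w|nu. Mx (R w))"
  proof (rule integral_mono_AE)
   have "AE x in distr nu borel R. x : (\<Union>z\<in>I N. C N z)" unfolding eq using full[of N] by (simp add: I_def C_def)
   hence "AE w in nu. R w : (\<Union>z\<in>I N. C N z)" by (rule AE_distrD[rotated]) simp
   thus "AE w in nu. q N w <.> R w - a N (q N w) <= Mx (R w)" using at(2)[of N]
   proof eventually_elim
    case (elim w)
    then obtain k where k: "k : I N" "R w : C N k" by auto
    have "Mx (R w) = (SUM z:{k}. indicator (C N z) (R w) *. (z <.> R w) - a N z * indicator (C N z) (R w))"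
     unfolding Mx_def using k finI[of N] cell_disjoint[of _ "I N" k "a N"]
     by (intro sum.mono_neutral_right) (auto simp: indicator_def C_def)
    hence "Mx (R w) = k <.> R w - a N k" using k by simp
    moreover have "q N w <.> R w - a N (q N w) <= k <.> R w - a N k"
     using k elim(2) by (cases "q N w = k") (auto simp: C_def cell_def inner_commute[of "R w"] less_imp_le)
    ultimately show ?case by simp
   qed
  qed (use iRq at(3)[of "a N" N] iMR in auto)
  also have "(LINT w|nu. Mx (R w)) = (LINT x|mu. Mx x)" unfolding eq[symmetric] by (simp add: integral_distr)
  also note intMx
  finally have "(LINT w|nu. q N w <.> R w) <= (SUM z:I N. p N z * (z <.> m N z))"
   using iRq at(3)[of "a N" N] at(4)[of "a N" N] by (simp add: sum_subtractf mult.commute)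
  also have "... = (LINT w|nu. q N w <.> m N (q N w))" using at(4)[of "%z. z <.> m N z" N] by simp
  finally have 1: "(LINT w|nu. q N w <.> R w) <= (LINT w|nu. q N w <.> m N (q N w))" .
  have iwR: "integrable nu (%w. w <.> R w)" by (rule integrable_inner_of_sq) (use nice_sq[OF n] sqR in auto)
  have iqm: "integrable nu (%w. q N w <.> m N (q N w))" by (rule at(3)[of "%z. z <.> m N z" N])
  have "(LINT w|nu. g N w) = (LINT w|nu. w <.> R w) - (LINT w|nu. w <.> m N (q N w))"
   unfolding g_def using iphi iwm at(3)[of "c N" N] sumc brenier_value[OF b nice_sets[OF n]] by simp
  also have "... <= (LINT w|nu. w <.> R w) - (LINT w|nu. w <.> m N (q N w)) - (LINT w|nu. q N w <.> R w) + (LINT w|nu. q N w <.> m N (q N w))"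
   using 1 by simp
  also have "... = (LINT w|nu. (w - q N w) <.> (R w - m N (q N w)))"
   unfolding inner_diff_left inner_diff_right using iwR iwm iRq iqm by simp
  finally show ?thesis .
 qed
 have bound: "(LINT w|nu. g N w) <= sqrt (e N) * (2 * sqrt K)" for N
 proof -
  have q: "sqint nu (%w. w)" "sqint nu (q N)" "sqint nu R" "sqint nu (%w. m N (q N w))"
   using nice_sq[OF n] sqq sqR sqm by (auto simp: sqint_def)
  have "l2 nu R = sqrt K" "l2 nu (%w. m N (q N w)) <= sqrt K" using KR int_m[of N] by (auto simp: l2_def)
  hence "l2 nu (%w. R w - m N (q N w)) <= 2 * sqrt K" using l2_diff[OF q(3,4)] by simp
  hence "l2 nu (%w. w - q N w) * l2 nu (%w. R w - m N (q N w)) <= l2 nu (%w. w - q N w) * (2 * sqrt K)"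
   by (intro mult_left_mono) auto
  with int_g[of N] l2_inner[OF sqint_diff[OF q(1,2)] sqint_diff[OF q(3,4)]] show ?thesis by (simp add: e_def l2_def)
 qed
 have e_lim: "e ----> 0"
 proof -
  have "(%N. (LINT w|nu. (norm (w - q N w))^2)) ----> (LINT w|nu. 0)"
  proof (rule integral_dominated_convergence[where w = "%w. 9 * (norm w)^2"])
   show "AE w in nu. (%N. (norm (w - q N w))^2) ----> 0" by (auto intro!: AE_I2 tendsto_eq_intros q(2))
   show "AE w in nu. norm ((norm (w - q N w))^2) <= 9 * (norm w)^2" for N
   proof (rule AE_I2)
    fix w
    have "norm (w - q N w) <= 3 * norm w" using norm_triangle_ineq4[of w "q N w"] q(3)[of N w] by linarith
    hence "(norm (w - q N w))^2 <= (3 * norm w)^2" by (intro power_mono) auto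
    thus "norm ((norm (w - q N w))^2) <= 9 * (norm w)^2" by (simp add: power_mult_distrib)
   qed
  qed (use nice_sq[OF n] in auto)
  thus ?thesis by (simp add: e_def[abs_def])
 qed
 have "(%N. (LINT w|nu. norm (g N w))) ----> 0"
 proof (rule tendsto_sandwich[OF _ _ tendsto_const])
  show "(%N. sqrt (e N) * (2 * sqrt K)) ----> 0"
   by (rule tendsto_mult_left_zero) (use tendsto_real_sqrt[OF e_lim] in simp)
  have "(LINT w|nu. norm (g N w)) = (LINT w|nu. g N w)" for N using borel_measurable_integrable[OF ig[of N]]
   by (intro integral_cong_AE) (use g0[of N] in "auto elim: eventually_mono")
  thus "\<forall>\<^sub>F N in sequentially. (LINT w|nu. norm (g N w)) <= sqrt (e N) * (2 * sqrt K)" using bound by simp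
 qed simp
 from tendsto_L1_AE_subseq[OF ig this] obtain r where r: "strict_mono r" "AE w in nu. (%k. g (r k) w) ----> 0" by blast
 have "AE w in nu. ALL N. w : Om & (ALL z':Om. phi z' >= phi w + m N (q N w) <.> (z' - w) - g N w)"
  by (subst AE_all_countable) (use g_sub in auto)
 with r(2) brenier_subgradient[OF n b] have "AE w in nu. (%k. m (r k) (q (r k) w)) ----> R w"
 proof eventually_elim
  case (elim w)
  show ?case
  proof (rule LIMSEQ_I)
   fix eps :: real assume "eps > 0"
   hence "eps / 2 > 0" by simp
   with elim obtain eta where eta: "eta > 0" "!!x. (ALL z':Om. phi z' >= phi w + x <.> (z' - w) - eta) ==> norm (x - R w) <= eps / 2"
    using approximate_subgradient_close[OF nice_open[OF n], of w phi "R w" "eps / 2"] by blast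
   have "\<forall>\<^sub>F k in sequentially. g (r k) w < eta" using elim(1) eta(1) by (rule order_tendstoD(2))
   hence "\<forall>\<^sub>F k in sequentially. norm (m (r k) (q (r k) w) - R w) < eps"
   proof eventually_elim
    case k: (elim k)
    have "norm (m (r k) (q (r k) w) - R w) <= eps / 2"
    proof (rule eta(2), intro ballI)
     fix z' assume "z' : Om"
     hence "phi z' >= phi w + m (r k) (q (r k) w) <.> (z' - w) - g (r k) w" using elim(3) by blast
     thus "phi z' >= phi w + m (r k) (q (r k) w) <.> (z' - w) - eta" using k by simp
    qed
    thus ?case using `eps > 0` by simp
   qed
   thus "EX no. ALL k>=no. norm (m (r k) (q (r k) w) - R w) < eps" by (simp add: eventually_sequentially)
  qed
 qed
 with r(1) show ?thesis by blast
qed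

text \<open>The two targets are coupled through the common source \<open>nu\<close>. This coupling
  need not be optimal between them, so the bound is stronger than a transport-entropy inequality for
  the Wasserstein distance. It holds for every discretisation of the source by
  \<open>cells_barycenter_bound\<close>, and Fatou's lemma passes to the limit.\<close>

theorem brenier_gap_bound:
 fixes nu mu :: "'a::euclidean_space measure" and h rho :: "'a => real"
 assumes n: "nice Om nu" and w: "slc_weight ka rho" and k: "ka > 0" and mu: "mu = dens rho" and n': "nice Om' mu"
  and h: "h : BM" and lo: "0 < lo" "!!x. lo <= h x" and hi: "!!x. h x <= hi" and h1: "(LINT x|mu. h x) = 1"
  and R: "brenier Om nu mu R phi psi" and S: "brenier Om nu (density mu (%x. ennreal (h x))) S phi' psi'"
 shows "(LINT z|nu. (norm (R z - S z))^2) <= 2 / ka * (LINT x|mu. h x * ln (h x))"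
proof -
 define eta where "eta = density mu (%x. ennreal (h x))"
 have nE: "nice Om' eta" unfolding eta_def by (rule nice_density[OF n' h lo hi h1])
 interpret N: prob_space nu using n by (rule nice_prob)
 interpret M: prob_space mu using n' by (rule nice_prob)
 note [measurable_cong] = nice_sets[OF n] nice_sets[OF n'] nice_sets[OF nE]
 have [measurable]: "R : BM" "S : BM" using R S by (auto simp: brenier_def)
 obtain q :: "nat => 'a => 'a" where q: "!!N. simple_function borel (q N)" "!!w. (%N. q N w) ----> w"
  "!!N w. norm (q N w) <= 2 * norm w"
  using borel_measurable_implies_sequence_metric[of "%x::'a. x" borel 0] by (auto simp: dist_norm)
 let ?I = "%N. atoms nu (q N)"
 have "EX a. (ALL z:?I N. measure mu (cell a (?I N) z) = measure nu (q N -` {z})) & (AE x in mu. x : (\<Union>z\<in>?I N. cell a (?I N) z))" for N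
  by (rule semidiscrete[OF n' N.prob_space_axioms nice_sets[OF n] q(1), of "?I N"]) (auto simp: atoms_def)
 then obtain a where a: "!!N z. z : ?I N ==> measure mu (cell (a N) (?I N) z) = measure nu (q N -` {z})"
  "!!N. AE x in mu. x : (\<Union>z\<in>?I N. cell (a N) (?I N) z)" by metis
 have "EX a. (ALL z:?I N. measure eta (cell a (?I N) z) = measure nu (q N -` {z})) & (AE x in eta. x : (\<Union>z\<in>?I N. cell a (?I N) z))" for N
  by (rule semidiscrete[OF nE N.prob_space_axioms nice_sets[OF n] q(1), of "?I N"]) (auto simp: atoms_def)
 then obtain b where b: "!!N z. z : ?I N ==> measure eta (cell (b N) (?I N) z) = measure nu (q N -` {z})"
  "!!N. AE x in eta. x : (\<Union>z\<in>?I N. cell (b N) (?I N) z)" by metis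
 define m where "m N z = barycenter mu (cell (a N) (?I N) z)" for N z
 define m' where "m' N z = barycenter eta (cell (b N) (?I N) z)" for N z
 obtain r1 where r1: "strict_mono r1" "AE w in nu. (%k. m (r1 k) (q (r1 k) w)) ----> R w"
  using barycenter_converges[OF n n' R q a m_def] by blast
 \<comment> \<open>The second subsequence is extracted from the first, so that both families of
   barycentres converge along it.\<close>
 have "EX r. strict_mono (r :: nat => nat) & (AE w in nu. (%k. m' (r1 (r k)) (q (r1 (r k)) w)) ----> S w)"
  by (rule barycenter_converges[OF n nE S[folded eta_def], of "%k. q (r1 k)" "%k. b (r1 k)" "%k. m' (r1 k)"])
    (use q b in "auto simp: m'_def intro: LIMSEQ_subseq_LIMSEQ[OF _ r1(1), unfolded o_def]")
 then obtain r2 where r2: "strict_mono r2" "AE w in nu. (%k. m' (r1 (r2 k)) (q (r1 (r2 k)) w)) ----> S w" by blast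
 define r where "r k = r1 (r2 k)" for k
 define B where "B = 2 / ka * (LINT x|mu. h x * ln (h x))"
 note at = simple_function_atoms[OF N.prob_space_axioms nice_sets[OF n] q(1)]
 have bound: "(LINT w|nu. (norm (m N (q N w) - m' N (q N w)))^2) <= B" for N
 proof -
  let ?p = "%z. measure nu (q N -` {z})"
  have "(LINT w|nu. (norm (m N (q N w) - m' N (q N w)))^2) = (SUM z:?I N. ?p z *. (norm (m N z - m' N z))^2)"
   by (rule at(4)[of "%z. (norm (m N z - m' N z))^2" N])
  also have "... = (SUM z:?I N. ?p z * (norm ((1 / ?p z) *. (LINT x|mu. indicator (cell (a N) (?I N) z) x *. x)
    - (1 / ?p z) *. (LINT x|eta. indicator (cell (b N) (?I N) z) x *. x)))^2)"
   by (rule sum.cong) (auto simp: m_def m'_def barycenter_def a b)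
  also have "... <= B" unfolding B_def
  proof (rule cells_barycenter_bound[OF w k mu M.prob_space_axioms nice_sq[OF n'] h lo hi eta_def h1, of "?I N" ?p "a N" "b N"])
   show "(SUM z:?I N. ?p z) = 1" using at(4)[of "%_. 1 :: real" N] by (simp add: N.prob_space)
  qed (use a b at(1) in "auto simp: atoms_def")
  finally show ?thesis .
 qed
 have meas [measurable]: "(%w. m N (q N w)) : BM" "(%w. m' N (q N w)) : BM" for N
  using borel_measurable_simple_function[OF simple_function_compose1[OF q(1)]] by auto
 have "AE w in nu. ennreal ((norm (R w - S w))^2) <= liminf (%k. ennreal ((norm (m (r k) (q (r k) w) - m' (r k) (q (r k) w)))^2))"
  using r1(2) r2(2)
 proof eventually_elim
  case (elim w)
  have "(%k. m (r k) (q (r k) w)) ----> R w" using LIMSEQ_subseq_LIMSEQ[OF elim(1) r2(1)] by (simp add: r_def o_def)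
  moreover have "(%k. m' (r k) (q (r k) w)) ----> S w" using elim(2) by (simp add: r_def)
  ultimately have "(%k. ennreal ((norm (m (r k) (q (r k) w) - m' (r k) (q (r k) w)))^2)) ----> ennreal ((norm (R w - S w))^2)"
   by (intro tendsto_ennrealI tendsto_intros)
  from lim_imp_Liminf[OF sequentially_bot this] show ?case by simp
 qed
 hence "(NN nu (%w. ennreal ((norm (R w - S w))^2)))
   <= (NN nu (%w. liminf (%k. ennreal ((norm (m (r k) (q (r k) w) - m' (r k) (q (r k) w)))^2))))"
  by (rule nn_integral_mono_AE)
 also have "... <= liminf (%k. (NN nu (%w. ennreal ((norm (m (r k) (q (r k) w) - m' (r k) (q (r k) w)))^2))))"
  by (rule nn_integral_liminf) measurable
 also have "... <= liminf (%k::nat. ennreal B)"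
 proof (intro Liminf_mono always_eventually allI)
  fix k
  have "(NN nu (%w. ennreal ((norm (m (r k) (q (r k) w) - m' (r k) (q (r k) w)))^2)))
   = ennreal (LINT w|nu. (norm (m (r k) (q (r k) w) - m' (r k) (q (r k) w)))^2)"
   by (rule nn_integral_eq_integral[OF at(3)[of "%z. (norm (m (r k) z - m' (r k) z))^2" "r k"]]) simp
  also have "... <= ennreal B" by (rule ennreal_leI) (rule bound)
  finally show "(NN nu (%w. ennreal ((norm (m (r k) (q (r k) w) - m' (r k) (q (r k) w)))^2))) <= ennreal B" .
 qed
 also have "... = ennreal B" by (simp add: Liminf_const)
 finally have fin: "(NN nu (%w. ennreal ((norm (R w - S w))^2))) <= ennreal B" .
 have B0: "0 <= B" using order_trans[OF _ bound[of 0]] by (simp add: integral_nonneg_AE)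
 have "integrable nu (%w. (norm (R w - S w))^2)"
  by (rule integrableI_nonneg) (use fin in "auto simp: order_le_less_trans")
 from nn_integral_eq_integral[OF this] fin have "ennreal (LINT w|nu. (norm (R w - S w))^2) <= ennreal B" by simp
 thus ?thesis using B0 by (simp add: B_def ennreal_le_iff)
qed

section \<open>Perturbing the source measure of a Brenier map\<close>

text \<open>Weak duality for the reversed problem makes the correlation of \<open>S' x\<close> and
  \<open>x\<close> at least the optimal value. So slackness holds for \<open>th\<close> and
  \<open>th'\<close> at this pair, and uniqueness of the subgradient of \<open>th\<close> at
  \<open>S' x\<close> identifies \<open>x\<close> with \<open>S (S' x)\<close>.\<close>

lemma brenier_inverse:
 fixes nu mu :: "'a::euclidean_space measure"
 assumes n: "nice Om nu" and n': "nice Om' mu" and S: "brenier Om nu mu S th th'" and S': "brenier Om' mu nu S' bet bet'"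
 shows "AE x in mu. S (S' x) = x"
proof -
 note [measurable_cong] = nice_sets[OF n] nice_sets[OF n']
 have [measurable]: "S : BM" "S' : BM" and dS: "dual_pair Om nu mu th th'" and dS': "dual_pair Om' mu nu bet bet'"
  and eq: "distr nu borel S = mu" "distr mu borel S' = nu" using S S' by (auto simp: brenier_def)
 have id: "distr nu borel (%z. z) = nu" "distr mu borel (%z. z) = mu"
  using distr_id2[OF nice_sets[OF n, symmetric]] distr_id2[OF nice_sets[OF n', symmetric]] by simp_all
 have "(LINT z|nu. z <.> S z) = (LINT z|nu. S z <.> z)" by (simp add: inner_commute)
 also have "... <= (LINT x|mu. bet x) + (LINT z|nu. bet' z)"
  by (rule dual_pair_coupling(1)[OF n' nice_sq[OF n] dS']) (use eq id in auto)
 also have "... = (LINT x|mu. x <.> S' x)" using brenier_value[OF S' nice_sets[OF n']] by simp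
 also have "... = (LINT x|mu. S' x <.> x)" by (simp add: inner_commute)
 finally have le: "(LINT z|nu. th z) + (LINT x|mu. th' x) <= (LINT x|mu. S' x <.> x)"
  using brenier_value[OF S nice_sets[OF n]] by simp
 have gap: "AE x in mu. th (S' x) + th' x = S' x <.> x"
  by (rule dual_pair_coupling(2)[OF n nice_sq[OF n'] dS _ _ _ _ le]) (use eq id in auto)
 have "AE x in mu. S' x : Om & GDERIV th (S' x) :> S (S' x) & (ALL z':Om. th z' >= th (S' x) + S (S' x) <.> (z' - S' x))"
  by (rule AE_distrD[where M' = borel and f = S'], simp, unfold eq(2), rule brenier_subgradient[OF n S])
 moreover have "AE x in mu. ALL z:Om. z <.> x <= th z + th' x" using dS by (simp add: dual_pair_def)
 ultimately show ?thesis using gap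
 proof eventually_elim
  case (elim x)
  have "x = S (S' x)"
  proof (rule subgradient_unique[OF nice_open[OF n]])
   fix z' assume "z' : Om"
   with elim show "th z' >= th (S' x) + x <.> (z' - S' x)" by (force simp: inner_diff_right inner_commute)
  qed (use elim in auto)
  thus ?case by simp
 qed
qed

text \<open>One and the same \<open>y\<close> must satisfy both bounds, so it is routed through
  \<open>mu1\<close>: first \<open>T\<close>, then the Brenier map \<open>S'\<close> from
  \<open>mu1\<close> to the tilted measure \<open>nu\<close>. \<open>brenier_gap_bound\<close> with
  source \<open>mu1\<close> and targets \<open>mu0\<close> and \<open>nu\<close> bounds
  \<open>y x - x\<close>; with source \<open>nu\<close>, and as targets \<open>mu1\<close> and the
  image of \<open>nu\<close> under \<open>T\<close>, it bounds \<open>T (y x) - T x\<close>. The map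
  \<open>S\<close> from \<open>nu\<close> to \<open>mu1\<close> and its potential \<open>th\<close>
  are kept for the rigidity argument.\<close>

theorem transport_perturbation:
 fixes mu0 mu1 :: "'a::euclidean_space measure" and h rho0 rho1 :: "'a => real"
 assumes k0: "ka0 > 0" and w0: "slc_weight ka0 rho0" and mu0: "mu0 = dens rho0" and n0: "nice Om0 mu0"
  and k1: "ka1 > 0" and w1: "slc_weight ka1 rho1" and mu1: "mu1 = dens rho1" and n1: "nice Om1 mu1"
  and T: "brenier Om0 mu0 mu1 T phi psi" and h: "h : BM" and lo: "0 < lo" "!!x. lo <= h x" and hi: "!!x. h x <= hi"
  and h1: "(LINT x|mu0. h x) = 1"
 obtains y th S where "y : BM" "distr mu0 borel y = density mu0 (%x. ennreal (h x))"
  "(LINT x|mu0. (norm (y x - x))^2) <= 2 / ka0 * (LINT x|mu0. h x * ln (h x))"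
  "(LINT x|mu0. (norm (T (y x) - T x))^2) <= 2 / ka1 * (LINT x|mu0. h x * ln (h x))"
  "convex_on Om0 th" "integrable mu0 th" "S : BM"
  "AE x in mu0. GDERIV th x :> S x" "AE x in mu0. S (y x) = T x" "integrable mu0 (%x. (norm (S x))^2)"
proof -
 note s0 [measurable_cong] = nice_sets[OF n0]
 note s1 [measurable_cong] = nice_sets[OF n1]
 note [measurable] = h
 interpret M0: prob_space mu0 using n0 by (rule nice_prob)
 interpret M1: prob_space mu1 using n1 by (rule nice_prob)
 define nu where "nu = density mu0 (%x. ennreal (h x))"
 have nnu: "nice Om0 nu" unfolding nu_def by (rule nice_density[OF n0 h lo hi h1])
 note snu [measurable_cong] = nice_sets[OF nnu]
 have h0: "h x > 0" for x using lo(1) lo(2)[of x] by simp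
 have h0': "0 <= h x" for x using h0[of x] by simp
 have AEnu: "(AE x in nu. P x) \<longleftrightarrow> (AE x in mu0. P x)" for P
  unfolding nu_def by (subst AE_density) (use h0 in auto)
 have [measurable]: "T : BM" and dT: "dual_pair Om0 mu0 mu1 phi psi"
  and Teq: "distr mu0 borel T = mu1" and Tgap: "AE z in mu0. phi z + psi (T z) = z <.> T z" using T by (auto simp: brenier_def)
 obtain S th th' where S: "brenier Om0 nu mu1 S th th'"
  using brenier_exists[OF nnu M1.prob_space_axioms s1 nice_sq[OF n1]] by blast
 obtain R al al' where R: "brenier Om1 mu1 mu0 R al al'"
  using brenier_exists[OF n1 M0.prob_space_axioms s0 nice_sq[OF n0]] by blast
 obtain S' bet bet' where S': "brenier Om1 mu1 nu S' bet bet'"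
  using brenier_exists[OF n1 nice_prob[OF nnu] snu nice_sq[OF nnu]] by blast
 have [measurable]: "S : BM" "R : BM" "S' : BM"
  and Seq: "distr nu borel S = mu1" and Req: "distr mu1 borel R = mu0" and S'eq: "distr mu1 borel S' = nu"
  using S R S' by (auto simp: brenier_def)
 have viaT: "AE x in mu0. P (T x)" if "AE x in mu1. P x" for P
  by (rule AE_distrD[where M' = borel and f = T]) (use that Teq in auto)
 have SS': "AE x in mu1. S (S' x) = x" by (rule brenier_inverse[OF nnu n1 S S'])
 have RT: "AE x in mu0. R (T x) = x" by (rule brenier_inverse[OF n1 n0 R T])
 define y where "y x = S' (T x)" for x
 have [measurable]: "y : BM" unfolding y_def by measurable
 have yeq: "distr mu0 borel y = nu"
 proof -
  have "distr mu0 borel y = distr (distr mu0 borel T) borel S'" by (subst distr_distr) (auto simp: y_def[abs_def] o_def)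
  thus ?thesis by (simp add: Teq S'eq)
 qed
 have Sy: "AE x in mu0. S (y x) = T x" using viaT[OF SS'] by (simp add: y_def)
 have b0: "(LINT x|mu0. (norm (y x - x))^2) <= 2 / ka0 * (LINT x|mu0. h x * ln (h x))"
 proof -
  have "(LINT x|mu0. (norm (y x - x))^2) = (LINT x|mu0. (norm (R (T x) - S' (T x)))^2)"
   by (rule integral_cong_AE) (use RT in "auto elim!: eventually_mono simp: y_def norm_minus_commute")
  also have "... = (LINT x|(distr mu0 borel T). (norm (R x - S' x))^2)" by (subst integral_distr) auto
  also have "... <= 2 / ka0 * (LINT x|mu0. h x * ln (h x))"
   unfolding Teq by (rule brenier_gap_bound[OF n1 w0 k0 mu0 n0 h lo hi h1 R S'[unfolded nu_def]])
  finally show ?thesis .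
 qed
 \<comment> \<open>Density with respect to \<open>mu1\<close> of the image of \<open>nu\<close>
   under \<open>T\<close>, as \<open>R\<close> inverts \<open>T\<close>. For this target
   \<open>T\<close> remains a Brenier map with unchanged potentials, and the entropy is the
   same.\<close>
 define h' where "h' x = h (R x)" for x
 have [measurable]: "h' : BM" unfolding h'_def by measurable
 define eta where "eta = density mu1 (%x. ennreal (h' x))"
 have h'T: "AE x in mu0. h' (T x) = h x" using RT by eventually_elim (simp add: h'_def)
 have pull: "(LINT x|mu1. g (h' x)) = (LINT x|mu0. g (h x))" if [measurable]: "g : BM" for g :: "real => real"
 proof -
  have "(LINT x|mu1. g (h' x)) = (LINT x|mu0. g (h' (T x)))" unfolding Teq[symmetric] by (subst integral_distr) auto
  also have "... = (LINT x|mu0. g (h x))" by (rule integral_cong_AE) (use h'T in "auto elim!: eventually_mono")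
  finally show ?thesis .
 qed
 have b1: "(LINT x|mu0. (norm (T (y x) - T x))^2) <= 2 / ka1 * (LINT x|mu0. h x * ln (h x))"
 proof -
  have Teta: "distr nu borel T = eta"
  proof -
   have "nu = density mu0 (%x. ennreal (h' (T x)))"
    unfolding nu_def by (rule density_cong) (use h'T in "auto elim!: eventually_mono")
   hence "distr nu borel T = density (distr mu0 borel T) (%x. ennreal (h' x))" by (simp add: density_distr)
   thus ?thesis by (simp add: Teq eta_def)
  qed
  have "dual_pair Om0 nu eta phi psi"
  proof -
   have i: "integrable mu0 phi" "integrable mu1 psi" and ae: "AE x in mu1. ALL z:Om0. z <.> x <= phi z + psi x"
    and c: "convex_on Om0 phi" using dT by (auto simp: dual_pair_def)
   have [measurable]: "phi : BM" "psi : BM"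
    using borel_measurable_integrable[OF i(1)] borel_measurable_integrable[OF i(2)]
    by (simp_all add: measurable_cong_sets[OF s0 refl] measurable_cong_sets[OF s1 refl])
   have h'b: "0 <= h' x" "h' x <= hi" for x using h0' hi by (auto simp: h'_def)
   have "integrable nu phi" unfolding nu_def
   proof (subst integrable_density)
    show "integrable mu0 (%x. h x *. phi x)"
    proof (rule I_bound)
     show "integrable mu0 (%x. hi * phi x)" using i by simp
     show "AE x in mu0. norm (h x *. phi x) <= norm (hi * phi x)"
     proof (rule AE_I2)
      fix x
      have "0 <= h x" "h x <= hi" using h0' hi by auto
      moreover hence "h x * abs (phi x) <= hi * abs (phi x)" by (intro mult_right_mono) auto
      ultimately show "norm (h x *. phi x) <= norm (hi * phi x)" by (simp add: abs_mult)
     qed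
    qed simp
   qed (use h0' in auto)
   moreover have "integrable eta psi" unfolding eta_def
   proof (subst integrable_density)
    show "integrable mu1 (%x. h' x *. psi x)"
    proof (rule I_bound)
     show "integrable mu1 (%x. hi * psi x)" using i by simp
     show "AE x in mu1. norm (h' x *. psi x) <= norm (hi * psi x)"
     proof (rule AE_I2)
      fix x
      have "0 <= h' x" "h' x <= hi" using h'b by auto
      moreover hence "h' x * abs (psi x) <= hi * abs (psi x)" by (intro mult_right_mono) auto
      ultimately show "norm (h' x *. psi x) <= norm (hi * psi x)" by (simp add: abs_mult)
     qed
    qed simp
   qed (use h'b in auto)
   moreover have "AE x in eta. ALL z:Om0. z <.> x <= phi z + psi x"
    unfolding eta_def by (subst AE_density) (use ae in "auto elim!: eventually_mono")
   ultimately show ?thesis using c by (simp add: dual_pair_def)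
  qed
  hence bT: "brenier Om0 nu (density mu1 (%x. ennreal (h' x))) T phi psi"
   using Teta Tgap by (simp add: brenier_def AEnu eta_def)
  have "(LINT x|mu0. (norm (T (y x) - T x))^2) = (LINT x|mu0. (norm (S (y x) - T (y x)))^2)"
   by (rule integral_cong_AE) (use Sy in "auto elim!: eventually_mono simp: norm_minus_commute")
  also have "... = (LINT x|(distr mu0 borel y). (norm (S x - T x))^2)" by (subst integral_distr) auto
  also have "... <= 2 / ka1 * (LINT x|mu1. h' x * ln (h' x))" unfolding yeq
   by (rule brenier_gap_bound[OF nnu w1 k1 mu1 n1 _ lo(1) _ _ _ S bT]) (use lo hi h1 pull[of "%x. x"] in "auto simp: h'_def")
  also have "(LINT x|mu1. h' x * ln (h' x)) = (LINT x|mu0. h x * ln (h x))" by (rule pull) simp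
  finally show ?thesis .
 qed
 have dS: "convex_on Om0 th" "integrable nu th" using S by (auto simp: brenier_def dual_pair_def)
 have [measurable]: "th : BM"
  using borel_measurable_integrable[OF dS(2)] by (simp add: measurable_cong_sets[OF snu refl])
 have intnu: "integrable mu0 f" if "integrable nu f" and [measurable]: "f : BM" for f :: "'a => real"
 proof (rule I_bound)
  have "integrable mu0 (%x. h x *. f x)" using that(1) unfolding nu_def by (subst (asm) integrable_density) (use h0' in auto)
  thus "integrable mu0 (%x. (1 / lo) * (h x * f x))" by simp
  show "AE x in mu0. norm (f x) <= norm ((1 / lo) * (h x * f x))"
  proof (rule AE_I2)
   fix x
   have "lo * abs (f x) <= h x * abs (f x)" using lo by (intro mult_right_mono) auto
   thus "norm (f x) <= norm ((1 / lo) * (h x * f x))" using lo(1) h0'[of x] by (simp add: abs_mult field_simps)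
  qed
 qed simp
 show thesis
 proof (rule that[of y th S])
  show "integrable mu0 th" by (rule intnu[OF dS(2)]) simp
  show "AE x in mu0. GDERIV th x :> S x" using brenier_subgradient[OF nnu S] unfolding AEnu by eventually_elim simp
  have "integrable nu (%x. (norm (S x))^2)" by (rule integrable_sq_distr) (use nice_sq[OF n1] Seq in auto)
  thus "integrable mu0 (%x. (norm (S x))^2)" by (rule intnu) simp
 qed (use yeq b0 b1 dS Sy in "auto simp: nu_def")
qed

section \<open>Test functions, entropy expansion and densities close to 1\<close>

lemma compact_support_derivative_lipschitz:
 fixes u :: "'a::euclidean_space => real"
 assumes diff: "!!x. u differentiable (at x)" and cont: "!!v. continuous_on UNIV (%x. frechet_derivative u (at x) v)"
  and K: "compact K" "!!x. x ~: K ==> u x = 0"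
 shows "(ALL x. x ~: K --> frechet_derivative u (at x) v = 0)" and "EX B>=0. ALL x y. abs (u x - u y) <= B * norm (x - y)"
proof -
 have der: "(u has_derivative frechet_derivative u (at x)) (at x)" for x using diff frechet_derivative_works by blast
 have zero: "frechet_derivative u (at x) v = 0" if "x ~: K" for x v
 proof -
  have "open (- K)" using compact_imp_closed[OF K(1)] by auto
  have "((%_. 0) has_derivative (%_. 0)) (at x)" by simp
  hence "(u has_derivative (%_. 0)) (at x)"
   by (rule has_derivative_transform_within_open[OF _ `open (- K)`]) (use that K in auto)
  hence "frechet_derivative u (at x) = (%_. 0)" using frechet_derivative_at by metis
  thus ?thesis by simp
 qed
 thus "ALL x. x ~: K --> frechet_derivative u (at x) v = 0" by blast
 have "EX M. ALL x. abs (frechet_derivative u (at x) v) <= M" for v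
 proof -
  have "compact ((%x. frechet_derivative u (at x) v) ` K)"
   by (rule compact_continuous_image[OF continuous_on_subset[OF cont] K(1)]) auto
  hence "bounded ((%x. frechet_derivative u (at x) v) ` K)" by (rule compact_imp_bounded)
  then obtain M where M: "!!x. x : K ==> abs (frechet_derivative u (at x) v) <= M" unfolding bounded_iff by auto
  have "abs (frechet_derivative u (at x) v) <= max M 0" for x
  proof (cases "x : K")
   case True
   show ?thesis using M[OF True] by simp
  qed (simp add: zero)
  thus ?thesis by blast
 qed
 hence "ALL v. EX M. ALL x. abs (frechet_derivative u (at x) v) <= M" by blast
 from choice[OF this] obtain M where M: "!!v x. abs (frechet_derivative u (at x) v) <= M v" by blast
 define B where "B = (SUM b:Basis. M b)"
 have M0: "M v >= 0" for v using M[of 0 v] abs_ge_zero order_trans by blast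
 have B0: "B >= 0" unfolding B_def by (intro sum_nonneg M0)
 have "onorm (frechet_derivative u (at x)) <= B" for x
 proof (rule onorm_bound[OF B0])
  fix v
  interpret bounded_linear "frechet_derivative u (at x)" using der has_derivative_bounded_linear by blast
  have "frechet_derivative u (at x) v = frechet_derivative u (at x) (SUM b:Basis. (v <.> b) *. b)" by (simp add: euclidean_representation)
  also have "... = (SUM b:Basis. (v <.> b) * frechet_derivative u (at x) b)" by (simp add: sum scaleR)
  finally have "norm (frechet_derivative u (at x) v) <= (SUM b:Basis. norm ((v <.> b) * frechet_derivative u (at x) b))"
   by (simp add: sum_norm_le)
  also have "... <= (SUM b:Basis. norm v * M b)"
   by (intro sum_mono) (auto simp: abs_mult intro!: mult_mono Basis_le_norm M)
  finally show "norm (frechet_derivative u (at x) v) <= B * norm v" by (simp add: B_def sum_distrib_left mult.commute)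
 qed
 hence "norm (u x - u y) <= B * norm (x - y)" for x y
  by (intro differentiable_bound[of UNIV u "%x. frechet_derivative u (at x)"]) (use der in auto)
 thus "EX B>=0. ALL x y. abs (u x - u y) <= B * norm (x - y)" using B0 by auto
qed

lemma gradient_eqI: "GDERIV f x :> D ==> gradient f x = D" unfolding gradient_def
proof (rule the_equality)
 fix D' assume "GDERIV f x :> D" "GDERIV f x :> D'"
 hence "(%h. h <.> D') = (%h. h <.> D)" unfolding gderiv_def using has_derivative_unique by blast
 hence "(D' - D) <.> (D' - D) = 0" by (metis inner_diff_right right_minus_eq)
 thus "D' = D" by simp
qed

definition tame :: "('a::euclidean_space => real) => real => real => bool" where
 "tame f K L \<longleftrightarrow> 0 <= K & 0 <= L & (ALL x. abs (f x) <= K & norm (gradient f x) <= K & GDERIV f x :> gradient f x) &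
  (ALL x y. norm (gradient f x - gradient f y) <= L * norm (x - y) &
   abs (f y - f x - gradient f x <.> (y - x)) <= L * (norm (y - x))^2) & f : BM & gradient f : BM"

lemma tameD:
 assumes "tame f K L"
 shows "0 <= K" "0 <= L" "abs (f x) <= K" "norm (gradient f x) <= K" "GDERIV f x :> gradient f x"
  "norm (gradient f x - gradient f y) <= L * norm (x - y)"
  "abs (f y - f x - gradient f x <.> (y - x)) <= L * (norm (y - x))^2"
  "f : BM" "gradient f : BM" using assms by (auto simp: tame_def)

lemma test_function_tame:
 fixes f :: "'a::euclidean_space => real"
 assumes "test_function f" shows "EX K L. tame f K L"
proof -
 define C where "C = closure {x. f x ~= 0}"
 have C: "compact C" "!!x. x ~: C ==> f x = 0"
  using assms closure_subset[of "{x. f x ~= 0}"] unfolding test_function_def C_def by blast+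
 have ck: "Ck k f" for k using assms by (simp add: test_function_def)
 have diff: "f differentiable (at x)" for x using ck[of 1] by simp
 have ck': "Ck k (%x. frechet_derivative f (at x) v)" for k v using ck[of "Suc k"] by simp
 have diff': "(%x. frechet_derivative f (at x) v) differentiable (at x)" for v x using ck'[of 1 v] by simp
 have cont': "continuous_on UNIV (%x. frechet_derivative f (at x) v)" for v using ck'[of 0 v] by simp
 have cont'': "continuous_on UNIV (%x. frechet_derivative (%x. frechet_derivative f (at x) v) (at x) w)" for v w
  using ck'[of 1 v] by simp
 note z1 = compact_support_derivative_lipschitz(1)[OF diff cont' C]
 define g where "g x = (SUM b:Basis. frechet_derivative f (at x) b *. b)" for x
 have gd: "GDERIV f x :> g x" for x
 proof -
  have der: "(f has_derivative frechet_derivative f (at x)) (at x)" using diff frechet_derivative_works by blast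
  interpret bounded_linear "frechet_derivative f (at x)" using der has_derivative_bounded_linear by blast
  have "frechet_derivative f (at x) v = v <.> g x" for v
  proof -
   have "frechet_derivative f (at x) v = frechet_derivative f (at x) (SUM b:Basis. (v <.> b) *. b)" by (simp add: euclidean_representation)
   also have "... = (SUM b:Basis. (v <.> b) * frechet_derivative f (at x) b)" by (simp add: sum scaleR)
   also have "... = v <.> g x" by (simp add: g_def inner_sum_right mult.commute)
   finally show ?thesis .
  qed
  hence "frechet_derivative f (at x) = (%v. v <.> g x)" by blast
  thus ?thesis using der by (simp add: gderiv_def)
 qed
 have grad: "gradient f = g" using gradient_eqI[OF gd] by blast
 have "ALL b. EX B>=0. ALL x y. abs (frechet_derivative f (at x) b - frechet_derivative f (at y) b) <= B * norm (x - y)"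
  by (intro allI compact_support_derivative_lipschitz(2)[OF diff' cont'' C(1)]) (use z1 in auto)
 then obtain B where B: "!!b. B b >= 0" "!!b x y. abs (frechet_derivative f (at x) b - frechet_derivative f (at y) b) <= B b * norm (x - y)"
  by metis
 define L where "L = (SUM b:(Basis::'a set). B b)"
 have L0: "L >= 0" unfolding L_def by (intro sum_nonneg B)
 have lip: "norm (g x - g y) <= L * norm (x - y)" for x y
 proof -
  have "g x - g y = (SUM b:Basis. (frechet_derivative f (at x) b - frechet_derivative f (at y) b) *. b)"
   by (simp add: g_def sum_subtractf scaleR_diff_left)
  hence "norm (g x - g y) <= (SUM b:Basis. norm ((frechet_derivative f (at x) b - frechet_derivative f (at y) b) *. b))"
   by (simp add: sum_norm_le)
  also have "... <= (SUM b:Basis. B b * norm (x - y))" by (intro sum_mono) (use B(2) in auto)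
  finally show ?thesis by (simp add: L_def sum_distrib_right)
 qed
 have contg: "continuous_on UNIV g" unfolding g_def by (intro continuous_intros cont')
 have contf: "continuous_on UNIV f" using diff differentiable_imp_continuous_within by (metis continuous_at_imp_continuous_on)
 have bnd: "EX M. ALL x. norm (u x) <= M" if "continuous_on UNIV u" "!!x. x ~: C ==> u x = 0" for u :: "'a => 'b::real_normed_vector"
 proof -
  have "compact (u ` C)" by (rule compact_continuous_image[OF continuous_on_subset[OF that(1)] C(1)]) auto
  hence "bounded (u ` C)" by (rule compact_imp_bounded)
  then obtain M where M: "!!x. x : C ==> norm (u x) <= M" unfolding bounded_iff by auto
  have "norm (u x) <= max M 0" for x
  proof (cases "x : C")
   case True
   show ?thesis using M[OF True] by simp
  qed (simp add: that)
  thus ?thesis by blast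
 qed
 obtain M1 where M1: "!!x. norm (f x) <= M1" using bnd[OF contf C(2)] by blast
 obtain M2 where M2: "!!x. norm (g x) <= M2" using bnd[OF contg] z1 by (force simp: g_def)
 have taylor: "abs (f y - f x - g x <.> (y - x)) <= L * (norm (y - x))^2" for x y
 proof -
  have "norm ((f y - g x <.> y) - (f x - g x <.> x)) <= (L * norm (y - x)) * norm (y - x)"
  proof (rule differentiable_bound[of "closed_segment x y" "%w. f w - g x <.> w" "%w v. v <.> g w - g x <.> v"])
   fix w assume w: "w : closed_segment x y"
   have "((%w. f w - g x <.> w) has_derivative (%v. v <.> g w - g x <.> v)) (at w)"
    using gd[of w] unfolding gderiv_def by (auto intro!: derivative_eq_intros)
   thus "((%w. f w - g x <.> w) has_derivative (%v. v <.> g w - g x <.> v)) (at w within closed_segment x y)"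
    by (rule has_derivative_at_withinI)
   show "onorm (%v. v <.> g w - g x <.> v) <= L * norm (y - x)"
   proof (rule onorm_bound)
    fix v
    have "norm (v <.> g w - g x <.> v) = abs (v <.> (g w - g x))" by (simp add: inner_diff_right inner_commute)
    also have "... <= norm v * norm (g w - g x)" by (rule Cauchy_Schwarz_ineq2)
    also have "... <= norm v * (L * norm (y - x))"
    proof (rule mult_left_mono)
     have "L * norm (w - x) <= L * norm (y - x)" using segment_bound1[OF w] L0 by (intro mult_left_mono) auto
     with lip[of w x] show "norm (g w - g x) <= L * norm (y - x)" by simp
    qed simp
    finally show "norm (v <.> g w - g x <.> v) <= L * norm (y - x) * norm v" by (simp add: mult.commute)
   qed (use L0 in simp)
  qed auto
  moreover have "(f y - g x <.> y) - (f x - g x <.> x) = f y - f x - g x <.> (y - x)" by (simp add: inner_diff_right)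
  ultimately show ?thesis by (simp add: power2_eq_square)
 qed
 show ?thesis unfolding tame_def grad using gd lip taylor L0 M1 M2
   borel_measurable_continuous_onI[OF contf] borel_measurable_continuous_onI[OF contg]
  by (intro exI[of _ "max (max M1 M2) 0"] exI[of _ L]) (auto simp: le_max_iff_disj)
qed

lemma ln_upper_cubic:
 fixes u :: real assumes "-1 < u"
 shows "ln (1 + u) <= u - u^2 / 2 + u^3 / 3"
proof -
 define d where "d u = u - u^2 / 2 + u^3 / 3 - ln (1 + u)" for u :: real
 have der: "(d has_real_derivative x^3 / (1 + x)) (at x)" if "-1 < x" for x
 proof -
  have "(d has_real_derivative (1 - x + x^2 - 1 / (1 + x))) (at x)"
   unfolding d_def using that by (auto intro!: derivative_eq_intros simp: field_simps power2_eq_square)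
  moreover have "1 - x + x^2 - 1 / (1 + x) = x^3 / (1 + x)"
   using that by (simp add: field_simps power2_eq_square power3_eq_cube)
  ultimately show ?thesis by simp
 qed
 have "d 0 <= d u"
 proof (cases "u >= 0")
  case True
  show ?thesis
  proof (rule DERIV_nonneg_imp_nondecreasing[OF True])
   fix x assume x: "0 <= x" "x <= u"
   hence "(d has_real_derivative x^3 / (1 + x)) (at x)" "x^3 / (1 + x) >= 0" using der[of x] by auto
   thus "EX y. (d has_real_derivative y) (at x) & y >= 0" by blast
  qed
 next
  case False
  hence "u <= 0" by simp
  show ?thesis
  proof (rule DERIV_nonpos_imp_nonincreasing[OF `u <= 0`])
   fix x assume x: "u <= x" "x <= 0"
   hence "x^3 / (1 + x) <= 0" using assms by (intro divide_nonpos_nonneg) (auto simp: power3_eq_cube mult_nonpos_nonneg mult_nonneg_nonpos2 intro: mult_nonneg_nonpos)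
   thus "EX y. (d has_real_derivative y) (at x) & y <= 0" using der[of x] x assms by auto
  qed
 qed
 thus ?thesis by (simp add: d_def)
qed

text \<open>For \<open>u\<close> a multiple \<open>eps\<close> of a centred function the linear term
  integrates to 0, so the relative entropy is \<open>eps^2 / 2\<close> times the variance up to a
  cubic error. The exact factor \<open>1 / 2\<close> is what keeps the final constant sharp.\<close>

lemma entropy_expansion:
 fixes u :: real assumes u: "abs u <= 1/2"
 shows "(1 + u) * ln (1 + u) <= u + u^2 / 2 + abs u^3"
proof -
 have "(1 + u) * ln (1 + u) <= (1 + u) * (u - u^2 / 2 + u^3 / 3)"
  using u by (intro mult_left_mono ln_upper_cubic) (auto simp: abs_le_iff)
 also have "... = u + u^2 / 2 - u^3 / 6 + u^4 / 3"
  by (simp add: field_simps power2_eq_square power3_eq_cube power4_eq_xxxx)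
 also have "u + u^2 / 2 - u^3 / 6 + u^4 / 3 <= u + u^2 / 2 + abs u^3 / 6 + u^4 / 3"
  using abs_ge_minus_self[of "u^3"] by (simp add: power_abs)
 also have "u^4 / 3 <= abs u^3 / 6"
 proof -
  have "u^4 = abs u * abs u^3" by (simp add: power_abs[symmetric] abs_mult[symmetric] power4_eq_xxxx power3_eq_cube)
  also have "... <= 1/2 * abs u^3" using u by (intro mult_right_mono) auto
  finally show ?thesis by simp
 qed
 finally show ?thesis using zero_le_power[OF abs_ge_zero, of u 3] by linarith
qed

lemma integrable_density_bounded:
 fixes f :: "'b => real"
 assumes "integrable M f" and [measurable]: "h : bm M" and "!!x. 0 <= h x" "!!x. h x <= b"
 shows "integrable (density M (%x. ennreal (h x))) f"
proof -
 have [measurable]: "f : bm M" using assms(1) by (rule borel_measurable_integrable)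
 have "integrable M (%x. h x *. f x)"
 proof (rule I_bound)
  show "integrable M (%x. b * f x)" using assms by simp
  show "AE x in M. norm (h x *. f x) <= norm (b * f x)"
  proof (rule AE_I2)
   fix x
   have "h x * abs (f x) <= b * abs (f x)" using assms(4) by (intro mult_right_mono) auto
   moreover have "b >= 0" using assms(3,4) order_trans by blast
   ultimately show "norm (h x *. f x) <= norm (b * f x)" using assms(3)[of x] by (simp add: abs_mult)
  qed
 qed simp
 thus ?thesis using assms by (subst integrable_density) auto
qed

context prob_space begin

lemma sqint_integrable:
 assumes X: "sqint M X" shows "integrable M X"
proof -
 have "norm (X w) <= norm (1 + (norm (X w))^2)" for w
  using sum_squares_bound[of "norm (X w)" 1] norm_ge_zero[of "X w"] zero_le_power2[of "norm (X w)"]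
  unfolding real_norm_def power_one by linarith
 hence "AE w in M. norm (X w) <= norm (1 + (norm (X w))^2)" by (intro AE_I2)
 moreover have "integrable M (%w. 1 + (norm (X w))^2)" using X by (simp add: sqint_def)
 ultimately show ?thesis using sqint_measurable[OF X] I_bound by blast
qed

lemma l2_const [simp]: "l2 M (%w. v) = norm v" by (simp add: l2_def prob_space)

lemma sqint_const [simp]: "sqint M (%w. v)" by (simp add: sqint_def)

lemma norm_integral_le_l2:
 assumes X: "sqint M X" shows "norm (LINT w|M. X w) <= l2 M X"
proof -
 let ?v = "(LINT w|M. X w)"
 have "(norm ?v)^2 = (LINT w|M. X w <.> ?v)" using sqint_integrable[OF X] by (simp add: dot_square_norm)
 also have "... <= l2 M X * norm ?v" using l2_inner[OF X sqint_const[of ?v]] by simp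
 finally show ?thesis by (cases "norm ?v = 0") (auto simp: power2_eq_square)
qed

text \<open>The factor 2 is a convenient bound for both \<open>sqrt (3/2)\<close> and
  \<open>sqrt 2\<close>.\<close>

lemma l2_change_of_density:
 fixes X :: "'a => 'c::euclidean_space"
 assumes [measurable]: "y : M ->M M" "h : bm M" and d: "distr M M y = density M (%x. ennreal (h x))"
  and h: "!!x. 1/2 <= h x" "!!x. h x <= 3/2" and X: "sqint M X"
 shows "sqint M (%w. X (y w))" "l2 M (%w. X (y w)) <= 2 * l2 M X" "l2 M X <= 2 * l2 M (%w. X (y w))"
proof -
 note [measurable] = sqint_measurable[OF X]
 have h0: "0 <= h x" for x using h(1)[of x] by simp
 have iX: "integrable M (%w. (norm (X w))^2)" using X by (simp add: sqint_def)
 have "integrable (distr M M y) (%w. (norm (X w))^2)"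
  unfolding d by (rule integrable_density_bounded[OF iX, of h "3/2"]) (use h0 h in auto)
 thus sy: "sqint M (%w. X (y w))" by (subst (asm) integrable_distr_eq) (auto simp: sqint_def)
 have ih: "integrable M (%w. h w * (norm (X w))^2)"
 proof (rule I_bound)
  show "integrable M (%w. 3/2 * (norm (X w))^2)" using iX by simp
  show "AE w in M. norm (h w * (norm (X w))^2) <= norm (3/2 * (norm (X w))^2)"
   using mult_right_mono[OF h(2) zero_le_power2] h0 by (intro AE_I2) simp
 qed simp
 have "(LINT w|M. (norm (X (y w)))^2) = (LINT w|(distr M M y). (norm (X w))^2)" by (subst integral_distr) auto
 also have "... = (LINT w|M. h w * (norm (X w))^2)" unfolding d by (subst integral_density) (use h0 in auto)
 finally have e: "(l2 M (%w. X (y w)))^2 = (LINT w|M. h w * (norm (X w))^2)" by (simp add: l2_square)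
 have "(LINT w|M. h w * (norm (X w))^2) <= (LINT w|M. 3/2 * (norm (X w))^2)"
  by (rule integral_mono[OF ih]) (use iX mult_right_mono[OF h(2) zero_le_power2] in auto)
 hence "(l2 M (%w. X (y w)))^2 <= 3/2 * (l2 M X)^2" unfolding e l2_square[of M X] using iX by simp
 also have "... <= (2 * l2 M X)^2" by (simp add: power_mult_distrib)
 finally show "l2 M (%w. X (y w)) <= 2 * l2 M X" by (rule power2_le_imp_le) simp
 have "(LINT w|M. 1/2 * (norm (X w))^2) <= (LINT w|M. h w * (norm (X w))^2)"
  by (rule integral_mono) (use iX ih mult_right_mono[OF h(1)] in auto)
 hence "1/2 * (l2 M X)^2 <= (l2 M (%w. X (y w)))^2" unfolding e l2_square[of M X] using iX by simp
 hence "(l2 M X)^2 <= (2 * l2 M (%w. X (y w)))^2"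
  using zero_le_power2[of "l2 M (%w. X (y w))"] unfolding power_mult_distrib power2_eq_square[of 2] by linarith
 thus "l2 M X <= 2 * l2 M (%w. X (y w))" by (rule power2_le_imp_le) simp
qed

end

section \<open>First-order perturbation and the upper bound for the variance\<close>

locale slc_pair =
 fixes ka0 ka1 :: real and rho0 rho1 :: "'a::euclidean_space => real" and mu0 mu1 :: "'a measure"
  and Om0 Om1 :: "'a set" and T :: "'a => 'a" and phi psi :: "'a => real"
 assumes k0: "ka0 > 0" and w0: "slc_weight ka0 rho0" and mu0: "mu0 = dens rho0" and n0: "nice Om0 mu0"
  and k1: "ka1 > 0" and w1: "slc_weight ka1 rho1" and mu1: "mu1 = dens rho1" and n1: "nice Om1 mu1"
  and T: "brenier Om0 mu0 mu1 T phi psi"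
begin

lemma sets0 [measurable_cong, simp]: "sets mu0 = sets borel" by (rule nice_sets[OF n0])
lemma sets1 [measurable_cong, simp]: "sets mu1 = sets borel" by (rule nice_sets[OF n1])
lemma space0 [simp]: "space mu0 = UNIV" by (rule nice_space[OF n0])

lemma T_measurable [measurable]: "T : BM" using T by (simp add: brenier_def)
lemma T_distr: "distr mu0 borel T = mu1" using T by (simp add: brenier_def)

sublocale P0: prob_space mu0 using n0 by (rule nice_prob)

lemma prob_UNIV [simp]: "measure mu0 UNIV = 1" using P0.prob_space by simp

lemma sq_id: "integrable mu0 (%x. (norm x)^2)" by (rule nice_sq[OF n0])
lemma sq_T: "integrable mu0 (%x. (norm (T x))^2)" by (rule integrable_sq_distr) (use nice_sq[OF n1] T_distr in auto)

definition F :: "real => 'a => 'a" where "F s x = (1 - s) *. x + s *. T x"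

lemma F_measurable [measurable]: "F s : BM" unfolding F_def by measurable

definition mean :: "real => ('a => real) => real" where "mean s f = (LINT x|mu0. f (F s x))"

definition var :: "real => ('a => real) => real" where "var s f = (LINT x|mu0. (f (F s x) - mean s f)^2)"

text \<open>\<open>(c s)^2\<close> is the value asserted for the Poincare constant;
  \<open>c s\<close> itself is the total weight with which the normalised displacements
  \<open>E0\<close> and \<open>E1\<close> enter the displacement of \<open>F s\<close>.\<close>

definition c :: "real => real" where "c s = (1 - s) / sqrt ka0 + s / sqrt ka1"

lemma sqint_id: "sqint mu0 (%x. x)" using sq_id by (simp add: sqint_def)
lemma sqint_T: "sqint mu0 T" using sq_T by (simp add: sqint_def)

lemma sqint_gradient:
 assumes f: "test_function f" shows "sqint mu0 (%x. gradient f (F s x))"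
proof -
 obtain K L where "tame f K L" using test_function_tame[OF f] by blast
 note KL = tameD[OF this]
 note [measurable] = KL(9)
 show ?thesis by (rule l2_mono(1)[of _ _ "%_. K *. (1::real)"]) (use KL in auto)
qed

text \<open>Displacements in source and target, scaled so that strong log-concavity gives both the
  same asymptotic bound, the standard deviation of the tilting function.\<close>

definition E0 :: "real => ('a => 'a) => 'a => 'a" where "E0 eps y x = (sqrt ka0 / eps) *. (y x - x)"
definition E1 :: "real => ('a => 'a) => 'a => 'a" where "E1 eps y x = (sqrt ka1 / eps) *. (T (y x) - T x)"

lemma displacement:
 assumes e: "0 < eps" and s: "0 <= s" "s <= 1" and y: "sqint mu0 y" "sqint mu0 (%x. T (y x))"
 shows "sqint mu0 (E0 eps y)" "sqint mu0 (E1 eps y)"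
  and "F s (y x) - F s x = eps *. (((1 - s) / sqrt ka0) *. E0 eps y x + (s / sqrt ka1) *. E1 eps y x)"
  and "sqint mu0 (%x. F s (y x) - F s x)"
  and "l2 mu0 (E0 eps y) <= B ==> l2 mu0 (E1 eps y) <= B ==> l2 mu0 (%x. F s (y x) - F s x) <= eps * (c s * B)"
proof -
 show q: "sqint mu0 (E0 eps y)" "sqint mu0 (E1 eps y)"
  unfolding E0_def[abs_def] E1_def[abs_def] by (rule sqint_scale sqint_diff sqint_id sqint_T y)+
 let ?a = "(1 - s) / sqrt ka0" and ?b = "s / sqrt ka1"
 have F: "F s (y x) - F s x = eps *. (?a *. E0 eps y x + ?b *. E1 eps y x)" for x
 proof -
  have "F s (y x) - F s x = (1 - s) *. (y x - x) + s *. (T (y x) - T x)" by (simp add: F_def algebra_simps)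
  moreover have "eps * (?a * (sqrt ka0 / eps)) = 1 - s" "eps * (?b * (sqrt ka1 / eps)) = s" using e k0 k1 by simp_all
  ultimately show ?thesis by (simp only: E0_def E1_def scaleR_add_right scaleR_scaleR)
 qed
 thus "F s (y x) - F s x = eps *. (?a *. E0 eps y x + ?b *. E1 eps y x)" .
 show "sqint mu0 (%x. F s (y x) - F s x)" unfolding F by (intro sqint_scale sqint_add q)
 assume n: "l2 mu0 (E0 eps y) <= B" "l2 mu0 (E1 eps y) <= B"
 have "l2 mu0 (%x. ?a *. E0 eps y x + ?b *. E1 eps y x) <= ?a * l2 mu0 (E0 eps y) + ?b * l2 mu0 (E1 eps y)"
  using l2_triangle[OF sqint_scale[OF q(1), of ?a] sqint_scale[OF q(2), of ?b]] s k0 k1 by (simp add: l2_scale)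
 also have "... <= ?a * B + ?b * B" using n s k0 k1 by (intro add_mono mult_left_mono) auto
 finally show "l2 mu0 (%x. F s (y x) - F s x) <= eps * (c s * B)"
  unfolding F l2_scale using e by (simp add: c_def distrib_right)
qed

definition tilt :: "real => ('a => real) => real => ('a => 'a) => bool" where
 "tilt s f eps y \<longleftrightarrow> y : BM & (ALL x. abs (eps * (f (F s x) - mean s f)) <= 1/2) &
  distr mu0 borel y = density mu0 (%x. ennreal (1 + eps * (f (F s x) - mean s f)))"

lemma tilt_push:
 fixes g :: "'a => real"
 assumes f [measurable]: "f : BM" and P: "tilt s f eps y"
 shows "AE x in mu0. Q x ==> AE x in mu0. Q (y x)" and "integrable mu0 g ==> integrable mu0 (%x. g (y x))"
  and "integrable mu0 g ==> (LINT x|mu0. g (y x) - g x) = eps * (LINT x|mu0. (f (F s x) - mean s f) * g x)"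
  and "sqint mu0 X ==> sqint mu0 (%x. X (y x))" and "sqint mu0 X ==> l2 mu0 (%x. X (y x)) <= 2 * l2 mu0 X"
  and "sqint mu0 X ==> l2 mu0 X <= 2 * l2 mu0 (%x. X (y x))"
proof -
 let ?f = "%x. f (F s x) - mean s f" and ?h = "%x. 1 + eps * (f (F s x) - mean s f)"
 have [measurable]: "y : BM" and b: "abs (eps * ?f x) <= 1/2"
  and d: "distr mu0 borel y = density mu0 (%x. ennreal (?h x))" for x using P by (simp_all add: tilt_def)
 have h: "1/2 <= ?h x" "?h x <= 3/2" "0 <= ?h x" for x using b[of x] by (auto simp: abs_le_iff)
 have AEd: "AE x in distr mu0 borel y. Q x" if "AE x in mu0. Q x" for Q
  unfolding d by (subst AE_density, measurable) (use that in eventually_elim, auto)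
 show "AE x in mu0. Q (y x)" if "AE x in mu0. Q x" by (rule AE_distrD[OF _ AEd[OF that]]) simp
 have dd: "distr mu0 mu0 y = density mu0 (%x. ennreal (?h x))" unfolding d[symmetric] by (rule distr_cong) auto
 note l = P0.l2_change_of_density[of y ?h, OF _ _ dd h(1,2)]
 show "sqint mu0 (%x. X (y x))" "l2 mu0 (%x. X (y x)) <= 2 * l2 mu0 X" "l2 mu0 X <= 2 * l2 mu0 (%x. X (y x))"
  if "sqint mu0 X" for X :: "'a => 'b" using l[of X] that by auto
 assume g: "integrable mu0 g"
 hence [measurable]: "g : BM"
  using borel_measurable_integrable[OF g] by (simp add: measurable_cong_sets[OF sets0 refl])
 have ig: "integrable (distr mu0 borel y) g"
  unfolding d by (rule integrable_density_bounded[OF g, of ?h "3/2"]) (use h in auto)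
 thus igy: "integrable mu0 (%x. g (y x))" by (subst (asm) integrable_distr_eq) auto
 have ihf: "integrable mu0 (%x. eps * ?f x * g x)"
 proof (rule I_bound[OF g])
  show "AE x in mu0. norm (eps * ?f x * g x) <= norm (g x)"
  proof (rule AE_I2)
   fix x
   have "abs (eps * ?f x) * abs (g x) <= 1 * abs (g x)" using b[of x] by (intro mult_right_mono) auto
   thus "norm (eps * ?f x * g x) <= norm (g x)" by (simp add: abs_mult)
  qed
 qed measurable
 have "(LINT x|mu0. g (y x)) = (LINT x|(distr mu0 borel y). g x)" by (rule integral_distr[symmetric]) auto
 also have "... = (LINT x|mu0. ?h x *. g x)" unfolding d by (rule integral_density) (use h in auto)
 also have "... = (LINT x|mu0. g x + eps * ?f x * g x)" by (rule I_cong) (simp_all add: algebra_simps)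
 also have "... = (LINT x|mu0. g x) + eps * (LINT x|mu0. ?f x * g x)" using g ihf by (simp add: mult.assoc)
 finally show "(LINT x|mu0. g (y x) - g x) = eps * (LINT x|mu0. ?f x * g x)" using g igy by simp
qed

lemma centered_test_function:
 fixes s :: real
 assumes f: "test_function f"
 defines "h \<equiv> %x. f (F s x) - mean s f"
 shows "sqint mu0 h" "(l2 mu0 h)^2 = var s f" "(LINT x|mu0. h x) = 0"
proof -
 obtain K L where "tame f K L" using test_function_tame[OF f] by blast
 note KL = tameD[OF this]
 note [measurable] = KL(8)
 have q: "sqint mu0 (%x. f (F s x))" by (rule l2_mono(1)[OF _ P0.sqint_const[of K]]) (use KL in auto)
 show "sqint mu0 h" unfolding h_def by (rule sqint_diff[OF q P0.sqint_const])
 show "(l2 mu0 h)^2 = var s f" by (simp add: l2_square var_def h_def)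
 show "(LINT x|mu0. h x) = 0" unfolding h_def using P0.sqint_integrable[OF q] by (simp add: mean_def)
qed

text \<open>The norm bounds and the pairing are the first-order information carried by
  \<open>y\<close>, with one error constant \<open>C\<close>. The map \<open>S\<close> from the
  tilted measure to \<open>mu1\<close> and its potential \<open>th\<close> are recorded for
  \<open>near_extremal_direction\<close>, where \<open>phi - th\<close> is studied.\<close>

definition perturbation ::
 "real => ('a => real) => real => real => ('a => 'a) => ('a => real) => ('a => 'a) => bool" where
 "perturbation s f C eps y th S \<longleftrightarrow> tilt s f eps y &
  l2 mu0 (E0 eps y) <= sqrt (var s f + C * eps) & l2 mu0 (E1 eps y) <= sqrt (var s f + C * eps) &
  var s f - C * eps <= (1 - s) / sqrt ka0 * (LINT x|mu0. gradient f (F s x) <.> E0 eps y x)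
   + s / sqrt ka1 * (LINT x|mu0. gradient f (F s x) <.> E1 eps y x) &
  convex_on Om0 th & integrable mu0 th & S : BM & sqint mu0 S &
  (AE x in mu0. GDERIV th x :> S x) & (AE x in mu0. S (y x) = T x)"

lemma perturbation_push:
 assumes "test_function f" "perturbation s f C eps y th S"
 shows "f : BM" "tilt s f eps y" "sqint mu0 y" "sqint mu0 (%x. T (y x))"
proof -
 show f: "f : BM" using test_function_tame[OF assms(1)] tameD(8) by blast
 show P: "tilt s f eps y" using assms(2) by (simp add: perturbation_def)
 show "sqint mu0 y" "sqint mu0 (%x. T (y x))" using tilt_push(4)[OF f P sqint_id] tilt_push(4)[OF f P sqint_T] .
qed

lemma perturbation_family:
 assumes s: "0 <= s" "s <= 1" and f: "test_function f"
 obtains C eps0 where "C >= 0" "eps0 > 0"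
  "!!eps. 0 < eps ==> eps < eps0 ==> EX y th S. perturbation s f C eps y th S"
proof -
 obtain K L where "tame f K L" using test_function_tame[OF f] by blast
 note KL = tameD[OF this]
 note [measurable] = KL(8,9)
 define fb where "fb x = f (F s x) - mean s f" for x
 define V where "V = var s f"
 note cf = centered_test_function[OF f, of s, folded fb_def[abs_def]]
 have [measurable]: "fb : BM" unfolding fb_def by measurable
 have i_f: "integrable mu0 (%x. f (F s x))" by (rule P0.integrable_const_bound[of _ K]) (use KL in auto)
 have "abs (mean s f) <= (LINT x|mu0. abs (f (F s x)))" unfolding mean_def by (rule integral_abs_bound)
 also have "... <= (LINT x|mu0. K)" by (rule integral_mono) (use i_f KL in auto)
 finally have fb: "abs (fb x) <= 2 * K" for x using KL(3)[of "F s x"] unfolding fb_def by simp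
 have ifb: "integrable mu0 fb" and ifb2: "integrable mu0 (%x. (fb x)^2)"
  using P0.sqint_integrable[OF cf(1)] cf(1) by (auto simp: sqint_def)
 have V: "V = (LINT x|mu0. (fb x)^2)" by (simp add: V_def var_def fb_def)
 have V0: "V >= 0" unfolding V by (rule integral_nonneg_AE) simp
 \<comment> \<open>From the cubic term of the entropy, as \<open>fb\<close> is bounded by
   \<open>2 * K\<close>; the leading 2 is there because the transport bounds contain twice the
   entropy. The constant \<open>C\<close> below also covers the second-order Taylor error of
   \<open>f\<close>.\<close>
 define C0 where "C0 = 2 * (2 * K)^3"
 have C0: "C0 >= 0" using KL(1) by (simp add: C0_def)
 define C where "C = max C0 (L * ((c s)^2 * (V + C0)))"
 \<comment> \<open>Ensures \<open>2 * K * eps <= 1/2\<close>, so that the tilted density lies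
   between \<open>1/2\<close> and \<open>3/2\<close>, and \<open>eps <= 1\<close>.\<close>
 define eps0 where "eps0 = 1 / (4 * K + 1)"
 have e0: "eps0 > 0" "eps0 <= 1" using KL(1) by (auto simp: eps0_def)
 show thesis
 proof (rule that[of C eps0, OF _ e0(1)])
  show "C >= 0" using C0 by (simp add: C_def)
  fix eps :: real assume e: "0 < eps" "eps < eps0"
  define h where "h x = 1 + eps * fb x" for x
  have [measurable]: "h : BM" unfolding h_def by measurable
  have efb: "abs (eps * fb x) <= 2 * K * eps" "abs (eps * fb x) <= 1/2" for x
  proof -
   have "eps * abs (fb x) <= eps * (2 * K)" using e fb by (intro mult_left_mono) auto
   thus 1: "abs (eps * fb x) <= 2 * K * eps" using e by (simp add: abs_mult mult.commute)
   have "eps * (4 * K + 1) <= 1" using e KL(1) by (simp add: eps0_def field_simps)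
   hence "2 * K * eps <= 1 / 2" using e by (simp add: algebra_simps)
   with 1 show "abs (eps * fb x) <= 1/2" by linarith
  qed
  have hb: "1/2 <= h x" "h x <= 3/2" for x using efb(2)[of x] by (auto simp: h_def abs_le_iff)
  have h1: "(LINT x|mu0. h x) = 1" unfolding h_def using ifb cf(3) by (simp add: P0.prob_space)
  have efb3: "abs (eps * fb x)^3 <= (2 * K * eps)^3" for x using efb(1) by (intro power_mono) auto
  define E where "E = (LINT x|mu0. h x * ln (h x))"
  have ihln: "integrable mu0 (%x. h x * ln (h x))"
  proof (rule P0.integrable_const_bound[of _ "3/2 * (abs (ln (1/2)) + abs (ln (3/2)))"])
   show "AE x in mu0. norm (h x * ln (h x)) <= 3/2 * (abs (ln (1/2)) + abs (ln (3/2)))"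
   proof (rule AE_I2)
    fix x
    have h0: "h x > 0" using hb(1)[of x] by simp
    have "ln (1/2) <= ln (h x)" "ln (h x) <= ln (3/2)" using hb[of x] h0 by (auto intro!: ln_mono)
    hence "abs (ln (h x)) <= abs (ln (1/2)) + abs (ln (3/2))" by linarith
    thus "norm (h x * ln (h x)) <= 3/2 * (abs (ln (1/2)) + abs (ln (3/2)))"
     using hb[of x] h0 unfolding real_norm_def abs_mult by (intro mult_mono) auto
   qed
  qed simp
  have E: "2 * E <= eps^2 * (V + C0 * eps)"
  proof -
   have "E <= (LINT x|mu0. eps * fb x + eps^2 / 2 * (fb x)^2 + (2 * K * eps)^3)" unfolding E_def
   proof (rule integral_mono[OF ihln])
    fix x
    have "h x * ln (h x) <= eps * fb x + (eps * fb x)^2 / 2 + abs (eps * fb x)^3"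
     unfolding h_def by (rule entropy_expansion[OF efb(2)])
    with efb3[of x] show "h x * ln (h x) <= eps * fb x + eps^2 / 2 * (fb x)^2 + (2 * K * eps)^3"
     by (simp add: power_mult_distrib)
   qed (use ifb ifb2 in auto)
   also have "... = eps^2 / 2 * V + (2 * K * eps)^3" using ifb ifb2 cf(3) V by (simp add: P0.prob_space)
   finally show ?thesis by (simp add: C0_def power_mult_distrib power2_eq_square power3_eq_cube algebra_simps)
  qed
  define W where "W = V + C0 * eps"
  have W: "W <= V + C * eps" "0 <= W" "W <= V + C0"
   using C0 V0 e e0 by (auto simp: W_def C_def intro!: mult_right_mono mult_left_le)
  obtain y th S where y: "y : BM" "distr mu0 borel y = density mu0 (%x. ennreal (h x))"
   and b0: "(LINT x|mu0. (norm (y x - x))^2) <= 2 / ka0 * E"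
   and b1: "(LINT x|mu0. (norm (T (y x) - T x))^2) <= 2 / ka1 * E"
   and S: "convex_on Om0 th" "integrable mu0 th" "S : BM"
    "AE x in mu0. GDERIV th x :> S x" "AE x in mu0. S (y x) = T x" "integrable mu0 (%x. (norm (S x))^2)"
   unfolding E_def
   by (rule transport_perturbation[OF k0 w0 mu0 n0 k1 w1 mu1 n1 T, of h "1/2" "3/2"]) (use hb h1 in auto)
  have P: "tilt s f eps y" using y efb(2) by (simp add: tilt_def h_def fb_def)
  note push = tilt_push[OF KL(8) P, folded fb_def]
  note G = sqint_gradient[OF f, of s] and D = displacement[OF e(1) s push(4)[OF sqint_id] push(4)[OF sqint_T]]
  have scaled: "l2 mu0 (%x. (sqrt ka / eps) *. X x) <= sqrt W"
   if "(LINT x|mu0. (norm (X x))^2) <= 2 / ka * E" "ka > 0" for X :: "'a => 'a" and ka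
  proof (rule real_le_rsqrt)
   have "(LINT x|mu0. (norm (X x))^2) <= eps^2 * W / ka"
    using that E by (simp add: W_def divide_right_mono[OF E] order_trans less_imp_le)
   thus "(l2 mu0 (%x. (sqrt ka / eps) *. X x))^2 <= W"
    using that(2) e by (simp add: l2_square power_mult_distrib power_divide field_simps)
  qed
  have l: "l2 mu0 (E0 eps y) <= sqrt W" "l2 mu0 (E1 eps y) <= sqrt W"
   unfolding E0_def[abs_def] E1_def[abs_def] by (rule scaled[OF b0 k0], rule scaled[OF b1 k1])
  let ?D = "%x. F s (y x) - F s x"
  let ?J = "(1 - s) / sqrt ka0 * (LINT x|mu0. gradient f (F s x) <.> E0 eps y x) + s / sqrt ka1 * (LINT x|mu0. gradient f (F s x) <.> E1 eps y x)"
  have iD: "integrable mu0 (%x. (norm (?D x))^2)" using D(4) by (simp add: sqint_def)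
  have iGD: "integrable mu0 (%x. gradient f (F s x) <.> ?D x)" by (rule sqint_inner[OF G D(4)])
  have ify: "integrable mu0 (%x. f (F s (y x)))" by (rule push(2)[OF i_f])
  have "(l2 mu0 ?D)^2 <= (eps * (c s * sqrt W))^2" by (rule power_mono[OF D(5)[OF l]]) simp
  also have "... <= eps^2 * ((c s)^2 * (V + C0))" using W by (simp add: power_mult_distrib mult_left_mono)
  finally have "L * (l2 mu0 ?D)^2 <= L * (eps^2 * ((c s)^2 * (V + C0)))" using KL(2) by (rule mult_left_mono)
  also have "... = eps^2 * (L * ((c s)^2 * (V + C0)))" by (rule mult.left_commute)
  also have "... <= eps^2 * C" unfolding C_def by (intro mult_left_mono max.cobounded2) simp
  finally have LD: "L * (l2 mu0 ?D)^2 <= eps^2 * C" .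
  \<comment> \<open>Tilting raises the mean of \<open>f\<close> by exactly \<open>eps\<close> times
    its variance. Taylor expansion of \<open>f\<close> along the displacement of \<open>F s\<close>
    converts this gain into a lower bound for the pairing of the gradient with \<open>E0\<close> and
    \<open>E1\<close>.\<close>
  have "(LINT x|mu0. fb x * f (F s x)) = (LINT x|mu0. (fb x)^2 + mean s f * fb x)"
   by (rule I_cong) (auto simp: fb_def power2_eq_square algebra_simps)
  also have "... = V" using ifb ifb2 cf(3) V by simp
  finally have "eps * V = (LINT x|mu0. f (F s (y x)) - f (F s x))" using push(3)[OF i_f] by simp
  also have "... <= (LINT x|mu0. gradient f (F s x) <.> ?D x + L * (norm (?D x))^2)"
  proof (rule integral_mono)
   show "f (F s (y x)) - f (F s x) <= gradient f (F s x) <.> ?D x + L * (norm (?D x))^2" for x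
    using KL(7)[of "F s (y x)" "F s x"] by (simp add: abs_le_iff)
  qed (use ify i_f iGD iD in auto)
  also have "... = (LINT x|mu0. gradient f (F s x) <.> ?D x) + L * (l2 mu0 ?D)^2" using iGD iD by (simp add: l2_square)
  also have "(LINT x|mu0. gradient f (F s x) <.> ?D x) = eps * ?J"
   unfolding D(3) inner_scaleR_right inner_add_right using sqint_inner[OF G D(1)] sqint_inner[OF G D(2)] by simp
  finally have "eps * (V - C * eps) <= eps * ?J" using LD by (simp add: power2_eq_square algebra_simps)
  hence gd: "V - C * eps <= ?J" using e by simp
  have "sqint mu0 S" using S by (simp add: sqint_def)
  moreover have "sqrt W <= sqrt (V + C * eps)" using W by simp
  ultimately show "EX y th S. perturbation s f C eps y th S"
   unfolding perturbation_def V_def[symmetric] using P S(1-5) gd order_trans[OF l(1)] order_trans[OF l(2)] by blast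
 qed
qed

end

context slc_pair begin

text \<open>Cauchy-Schwarz in the pairing of a perturbation gives, as \<open>eps\<close> tends to 0,
  a bound of the variance by \<open>c s * ?N\<close> times its own square root.\<close>

lemma variance_bound:
 assumes s: "0 <= s" "s <= 1" and f: "test_function f"
 shows "var s f <= (c s * l2 mu0 (%x. gradient f (F s x)))^2"
proof -
 let ?N = "l2 mu0 (%x. gradient f (F s x))"
 note G = sqint_gradient[OF f, of s]
 have V0: "var s f >= 0" unfolding var_def by (rule integral_nonneg_AE) simp
 obtain C eps0 where C: "C >= 0" "eps0 > 0"
  and P: "!!eps. 0 < eps ==> eps < eps0 ==> EX y th S. perturbation s f C eps y th S"
  by (rule perturbation_family[OF s f]) blast
 have ev: "\<forall>\<^sub>F eps in at_right 0. var s f - C * eps <= c s * ?N * sqrt (var s f + C * eps)"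
  unfolding eventually_at_right_field
 proof (intro exI[of _ eps0] conjI allI impI C)
  fix eps assume e: "0 < eps" "eps < eps0"
  obtain y th S where "perturbation s f C eps y th S" using P[OF e] by blast
  note p = this[unfolded perturbation_def] and D = displacement[OF e(1) s perturbation_push(3,4)[OF f this]]
  have "a * (LINT x|mu0. gradient f (F s x) <.> X x) <= a * (?N * sqrt (var s f + C * eps))"
   if "l2 mu0 X <= sqrt (var s f + C * eps)" "sqint mu0 X" "0 <= a" for a X
   using that l2_inner[OF G that(2)] mult_left_mono[OF that(1) l2_nonneg[of mu0 "%x. gradient f (F s x)"]]
   by (intro mult_left_mono) auto
  from this[OF _ D(1), of "(1 - s) / sqrt ka0"] this[OF _ D(2), of "s / sqrt ka1"]
  show "var s f - C * eps <= c s * ?N * sqrt (var s f + C * eps)"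
   using p s k0 k1 by (simp add: c_def ring_distribs mult.assoc)
 qed
 have "((%eps. var s f - C * eps) \<longlongrightarrow> var s f - C * 0) (at_right 0)"
  "((%eps. c s * ?N * sqrt (var s f + C * eps)) \<longlongrightarrow> c s * ?N * sqrt (var s f + C * 0)) (at_right 0)"
  by (intro tendsto_intros)+
 hence "var s f - C * 0 <= c s * ?N * sqrt (var s f + C * 0)" by (intro tendsto_le[OF _ _ _ ev]) auto
 hence *: "sqrt (var s f) * sqrt (var s f) <= c s * ?N * sqrt (var s f)" using V0 by simp
 have "0 <= c s * ?N" using s k0 k1 by (simp add: c_def)
 hence "sqrt (var s f) <= c s * ?N" using V0 mult_right_le_imp_le[OF *] by (cases "var s f = 0") simp_all
 hence "(sqrt (var s f))^2 <= (c s * ?N)^2" by (intro power_mono) (use V0 in auto)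
 thus ?thesis using V0 by simp
qed

end

section \<open>Poincare inequalities for strongly log-concave weights and on the doubled
  space\<close>

lemma exp_lower_cubic: "1 + z + z^2 / 2 - abs z ^ 3 <= exp (z::real)"
proof -
 obtain t where t: "exp z = (SUM m<4. z ^ m / fact m) + exp t / fact 4 * z ^ 4" using Maclaurin_exp_le[of z 4] by blast
 have "(SUM m<4. z ^ m / fact m) = 1 + z + z^2 / 2 + z ^ 3 / 6" by (simp add: eval_nat_numeral)
 moreover have "0 <= exp t / fact 4 * z ^ 4" by simp
 moreover have "z ^ 3 / 6 >= - (abs z ^ 3)"
  using abs_ge_minus_self[of "z ^ 3"] abs_ge_zero[of "z ^ 3"] unfolding power_abs by linarith
 ultimately show ?thesis using t by linarith
qed

text \<open>Prekopa--Leindler for \<open>exp (- \<tau> u) \<rho>\<close>, \<open>exp (\<tau> u - \<tau>\<^sup>2 H\<^sup>2 / \<kappa>) \<rho>\<close> and \<open>\<rho>\<close>, expanded to second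
  order in \<open>\<tau>\<close>.\<close>

lemma poincare_uniform_slope:
 fixes rho u H :: "'a::euclidean_space => real"
 defines "M \<equiv> dens rho"
 assumes k: "ka > 0" and w: "slc_weight ka rho" and fin: "finite_measure M" and [measurable]: "u : BM" "H : BM"
  and B: "!!x. abs (u x) <= B" and H: "!!x. 0 <= H x" "!!x. H x <= L" and r: "r > 0"
  and lip: "!!x y. rho x > 0 ==> rho y > 0 ==> u y - u x <= L * norm (x - y)"
  and slope: "!!x y. rho x > 0 ==> rho y > 0 ==> norm (x - y) < r ==> u y - u x <= H y * norm (x - y)"
  and mean: "(LINT x|M. u x) = 0"
 shows "(LINT x|M. (u x)^2) <= 1 / ka * (LINT x|M. (H x)^2)"
proof -
 interpret finite_measure M by fact
 note [measurable] = slc_weight_measurable[OF w]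
 note nn = slc_weight_nonneg[OF w]
 have [measurable_cong, simp]: "sets M = sets borel" by (simp add: M_def)
 have sp [simp]: "space M = UNIV" by (simp add: M_def)
 have B0: "0 <= B" using B[of 0] by linarith
 have L0: "0 <= L" using H[of 0] by linarith
 have bd: "integrable M f" if "f : BM" "!!x. abs (f x) <= K" for f :: "'a => real" and K
  by (rule integrable_const_bound[of _ K]) (use that in auto)
 have H2: "(H x)^2 <= L^2" for x by (rule power_mono) (use H in auto)
 have u2: "(u x)^2 <= B^2" for x using power_mono[OF B abs_ge_zero, of x 2] by simp
 have iu: "integrable M u" "integrable M (%x. (u x)^2)" "integrable M (%x. (H x)^2)"
  by (rule bd[of _ B] bd[of _ "B^2"] bd[of _ "L^2"]; use B u2 H2 in simp)+
 define m where "m = measure M UNIV"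
 have m0: "0 <= m" by (simp add: m_def)
 define U where "U = (LINT x|M. (u x)^2)"
 define h where "h = (LINT x|M. (H x)^2) / ka"
 define D where "D = B + L^2 / ka"
 have D: "B <= D" "L^2 / ka <= D" "0 <= D" using B0 k by (auto simp: D_def)
 define E where "E = D^2 + D ^ 3"
 \<comment> \<open>At distance \<open>r\<close> or more only the constant \<open>L\<close> is known,
   and curvature must absorb it: \<open>tau * L <= ka * r / 4\<close>. The bound
   \<open>tau <= 1\<close> serves the remainder estimates.\<close>
 define tau0 where "tau0 = min 1 (ka * r / (4 * L + 1))"
 have t0: "tau0 > 0" using k r L0 by (auto simp: tau0_def)
 have key: "(m + tau^2 * (U / 2) - tau ^ 3 * (E * m)) * (m + tau^2 * (U / 2 - h) - tau ^ 3 * (E * m)) <= m^2"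
  if t: "0 < tau" "tau < tau0" and pos: "0 <= m + tau^2 * (U / 2) - tau ^ 3 * (E * m)"
   "0 <= m + tau^2 * (U / 2 - h) - tau ^ 3 * (E * m)" for tau
 proof -
  define z where "z x = tau * u x - tau^2 * (H x)^2 / ka" for x
  have [measurable]: "z : BM" unfolding z_def by measurable
  have t1: "tau <= 1" "tau * (4 * L + 1) <= ka * r" using t L0 by (auto simp: tau0_def field_simps)
  have D2: "B <= D" "(H x)^2 / ka <= D" "B + (H x)^2 / ka <= D" for x
   using D H2[of x] divide_right_mono[OF H2[of x], of ka] k by (auto simp: D_def)
  have tH: "tau^2 * (H x)^2 / ka <= tau * ((H x)^2 / ka)" for x
   using t t1 k mult_right_mono[of tau 1 "tau * ((H x)^2 / ka)"] by (simp add: power2_eq_square mult.assoc)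
  have tu: "abs (tau * u x) <= tau * B" for x using B[of x] t by (simp add: abs_mult)
  have zb: "abs (z x) <= tau * D" for x
  proof -
   have "tau * (B + (H x)^2 / ka) <= tau * D" using D2(3)[of x] t by (intro mult_left_mono) auto
   moreover have "0 <= tau^2 * (H x)^2 / ka" using k by simp
   ultimately show ?thesis using tu[of x] tH[of x] unfolding z_def abs_le_iff distrib_left by linarith
  qed
  have zl: "1 + tau * u x - tau^2 * ((H x)^2 / ka) + tau^2 * ((u x)^2 / 2) - tau ^ 3 * E <= exp (z x)" for x
  proof -
   have "abs (z x) ^ 3 <= (tau * D) ^ 3" by (rule power_mono[OF zb]) simp
   moreover have "tau^2 * (u x)^2 - 2 * tau ^ 3 * D^2 <= (z x)^2"
   proof -
    have "u x * ((H x)^2 / ka) <= D * D"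
     using D B[of x] D2(2)[of x] k mult_mono[of "abs (u x)" D "(H x)^2 / ka" D] mult_right_mono[OF abs_ge_self[of "u x"], of "(H x)^2 / ka"]
     by simp
    hence "2 * tau ^ 3 * (u x * ((H x)^2 / ka)) <= 2 * tau ^ 3 * (D * D)" using t by (intro mult_left_mono) auto
    moreover have "(z x)^2 = tau^2 * (u x)^2 - 2 * tau ^ 3 * (u x * ((H x)^2 / ka)) + (tau^2 * (H x)^2 / ka)^2"
     by (simp add: z_def power2_eq_square power3_eq_cube algebra_simps)
    moreover have "0 <= (tau^2 * (H x)^2 / ka)^2" by simp
    ultimately show ?thesis unfolding power2_eq_square[of D] by linarith
   qed
   moreover have "a <= b ==> c <= d ==> 1 + v + d / 2 - a <= e ==> 1 + v + c / 2 - b <= e" for a b c d e v :: real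
    by linarith
   ultimately have "1 + z x + (tau^2 * (u x)^2 - 2 * tau ^ 3 * D^2) / 2 - (tau * D) ^ 3 <= exp (z x)"
    using exp_lower_cubic[of "z x"] by blast
   thus ?thesis by (simp add: z_def E_def power_mult_distrib diff_divide_distrib algebra_simps)
  qed
  have ul: "1 - tau * u x + tau^2 * ((u x)^2 / 2) - tau ^ 3 * E <= exp (- (tau * u x))" for x
  proof -
   have "abs (- (tau * u x)) ^ 3 <= (tau * D) ^ 3"
    by (rule power_mono) (use order_trans[OF tu[of x] mult_left_mono[OF D(1), of tau]] t in auto)
   also have "... <= tau ^ 3 * E" using D t by (simp add: E_def power_mult_distrib)
   finally show ?thesis using exp_lower_cubic[of "- (tau * u x)"] by (simp add: power_mult_distrib)
  qed
  define P where "P = (LINT x|M. exp (- (tau * u x)))"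
  define Q where "Q = (LINT x|M. exp (z x))"
  have iP: "integrable M (%x. exp (- (tau * u x)))"
   by (rule bd[of _ "exp (tau * B)"]) (use tu in "auto simp: abs_le_iff")
  have iQ: "integrable M (%x. exp (z x))" by (rule bd[of _ "exp (tau * D)"]) (use zb in "auto simp: abs_le_iff")
  have "(LINT x|M. 1 - tau * u x + tau^2 * ((u x)^2 / 2) - tau ^ 3 * E) <= P"
   unfolding P_def using iu iP ul by (intro integral_mono) auto
  hence P: "m + tau^2 * (U / 2) - tau ^ 3 * (E * m) <= P" using iu mean by (simp add: m_def U_def algebra_simps)
  have "(LINT x|M. 1 + tau * u x - tau^2 * ((H x)^2 / ka) + tau^2 * ((u x)^2 / 2) - tau ^ 3 * E) <= Q"
   unfolding Q_def using iu iQ zl by (intro integral_mono) auto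
  hence Q: "m + tau^2 * (U / 2 - h) - tau ^ 3 * (E * m) <= Q"
   using iu mean by (simp add: m_def U_def h_def algebra_simps)
  have PQ0: "0 <= P" "0 <= Q" by (auto simp: P_def Q_def intro!: integral_nonneg_AE)
  have enn: "(NL x. ennreal (rho x * f x)) = ennreal (LINT x|M. f x)"
   if "integrable M f" "f : BM" "!!x. 0 <= f x" for f
  proof -
   have "(NL x. ennreal (rho x * f x)) = (NN M (%x. ennreal (f x)))"
    unfolding M_def by (subst nn_integral_density) (use that nn in "auto simp: ennreal_mult'")
   also have "... = ennreal (LINT x|M. f x)" by (rule nn_integral_eq_integral) (use that in auto)
   finally show ?thesis .
  qed
  have "ennreal (P powr (1 - 1/2) * Q powr (1/2)) <= (NL x. ennreal (rho x))"
  proof (rule prekopa_leindler[of "1/2" "%x. ennreal (rho x * exp (- (tau * u x)))" "%x. ennreal (rho x * exp (z x))"])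
   show "ennreal P <= (NL x. ennreal (rho x * exp (- (tau * u x))))" using enn[OF iP] by (simp add: P_def)
   show "ennreal Q <= (NL x. ennreal (rho x * exp (z x)))" using enn[OF iQ] by (simp add: Q_def)
   fix x y :: 'a and a b :: real
   assume ab: "0 <= a" "0 <= b" "ennreal a <= ennreal (rho x * exp (- (tau * u x)))" "ennreal b <= ennreal (rho y * exp (z y))"
   hence ab': "a <= rho x * exp (- (tau * u x))" "b <= rho y * exp (z y)" using nn by (auto simp: ennreal_le_iff)
   have "a powr (1 - 1/2) * b powr (1/2) <= rho ((1 - 1/2) *. x + (1/2) *. y)"
   proof (cases "rho x > 0 & rho y > 0")
    case False
    hence "a = 0 | b = 0" using ab ab' nn[of x] nn[of y] by force
    thus ?thesis using nn by auto
   next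
    case True
    let ?d = "norm (x - y)"
    \<comment> \<open>Nearby points use Young's inequality with the slope \<open>H y\<close>, which
      explains the correction term in \<open>z\<close>; distant points use the smallness of
      \<open>tau\<close>.\<close>
    have e: "z y - tau * u x <= ka / 4 * ?d^2"
    proof (cases "?d < r")
     case 1: True
     have "tau * (u y - u x) <= tau * (H y * ?d)" using slope[of x y] True 1 t by (intro mult_left_mono) auto
     moreover have "0 <= (tau * H y - ka / 2 * ?d)^2 / ka" using k by simp
     hence "tau * (H y * ?d) <= tau^2 * (H y)^2 / ka + ka / 4 * ?d^2"
      using k by (simp add: power2_eq_square field_simps)
     ultimately show ?thesis by (simp add: z_def algebra_simps)
    next
     case 2: False
     have "tau * (u y - u x) <= tau * (L * ?d)" using lip[of x y] True t by (intro mult_left_mono) auto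
     also have "... = (tau * L) * ?d" by simp
     also have "tau * L <= ka / 4 * r" using t1(2) t by (simp add: algebra_simps)
     also have "ka / 4 * r <= ka / 4 * ?d" using 2 k by simp
     finally have "tau * (u y - u x) <= ka / 4 * ?d^2" by (simp add: power2_eq_square mult_right_mono)
     moreover have "0 <= tau^2 * (H y)^2 / ka" using k by simp
     ultimately show ?thesis by (simp add: z_def algebra_simps)
    qed
    have "a powr (1 - 1/2) * b powr (1/2)
      <= (rho x * exp (- (tau * u x))) powr (1 - 1/2) * (rho y * exp (z y)) powr (1/2)"
     using ab ab' by (intro mult_mono powr_mono2) auto
    also have "... = rho x powr (1 - 1/2) * rho y powr (1/2) * exp ((z y - tau * u x) / 2)"
    proof -
     have "(v * exp b) powr h = v powr h * exp (h * b)" if "0 <= v" for v b h :: real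
      using that by (cases "v = 0") (simp_all add: powr_def ln_mult exp_add[symmetric] algebra_simps)
     note e = this[OF nn]
     have "(1 - 1/2) * - (tau * u x) + 1/2 * z y = (z y - tau * u x) / 2" by simp
     hence "exp ((1 - 1/2) * - (tau * u x)) * exp (1/2 * z y) = exp ((z y - tau * u x) / 2)"
      by (simp only: exp_add[symmetric])
     thus ?thesis unfolding e by (simp only: ac_simps) 
    qed
    also have "... <= rho x powr (1 - 1/2) * rho y powr (1/2) * exp (ka * (1/2) * (1 - 1/2) / 2 * ?d^2)"
     using e by (intro mult_left_mono) auto
    also have "... <= rho ((1 - 1/2) *. x + (1/2) *. y)" by (rule slc_weight_ineq[OF w]) auto
    finally show ?thesis .
   qed
   thus "ennreal (a powr (1 - 1/2) * b powr (1/2)) <= ennreal (rho ((1 - 1/2) *. x + (1/2) *. y))"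
    by (rule ennreal_leI)
  qed (use PQ0 in auto)
  also have "(NL x. ennreal (rho x)) = ennreal m" using enn[of "%_. 1"] by (simp add: m_def)
  finally have "sqrt P * sqrt Q <= m" using m0 PQ0 by (simp add: powr_half_sqrt)
  hence "(sqrt P * sqrt Q)^2 <= m^2" using PQ0 by (intro power_mono) auto
  hence "P * Q <= m^2" using PQ0 by (simp add: power_mult_distrib)
  moreover have "(m + tau^2 * (U / 2) - tau ^ 3 * (E * m)) * (m + tau^2 * (U / 2 - h) - tau ^ 3 * (E * m)) <= P * Q"
   using P Q pos PQ0 by (intro mult_mono) auto
  ultimately show ?thesis by simp
 qed
 show ?thesis
 proof (cases "m = 0")
  case True
  have "U <= (LINT x|M. B^2)" unfolding U_def by (rule integral_mono) (use iu u2 in auto)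
  also have "... = 0" using True by (simp add: m_def)
  finally show ?thesis using k by (simp add: U_def order_trans)
 next
  case False
  with m0 have m: "m > 0" by simp
  let ?a = "%tau::real. m + tau^2 * (U / 2) - tau ^ 3 * (E * m)" and ?b = "%tau::real. m + tau^2 * (U / 2 - h) - tau ^ 3 * (E * m)"
  have lim: "(?a \<longlongrightarrow> m + 0^2 * (U / 2) - 0 ^ 3 * (E * m)) (at_right 0)"
   "(?b \<longlongrightarrow> m + 0^2 * (U / 2 - h) - 0 ^ 3 * (E * m)) (at_right 0)" by (intro tendsto_intros)+
  have "\<forall>\<^sub>F tau in at_right 0. 0 < ?a tau" "\<forall>\<^sub>F tau in at_right 0. 0 < ?b tau"
   by (rule order_tendstoD[OF lim(1)] order_tendstoD[OF lim(2)]; use m in simp)+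
  moreover have "\<forall>\<^sub>F tau in at_right 0. 0 < tau & tau < tau0"
   unfolding eventually_at_right_field using t0 by blast
  \<comment> \<open>The product in \<open>key\<close> is \<open>m^2 + tau^2 * m * (U - h)\<close> up
    to higher order; dividing by \<open>tau^2\<close> isolates the claim.\<close>
  ultimately have ev: "\<forall>\<^sub>F tau in at_right 0.
   m * (U - h - 2 * tau * (E * m)) + tau^2 * ((U / 2 - tau * (E * m)) * (U / 2 - h - tau * (E * m))) <= 0"
  proof eventually_elim
   case (elim tau)
   have "tau^2 * (m * (U - h - 2 * tau * (E * m)) + tau^2 * ((U / 2 - tau * (E * m)) * (U / 2 - h - tau * (E * m))))
    = ?a tau * ?b tau - m^2" by (simp add: power2_eq_square power3_eq_cube algebra_simps)
   also have "... <= 0" using key[of tau] elim by simp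
   finally show ?case using elim by (simp add: mult_le_0_iff)
  qed
  have "((%tau. m * (U - h - 2 * tau * (E * m)) + tau^2 * ((U / 2 - tau * (E * m)) * (U / 2 - h - tau * (E * m))))
    \<longlongrightarrow> m * (U - h - 2 * 0 * (E * m)) + 0^2 * ((U / 2 - 0 * (E * m)) * (U / 2 - h - 0 * (E * m)))) (at_right 0)"
   by (intro tendsto_intros)
  from tendsto_upperbound[OF this ev] have "m * (U - h) <= 0" by simp
  thus ?thesis using m by (simp add: mult_le_0_iff U_def h_def)
 qed
qed


text \<open>A slope bound whose radius depends on the point is made uniform by using
  \<open>H j\<close>, the largest slope seen within distance \<open>1 / Suc j\<close>, cut off at
  \<open>L\<close> and kept above \<open>g\<close>. It tends almost everywhere to \<open>g\<close>,
  the minimum of \<open>G\<close> and \<open>L\<close>, so dominated convergence applies.\<close>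

lemma poincare_local_slope:
 fixes rho u G :: "'a::euclidean_space => real"
 defines "M \<equiv> dens rho"
 assumes k: "ka > 0" and w: "slc_weight ka rho" and fin: "finite_measure M" and [measurable]: "u : BM" "G : BM"
  and B: "!!x. abs (u x) <= B" and G0: "!!x. 0 <= G x"
  and lip: "!!x y. rho x > 0 ==> rho y > 0 ==> u y - u x <= L * norm (x - y)" and L0: "L >= 0"
  and slope: "AE y in lborel. rho y > 0 -->
   (ALL eta>0. EX r>0. ALL x. rho x > 0 --> norm (x - y) < r --> u y - u x <= (G y + eta) * norm (x - y))"
  and mean: "(LINT x|M. u x) = 0"
 shows "ennreal (LINT x|M. (u x)^2) <= (NN M (%x. ennreal (1 / ka * (G x)^2)))"
proof -
 interpret finite_measure M by fact
 note [measurable] = slc_weight_measurable[OF w]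
 have [measurable_cong, simp]: "sets M = sets borel" by (simp add: M_def)
 have sp [simp]: "space M = UNIV" by (simp add: M_def)
 let ?S = "{x. rho x > 0}"
 obtain D where D: "countable D" "D <= ?S" "?S <= closure D" using separable by blast
 have cD: "countable (insert 0 D)" using D by simp
 define g where "g x = min (G x) L" for x
 have [measurable]: "g : BM" unfolding g_def by measurable
 have g: "0 <= g x" "g x <= L" "g x <= G x" for x using G0[of x] L0 by (auto simp: g_def)
 \<comment> \<open>Only points of the countable dense set \<open>D\<close> are used, which keeps the
   supremum measurable; \<open>slopeH\<close> extends the estimate to all \<open>x\<close> by the
   Lipschitz bound.\<close>
 define q where "q j x y = (if x : D & x ~= y & norm (x - y) < 1 / real (Suc j)
  then min L (max 0 ((u y - u x) / norm (x - y))) else 0)" for j x y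
 have q: "0 <= q j x y" "q j x y <= L" for j x y using L0 by (auto simp: q_def)
 define H where "H j y = max (g y) (SUP x\<in>insert 0 D. q j x y)" for j y
 have bdd: "bdd_above ((%x. q j x y) ` insert 0 D)" for j y using q by (intro bdd_aboveI2[of _ _ L])
 have [measurable]: "q j x : BM" for j x unfolding q_def by measurable
 have Hm [measurable]: "H j : BM" for j
  unfolding H_def using bdd by (intro borel_measurable_max borel_measurable_cSUP[OF cD]) auto
 have HL: "H j y <= L" for j y unfolding H_def using g(2) q by (intro max.boundedI cSUP_least) auto
 have H0: "0 <= H j y" for j y using g(1)[of y] by (simp add: H_def le_max_iff_disj)
 have slopeH: "u y - u x <= H j y * norm (x - y)" if x: "rho x > 0" and y: "rho y > 0" and d: "norm (x - y) < 1 / real (Suc j)" for x y j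
 proof -
  have xy: "u y - u x <= H j y * norm (x - y)" if x: "x : D" "norm (x - y) < 1 / real (Suc j)" for x
  proof (cases "x = y")
   case False
   have "(u y - u x) / norm (x - y) <= L" using lip[of x y] x y D False by (auto simp: field_simps)
   hence "(u y - u x) / norm (x - y) <= q j x y" using x False by (simp add: q_def)
   also have "... <= H j y" unfolding H_def using x by (intro max.coboundedI2 cSUP_upper bdd) auto
   finally show ?thesis using False by (simp add: field_simps)
  qed simp
  obtain X where X: "!!n. X n : D" "X ----> x" using D(3) x closure_sequential[of x D] by blast
  have lim: "(%n. norm (X n - y)) ----> norm (x - y)" by (intro tendsto_intros X)
  have "\<forall>\<^sub>F n in sequentially. norm (X n - y) < 1 / real (Suc j)" by (rule order_tendstoD(2)[OF lim d])
  hence ev: "\<forall>\<^sub>F n in sequentially. u y - u x <= H j y * norm (X n - y) + L * norm (x - X n)"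
  proof eventually_elim
   case (elim n)
   have "X n : ?S" using X(1) D(2) by blast
   hence "u (X n) - u x <= L * norm (x - X n)" using lip[OF x] by simp
   thus ?case using xy[OF X(1) elim] by simp
  qed
  have "(%n. H j y * norm (X n - y) + L * norm (x - X n)) ----> H j y * norm (x - y) + L * norm (x - x)"
   by (intro tendsto_intros X)
  from tendsto_lowerbound[OF this ev] show ?thesis by simp
 qed
 have le: "(LINT x|M. (u x)^2) <= 1 / ka * (LINT x|M. (H j x)^2)" for j unfolding M_def
  by (rule poincare_uniform_slope[OF k w, of u "H j" B L "1 / real (Suc j)"])
    (use fin mean B H0 HL lip slopeH in "auto simp: M_def[symmetric]")
 have AEH: "AE y in M. (%j. (H j y)^2) ----> (g y)^2"
 proof -
  have "AE y in M. rho y > 0 & (ALL eta>0. EX r>0. ALL x. rho x > 0 --> norm (x - y) < r --> u y - u x <= (G y + eta) * norm (x - y))"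
   unfolding M_def by (subst AE_density, measurable) (use slope in eventually_elim, auto)
  thus ?thesis
  proof eventually_elim
   case (elim y)
   have "(%j. H j y) ----> g y"
   proof (rule LIMSEQ_I)
    fix e :: real assume "e > 0"
    then obtain r where r: "r > 0" "!!x. rho x > 0 ==> norm (x - y) < r ==> u y - u x <= (G y + e / 2) * norm (x - y)"
     using elim half_gt_zero by blast
    obtain N where N: "1 / real (Suc N) < r" using r(1) by (rule nat_approx_posE)
    have "norm (H j y - g y) < e" if "N <= j" for j
    proof -
     have jN: "1 / real (Suc j) <= 1 / real (Suc N)" using that by (simp add: field_simps)
     have "q j x y <= g y + e / 2" for x
     proof (cases "x : D & x ~= y & norm (x - y) < 1 / real (Suc j)")
      case True
      hence "rho x > 0" "norm (x - y) < r" using D(2) jN N by auto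
      from r(2)[OF this] have "(u y - u x) / norm (x - y) <= G y + e / 2" using True by (simp add: field_simps)
      thus ?thesis using True G0[of y] `e > 0` L0 by (auto simp: q_def g_def min_def)
     qed (use g(1)[of y] `e > 0` in "auto simp: q_def")
     hence "(SUP x\<in>insert 0 D. q j x y) <= g y + e / 2" by (intro cSUP_least) auto
     hence "H j y <= g y + e / 2" using `e > 0` by (simp add: H_def)
     moreover have "g y <= H j y" by (simp add: H_def)
     ultimately show ?thesis using `e > 0` by simp
    qed
    thus "EX no. ALL n>=no. norm (H n y - g y) < e" by blast
   qed
   thus ?case by (rule tendsto_power)
  qed
 qed
 have ig: "integrable M (%x. 1 / ka * (g x)^2)"
 proof (rule integrable_const_bound[of _ "1 / ka * L^2"])
  show "AE x in M. norm (1 / ka * (g x)^2) <= 1 / ka * L^2"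
   using power_mono[OF g(2) g(1), of _ 2] k by (intro AE_I2) (simp add: divide_right_mono)
 qed simp
 have "(%j. (LINT x|M. (H j x)^2)) ----> (LINT x|M. (g x)^2)"
 proof (rule integral_dominated_convergence[where w = "%_. L^2"])
  show "AE x in M. norm ((H j x)^2) <= L^2" for j using power_mono[OF HL H0, of _ _ 2] by (intro AE_I2) simp
 qed (use AEH in auto)
 from tendsto_mult_left[OF this, of "1 / ka"]
 have "(LINT x|M. (u x)^2) <= 1 / ka * (LINT x|M. (g x)^2)" by (rule LIMSEQ_le_const) (use le in blast)
 hence "ennreal (LINT x|M. (u x)^2) <= ennreal (LINT x|M. 1 / ka * (g x)^2)"
  unfolding integral_mult_right_zero by (rule ennreal_leI)
 also have "ennreal (LINT x|M. 1 / ka * (g x)^2) = (NN M (%x. ennreal (1 / ka * (g x)^2)))"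
  using k ig by (intro nn_integral_eq_integral[symmetric]) auto
 also have "(NN M (%x. ennreal (1 / ka * (g x)^2))) <= (NN M (%x. ennreal (1 / ka * (G x)^2)))"
  using k power_mono[OF g(3) g(1), of _ 2] by (intro nn_integral_mono ennreal_leI mult_left_mono) auto
 finally show ?thesis .
qed

lemma nn_integral_lborel_affine:
 fixes f :: "'a::euclidean_space => ennreal"
 assumes [measurable]: "f : BM" and "c ~= 0"
 shows "(NL x. f x) = ennreal (abs c ^ DIM('a)) * (NL x. f (t + c *. x))" by (subst lborel_affine[OF assms(2), of t])
   (simp add: nn_integral_density nn_integral_distr nn_integral_cmult)

text \<open>Two affine substitutions in one block each, \<open>x = y + 2 *. b\<close> and then
  \<open>y = a - b\<close>; the first one carries the whole Jacobian.\<close>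

lemma nn_integral_rotate:
 fixes f :: "'a::euclidean_space => 'a => ennreal"
 assumes [measurable]: "(%(x, y). f x y) : bm (borel >< borel)"
 shows "(NL y. (NL x. f x y)) = ennreal (2 ^ DIM('a)) * (NL a. (NL b. f (a + b) (a - b)))"
proof -
 have [measurable]: "(%w. f (g w) (h w)) : bm N"
  if [measurable]: "g : N ->M borel" "h : N ->M borel" for g h and N :: "'z measure"
 proof -
  have "(%w. (%(x, y). f x y) (g w, h w)) : bm N" by measurable
  thus ?thesis by simp
 qed
 have "(NL y. (NL x. f x y)) = (NL y. ennreal (2 ^ DIM('a)) * (NL b. f (y + 2 *. b) y))"
  by (rule nn_integral_cong, subst nn_integral_lborel_affine[where c = 2]) (auto simp del: ennreal_power)
 also have "... = ennreal (2 ^ DIM('a)) * (NL y. (NL b. f (y + 2 *. b) y))" by (rule nn_integral_cmult) measurable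
 also have "(NL y. (NL b. f (y + 2 *. b) y)) = (NL b. (NL y. f (y + 2 *. b) y))"
  by (rule lborel_pair.Fubini') measurable
 also have "... = (NL b. (NL a. f (a + b) (a - b)))"
 proof (rule nn_integral_cong)
  fix b :: 'a
  have e: "- b + 1 *. a + 2 *. b = a + b" "- b + 1 *. a = a - b" for a by (simp_all add: algebra_simps scaleR_2)
  have "(NL y. f (y + 2 *. b) y) = ennreal (abs 1 ^ DIM('a)) * (NL a. f (- b + 1 *. a + 2 *. b) (- b + 1 *. a))"
   by (rule nn_integral_lborel_affine) auto
  thus "(NL y. f (y + 2 *. b) y) = (NL a. f (a + b) (a - b))" unfolding e(1) unfolding e(2) by simp
 qed
 also have "... = (NL a. (NL b. f (a + b) (a - b)))" by (rule lborel_pair.Fubini') measurable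
 finally show ?thesis .
qed

lemma slc_weight_translate_prod:
 assumes w: "slc_weight ka rho"
 shows "slc_weight (2 * ka) (%b. rho (a + b) * rho (a - b))" unfolding slc_weight_def
proof (intro conjI allI impI)
 note [measurable] = slc_weight_measurable[OF w]
 show "(%b. rho (a + b) * rho (a - b)) : BM" by measurable
 note nn = slc_weight_nonneg[OF w]
 show "0 <= rho (a + b) * rho (a - b)" for b using nn by simp
 fix x y :: 'a and s :: real assume s: "0 < s" "s < 1"
 let ?m = "(1 - s) *. x + s *. y"
 have m: "(1 - s) *. (a + x) + s *. (a + y) = a + ?m" "(1 - s) *. (a - x) + s *. (a - y) = a - ?m"
  "norm (a - x - (a - y)) = norm (x - y)" by (auto simp: algebra_simps norm_minus_commute)
 let ?e = "exp (ka * s * (1 - s) / 2 * (norm (x - y))^2)"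
 have "(rho (a + x) powr (1 - s) * rho (a + y) powr s * ?e) * (rho (a - x) powr (1 - s) * rho (a - y) powr s * ?e)
  <= rho (a + ?m) * rho (a - ?m)"
  using slc_weight_ineq[OF w s, of "a + x" "a + y"] slc_weight_ineq[OF w s, of "a - x" "a - y"] nn
  unfolding m by (intro mult_mono) auto
 moreover have "?e * ?e = exp (2 * ka * s * (1 - s) / 2 * (norm (x - y))^2)" by (simp add: exp_add[symmetric])
 ultimately show "(rho (a + x) * rho (a - x)) powr (1 - s) * (rho (a + y) * rho (a - y)) powr s
   * exp (2 * ka * s * (1 - s) / 2 * (norm (x - y))^2) <= rho (a + ?m) * rho (a - ?m)"
  using nn by (simp add: powr_mult mult_ac)
qed

text \<open>In the coordinates \<open>x = a + b\<close>, \<open>y = a - b\<close> the difference \<open>u x - u y\<close> is odd in \<open>b\<close>, so it has mean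
  zero on every fibre, and there the weight is \<open>2\<kappa>\<close>-strongly log-concave.\<close>

lemma doubled_poincare_bounded:
 fixes rho u :: "'a::euclidean_space => real" and g :: "'a => 'a"
 assumes k: "ka > 0" and w: "slc_weight ka rho" and fin: "(NL x. ennreal (rho x)) < \<infinity>"
  and [measurable]: "u : BM" "g : BM" and B: "!!x. abs (u x) <= B" and L: "L >= 0"
  and lip: "!!x y. rho x > 0 ==> rho y > 0 ==> abs (u y - u x) <= L * norm (x - y)"
  and g: "AE x in lborel. rho x > 0 --> GDERIV u x :> g x"
 shows "(NL y. (NL x. ennreal (rho x * rho y * (u x - u y)^2)))
  <= (NL y. (NL x. ennreal (rho x * rho y * (1 / (2 * ka) * (norm (g x + g y))^2))))"
proof -
 note [measurable] = slc_weight_measurable[OF w]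
 note nn = slc_weight_nonneg[OF w]
 have "(NL y. (NL x. ennreal (rho x * rho y))) = (NL x. ennreal (rho x)) * (NL x. ennreal (rho x))"
  using nn by (simp add: ennreal_mult' nn_integral_cmult nn_integral_multc)
 also have "... < \<infinity>" using fin by (simp add: ennreal_mult_less_top)
 also have "(NL y. (NL x. ennreal (rho x * rho y)))
  = ennreal (2 ^ DIM('a)) * (NL a. (NL b. ennreal (rho (a + b) * rho (a - b))))"
  by (rule nn_integral_rotate) measurable
 finally have "(NL a. (NL b. ennreal (rho (a + b) * rho (a - b)))) ~= \<infinity>"
  by (auto simp: ennreal_mult_less_top simp del: ennreal_power)
 hence fib: "AE a in lborel. (NL b. ennreal (rho (a + b) * rho (a - b))) ~= \<infinity>"
  by (intro nn_integral_PInf_AE) measurable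
 have fibre: "(NL b. ennreal (rho (a + b) * rho (a - b) * (u (a + b) - u (a - b))^2))
  <= (NL b. ennreal (rho (a + b) * rho (a - b) * (1 / (2 * ka) * (norm (g (a + b) + g (a - b)))^2)))"
  if fa: "(NL b. ennreal (rho (a + b) * rho (a - b))) ~= \<infinity>" for a
 proof -
  let ?w = "%b. rho (a + b) * rho (a - b)" and ?q = "%b. u (a + b) - u (a - b)"
  let ?M = "density lborel (%b. ennreal (?w b))" and ?G = "%b. norm (g (a + b) + g (a - b))"
  have fm: "finite_measure ?M" by (rule finite_measureI) (use fa in "simp add: emeasure_density")
  interpret finite_measure ?M by fact
  have qB: "abs (?q b) <= 2 * B" for b using B[of "a + b"] B[of "a - b"] by linarith
  have pos: "rho (a + b) > 0 & rho (a - b) > 0" if "?w b > 0" for b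
   using that nn[of "a + b"] nn[of "a - b"] by (simp add: zero_less_mult_iff)
  have AE_shift: "AE b in lborel. P (t + c *. b)" if "AE x in lborel. P x" "c ~= 0" for P and t :: 'a and c
  proof -
   have "EX N:null_sets lborel. {x. ~ P x} <= N" using that(1) by (simp add: eventually_ae_filter)
   then obtain N where N: "{x. ~ P x} <= N" "N : null_sets lborel" by blast
   have [measurable]: "N : sets borel" using N(2) by (simp add: null_sets_def)
   have "vol N = ennreal (abs c ^ DIM('a)) * (NL b. indicator N (t + c *. b))"
    using nn_integral_lborel_affine[of "indicator N" c t] that(2) by simp
   hence "(NL b. indicator N (t + c *. b)) = 0" using N(2) that(2) by (simp add: null_setsD1)
   hence "AE b in lborel. indicator N (t + c *. b) = (0::ennreal)" by (subst (asm) nn_integral_0_iff_AE) auto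
   thus ?thesis by eventually_elim (use N(1) in "auto split: split_indicator_asm")
  qed
  have g1: "AE b in lborel. rho (a + b) > 0 --> GDERIV u (a + b) :> g (a + b)" using AE_shift[OF g, of 1 a] by simp
  have g2: "AE b in lborel. rho (a - b) > 0 --> GDERIV u (a - b) :> g (a - b)" using AE_shift[OF g, of "-1" a] by simp
  have "ennreal (LINT b|?M. (?q b)^2) <= (NN ?M (%b. ennreal (1 / (2 * ka) * (?G b)^2)))"
  proof (rule poincare_local_slope[where B = "2 * B" and L = "2 * L"])
   show "slc_weight (2 * ka) ?w" by (rule slc_weight_translate_prod[OF w])
   show "abs (?q b) <= 2 * B" for b by (rule qB)
   show "?q y - ?q x <= 2 * L * norm (x - y)" if "?w x > 0" "?w y > 0" for x y
    using lip[of "a + x" "a + y"] lip[of "a - y" "a - x"] pos[OF that(1)] pos[OF that(2)]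
    by (simp add: norm_minus_commute abs_le_iff algebra_simps)
   \<comment> \<open>The second argument runs against \<open>b\<close>, so the
     \<open>b\<close>-gradient of the difference of values is the sum of gradients,
     \<open>g (a + b) + g (a - b)\<close>.\<close>
   show "AE y in lborel. ?w y > 0 -->
    (ALL eta>0. EX r>0. ALL x. ?w x > 0 --> norm (x - y) < r --> ?q y - ?q x <= (?G y + eta) * norm (x - y))"
    using g1 g2
   proof eventually_elim
    case (elim b)
    show ?case
    proof (intro impI allI)
     fix eta :: real assume b: "?w b > 0" and "eta > 0"
     hence e: "eta / 2 > 0" by simp
     have G: "GDERIV u (a + b) :> g (a + b)" "GDERIV u (a - b) :> g (a - b)" using elim pos[OF b] by auto
     obtain d1 where d1: "d1 > 0" "!!y. norm (y - (a + b)) < d1 ==>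
       abs (u y - u (a + b) - (y - (a + b)) <.> g (a + b)) <= eta / 2 * norm (y - (a + b))"
      using gderivE[OF G(1) e] by metis
     obtain d2 where d2: "d2 > 0" "!!y. norm (y - (a - b)) < d2 ==>
       abs (u y - u (a - b) - (y - (a - b)) <.> g (a - b)) <= eta / 2 * norm (y - (a - b))"
      using gderivE[OF G(2) e] by metis
     have "?q b - ?q x <= (?G b + eta) * norm (x - b)" if x: "norm (x - b) < min d1 d2" for x
     proof -
      have n: "norm (a + x - (a + b)) = norm (x - b)" "norm (a - x - (a - b)) = norm (x - b)"
       by (simp_all add: norm_minus_commute)
      have "abs (u (a + x) - u (a + b) - (x - b) <.> g (a + b)) <= eta / 2 * norm (x - b)"
       using d1(2)[of "a + x"] x by (simp add: n)
      moreover have "abs (u (a - x) - u (a - b) - (b - x) <.> g (a - b)) <= eta / 2 * norm (x - b)"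
       using d2(2)[of "a - x"] x unfolding n by (simp add: algebra_simps)
      moreover have "- ((x - b) <.> (g (a + b) + g (a - b))) <= norm (x - b) * ?G b"
       using Cauchy_Schwarz_ineq2[of "x - b" "g (a + b) + g (a - b)"] by linarith
      ultimately have "?q b - ?q x <= eta / 2 * norm (x - b) + eta / 2 * norm (x - b) + norm (x - b) * ?G b"
       unfolding abs_le_iff inner_add_right inner_diff_left by linarith
      thus ?thesis by (simp add: algebra_simps)
     qed
     thus "EX r>0. ALL x. ?w x > 0 --> norm (x - b) < r --> ?q b - ?q x <= (?G b + eta) * norm (x - b)"
      using d1(1) d2(1) by (intro exI[of _ "min d1 d2"]) auto
    qed
   qed
   have "(LINT b|?M. ?q b) = (LINT b|lborel. ?w b * ?q b)" using nn by (subst integral_density) auto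
   also have "... = (LINT b|(distr lborel borel (%x. 0 - x)). ?w b * ?q b)" by (simp only: lborel_distr_reflect)
   also have "... = (LINT b|lborel. ?w (0 - b) * ?q (0 - b))" by (rule integral_distr) measurable
   also have "... = - (LINT b|lborel. ?w b * ?q b)"
    by (subst Bochner_Integration.integral_minus[symmetric], rule I_cong)
      (auto simp: algebra_simps)
   also have "(LINT b|lborel. ?w b * ?q b) = (LINT b|?M. ?q b)" using nn by (subst integral_density) auto
   finally show "(LINT b|?M. ?q b) = 0" by simp
  qed (use k L fm in auto)
  moreover have "ennreal (LINT b|?M. (?q b)^2) = (NN ?M (%b. ennreal ((?q b)^2)))"
  proof (rule nn_integral_eq_integral[symmetric])
   show "integrable ?M (%b. (?q b)^2)"
    by (rule integrable_const_bound[of _ "(2 * B)^2"]) (use power_mono[OF qB abs_ge_zero, of _ 2] in auto)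
  qed simp
  moreover have "(NN ?M (%b. ennreal (h b))) = (NL b. ennreal (?w b * h b))" if "h : BM" "!!b. 0 <= h b" for h
   using that nn by (subst nn_integral_density) (auto simp: ennreal_mult')
  ultimately show ?thesis using k by simp
 qed
 have "(NL y. (NL x. ennreal (rho x * rho y * (u x - u y)^2)))
  = ennreal (2 ^ DIM('a)) * (NL a. (NL b. ennreal (rho (a + b) * rho (a - b) * (u (a + b) - u (a - b))^2)))"
  by (rule nn_integral_rotate) measurable
 also have "... <= ennreal (2 ^ DIM('a)) * (NL a. (NL b. ennreal (rho (a + b) * rho (a - b) *
   (1 / (2 * ka) * (norm (g (a + b) + g (a - b)))^2))))"
  by (intro mult_left_mono nn_integral_mono_AE) (use fib fibre in "auto elim: eventually_mono")
 also have "... = (NL y. (NL x. ennreal (rho x * rho y * (1 / (2 * ka) * (norm (g x + g y))^2))))"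
  by (rule nn_integral_rotate[symmetric]) measurable
 finally show ?thesis .
qed

text \<open>\<open>K n\<close> consists of the points of a large ball around which a ball of radius
  \<open>2 * r n\<close> stays in the closure of \<open>Om\<close>. It is an intersection of
  translates of that closure, hence closed and convex, and the closure of an open convex set has the
  set itself as interior.\<close>

lemma convex_exhaustion:
 fixes Om :: "'a::euclidean_space set"
 assumes o: "open Om" and c: "convex Om"
 obtains K :: "nat => 'a set" and r where "!!n. compact (K n)" "!!n. convex (K n)" "!!n. r n > 0"
  "!!n x. x : K n ==> cball x (r n) <= Om" "incseq K" "(UN n. K n) = Om"
proof -
 define r where "r n = 1 / real (Suc n)" for n
 define K where "K n = cball 0 (real n) Int (\<Inter>w\<in>cball 0 (2 * r n). (%x. x + w) -` closure Om)" for n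
 have r: "r n > 0" "m <= n ==> r n <= r m" for m n by (auto simp: r_def field_simps)
 have cl: "closed ((%x. x + w) -` closure Om)" for w :: 'a
  by (intro continuous_closed_vimage) (auto intro!: continuous_intros)
 have cv: "convex ((%x. x + w) -` closure Om)" for w :: 'a
 proof -
  have "(%x. x + w) -` closure Om = (%x. x - w) ` closure Om" by (force simp: image_iff intro!: bexI[of _ "_ + w"])
  thus ?thesis using convex_translation_subtract[OF convex_closure[OF c]] by simp
 qed
 have cball: "cball x (r n) <= Om" if "x : K n" for x n
 proof -
  have "cball x (2 * r n) <= closure Om"
  proof
   fix y assume "y : cball x (2 * r n)"
   hence "y - x : cball 0 (2 * r n)" by (simp add: dist_norm norm_minus_commute)
   hence "x + (y - x) : closure Om" using that unfolding K_def by blast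
   thus "y : closure Om" by simp
  qed
  hence "ball x (2 * r n) <= interior (closure Om)" by (meson ball_subset_cball interior_maximal open_ball order_trans)
  also have "... = Om" using convex_interior_closure[OF c] interior_open[OF o] by simp
  finally show ?thesis using r(1)[of n] by (auto simp: subset_iff)
 qed
 show thesis
 proof (rule that[of K r, OF _ _ r(1) cball])
  show "compact (K n)" for n unfolding K_def by (intro compact_Int_closed compact_cball closed_INT ballI cl)
  show "convex (K n)" for n unfolding K_def by (intro convex_Int convex_INT convex_cball cv)
  show "incseq K"
  proof (rule incseq_SucI, rule subsetI)
   fix n x assume x: "x : K n"
   have "cball 0 (2 * r (Suc n)) <= cball (0::'a) (2 * r n)" using r(2)[of n "Suc n"] by (intro subset_cball) simp
   thus "x : K (Suc n)" using x unfolding K_def by auto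
  qed
  have "EX n. x : K n" if x: "x : Om" for x
  proof -
   obtain e where e: "e > 0" "ball x e <= Om" using o x open_contains_ball by blast
   obtain N1 where N1: "norm x <= real N1" using real_arch_simple by blast
   obtain N2 where N2: "r N2 < e / 2" using nat_approx_posE[of "e / 2"] e(1) unfolding r_def by auto
   let ?n = "max N1 N2"
   have "x + w : closure Om" if "w : cball 0 (2 * r ?n)" for w
   proof -
    have "norm w < e" using that N2 r(2)[of N2 ?n] by simp
    hence "x + w : ball x e" by (simp add: dist_norm)
    thus ?thesis using e(2) closure_subset by blast
   qed
   thus ?thesis using N1 by (intro exI[of _ ?n]) (auto simp: K_def)
  qed
  moreover have "x : Om" if "x : K n" for x n using cball[OF that] r(1)[of n] by (auto simp: subset_iff)
  ultimately show "(UN n. K n) = Om" by auto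
 qed
qed

text \<open>The segment from \<open>x\<close> to \<open>y\<close> is prolonged by length
  \<open>r\<close> to \<open>z\<close>. As \<open>y\<close> lies between \<open>x\<close> and
  \<open>z\<close>, the increment is at most the fraction \<open>s = d / (d + r)\<close> of the
  oscillation \<open>2 * B\<close>.\<close>

lemma convex_on_lipschitz:
 fixes phi :: "'a::real_normed_vector => real"
 assumes c: "convex_on Om phi" and r: "r > 0" and xy: "x : Om" "cball y r <= Om"
  and B: "abs (phi x) <= B" "!!z. z : cball y r ==> abs (phi z) <= B"
 shows "phi y - phi x <= 2 * B / r * norm (y - x)"
proof (cases "x = y")
 case False
 define d where "d = norm (y - x)"
 have d: "d > 0" using False by (simp add: d_def)
 define z where "z = y + (r / d) *. (y - x)"
 define s where "s = d / (d + r)"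
 have s: "0 < s" "s <= 1" "s * 2 * B <= d / r * (2 * B)"
 proof -
  have "0 <= B" using B(1) by linarith
  moreover have "s <= d / r" using d r by (simp add: s_def frac_le)
  ultimately show "s * 2 * B <= d / r * (2 * B)" using mult_right_mono[of s "d / r" "2 * B"] by simp
 qed (use d r in "auto simp: s_def")
 have z: "z : cball y r" using d r by (simp add: z_def dist_norm d_def)
 have "d + r ~= 0" using d r by simp
 hence e: "s * (r / d) = 1 - s" using d by (simp add: s_def field_simps)
 have "s *. z = s *. y + (1 - s) *. (y - x)" by (simp only: z_def scaleR_add_right scaleR_scaleR e)
 hence y: "(1 - s) *. x + s *. z = y" by (simp add: algebra_simps)
 have "phi y <= (1 - s) * phi x + s * phi z" using convex_onD[OF c, of s x z] s z xy unfolding y by auto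
 hence "phi y - phi x <= s * (phi z - phi x)" by (simp add: algebra_simps)
 also have "... <= s * (2 * B)" using s B(1) B(2)[OF z] by (intro mult_left_mono) auto
 also have "... <= d / r * (2 * B)" using s(3) by (simp only: mult.assoc)
 also have "... = 2 * B / r * norm (y - x)" by (simp add: d_def)
 finally show ?thesis .
qed simp

lemma slc_weight_restrict:
 fixes rho h :: "'a::euclidean_space => real" and K :: "'a set"
 defines "mu \<equiv> dens rho" and "M \<equiv> density lborel (%x. ennreal (rho x * indicator K x))"
 assumes w: "slc_weight ka rho" and K: "convex K" and Km [measurable]: "K : sets borel" and fm: "finite_measure mu"
 shows "slc_weight ka (%x. rho x * indicator K x)" "finite_measure M"
  and "f : BM ==> nn_integral M f <= nn_integral mu f"
  and "h : BM ==> (LINT x|M. h x) = (LINT x|mu. indicator K x * h x)"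
  and "h : BM ==> integrable M h \<longleftrightarrow> integrable mu (%x. indicator K x * h x)"
proof -
 let ?w = "%x. rho x * indicator K x"
 note [measurable] = slc_weight_measurable[OF w] and nn = slc_weight_nonneg[OF w]
 have sets [measurable_cong]: "sets mu = sets borel" by (simp add: mu_def)
 show "slc_weight ka ?w" unfolding slc_weight_def
 proof (intro conjI allI impI)
  show "?w : BM" by measurable
  show "0 <= ?w x" for x using nn by simp
  fix x y and s :: real assume s: "0 < s" "s < 1"
  show "?w x powr (1 - s) * ?w y powr s * exp (ka * s * (1 - s) / 2 * (norm (x - y))^2) <= ?w ((1 - s) *. x + s *. y)"
  proof (cases "x : K & y : K")
   case True
   hence "(1 - s) *. x + s *. y : K" using s by (intro convexD K) auto
   thus ?thesis using True slc_weight_ineq[OF w s] by simp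
  qed (use nn s in auto)
 qed
 have M: "M = density mu (%x. ennreal (indicator K x))"
  unfolding M_def mu_def using nn by (subst density_density_eq) (auto simp: ennreal_mult')
 show le: "nn_integral M f <= nn_integral mu f" if "f : BM" for f
  unfolding M using that by (subst nn_integral_density) (auto intro!: nn_integral_mono split: split_indicator)
 show "finite_measure M" using le[of "%_. 1"] finite_measure.emeasure_finite[OF fm, of "space mu"]
  by (intro finite_measureI) (auto simp: top_unique M)
 assume h: "h : BM"
 thus "(LINT x|M. h x) = (LINT x|mu. indicator K x * h x)" unfolding M by (subst integral_density) auto
 show "integrable M h \<longleftrightarrow> integrable mu (%x. indicator K x * h x)" unfolding M using h by (subst integrable_density) auto
qed

lemma truncated_integral_tendsto:
 fixes h :: "'a => real"
 assumes K: "incseq K" "!!n. K n : sets M" and ae: "AE x in M. x : (UN n. K n)" and h: "integrable M h"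
 shows "(%n. (LINT x|M. indicator (K n) x * h x)) ----> (LINT x|M. h x)"
proof (rule integral_dominated_convergence[where w = "%x. norm (h x)"])
 show "AE x in M. (%n. indicator (K n) x * h x) ----> h x" using ae
 proof eventually_elim
  case (elim x) thus ?case using tendsto_mult_right[OF LIMSEQ_indicator_incseq[OF K(1), of x], of "h x"] by simp
 qed
qed (use h K(2) in "auto split: split_indicator")

text \<open>The case \<open>s = -1\<close> produces twice the unnormalised variance; the case
  \<open>s = 1\<close> evaluates the right-hand side of the doubled inequality, where the mean
  enters with a plus sign.\<close>

lemma (in finite_measure) doubled_integral:
 fixes h :: "'a => 'b::euclidean_space"
 assumes h: "integrable M h" "integrable M (%x. (norm (h x))^2)" and k: "0 <= k" and s: "s = 1 | s = -1"
 shows "(NN M (%y. (NN M (%x. ennreal (k * (norm (h x + s *. h y))^2)))))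
  = ennreal (2 * k * (measure M (space M) * (LINT x|M. (norm (h x))^2) + s * (norm (LINT x|M. h x))^2))"
proof -
 let ?a = "(LINT x|M. (norm (h x))^2)" and ?b = "(LINT x|M. h x)" and ?m = "measure M (space M)"
 let ?f = "%y. k * ?a + 2 * k * s * (?b <.> h y) + ?m * (k * (norm (h y))^2)"
 have e: "k * (norm (h x + s *. h y))^2 = k * (norm (h x))^2 + 2 * k * s * (h x <.> h y) + k * (norm (h y))^2" for x y
  using s by (auto simp: power2_norm_eq_inner inner_simps inner_commute algebra_simps)
 have i: "integrable M (%x. k * (norm (h x + s *. h y))^2)"
  and v: "(LINT x|M. k * (norm (h x + s *. h y))^2) = ?f y" for y unfolding e using h by simp_all
 have "(NN M (%x. ennreal (k * (norm (h x + s *. h y))^2))) = ennreal (?f y)" for y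
  unfolding v[symmetric] by (rule nn_integral_eq_integral[OF i]) (use k in simp)
 moreover have "(NN M (%y. ennreal (?f y))) = ennreal (LINT y|M. ?f y)"
 proof (rule nn_integral_eq_integral)
  show "AE y in M. 0 <= ?f y" unfolding v[symmetric] by (intro AE_I2 integral_nonneg_AE) (use k in simp)
 qed (use h in simp)
 moreover have "(LINT y|M. ?f y) = 2 * k * (?m * ?a + s * (norm ?b)^2)" using h by (simp add: dot_square_norm algebra_simps)
 ultimately show ?thesis by simp
qed

text \<open>The potentials may be unbounded, so the doubled inequality is first used on the compact
  convex sets \<open>K n\<close>, where \<open>u\<close> is bounded and Lipschitz and the restricted
  weight keeps its curvature. Square integrability of \<open>u\<close> is an outcome of the
  argument.\<close>

lemma doubled_poincare:
 fixes rho phi th :: "'a::euclidean_space => real" and T S :: "'a => 'a"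
 defines "mu \<equiv> dens rho"
 defines "u \<equiv> %x. phi x - th x" and "g \<equiv> %x. T x - S x"
 assumes k: "ka > 0" and w: "slc_weight ka rho" and n: "nice Om mu"
  and c: "convex_on Om phi" "convex_on Om th" and i: "integrable mu phi" "integrable mu th"
  and T: "T : BM" "S : BM" "sqint mu T" "sqint mu S"
  and G: "AE x in mu. GDERIV phi x :> T x" "AE x in mu. GDERIV th x :> S x"
 shows "integrable mu (%x. (u x)^2)"
  and "(LINT x|mu. (u x)^2) - (LINT x|mu. u x)^2 <= 1 / (2 * ka) * ((LINT x|mu. (norm (g x))^2) + (norm (LINT x|mu. g x))^2)"
proof -
 interpret prob_space mu by (rule nice_prob[OF n])
 have sets [measurable_cong, simp]: "sets mu = sets borel" by (rule nice_sets[OF n])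
 have sp [simp]: "space mu = UNIV" by (rule nice_space[OF n])
 have pU [simp]: "prob UNIV = 1" using prob_space by simp
 note [measurable] = slc_weight_measurable[OF w] T(1,2)
 note nn = slc_weight_nonneg[OF w]
 have um [measurable]: "u : BM" and iu: "integrable mu u"
  using i borel_measurable_integrable[OF i(1)] borel_measurable_integrable[OF i(2)]
  unfolding u_def by (auto simp: measurable_cong_sets[OF sets refl])
 have gm [measurable]: "g : BM" unfolding g_def by measurable
 have sg: "sqint mu g" unfolding g_def by (rule sqint_diff[OF T(3,4)])
 have ig: "integrable mu g" by (rule sqint_integrable[OF sg])
 have ig2: "integrable mu (%x. (norm (g x))^2)" using sg by (simp add: sqint_def)
 have Gu: "AE x in lborel. rho x > 0 --> GDERIV u x :> g x"
 proof -
  have "AE x in mu. GDERIV u x :> g x" using G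
  proof eventually_elim
   case (elim x) thus ?case unfolding u_def g_def gderiv_def inner_diff_right by (rule has_derivative_diff)
  qed
  thus ?thesis unfolding mu_def by (subst (asm) AE_density) auto
 qed
 define R where "R = 1 / (2 * ka) * ((LINT x|mu. (norm (g x))^2) + (norm (LINT x|mu. g x))^2)"
 have R0: "R >= 0" using k by (simp add: R_def)
 have dens: "(NL y. (NL x. ennreal (w x * w y * h x y))) = (NN (dens w) (%y. (NN (dens w) (%x. ennreal (h x y)))))"
  if [measurable]: "(%(x, y). h x y) : bm (borel >< borel)" "w : BM"
   and "!!x y. 0 <= h x y" "!!x. 0 <= w x" for h and w :: "'a => real"
 proof -
  have [measurable]: "(%w. h (g w) (g' w)) : bm N"
   if [measurable]: "g : N ->M borel" "g' : N ->M borel" for g g' and N :: "'z measure"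
  proof -
   have "(%w. (%(x, y). h x y) (g w, g' w)) : bm N" by measurable
   thus ?thesis by simp
  qed
  show ?thesis
   using that(4) by (simp add: nn_integral_density that(3) ennreal_mult' nn_integral_cmult[symmetric] mult_ac)
 qed
 have rhs: "(NN mu (%y. (NN mu (%x. ennreal (1 / (2 * ka) * (norm (g x + g y))^2))))) = ennreal (2 * R)"
  using doubled_integral[OF ig ig2, of "1 / (2 * ka)" 1] k by (simp add: R_def field_simps)
 obtain K r where K: "!!n. compact (K n)" "!!n. convex (K n)" "!!n. r n > 0"
  "!!n x. x : K n ==> cball x (r n) <= Om" "incseq K" "(UN n. K n) = Om"
  by (rule convex_exhaustion[OF nice_open[OF n] nice_convex[OF n]]) blast
 have Km [measurable]: "K n : sets borel" for n by (intro borel_compact K)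
 define a where "a n = (LINT x|mu. indicator (K n) x * u x)" for n
 define b where "b n = (LINT x|mu. indicator (K n) x * (u x)^2)" for n
 define m :: "nat => real" where "m n = (LINT x|mu. indicator (K n) x)" for n
 have bound: "EX B. ALL x:{y + w |y w. y : K n & w : cball 0 (r n)}. abs (phi x) <= B & abs (th x) <= B" for n
 proof -
  let ?N = "{y + w |y w. y : K n & w : cball 0 (r n)}"
  have N: "compact ?N" by (intro compact_sums K compact_cball)
  have sub: "?N <= Om"
  proof safe
   fix y w :: 'a assume "y : K n" "w : cball 0 (r n)"
   hence "y + w : cball y (r n)" by (simp add: dist_norm)
   with `y : K n` show "y + w : Om" using K(4) by blast
  qed
  have b: "bounded (h ` ?N)" if "convex_on Om h" for h :: "'a => real"
   by (intro compact_imp_bounded compact_continuous_image N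
     continuous_on_subset[OF convex_on_continuous[OF nice_open[OF n] that] sub])
  obtain B1 B2 where "ALL x:?N. abs (phi x) <= B1" "ALL x:?N. abs (th x) <= B2"
   using b[OF c(1)] b[OF c(2)] unfolding bounded_iff by (auto simp del: mem_Collect_eq)
  thus ?thesis by (intro exI[of _ "max B1 B2"]) fastforce
 qed
 have step: "integrable mu (%x. indicator (K n) x * (u x)^2) & m n * b n - (a n)^2 <= R" for n
 proof -
  let ?I = "%x. indicator (K n) x :: real"
  let ?N = "{y + w |y w. y : K n & w : cball 0 (r n)}"
  obtain B where B: "!!x. x : ?N ==> abs (phi x) <= B & abs (th x) <= B" using bound[of n] by blast
  have [measurable]: "?N : sets borel" by (intro borel_compact compact_sums K compact_cball)
  have KN: "cball y (r n) <= ?N" if "y : K n" for y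
  proof
   fix x assume "x : cball y (r n)"
   thus "x : ?N" using that by (intro CollectI exI[of _ y] exI[of _ "x - y"]) (auto simp: dist_norm norm_minus_commute)
  qed
  have KN': "y : ?N" if "y : K n" for y by (rule subsetD[OF KN[OF that]]) (use K(3)[of n] in simp)
  define v where "v x = indicator ?N x * u x" for x
  have [measurable]: "v : BM" unfolding v_def by measurable
  have vu: "v x = u x" if "x : K n" for x using KN'[OF that] by (simp add: v_def)
  have vB: "abs (v x) <= 2 * abs B" for x
  proof (cases "x : ?N")
   case True with B[OF True] show ?thesis by (auto simp: v_def u_def)
  qed (simp add: v_def)
  let ?w = "%x. rho x * ?I x"
  let ?M = "density lborel (%x. ennreal (?w x))"
  have wle: "?w x <= rho x" "0 <= ?w x" for x using nn[of x] by (auto split: split_indicator)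
  note rs = slc_weight_restrict[OF w K(2)[of n] Km finite_measure_axioms[unfolded mu_def], folded mu_def]
  have lip: "abs (v y - v x) <= 4 * abs B / r n * norm (x - y)" if "?w x > 0" "?w y > 0" for x y
  proof -
   have xy: "x : K n" "y : K n" using that by (auto split: split_indicator_asm)
   have *: "h y - h x <= 2 * abs B / r n * norm (y - x)"
    if "x : K n" "y : K n" "convex_on Om h" "!!z. z : ?N ==> abs (h z) <= B" for h x y
   proof (rule convex_on_lipschitz[OF that(3) K(3)])
    show "x : Om" using K(6) that by blast
    show "cball y (r n) <= Om" by (rule K(4)[OF that(2)])
    show "abs (h x) <= abs B" using that(4)[OF KN'[OF that(1)]] by simp
    show "abs (h z) <= abs B" if "z : cball y (r n)" for z
     using `!!z. z : ?N ==> abs (h z) <= B`[of z] KN[OF `y : K n`] that by fastforce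
   qed
   show ?thesis using *[OF xy c(1)] *[OF xy c(2)] *[OF xy(2,1) c(1)] *[OF xy(2,1) c(2)] B
    unfolding vu[OF xy(1)] vu[OF xy(2)] u_def norm_minus_commute[of y x] abs_le_iff by auto
  qed
  have Gv: "AE x in lborel. ?w x > 0 --> GDERIV v x :> g x" using Gu
  proof eventually_elim
   case (elim x)
   show ?case
   proof
    assume "?w x > 0"
    hence x: "x : K n" "rho x > 0" by (auto split: split_indicator_asm)
    have "(u has_derivative (%h. h <.> g x)) (at x)" using elim x by (simp add: gderiv_def)
    thus "GDERIV v x :> g x" unfolding gderiv_def
    proof (rule has_derivative_transform_within_open[of _ _ _ _ "ball x (r n)"])
     fix z assume "z : ball x (r n)"
     hence "z : ?N" using KN[OF x(1)] by (auto simp: subset_iff)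
     thus "u z = v z" by (simp add: v_def)
    qed (use K(3) in auto)
   qed
  qed
  interpret M: finite_measure ?M by (rule rs(2))
  have iv: "integrable ?M v" by (rule M.integrable_const_bound[of _ "2 * abs B"]) (use vB in auto)
  have iv2: "integrable ?M (%x. (v x)^2)"
   by (rule M.integrable_const_bound[of _ "(2 * abs B)^2"]) (use power_mono[OF vB abs_ge_zero, of _ 2] in auto)
  have fin: "(NL x. ennreal (?w x)) < \<infinity>"
   using M.emeasure_finite[of UNIV] by (simp add: emeasure_density less_top)
  have v: "?I x * v x = ?I x * u x" "?I x * (v x)^2 = ?I x * (u x)^2" for x by (auto simp: vu split: split_indicator)
  have "measure ?M (space ?M) = m n" using rs(4)[of "%_. 1"] by (simp add: m_def)
  moreover have "(LINT x|?M. v x) = a n" "(LINT x|?M. (v x)^2) = b n" by (simp_all add: rs(4) v a_def b_def)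
  ultimately have "ennreal (2 * (m n * b n - (a n)^2)) = (NN ?M (%y. (NN ?M (%x. ennreal ((v x - v y)^2)))))"
   using M.doubled_integral[OF iv _ zero_le_one, of "-1"] iv2 by simp
  also have "... = (NL y. (NL x. ennreal (?w x * ?w y * (v x - v y)^2)))" by (rule dens[symmetric]) (use wle in auto)
  also have "... <= (NL y. (NL x. ennreal (?w x * ?w y * (1 / (2 * ka) * (norm (g x + g y))^2))))"
   by (rule doubled_poincare_bounded[OF k rs(1) fin _ gm vB _ lip Gv]) (use K(3)[of n] in auto)
  also have "... <= (NL y. (NL x. ennreal (rho x * rho y * (1 / (2 * ka) * (norm (g x + g y))^2))))"
   using wle nn k by (intro nn_integral_mono ennreal_leI mult_mono) auto
  also have "... = ennreal (2 * R)" unfolding rhs[symmetric] mu_def by (rule dens) (use k nn in auto)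
  finally show ?thesis using iv2 R0 by (simp add: ennreal_le_iff rs(5) v)
 qed
 have IK: "(%n. indicator (K n) x :: real) ----> indicator Om x" for x
  using LIMSEQ_indicator_incseq[OF K(5), of x] K(6) by simp
 have AEOm: "AE x in mu. x : Om" by (rule nice_AE[OF n])
 note lim = truncated_integral_tendsto[OF K(5), of mu, unfolded K(6), OF _ AEOm]
 have lima: "a ----> (LINT x|mu. u x)" and limm: "m ----> 1"
  unfolding a_def m_def using lim[OF _ iu] lim[of "%_. 1"] by simp_all
 have incb: "incseq b"
 proof (rule incseq_SucI)
  fix n
  have "indicator (K n) x * (u x)^2 <= indicator (K (Suc n)) x * (u x)^2" for x
   using incseq_SucD[OF K(5), of n] by (auto split: split_indicator)
  thus "b n <= b (Suc n)" unfolding b_def using step by (intro integral_mono) auto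
 qed
 obtain N where N: "!!n. n >= N ==> m n > 1 / 2"
  using order_tendstoD(1)[OF limm, of "1/2"] by (auto simp: eventually_sequentially)
 have "Bseq (%n. (a n)^2)"
  using tendsto_power[OF lima, of 2] by (intro convergent_imp_Bseq) (auto simp: convergent_def)
 then obtain A where A: "!!n. (a n)^2 <= A" unfolding Bseq_def by auto
 \<comment> \<open>\<open>b\<close> is increasing and \<open>m p > 1 / 2\<close> for large
   \<open>p\<close>, so the inequality on a large \<open>K p\<close> bounds every
   \<open>b n\<close>; monotone convergence then yields the integrability of the square of
   \<open>u\<close>.\<close>
 have "b n <= 2 * (R + A)" for n
 proof -
  define p where "p = max n N"
  have p: "n <= p" "N <= p" by (simp_all add: p_def)
  have b0: "0 <= b p" unfolding b_def by (intro integral_nonneg_AE) simp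
  have "b n <= b p" using incb p by (simp add: incseq_def)
  also have "... <= 2 * (m p * b p)" using mult_right_mono[OF less_imp_le[OF N[OF p(2)]] b0] by simp
  also have "... <= 2 * (R + (a p)^2)" using step[of p] by (simp add: diff_le_eq)
  also have "... <= 2 * (R + A)" using A[of p] by simp
  finally show ?thesis .
 qed
 then obtain L where L: "b ----> L" using incseq_convergent[OF incb] by blast
 let ?v = "%x. indicator Om x * (u x)^2"
 have mono: "AE x in mu. mono (%n. indicator (K n) x * (u x)^2)"
  using K(5) by (intro AE_I2 monoI mult_right_mono) (auto simp: incseq_def split: split_indicator)
 have lv: "AE x in mu. (%n. indicator (K n) x * (u x)^2) ----> ?v x" by (intro AE_I2 tendsto_mult_right IK)
 have [measurable]: "Om : sets borel" using nice_open[OF n] by simp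
 have "integrable mu ?v" "(LINT x|mu. ?v x) = L"
  by (rule integrable_monotone_convergence[OF _ mono lv L[unfolded b_def]]
       integral_monotone_convergence[OF _ mono lv L[unfolded b_def]]; use step in simp)+
 moreover have ae: "AE x in mu. ?v x = (u x)^2" using AEOm by eventually_elim simp
 ultimately have u2: "integrable mu (%x. (u x)^2)" "(LINT x|mu. (u x)^2) = L"
  using integrable_cong_AE[OF _ _ ae] integral_cong_AE[OF _ _ ae] by auto
 thus "integrable mu (%x. (u x)^2)" by simp
 have "(%n. m n * b n - (a n)^2) ----> 1 * L - (LINT x|mu. u x)^2" by (intro tendsto_intros limm L lima)
 hence "1 * L - (LINT x|mu. u x)^2 <= R" by (rule LIMSEQ_le_const2) (use step in auto)
 thus "(LINT x|mu. (u x)^2) - (LINT x|mu. u x)^2 <= 1 / (2 * ka) * ((LINT x|mu. (norm (g x))^2) + (norm (LINT x|mu. g x))^2)"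
  using u2 by (simp add: R_def)
qed

section \<open>Near-extremal test functions and the extremal direction\<close>

lemma l2_cong_AE:
 assumes "X : bm P" "Y : bm P" "AE w in P. X w = Y w"
 shows "l2 P X = l2 P Y"
proof -
 have "(LINT w|P. (norm (X w))^2) = (LINT w|P. (norm (Y w))^2)"
  by (rule integral_cong_AE) (use assms in "auto elim: eventually_mono")
 thus ?thesis by (simp add: l2_def)
qed

lemma l2_commute: "l2 P (%w. X w - Y w) = l2 P (%w. Y w - X w)" by (simp add: l2_def norm_minus_commute)

lemma l2_triangle3:
 assumes "sqint P X" "sqint P Y" "sqint P Z"
 shows "l2 P (%w. X w - Z w) <= l2 P (%w. X w - Y w) + l2 P (%w. Y w - Z w)"
 using l2_triangle[OF sqint_diff[OF assms(1,2)] sqint_diff[OF assms(2,3)]] by simp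

lemma l2_le_diff:
 assumes "sqint P X" "sqint P Y" shows "l2 P X <= l2 P Y + l2 P (%w. X w - Y w)"
 using l2_triangle[OF assms(2) sqint_diff[OF assms]] by simp

context slc_pair begin

text \<open>In the combination of the squared distances of \<open>w\<close> to \<open>E0\<close> and
  \<open>E1\<close> with weights \<open>a0\<close> and \<open>a1\<close>, the squared norms are
  about 1 at most, and the pairing is about \<open>c t = a0 + a1\<close> at least. Everything
  cancels except \<open>c t * dl\<close> and terms of order \<open>eps\<close>; the two bounds on
  \<open>c t * dl\<close> make each distance small on its own.\<close>

lemma near_extremal_step:
 assumes t: "0 < t" "t < 1" and f: "test_function f" "var t f = 1"
 defines "w \<equiv> %x. c t *. gradient f (F t x)"
 assumes d: "(l2 mu0 w)^2 <= 1 + dl" and r: "r > 0"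
  "c t * dl < (1 - t) / sqrt ka0 * r^2" "c t * dl < t / sqrt ka1 * r^2"
 shows "\<forall>\<^sub>F eps in at_right 0. EX C y th S. perturbation t f C eps y th S &
  l2 mu0 (%x. w x - E0 eps y x) <= r & l2 mu0 (%x. w x - E1 eps y x) <= r & l2 mu0 (%x. w (y x) - w x) <= r"
proof -
 define a0 where "a0 = (1 - t) / sqrt ka0"
 define a1 where "a1 = t / sqrt ka1"
 have a: "0 < a0" "0 < a1" "c t = a0 + a1" using t k0 k1 by (auto simp: a0_def a1_def c_def)
 have c0: "c t > 0" using a by simp
 have qw: "sqint mu0 w" unfolding w_def by (rule sqint_scale[OF sqint_gradient[OF f(1)]])
 obtain K L where "tame f K L" using test_function_tame[OF f(1)] by blast
 note KL = tameD[OF this]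
 obtain C eps0 where C: "C >= 0" "eps0 > 0"
  and P: "!!eps. 0 < eps ==> eps < eps0 ==> EX y th S. perturbation t f C eps y th S"
  by (rule perturbation_family[OF less_imp_le[OF t(1)] less_imp_le[OF t(2)] f(1)]) blast
 have "((%eps. c t * (dl + 3 * C * eps)) \<longlongrightarrow> c t * (dl + 3 * C * 0)) (at_right 0)"
  "((%eps. c t * L * (eps * (c t * sqrt (1 + C * eps)))) \<longlongrightarrow> c t * L * (0 * (c t * sqrt (1 + C * 0)))) (at_right 0)"
  by (intro tendsto_intros)+
 hence l: "((%eps. c t * (dl + 3 * C * eps)) \<longlongrightarrow> c t * dl) (at_right 0)"
  "((%eps. c t * L * (eps * (c t * sqrt (1 + C * eps)))) \<longlongrightarrow> 0) (at_right 0)" by simp_all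
 have "\<forall>\<^sub>F eps in at_right 0. 0 < eps & eps < eps0" unfolding eventually_at_right_field using C(2) by blast
 thus ?thesis using order_tendstoD(2)[OF l(1) r(2)] order_tendstoD(2)[OF l(1) r(3)] order_tendstoD(2)[OF l(2) r(1)]
 proof eventually_elim
  case (elim eps)
  obtain y th S where P: "perturbation t f C eps y th S" using P[of eps] elim by blast
  have e: "0 < eps" using elim by simp
  note p = P[unfolded perturbation_def f(2)] and pp = perturbation_push[OF f(1) P]
  note q = displacement[OF e less_imp_le[OF t(1)] less_imp_le[OF t(2)] pp(3,4)]
  have C1: "0 <= 1 + C * eps" using C e by simp
  have n: "l2 mu0 (E0 eps y) <= sqrt (1 + C * eps)" "l2 mu0 (E1 eps y) <= sqrt (1 + C * eps)" using p by blast+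
  have n2: "(l2 mu0 (E0 eps y))^2 <= 1 + C * eps" "(l2 mu0 (E1 eps y))^2 <= 1 + C * eps"
   using power_mono[OF n(1), of 2] power_mono[OF n(2), of 2] C1 by simp_all
  define I0 where "I0 = (LINT x|mu0. w x <.> E0 eps y x)"
  define I1 where "I1 = (LINT x|mu0. w x <.> E1 eps y x)"
  have I: "a0 * I0 + a1 * I1 >= c t * (1 - C * eps)"
  proof -
   have "c t * (1 - C * eps) <= c t * (a0 * (LINT x|mu0. gradient f (F t x) <.> E0 eps y x) + a1 * (LINT x|mu0. gradient f (F t x) <.> E1 eps y x))"
    using p c0 unfolding a0_def[symmetric] a1_def[symmetric] by (intro mult_left_mono) auto
   also have "... = a0 * I0 + a1 * I1" by (simp add: I0_def I1_def w_def algebra_simps)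
   finally show ?thesis .
  qed
  have "a0 * (l2 mu0 (%x. w x - E0 eps y x))^2 + a1 * (l2 mu0 (%x. w x - E1 eps y x))^2
   = a0 * (l2 mu0 (E0 eps y))^2 + a1 * (l2 mu0 (E1 eps y))^2 + c t * (l2 mu0 w)^2 - 2 * (a0 * I0 + a1 * I1)"
   unfolding l2_diff_square[OF qw q(1)] l2_diff_square[OF qw q(2)] I0_def I1_def a(3) by (simp add: algebra_simps)
  also have "... <= a0 * (1 + C * eps) + a1 * (1 + C * eps) + c t * (1 + dl) - 2 * (c t * (1 - C * eps))"
   using a c0 n2 d I by (intro diff_mono add_mono mult_left_mono) auto
  also have "... = c t * (dl + 3 * C * eps)" unfolding a(3) by (simp add: algebra_simps)
  finally have sum: "a0 * (l2 mu0 (%x. w x - E0 eps y x))^2 + a1 * (l2 mu0 (%x. w x - E1 eps y x))^2 <= c t * (dl + 3 * C * eps)" .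
  have "0 <= a0 * (l2 mu0 (%x. w x - E0 eps y x))^2" "0 <= a1 * (l2 mu0 (%x. w x - E1 eps y x))^2" using a by simp_all
  with sum elim(2,3) have "a0 * (l2 mu0 (%x. w x - E0 eps y x))^2 <= a0 * r^2" "a1 * (l2 mu0 (%x. w x - E1 eps y x))^2 <= a1 * r^2"
   unfolding a0_def[symmetric] a1_def[symmetric] by linarith+
  hence "(l2 mu0 (%x. w x - E0 eps y x))^2 <= r^2" "(l2 mu0 (%x. w x - E1 eps y x))^2 <= r^2" using a by simp_all
  hence R: "l2 mu0 (%x. w x - E0 eps y x) <= r" "l2 mu0 (%x. w x - E1 eps y x) <= r"
   using r(1) by (auto intro: power2_le_imp_le)
  have "norm (w (y x) - w x) <= norm ((c t * L) *. (F t (y x) - F t x))" for x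
   using KL(6)[of "F t (y x)" "F t x"] KL(2) c0 unfolding w_def scaleR_diff_right[symmetric] norm_scaleR
   by (simp add: mult.assoc mult_left_mono)
  hence "l2 mu0 (%x. w (y x) - w x) <= l2 mu0 (%x. (c t * L) *. (F t (y x) - F t x))"
   by (rule l2_mono(2)[OF sqint_measurable[OF sqint_diff[OF tilt_push(4)[OF pp(1,2) qw] qw]] sqint_scale[OF q(4)]])
  also have "... <= c t * L * (eps * (c t * sqrt (1 + C * eps)))"
   using q(5)[OF n] c0 KL(2) by (simp add: l2_scale mult_left_mono)
  finally have "l2 mu0 (%x. w (y x) - w x) <= r" using elim(4) by simp
  with P R show ?case by blast
 qed
qed

text \<open>A perturbation at scale \<open>eps\<close> supplies \<open>u = phi - th\<close>, whose
  scaled gradient \<open>Q\<close> is close to \<open>w\<close>; the map \<open>y'\<close> at scale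
  \<open>r * eps\<close> probes it. Convexity of both potentials bounds the covariance of
  \<open>u\<close> with the test function from below, the doubled Poincare inequality bounds it from
  above. Together they force the mean \<open>v\<close> of \<open>w\<close> to have norm close to 1,
  and \<open>e\<close> is its direction.\<close>

lemma near_extremal_direction:
 assumes t: "0 < t" "t < 1" and f: "test_function f" "var t f = 1"
 defines "w \<equiv> %x. c t *. gradient f (F t x)"
 assumes d: "(l2 mu0 w)^2 <= 1 + r" and r: "0 < r" "r <= 1 / 1000"
  and ev: "\<forall>\<^sub>F eps in at_right 0. EX C y th S. perturbation t f C eps y th S &
   l2 mu0 (%x. w x - E0 eps y x) <= r & l2 mu0 (%x. w x - E1 eps y x) <= r & l2 mu0 (%x. w (y x) - w x) <= r"
 obtains e where "norm e = 1"
  "1 - 112 * r <= sqrt ka0 * l2 mu0 (%x. e <.> (x - (LINT x|mu0. x)))"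
  "1 - 112 * r <= sqrt ka1 * l2 mu0 (%x. e <.> (T x - (LINT x|mu0. T x)))"
proof -
 let ?f = "%x. f (F t x) - mean t f"
 have qf: "sqint mu0 ?f" "l2 mu0 ?f = 1" "(LINT x|mu0. ?f x) = 0"
  using centered_test_function[OF f(1), of t] by (simp_all add: f(2) power2_eq_1_iff)
    (smt (verit) l2_nonneg)
 have cs: "abs (LINT x|mu0. ?f x * X x) <= l2 mu0 (%x. X x - (LINT x|mu0. X x))" if X: "sqint mu0 X" for X
 proof -
  let ?m = "(LINT x|mu0. X x)"
  have "(LINT x|mu0. ?f x <.> (X x - ?m)) = (LINT x|mu0. ?f x * X x - ?m * ?f x)"
   by (rule I_cong) (auto simp: algebra_simps)
  also have "... = (LINT x|mu0. ?f x * X x) - ?m * (LINT x|mu0. ?f x)"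
   using sqint_inner[OF qf(1) X] P0.sqint_integrable[OF qf(1)]
   by (subst Bochner_Integration.integral_diff) (simp_all only: inner_real_def integrable_mult_right integral_mult_right_zero)
  finally show ?thesis using l2_inner_abs[OF qf(1) sqint_diff[OF X P0.sqint_const[of ?m]]] qf(2,3) by simp
 qed
 have qw: "sqint mu0 w" unfolding w_def by (rule sqint_scale[OF sqint_gradient[OF f(1)]])
 have w1: "1 <= l2 mu0 w"
 proof -
  have "0 <= c t" using t k0 k1 by (simp add: c_def)
  hence "1 <= (l2 mu0 w)^2"
   using variance_bound[OF less_imp_le[OF t(1)] less_imp_le[OF t(2)] f(1)] f(2) by (simp add: w_def l2_scale)
  thus ?thesis using power2_le_imp_le[of 1 "l2 mu0 w"] by simp
 qed
 have w2: "l2 mu0 w <= 1 + r"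
 proof (rule power2_le_imp_le)
  show "(l2 mu0 w)^2 <= (1 + r)^2" using d r zero_le_power2[of r] unfolding power2_sum power_one by linarith
 qed (use r in simp)
 obtain b where b: "b > 0" and ex: "!!eps. 0 < eps ==> eps < b ==> EX C y th S. perturbation t f C eps y th S &
   l2 mu0 (%x. w x - E0 eps y x) <= r & l2 mu0 (%x. w x - E1 eps y x) <= r & l2 mu0 (%x. w (y x) - w x) <= r"
  using ev unfolding eventually_at_right_field by blast
 \<comment> \<open>Only the ratio \<open>r\<close> of the two scales matters: it makes the mismatch
   term \<open>r * (?F1 x <.> ?F0 x)\<close> below as small as the other errors.\<close>
 define eps where "eps = b / 2"
 have e: "0 < eps" "eps < b" "0 < r * eps" using b r by (auto simp: eps_def)
 have "r * eps < 1 * b" using r e by (intro mult_strict_mono) auto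
 hence e': "r * eps < b" by simp
 obtain C y th S where P: "perturbation t f C eps y th S"
  and h1: "l2 mu0 (%x. w x - E1 eps y x) <= r" and hw: "l2 mu0 (%x. w (y x) - w x) <= r" using ex[OF e(1,2)] by blast
 obtain C' y' th' S' where P': "perturbation t f C' (r * eps) y' th' S'"
  and h0': "l2 mu0 (%x. w x - E0 (r * eps) y' x) <= r"
  and h1': "l2 mu0 (%x. w x - E1 (r * eps) y' x) <= r" and hw': "l2 mu0 (%x. w (y' x) - w x) <= r"
  using ex[OF e(3) e'] by blast
 note pp = perturbation_push[OF f(1) P] and pp' = perturbation_push[OF f(1) P']
 note push = tilt_push[OF pp(1,2)] and push' = tilt_push[OF pp'(1,2)]
 note D = displacement[OF e(1) less_imp_le[OF t(1)] less_imp_le[OF t(2)] pp(3,4)]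
  and D' = displacement[OF e(3) less_imp_le[OF t(1)] less_imp_le[OF t(2)] pp'(3,4)]
 have S: "convex_on Om0 th" "integrable mu0 th" "S : BM"
  "AE x in mu0. GDERIV th x :> S x" "AE x in mu0. S (y x) = T x" "sqint mu0 S"
  using P unfolding perturbation_def by blast+
 have phi: "convex_on Om0 phi" "integrable mu0 phi" using T by (simp_all add: brenier_def dual_pair_def)
 have Gphi: "AE x in mu0. x : Om0 & GDERIV phi x :> T x & (ALL z:Om0. phi z >= phi x + T x <.> (z - x))"
  by (rule brenier_subgradient[OF n0 T])
 let ?E1 = "E1 eps y" and ?F0 = "E0 (r * eps) y'" and ?F1 = "E1 (r * eps) y'"
 \<comment> \<open>Since \<open>S (y x) = T x\<close>, the value of \<open>Q\<close> at
   \<open>y x\<close> is \<open>?E1 x\<close>. So \<open>Q\<close> inherits closeness to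
   \<open>w\<close>, each change of measure costing a factor 2.\<close>
 define Q where "Q x = (sqrt ka1 / eps) *. (T x - S x)" for x
 have q: "sqint mu0 ?E1" "sqint mu0 ?F0" "sqint mu0 ?F1" "sqint mu0 Q"
  unfolding Q_def by (rule sqint_scale sqint_diff sqint_T S(6) D D')+
 note h = h1 h0' h1'
 note qwy = push(4)[OF qw] and qwy' = push'(4)[OF qw] and qQy = push(4)[OF q(4)] and qQy' = push'(4)[OF q(4)]
 have E2: "l2 mu0 ?F0 <= 2" "l2 mu0 ?F1 <= 2" using l2_le_diff[OF q(2) qw] l2_le_diff[OF q(3) qw] h(2,3) w2 r
  unfolding l2_commute[of _ ?F0 w] l2_commute[of _ ?F1 w] by linarith+
 have Qw: "l2 mu0 (%x. Q x - w x) <= 4 * r" "l2 mu0 (%x. Q (y' x) - w (y' x)) <= 8 * r"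
 proof -
  have "l2 mu0 (%x. Q (y x) - w (y x)) = l2 mu0 (%x. ?E1 x - w (y x))"
  proof (rule l2_cong_AE)
   show "AE x in mu0. Q (y x) - w (y x) = ?E1 x - w (y x)" using S(5) by eventually_elim (simp add: Q_def E1_def)
  qed (use sqint_measurable[OF sqint_diff[OF qQy qwy]] sqint_measurable[OF sqint_diff[OF q(1) qwy]] in auto)
  also have "... <= l2 mu0 (%x. ?E1 x - w x) + l2 mu0 (%x. w x - w (y x))" by (rule l2_triangle3[OF q(1) qw qwy])
  also have "... <= 2 * r" using h(1) hw unfolding l2_commute[of _ ?E1 w] l2_commute[of _ w "%x. w (y x)"] by linarith
  finally have 1: "l2 mu0 (%x. Q (y x) - w (y x)) <= 2 * r" .
  thus 2: "l2 mu0 (%x. Q x - w x) <= 4 * r" using push(6)[OF sqint_diff[OF q(4) qw]] by linarith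
  thus "l2 mu0 (%x. Q (y' x) - w (y' x)) <= 8 * r" using push'(5)[OF sqint_diff[OF q(4) qw]] by linarith
 qed
 define u where "u x = phi x - th x" for x
 have iu: "integrable mu0 u" unfolding u_def using phi S by simp
 define J where "J = (LINT x|mu0. ?f x * u x)"
 define A where "A = sqrt ka0 * sqrt ka1 / eps * J"
 \<comment> \<open>The error is \<open>16 * r + 2 * r + 2 * r + 4 * r\<close>: from replacing
   \<open>Q\<close> by \<open>w\<close> at \<open>y' x\<close>, then \<open>w (y' x)\<close> by
   \<open>w x\<close>, then \<open>?F0\<close> by \<open>w\<close>, and from the mismatch of
   scales.\<close>
 have "A >= 1 - 24 * r"
 proof -
  let ?k = "r * eps / sqrt ka0 * (eps / sqrt ka1)"
  have kp: "?k > 0" using e k0 k1 r by simp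
  have i: "integrable mu0 (%x. Q (y' x) <.> ?F0 x)" "integrable mu0 (%x. ?F1 x <.> ?F0 x)"
   by (rule sqint_inner q qQy')+
  have AE': "AE x in mu0. GDERIV th (y' x) :> S (y' x)" by (rule push'(1)[OF S(4)])
  have AEOm: "AE x in mu0. y' x : Om0" by (rule push'(1)[OF nice_AE[OF n0]])
  have "?k * (LINT x|mu0. Q (y' x) <.> ?F0 x - r * (?F1 x <.> ?F0 x))
   = (LINT x|mu0. ?k * (Q (y' x) <.> ?F0 x - r * (?F1 x <.> ?F0 x)))" by simp
  also have "... <= (LINT x|mu0. u (y' x) - u x)"
  proof (rule integral_mono_AE)
   show "AE x in mu0. ?k * (Q (y' x) <.> ?F0 x - r * (?F1 x <.> ?F0 x)) <= u (y' x) - u x" using Gphi AE' AEOm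
   proof eventually_elim
    case (elim x)
    have "th x >= th (y' x) + S (y' x) <.> (x - y' x)" by (rule convex_gderiv_subgradient[OF S(1)]) (use elim in auto)
    moreover have "phi (y' x) >= phi x + T x <.> (y' x - x)" using elim by blast
    ultimately have "u (y' x) - u x >= (T x - S (y' x)) <.> (y' x - x)" unfolding u_def by (simp add: inner_simps)
    moreover have "T x - S (y' x) = (eps / sqrt ka1) *. (Q (y' x) - r *. ?F1 x)"
     using e k1 r by (simp add: Q_def E1_def algebra_simps)
    moreover have "y' x - x = (r * eps / sqrt ka0) *. ?F0 x" using e k0 r by (simp add: E0_def)
    ultimately show ?case by (simp add: inner_diff_left mult_ac)
   qed
   show "integrable mu0 (%x. ?k * (Q (y' x) <.> ?F0 x - r * (?F1 x <.> ?F0 x)))" using i by simp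
   show "integrable mu0 (%x. u (y' x) - u x)" using iu push'(2)[OF iu] by simp
  qed
  also have "... = r * eps * J" using push'(3)[OF iu] by (simp add: J_def)
  also have "... = ?k * A" using e k0 k1 r by (simp add: A_def)
  finally have "(LINT x|mu0. Q (y' x) <.> ?F0 x - r * (?F1 x <.> ?F0 x)) <= A" using kp by (rule mult_left_le_imp_le)
  hence A: "(LINT x|mu0. Q (y' x) <.> ?F0 x) - r * (LINT x|mu0. ?F1 x <.> ?F0 x) <= A" using i by simp
  have "(LINT x|mu0. Q (y' x) <.> ?F0 x) = (LINT x|mu0. (Q (y' x) - w (y' x)) <.> ?F0 x + (w (y' x) - w x) <.> ?F0 x - w x <.> (w x - ?F0 x) + w x <.> w x)"
   by (rule I_cong) (auto simp: inner_simps)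
  also have "... = (LINT x|mu0. (Q (y' x) - w (y' x)) <.> ?F0 x) + (LINT x|mu0. (w (y' x) - w x) <.> ?F0 x) - (LINT x|mu0. w x <.> (w x - ?F0 x)) + (LINT x|mu0. w x <.> w x)"
   using sqint_inner[OF sqint_diff[OF qQy' qwy'] q(2)] sqint_inner[OF sqint_diff[OF qwy' qw] q(2)]
    sqint_inner[OF qw sqint_diff[OF qw q(2)]] sqint_inner[OF qw qw]
   by (simp only: Bochner_Integration.integral_add Bochner_Integration.integral_diff Bochner_Integration.integrable_add Bochner_Integration.integrable_diff)
  finally have eq: "(LINT x|mu0. Q (y' x) <.> ?F0 x) = (LINT x|mu0. (Q (y' x) - w (y' x)) <.> ?F0 x) + (LINT x|mu0. (w (y' x) - w x) <.> ?F0 x) - (LINT x|mu0. w x <.> (w x - ?F0 x)) + (LINT x|mu0. w x <.> w x)" .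
  have "abs ((LINT x|mu0. (Q (y' x) - w (y' x)) <.> ?F0 x)) <= 8 * r * 2"
   by (rule order_trans[OF l2_inner_abs[OF sqint_diff[OF qQy' qwy'] q(2)] mult_mono[OF Qw(2) E2(1)]]) (use r in auto)
  moreover have "abs ((LINT x|mu0. (w (y' x) - w x) <.> ?F0 x)) <= r * 2"
   by (rule order_trans[OF l2_inner_abs[OF sqint_diff[OF qwy' qw] q(2)] mult_mono[OF hw' E2(1)]]) (use r in auto)
  moreover have "abs ((LINT x|mu0. w x <.> (w x - ?F0 x))) <= 2 * r"
   by (rule order_trans[OF l2_inner_abs[OF qw sqint_diff[OF qw q(2)]] mult_mono[OF _ h(2)]]) (use r w2 in auto)
  moreover have "abs (LINT x|mu0. ?F1 x <.> ?F0 x) <= 2 * 2"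
   by (rule order_trans[OF l2_inner_abs[OF q(3) q(2)] mult_mono[OF E2(2) E2(1)]]) auto
  hence "abs (r * (LINT x|mu0. ?F1 x <.> ?F0 x)) <= r * 4" using r by (simp add: abs_mult)
  moreover have "1 <= (LINT x|mu0. w x <.> w x)"
   using power_mono[OF w1, of 2] by (simp add: l2_square dot_square_norm)
  ultimately show ?thesis using A eq unfolding abs_le_iff by linarith
 qed
 \<comment> \<open>By Cauchy-Schwarz with the normalised test function, the squared covariance
   \<open>J^2\<close> is at most the variance of \<open>u\<close>.\<close>
 moreover have "2 * A^2 <= (l2 mu0 Q)^2 + (norm (LINT x|mu0. Q x))^2"
 proof -
  have Gphi': "AE x in mu0. GDERIV phi x :> T x" using Gphi by eventually_elim blast
  have db: "integrable mu0 (%x. (u x)^2)" "(LINT x|mu0. (u x)^2) - (LINT x|mu0. u x)^2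
   <= 1 / (2 * ka0) * ((LINT x|mu0. (norm (T x - S x))^2) + (norm (LINT x|mu0. T x - S x))^2)"
   using doubled_poincare[OF k0 w0 n0[unfolded mu0], folded mu0, OF phi(1) S(1) phi(2) S(2) T_measurable S(3) sqint_T S(6) Gphi' S(4)]
   unfolding u_def by blast+
  let ?U = "(LINT x|mu0. u x)"
  have qu: "sqint mu0 u" using db(1) iu by (auto simp: sqint_def)
  have "abs J <= l2 mu0 (%x. u x - ?U)" unfolding J_def by (rule cs[OF qu])
  hence "J^2 <= (l2 mu0 (%x. u x - ?U))^2" using power_mono[of "abs J" _ 2] by simp
  also have "... = (LINT x|mu0. (u x)^2) - ?U^2"
   unfolding l2_diff_square[OF qu P0.sqint_const] l2_square[of _ u] using iu by (simp add: power2_eq_square)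
  finally have J: "J^2 <= 1 / (2 * ka0) * ((LINT x|mu0. (norm (T x - S x))^2) + (norm (LINT x|mu0. T x - S x))^2)" using db(2) by simp
  have "(l2 mu0 Q)^2 = ka1 / eps^2 * (LINT x|mu0. (norm (T x - S x))^2)"
   "(norm (LINT x|mu0. Q x))^2 = ka1 / eps^2 * (norm (LINT x|mu0. T x - S x))^2"
   using k1 by (simp_all add: Q_def[abs_def] l2_square power_mult_distrib power_divide)
  moreover have "2 * A^2 = 2 * ka0 * ka1 / eps^2 * J^2" using k0 k1 by (simp add: A_def power_mult_distrib power_divide)
  moreover have "2 * ka0 * ka1 / eps^2 * J^2 <= 2 * ka0 * ka1 / eps^2 * (1 / (2 * ka0) * ((LINT x|mu0. (norm (T x - S x))^2) + (norm (LINT x|mu0. T x - S x))^2))"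
   using J k0 k1 by (intro mult_left_mono) auto
  ultimately show ?thesis using k0 by (simp add: distrib_left)
 qed
 moreover have "l2 mu0 Q <= 1 + 5 * r" using l2_le_diff[OF q(4) qw] Qw(1) w2 by linarith
 hence "(l2 mu0 Q)^2 <= (1 + 5 * r)^2" by (rule power_mono) simp
 moreover define v where "v = (LINT x|mu0. w x)"
 have Iv: "norm ((LINT x|mu0. X x) - v) <= l2 mu0 (%x. X x - w x)" if X: "sqint mu0 X" for X
  using P0.norm_integral_le_l2[OF sqint_diff[OF X qw]] P0.sqint_integrable[OF X] P0.sqint_integrable[OF qw]
  by (simp add: v_def)
 have "norm (LINT x|mu0. Q x) <= norm v + 4 * r"
  using Iv[OF q(4)] Qw(1) norm_triangle_ineq2[of "(LINT x|mu0. Q x)" v] by linarith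
 hence "(norm (LINT x|mu0. Q x))^2 <= (norm v + 4 * r)^2" by (rule power_mono) simp
 moreover have "(1 - 24 * r)^2 <= A^2" by (rule power_mono) (use `A >= 1 - 24 * r` r in auto)
 ultimately have "2 * (1 - 24 * r)^2 - (1 + 5 * r)^2 <= (norm v + 4 * r)^2" by linarith
 \<comment> \<open>To first order the right side is \<open>1 - 106 * r\<close> and the left side
   \<open>1 - 214 * r\<close>; the difference pays for the quadratic terms as
   \<open>r <= 1 / 1000\<close>.\<close>
 moreover have "(1 - 107 * r)^2 <= 2 * (1 - 24 * r)^2 - (1 + 5 * r)^2"
 proof -
  have "10322 * (r * r) <= 108 * r" using mult_right_mono[of r "1/1000" r] r by linarith
  thus ?thesis by (simp add: power2_eq_square algebra_simps)
 qed
 ultimately have "(1 - 107 * r)^2 <= (norm v + 4 * r)^2" by (rule order_trans[rotated])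
 hence "1 - 107 * r <= norm v + 4 * r" by (rule power2_le_imp_le) (use r in simp)
 hence v: "1 - 111 * r <= norm v" by simp
 hence v0: "norm v > 0" using r by linarith
 define e where "e = v /\<^sub>R norm v"
 have ne: "norm e = 1" using v0 by (simp add: e_def)
 \<comment> \<open>Used for the identity and for \<open>T\<close>. The mean of the scaled
   displacement is close to \<open>v\<close>; by the tilt, its component along \<open>e\<close> is a
   covariance with the test function, which the standard deviation of \<open>e <.> X x\<close>
   bounds.\<close>
 have main: "1 - 112 * r <= sqrt ka * l2 mu0 (%x. e <.> (X x - (LINT x|mu0. X x)))"
  if X: "sqint mu0 X" and D: "l2 mu0 (%x. w x - (sqrt ka / (r * eps)) *. (X (y' x) - X x)) <= r" and k: "ka > 0" for X ka
 proof -
  define D where "D x = (sqrt ka / (r * eps)) *. (X (y' x) - X x)" for x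
  have qD: "sqint mu0 D" unfolding D_def by (intro sqint_scale sqint_diff push'(4) X)
  have iX: "integrable mu0 X" by (rule P0.sqint_integrable[OF X])
  have "e <.> v = norm v" using v0 by (simp add: e_def dot_square_norm power2_eq_square)
  moreover have "- (e <.> ((LINT x|mu0. D x) - v)) <= r"
   using Cauchy_Schwarz_ineq2[of e "(LINT x|mu0. D x) - v"] Iv[OF qD] that(2) ne
   unfolding D_def[symmetric] l2_commute[of _ w D] by simp
  ultimately have "norm v - r <= e <.> (LINT x|mu0. D x)" by (simp add: inner_diff_right)
  also have "... = (LINT x|mu0. e <.> D x)" using P0.sqint_integrable[OF qD] by simp
  also have "... = (LINT x|mu0. sqrt ka / (r * eps) * (e <.> X (y' x) - e <.> X x))"
   by (simp add: D_def inner_diff_right)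
  also have "... = sqrt ka / (r * eps) * (LINT x|mu0. e <.> X (y' x) - e <.> X x)" by (rule integral_mult_right_zero)
  also have "... = sqrt ka * (LINT x|mu0. ?f x * (e <.> X x))" using e r push'(3)[of "%x. e <.> X x"] iX by simp
  also have "... <= sqrt ka * l2 mu0 (%x. e <.> X x - (LINT x|mu0. e <.> X x))"
  proof (rule mult_left_mono)
   have "sqint mu0 (%x. e <.> X x)"
    by (rule l2_mono(1)[OF _ X]) (use sqint_measurable[OF X] Cauchy_Schwarz_ineq2[of e] ne in auto)
   thus "(LINT x|mu0. ?f x * (e <.> X x)) <= l2 mu0 (%x. e <.> X x - (LINT x|mu0. e <.> X x))"
    using cs abs_ge_self order_trans by blast
  qed (use k in simp)
  finally show ?thesis using v iX by (simp add: inner_diff_right)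
 qed
 show thesis by (rule that[OF ne main[OF sqint_id h0'[unfolded E0_def] k0] main[OF sqint_T h1'[unfolded E1_def] k1]])
qed

end

context slc_pair begin

text \<open>Unit vectors obtained for errors \<open>r n\<close> tending to 0 accumulate on the
  sphere, and both standard deviations depend continuously on the direction.\<close>

lemma extremal_direction:
 assumes t: "0 < t" "t < 1"
  and ex: "!!dl. dl > 0 ==> EX f. test_function f & var t f = 1 & (l2 mu0 (%x. c t *. gradient f (F t x)))^2 <= 1 + dl"
 obtains e where "norm e = 1"
  "1 <= sqrt ka0 * l2 mu0 (%x. e <.> (x - (LINT x|mu0. x)))"
  "1 <= sqrt ka1 * l2 mu0 (%x. e <.> (T x - (LINT x|mu0. T x)))"
proof -
 have approx: "EX e. norm e = 1 & 1 - 112 * r <= sqrt ka0 * l2 mu0 (%x. e <.> (x - (LINT x|mu0. x)))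
   & 1 - 112 * r <= sqrt ka1 * l2 mu0 (%x. e <.> (T x - (LINT x|mu0. T x)))" if r: "0 < r" "r <= 1 / 1000" for r
 proof -
  let ?a0 = "(1 - t) / sqrt ka0" and ?a1 = "t / sqrt ka1"
  have a: "0 < ?a0" "0 < ?a1" using t k0 k1 by auto
  have c0: "0 < c t" using a by (simp add: c_def)
  \<comment> \<open>Fits both smallness hypotheses of \<open>near_extremal_step\<close>; the 2 in
    the denominator makes them strict.\<close>
  define dl where "dl = min r (min (?a0 * r^2) (?a1 * r^2) / (2 * c t))"
  have ar: "0 < ?a0 * r^2" "0 < ?a1 * r^2" using mult_pos_pos[OF a(1), of "r^2"] mult_pos_pos[OF a(2), of "r^2"] r by simp_all
  have d: "dl > 0" "dl <= r" unfolding dl_def using ar r(1) c0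
   by (simp_all only: min_less_iff_conj min.cobounded1 zero_less_divide_iff) simp
  have "c t * dl <= min (?a0 * r^2) (?a1 * r^2) / 2"
   using c0 mult_left_mono[of dl "min (?a0 * r^2) (?a1 * r^2) / (2 * c t)" "c t"] by (simp add: dl_def)
  have cd: "c t * dl < ?a0 * r^2" "c t * dl < ?a1 * r^2"
  proof -
   have "x < p & x < q" if "x <= min p q / 2" "0 < p" "0 < q" for x p q :: real
    using that by (auto simp: min_def split: if_splits)
   from this[OF `c t * dl <= _` ar] show "c t * dl < ?a0 * r^2" "c t * dl < ?a1 * r^2" by blast+
  qed
  obtain f where f: "test_function f" "var t f = 1" "(l2 mu0 (%x. c t *. gradient f (F t x)))^2 <= 1 + dl"
   using ex[OF d(1)] by blast
  have "(l2 mu0 (%x. c t *. gradient f (F t x)))^2 <= 1 + r" using f(3) d(2) by simp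
  from near_extremal_direction[OF t f(1,2) this r near_extremal_step[OF t f r(1) cd]]
  show ?thesis by blast
 qed
 define r where "r n = 1 / real (1000 + n)" for n
 have r: "0 < r n" "r n <= 1 / 1000" for n by (auto simp: r_def field_simps)
 have r0: "r ----> 0" unfolding r_def
  by (rule LIMSEQ_ignore_initial_segment[OF lim_inverse_n', of 1000, unfolded add.commute[of _ "1000::nat"]])
 obtain E where E: "!!n. norm (E n) = 1"
  "!!n. 1 - 112 * r n <= sqrt ka0 * l2 mu0 (%x. E n <.> (x - (LINT x|mu0. x)))"
  "!!n. 1 - 112 * r n <= sqrt ka1 * l2 mu0 (%x. E n <.> (T x - (LINT x|mu0. T x)))" using approx[OF r] by metis
 have "E n : sphere 0 1" for n using E(1) by simp
 then obtain e q where e: "e : sphere 0 1" "strict_mono q" "(E o q) ----> e"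
  using compact_sphere[of "0::'a" 1] unfolding compact_def by metis
 have lim: "1 <= sqrt ka * l2 mu0 (%x. e <.> Y x)"
  if Y: "sqint mu0 Y" and le: "!!n. 1 - 112 * r n <= sqrt ka * l2 mu0 (%x. E n <.> Y x)" and k: "ka > 0" for Y ka
 proof -
  note [measurable] = sqint_measurable[OF Y]
  have q: "sqint mu0 (%x. v <.> Y x)" "l2 mu0 (%x. v <.> Y x) <= norm v * l2 mu0 Y" for v
   using l2_mono[of "%x. v <.> Y x" mu0 "%x. norm v *. Y x"] Cauchy_Schwarz_ineq2[of v] sqint_scale[OF Y]
   by (auto simp: l2_scale)
  have "1 - 112 * r (q n) <= sqrt ka * (l2 mu0 (%x. e <.> Y x) + norm (E (q n) - e) * l2 mu0 Y)" for n
  proof -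
   have "l2 mu0 (%x. E (q n) <.> Y x) <= l2 mu0 (%x. e <.> Y x) + l2 mu0 (%x. (E (q n) - e) <.> Y x)"
    using l2_le_diff[OF q(1)[of "E (q n)"] q(1)[of e]] by (simp add: inner_diff_left)
   also have "... <= l2 mu0 (%x. e <.> Y x) + norm (E (q n) - e) * l2 mu0 Y" using q(2) by simp
   finally show ?thesis using le[of "q n"] k order_trans mult_left_mono[of _ _ "sqrt ka"] by (meson less_imp_le real_sqrt_gt_zero)
  qed
  moreover have "(%n. sqrt ka * (l2 mu0 (%x. e <.> Y x) + norm (E (q n) - e) * l2 mu0 Y))
    ----> sqrt ka * (l2 mu0 (%x. e <.> Y x) + norm (e - e) * l2 mu0 Y)"
   using e(3) unfolding o_def by (intro tendsto_intros)
  moreover have "(%n. 1 - 112 * r (q n)) ----> 1 - 112 * 0"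
   using LIMSEQ_subseq_LIMSEQ[OF r0 e(2)] unfolding o_def by (intro tendsto_intros)
  ultimately show ?thesis using LIMSEQ_le[of "%n. 1 - 112 * r (q n)"] by fastforce
 qed
 show thesis by (rule that[of e]; use e(1) lim[OF sqint_diff[OF sqint_id P0.sqint_const] E(2) k0]
    lim[OF sqint_diff[OF sqint_T P0.sqint_const] E(3) k1] in simp)
qed

end

section \<open>Stein's identity and the Gaussian factor of an extremal measure\<close>

text \<open>Balls are convex, so the restricted weight keeps its curvature, and \<open>u\<close> is
  bounded on them; subtracting the conditional mean \<open>cc\<close> centres it. Linear growth of
  \<open>u\<close> and the second moment of the measure permit the limit of large balls.\<close>

lemma poincare_lipschitz:
 fixes rho u G :: "'a::euclidean_space => real"
 defines "mu \<equiv> dens rho"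
 assumes k: "ka > 0" and w: "slc_weight ka rho" and n: "nice Om mu" and L: "L >= 0"
  and lip: "!!x y. abs (u y - u x) <= L * norm (x - y)"
  and [measurable]: "G : BM" and G0: "!!x. 0 <= G x" and iG: "integrable mu (%x. (G x)^2)"
  and slope: "!!y eta. eta > 0 ==> EX r>0. ALL x. norm (x - y) < r --> u y - u x <= (G y + eta) * norm (x - y)"
 shows "sqint mu u" and "(LINT x|mu. (u x)^2) - (LINT x|mu. u x)^2 <= 1 / ka * (LINT x|mu. (G x)^2)"
proof -
 interpret prob_space mu by (rule nice_prob[OF n])
 have sets [measurable_cong, simp]: "sets mu = sets borel" by (rule nice_sets[OF n])
 have sp [simp]: "space mu = UNIV" by (rule nice_space[OF n])
 have pU [simp]: "prob UNIV = 1" using prob_space by simp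
 note [measurable] = slc_weight_measurable[OF w]
 note nn = slc_weight_nonneg[OF w]
 have "L-lipschitz_on UNIV u" using lip L by (auto simp: lipschitz_on_def dist_norm norm_minus_commute)
 hence [measurable]: "u : BM" by (intro borel_measurable_continuous_onI lipschitz_on_continuous_on)
 have growth: "abs (u x) <= abs (u 0) + L * norm x" for x using lip[of x 0] by simp
 have qid: "sqint mu (%x. x)" using nice_sq[OF n] by (simp add: sqint_def)
 show qu: "sqint mu u"
 proof (rule l2_mono(1))
  show "sqint mu (%x. abs (u 0) + norm (L *. x))"
   using sqint_add[OF sqint_const[of "abs (u 0)"] l2_mono(1)[OF _ sqint_scale[OF qid, of L], of "%x. norm (L *. x)"]] by simp
  show "norm (u x) <= norm (abs (u 0) + norm (L *. x))" for x using growth[of x] L by simp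
 qed simp
 have iu: "integrable mu u" "integrable mu (%x. (u x)^2)" using sqint_integrable[OF qu] qu by (auto simp: sqint_def)
 define R where "R = 1 / ka * (LINT x|mu. (G x)^2)"
 have R0: "0 <= R" using k by (simp add: R_def)
 define I :: "nat => 'a => real" where "I n = indicator (cball 0 (real n))" for n
 have [measurable]: "I n : BM" for n unfolding I_def by (rule borel_measurable_indicator) simp
 have I01: "I n x * I n x = I n x" for n x by (auto simp: I_def split: split_indicator)
 define a where "a n = (LINT x|mu. I n x * u x)" for n
 define b where "b n = (LINT x|mu. I n x * (u x)^2)" for n
 define m where "m n = (LINT x|mu. I n x)" for n
 have iI: "integrable mu (%x. I n x * h x)" if "integrable mu h" for n and h :: "'a => real"
  using integrable_mult_indicator[OF _ that, of "cball 0 (real n)"] by (simp add: I_def)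
 have "incseq (%n. cball (0::'a) (real n))" by (auto simp: incseq_def)
 moreover have "(UN n. cball (0::'a) (real n)) = UNIV" using real_arch_simple by auto
 ultimately have lim: "(%n. (LINT x|mu. I n x * h x)) ----> (LINT x|mu. h x)" if "integrable mu h" for h :: "'a => real"
  unfolding I_def by (intro truncated_integral_tendsto that) auto
 have la: "a ----> (LINT x|mu. u x)" and lb: "b ----> (LINT x|mu. (u x)^2)" and lm: "m ----> 1"
  unfolding a_def b_def m_def using lim[OF iu(1)] lim[OF iu(2)] lim[of "%_. 1"] by simp_all
 have step: "m n * b n - (a n)^2 <= m n * R" if m: "m n > 0" for n
 proof -
  define cc where "cc = a n / m n"
  let ?w = "%x. rho x * I n x" and ?v = "%x. I n x * (u x - cc)"
  let ?M = "density lborel (%x. ennreal (?w x))"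
  have wpos: "?w x > 0 ==> I n x = 1" for x by (auto simp: I_def split: split_indicator_asm)
  note rs = slc_weight_restrict[OF w convex_cball _ finite_measure_axioms[unfolded mu_def], of 0 "real n", folded mu_def I_def]
  have "ennreal (LINT x|?M. (?v x)^2) <= (NN ?M (%x. ennreal (1 / ka * (G x)^2)))"
  proof (rule poincare_local_slope[OF k rs(1,2)])
   show "abs (?v x) <= abs (u 0) + L * real n + abs cc" for x
   proof (cases "norm x <= real n")
    case True thus ?thesis using growth[of x] mult_left_mono[OF True L] by (simp add: I_def)
   qed (use L in "simp add: I_def")
   show "?v y - ?v x <= L * norm (x - y)" if "?w x > 0" "?w y > 0" for x y
    using wpos[OF that(1)] wpos[OF that(2)] lip[where x = x and y = y] by simp
   have "EX r>0. ALL x. ?w x > 0 --> norm (x - y) < r --> ?v y - ?v x <= (G y + eta) * norm (x - y)"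
    if y: "?w y > 0" and e: "eta > 0" for y eta
   proof -
    obtain r where r: "r > 0" "!!x. norm (x - y) < r ==> u y - u x <= (G y + eta) * norm (x - y)" using slope[OF e] by blast
    have "?v y - ?v x <= (G y + eta) * norm (x - y)" if x: "?w x > 0" "norm (x - y) < r" for x
     using r(2)[OF x(2)] wpos[OF y] wpos[OF x(1)] by simp
    with r(1) show ?thesis by blast
   qed
   thus "AE y in lborel. ?w y > 0 -->
    (ALL eta>0. EX r>0. ALL x. ?w x > 0 --> norm (x - y) < r --> ?v y - ?v x <= (G y + eta) * norm (x - y))" by blast
   have "(LINT x|?M. ?v x) = (LINT x|mu. I n x * u x - cc * I n x)"
    by (subst rs(4), measurable) (rule I_cong, auto simp: algebra_simps I01 mult.assoc[symmetric])
   also have "... = a n - cc * m n" unfolding a_def m_def using iI[OF iu(1)] iI[of "%_. 1"] by simp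
   finally show "(LINT x|?M. ?v x) = 0" using m by (simp add: cc_def)
  qed (use G0 L in auto)
  also have "... <= (NN mu (%x. ennreal (1 / ka * (G x)^2)))" by (rule rs(3)) auto
  also have "... = ennreal R"
   unfolding R_def integral_mult_right_zero[symmetric] by (rule nn_integral_eq_integral) (use iG k in auto)
  finally have le: "(LINT x|?M. (?v x)^2) <= R" using R0 by (simp add: ennreal_le_iff)
  have "(LINT x|?M. (?v x)^2) = (LINT x|mu. I n x * (u x)^2 - 2 * cc * (I n x * u x) + cc^2 * I n x)"
  proof (subst rs(4), measurable, rule I_cong)
   fix x
   have "I n x = 0 | I n x = 1" by (auto simp: I_def split: split_indicator)
   thus "I n x * (?v x)^2 = I n x * (u x)^2 - 2 * cc * (I n x * u x) + cc^2 * I n x"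
    by (elim disjE) (simp_all add: power2_eq_square algebra_simps)
  qed simp
  also have "... = b n - 2 * cc * a n + cc^2 * m n"
   unfolding a_def m_def b_def using iI[OF iu(1)] iI[OF iu(2)] iI[of "%_. 1"] by simp
  finally have "m n * (b n - 2 * cc * a n + cc^2 * m n) <= m n * R" using le m by (intro mult_left_mono) auto
  moreover have "m n * (b n - 2 * cc * a n + cc^2 * m n) = m n * b n - (a n)^2"
   using m by (simp add: cc_def power2_eq_square field_simps)
  ultimately show ?thesis by simp
 qed
 have "\<forall>\<^sub>F n in sequentially. m n > 0" by (rule order_tendstoD(1)[OF lm]) simp
 hence ev: "\<forall>\<^sub>F n in sequentially. m n * b n - (a n)^2 <= m n * R" by eventually_elim (rule step)
 have "(%n. m n * b n - (a n)^2) ----> 1 * (LINT x|mu. (u x)^2) - (LINT x|mu. u x)^2" "(%n. m n * R) ----> 1 * R"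
  by (intro tendsto_intros la lb lm)+
 from tendsto_le[OF _ this(2,1) ev] show "(LINT x|mu. (u x)^2) - (LINT x|mu. u x)^2 <= 1 / ka * (LINT x|mu. (G x)^2)"
  by (simp add: R_def)
qed

lemma perp_proj_props:
 fixes e :: "'a::euclidean_space"
 assumes e: "norm e = 1"
 shows perp_proj_diff: "perp_proj e x - perp_proj e y = perp_proj e (x - y)"
  and norm_perp_split: "(norm x)^2 = (e <.> x)^2 + (norm (perp_proj e x))^2"
  and norm_perp_le: "norm (perp_proj e x) <= norm x" and abs_inner_unit_le: "abs (e <.> x) <= norm x"
  and perp_proj_in: "perp_proj e x : {e}\<^sup>\<bottom>" and perp_proj_measurable: "perp_proj e : BM"
proof -
 have ee: "e <.> e = 1" using e by (simp add: dot_square_norm)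
 show "perp_proj e x - perp_proj e y = perp_proj e (x - y)" for x y by (simp add: perp_proj_def algebra_simps inner_simps)
 show s: "(norm x)^2 = (e <.> x)^2 + (norm (perp_proj e x))^2" for x
  unfolding perp_proj_def power2_norm_eq_inner by (simp add: inner_simps ee inner_commute power2_eq_square)
 show "norm (perp_proj e x) <= norm x" by (rule power2_le_imp_le) (use s[of x] in auto)
 show "abs (e <.> x) <= norm x" using Cauchy_Schwarz_ineq2[of e x] e by simp
 show "perp_proj e x : {e}\<^sup>\<bottom>"
  by (simp add: perp_proj_def orthogonal_comp_def orthogonal_def inner_simps ee inner_commute)
 show "perp_proj e : BM" unfolding perp_proj_def[abs_def] by measurable
qed

lemma bound_by_square_imp_zero:
 fixes D Z :: real
 assumes "!!tau. 2 * tau * D <= tau^2 * Z" shows "D = 0"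
proof (rule ccontr)
 assume D: "D ~= 0"
 have Z: "0 <= Z" using assms[of 1] assms[of "-1"] by simp
 define p where "p = 1 / (Z + 1)"
 have p: "p > 0" "p * Z <= 1" using Z by (auto simp: p_def)
 have "2 * (p * D) * D <= (p * D)^2 * Z" by (rule assms)
 also have "... = (p * D^2) * (p * Z)" by (simp add: power2_eq_square)
 also have "... <= (p * D^2) * 1" using p by (intro mult_left_mono) auto
 finally have "p * D^2 <= 0" by (simp add: power2_eq_square mult_ac)
 moreover have "p * D^2 > 0" using p D by simp
 ultimately show False by simp
qed

text \<open>The Poincare inequality for \<open>s + \<tau> \<theta>(s) g(p)\<close>, where \<open>s\<close> and \<open>p\<close> are the coordinates along
  \<open>e\<close> and orthogonal to it, is an equality at \<open>\<tau> = 0\<close>; its first variation is the Stein identity.\<close>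

lemma stein_identity:
 fixes rho :: "'a::euclidean_space => real" and g :: "'a => real" and th th' :: "real => real" and e :: 'a
 defines "mu \<equiv> dens rho"
 defines "s \<equiv> %x. e <.> (x - (LINT x|mu. x))"
 assumes k: "ka > 0" and w: "slc_weight ka rho" and n: "nice Om mu" and e: "norm e = 1"
  and ext: "1 <= ka * (LINT x|mu. (s x)^2)"
  and th: "!!x. (th has_real_derivative th' x) (at x)" and [measurable]: "th' : BM"
  and B: "!!x. abs (th x) <= B" "!!x. abs (th' x) <= B"
  and g: "!!x. 0 <= g x" "!!x. g x <= 1" and L: "L-lipschitz_on UNIV g"
 shows "ka * (LINT x|mu. s x * (th (s x) * g (perp_proj e x))) = (LINT x|mu. th' (s x) * g (perp_proj e x))"
proof -
 interpret prob_space mu by (rule nice_prob[OF n])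
 have sets [measurable_cong, simp]: "sets mu = sets borel" by (rule nice_sets[OF n])
 have sp [simp]: "space mu = UNIV" by (rule nice_space[OF n])
 have pU [simp]: "prob UNIV = 1" using prob_space by simp
 let ?P = "perp_proj e"
 note P = perp_proj_props[OF e]
 note [measurable] = P(6)
 have B0: "0 <= B" using B(1)[of 0] by linarith
 have L0: "0 <= L" using L by (rule lipschitz_on_nonneg)
 have gl: "abs (g x - g y) <= L * norm (x - y)" for x y using lipschitz_onD[OF L] by (simp add: dist_norm)
 have [measurable]: "g : BM" "th : BM"
  using lipschitz_on_continuous_on[OF L] DERIV_continuous_on[OF has_field_derivative_at_within[OF th]]
  by (auto intro: borel_measurable_continuous_onI)
 have [measurable]: "s : BM" unfolding s_def by measurable
 have qid: "sqint mu (%x. x)" using nice_sq[OF n] by (simp add: sqint_def)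
 have qs: "sqint mu s" unfolding s_def by (rule l2_mono(1)[OF _ sqint_diff[OF qid sqint_const]]) (use P(4) in auto)
 have is0: "(LINT x|mu. s x) = 0" unfolding s_def using sqint_integrable[OF qid] by (simp add: inner_diff_right)
 have sd: "s y - s x = e <.> (y - x)" for x y by (simp add: s_def inner_diff_right)
 define h where "h x = th (s x) * g (?P x)" for x
 have hB: "abs (h x) <= B" for x
  using mult_mono[OF B(1) g(2) B0 g(1), of "s x" "?P x"] g(1) by (simp add: h_def abs_mult)
 have [measurable]: "h : BM" unfolding h_def by measurable
 have qh: "sqint mu h" by (rule l2_mono(1)[OF _ sqint_const[of B]]) (use hB B0 in auto)
 define q where "q x = th' (s x) * g (?P x)" for x
 have qB: "abs (q x) <= B" for x
  using mult_mono[OF B(2) g(2) B0 g(1), of "s x" "?P x"] g(1) by (simp add: q_def abs_mult)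
 have [measurable]: "q : BM" unfolding q_def by measurable
 have qq: "sqint mu q" by (rule l2_mono(1)[OF _ sqint_const[of B]]) (use qB B0 in auto)
 have thl: "abs (th y - th x) <= B * abs (y - x)" for x y
  using field_differentiable_bound[OF convex_UNIV, of th th' B y x] th B(2) by auto
 define D where "D = ka * (LINT x|mu. s x * h x) - (LINT x|mu. q x)"
 define Z where "Z = (LINT x|mu. (q x)^2) + (B * L)^2"
 have "2 * tau * D <= tau^2 * Z" for tau
 proof -
  define u where "u x = s x + tau * h x" for x
  \<comment> \<open>The slope of \<open>u\<close> is \<open>1 + tau * q x\<close> along
    \<open>e\<close> and at most \<open>abs tau * (B * L)\<close> across, where \<open>g\<close> is
    only Lipschitz. The directions are orthogonal, so squares add, and the transversal part enters
    only at order \<open>tau^2\<close>, invisible to the first variation.\<close>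
  define G where "G x = sqrt ((1 + tau * q x)^2 + (tau * (B * L))^2)" for x
  have G2: "(G x)^2 = (1 + tau * q x)^2 + (tau * (B * L))^2" for x by (simp add: G_def)
  have hd: "h y - h x = g (?P y) * (th (s y) - th (s x)) + th (s x) * (g (?P y) - g (?P x))" for x y
   by (simp add: h_def algebra_simps)
  have gd: "abs (th (s x) * (g (?P y) - g (?P x))) <= B * L * norm (?P (y - x))" for x y
   using mult_mono[OF B(1) gl[of "?P y" "?P x"] B0 abs_ge_zero, of "s x"] by (simp add: abs_mult P(1) mult.assoc)
  have iG: "integrable mu (%x. (G x)^2)" and EG: "(LINT x|mu. (G x)^2) = 1 + 2 * tau * (LINT x|mu. q x) + tau^2 * Z"
  proof -
   have e: "(G x)^2 = (1 + (tau * (B * L))^2) + (2 * tau) * q x + tau^2 * (q x)^2" for x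
    unfolding G2 by (simp add: power2_eq_square algebra_simps)
   show "integrable mu (%x. (G x)^2)" "(LINT x|mu. (G x)^2) = 1 + 2 * tau * (LINT x|mu. q x) + tau^2 * Z"
    unfolding e Z_def using sqint_integrable[OF qq] qq by (simp_all add: sqint_def power_mult_distrib algebra_simps)
  qed
  have "(LINT x|mu. (u x)^2) - (LINT x|mu. u x)^2 <= 1 / ka * (LINT x|mu. (G x)^2)" unfolding mu_def
  proof (rule poincare_lipschitz(2)[OF k w n[unfolded mu_def], where L = "1 + abs (tau) * (B + B * L)"])
   show "0 <= 1 + abs (tau) * (B + B * L)" using B0 L0 by simp
   show "abs (u y - u x) <= (1 + abs (tau) * (B + B * L)) * norm (x - y)" for x y
   proof -
    have a: "abs (s y - s x) <= norm (y - x)" using P(4) by (simp add: sd)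
    have "abs (g (?P y) * (th (s y) - th (s x))) <= 1 * (B * norm (y - x))"
     unfolding abs_mult using g[of "?P y"] order_trans[OF thl[of "s y" "s x"] mult_left_mono[OF a B0]] by (intro mult_mono) auto
    moreover have "abs (th (s x) * (g (?P y) - g (?P x))) <= B * L * norm (y - x)"
     using order_trans[OF gd mult_left_mono[OF P(3)]] B0 L0 by simp
    ultimately have "abs (h y - h x) <= (B + B * L) * norm (y - x)" unfolding hd distrib_right by linarith
    hence "abs (tau) * abs (h y - h x) <= abs (tau) * ((B + B * L) * norm (y - x))" by (intro mult_left_mono) auto
    moreover have "abs (u y - u x) <= abs (s y - s x) + abs (tau) * abs (h y - h x)"
     unfolding u_def abs_mult[symmetric] right_diff_distrib by linarith
    ultimately show ?thesis using a by (simp add: distrib_right mult.assoc norm_minus_commute)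
   qed
   show "G : BM" unfolding G_def by measurable
   show "0 <= G x" for x by (simp add: G_def)
   show "integrable (dens rho) (%x. (G x)^2)" using iG unfolding mu_def .
   show "EX r>0. ALL x. norm (x - y) < r --> u y - u x <= (G y + eta) * norm (x - y)" if "eta > 0" for y eta
   proof -
    have "eta / (abs (tau) + 1) > 0" using that by simp
    then obtain r where r: "r > 0" "!!z. norm (z - s y) < r ==> abs (th z - th (s y) - th' (s y) * (z - s y)) <= eta / (abs (tau) + 1) * norm (z - s y)"
     using th[of "s y"] unfolding has_field_derivative_def has_derivative_at_alt by (metis real_norm_def)
    have "u y - u x <= (G y + eta) * norm (x - y)" if x: "norm (x - y) < r" for x
    proof -
     let ?d = "y - x"
     have sy: "abs (s x - s y) <= norm ?d" using P(4)[of "x - y"] by (simp add: sd norm_minus_commute)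
     hence "abs (th (s x) - th (s y) - th' (s y) * (s x - s y)) <= eta / (abs (tau) + 1) * norm ?d"
      using r(2)[of "s x"] x mult_left_mono[OF sy, of "eta / (abs (tau) + 1)"] `eta > 0` by (simp add: norm_minus_commute)
     hence "abs (g (?P y)) * abs (th (s y) - th (s x) - th' (s y) * (s y - s x)) <= 1 * (eta / (abs (tau) + 1) * norm ?d)"
      using g[of "?P y"] by (intro mult_mono) (auto simp: abs_minus_commute algebra_simps)
     hence 1: "abs (g (?P y) * (th (s y) - th (s x)) - q y * (s y - s x)) <= eta / (abs (tau) + 1) * norm ?d"
      unfolding abs_mult[symmetric] by (simp add: q_def algebra_simps)
     have "abs (h y - h x - q y * (s y - s x)) <= eta / (abs (tau) + 1) * norm ?d + B * L * norm (?P ?d)"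
      unfolding hd using 1 gd[of x y] by linarith
     hence "abs (tau) * abs (h y - h x - q y * (s y - s x)) <= abs (tau) * (eta / (abs (tau) + 1) * norm ?d + B * L * norm (?P ?d))"
      by (intro mult_left_mono) auto
     moreover have "abs (tau) * (eta / (abs (tau) + 1) * norm ?d) <= eta * norm ?d"
     proof -
      have "abs (tau) / (abs (tau) + 1) <= 1" by simp
      from mult_right_mono[OF this, of "eta * norm ?d"] `eta > 0` show ?thesis by (simp add: mult_ac)
     qed
     moreover have "u y - u x = (1 + tau * q y) * (s y - s x) + tau * (h y - h x - q y * (s y - s x))"
      by (simp add: u_def algebra_simps)
     moreover have "tau * (h y - h x - q y * (s y - s x)) <= abs (tau) * abs (h y - h x - q y * (s y - s x))"
      unfolding abs_mult[symmetric] by simp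
     moreover have "(1 + tau * q y) * (s y - s x) + abs (tau) * (B * L * norm (?P ?d)) <= G y * norm ?d"
     proof -
      let ?a = "(1 + tau * q y, abs (tau) * (B * L))" and ?b = "(s y - s x, norm (?P ?d))"
      have "?a <.> ?b <= norm ?a * norm ?b" by (rule norm_cauchy_schwarz)
      moreover have "norm ?a = G y" by (simp add: norm_Pair G_def power_mult_distrib)
      moreover have "norm ?b = norm ?d" using arg_cong[OF P(2)[of ?d], of sqrt] by (simp add: norm_Pair sd)
      ultimately show ?thesis by (simp add: mult_ac)
     qed
     ultimately show ?thesis by (simp add: distrib_right distrib_left norm_minus_commute)
    qed
    with r(1) show ?thesis by blast
   qed
  qed
  moreover have "(LINT x|mu. u x) = tau * (LINT x|mu. h x)"
   unfolding u_def using is0 sqint_integrable[OF qs] sqint_integrable[OF qh] by simp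
  moreover have "(LINT x|mu. (u x)^2) = (LINT x|mu. (s x)^2) + 2 * tau * (LINT x|mu. s x * h x) + tau^2 * (LINT x|mu. (h x)^2)"
  proof -
   have "(LINT x|mu. (u x)^2) = (LINT x|mu. (s x)^2 + 2 * tau * (s x * h x) + tau^2 * (h x)^2)"
    by (rule I_cong) (auto simp: u_def power2_eq_square algebra_simps)
   thus ?thesis using qs qh sqint_inner[OF qs qh] by (simp add: sqint_def)
  qed
  moreover have "(LINT x|mu. h x)^2 <= (LINT x|mu. (h x)^2)"
   using power_mono[OF norm_integral_le_l2[OF qh] norm_ge_zero, of 2] by (simp add: l2_square)
  hence "tau^2 * (LINT x|mu. h x)^2 <= tau^2 * (LINT x|mu. (h x)^2)" by (rule mult_left_mono) simp
  ultimately have "(LINT x|mu. (s x)^2) + 2 * tau * (LINT x|mu. s x * h x) <= 1 / ka * (1 + 2 * tau * (LINT x|mu. q x) + tau^2 * Z)"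
   unfolding EG by (simp add: power_mult_distrib)
  hence "ka * ((LINT x|mu. (s x)^2) + 2 * tau * (LINT x|mu. s x * h x)) <= ka * (1 / ka * (1 + 2 * tau * (LINT x|mu. q x) + tau^2 * Z))"
   using k by (intro mult_left_mono) auto
  thus ?thesis using ext k by (simp add: D_def algebra_simps)
 qed
 hence "D = 0" by (rule bound_by_square_imp_zero)
 thus ?thesis by (simp add: D_def h_def q_def)
qed


lemma DERIV_of_square_bound:
 fixes f :: "real => real"
 assumes "!!y. abs (f y - f x - (y - x) * D) <= K * (y - x)^2"
 shows "(f has_real_derivative D) (at x)" unfolding has_field_derivative_def has_derivative_at_alt
proof (intro conjI allI impI)
 fix eps :: real assume e: "eps > 0"
 have K: "0 <= K" using assms[of "x + 1"] by simp
 show "EX d>0. ALL y. norm (y - x) < d --> norm (f y - f x - D * (y - x)) <= eps * norm (y - x)"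
 proof (intro exI[of _ "eps / (K + 1)"] conjI allI impI)
  fix y assume y: "norm (y - x) < eps / (K + 1)"
  hence "K * abs (y - x) <= eps"
  proof -
   have "abs (y - x) * (K + 1) < eps" using y K by (simp add: pos_less_divide_eq)
   thus ?thesis using abs_ge_zero[of "y - x"] by (simp add: algebra_simps)
  qed
  from mult_right_mono[OF this, of "abs (y - x)"]
  have "K * (y - x)^2 <= eps * abs (y - x)" by (simp add: power2_eq_square mult.assoc abs_mult[symmetric])
  thus "norm (f y - f x - D * (y - x)) <= eps * norm (y - x)" using assms[of y] by (simp add: mult.commute)
 qed (use e K in simp)
qed (simp add: bounded_linear_mult_right)

lemma cos_quadratic_bound: "abs (cos (x + h) - cos x + h * sin x) <= h^2" for x h :: real
proof -
 have "cmod (iexp h - (1 + \<i> * h)) <= h^2 / 2" using iexp_approx1[of h 1] by (simp add: power2_eq_square)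
 hence "cmod (cis x * (cis h - (1 + \<i> * h))) <= h^2 / 2" by (simp add: norm_mult cis_conv_exp)
 moreover have "Re (cis x * (cis h - (1 + \<i> * h))) = cos (x + h) - cos x + h * sin x"
  by (simp add: cos_add algebra_simps)
 ultimately show ?thesis using abs_Re_le_cmod[of "cis x * (cis h - (1 + \<i> * h))"] zero_le_power2[of h] by linarith
qed

text \<open>The Stein identity turns \<open>a \<mapsto> \<integral> cos (a z + p) g\<close> into a solution of \<open>C' = - a C\<close>.\<close>

lemma slc_extremal_split:
 fixes rho :: "'a::euclidean_space => real" and e :: 'a and ka :: real
 defines "mu \<equiv> dens rho"
 defines "z \<equiv> %x. sqrt ka * (e <.> (x - (LINT x|mu. x)))"
 assumes k: "ka > 0" and w: "slc_weight ka rho" and n: "nice Om mu" and e: "norm e = 1"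
  and ext: "1 <= (LINT x|mu. (z x)^2)" and A: "A : sets borel" and B: "B : sets borel"
 shows "emeasure mu {x. z x : A & perp_proj e x : B} = emeasure std_normal_distribution A * emeasure mu {x. perp_proj e x : B}"
proof -
 interpret prob_space mu by (rule nice_prob[OF n])
 interpret N: real_distribution std_normal_distribution by (rule real_dist_normal_dist)
 have sets [measurable_cong, simp]: "sets mu = sets borel" by (rule nice_sets[OF n])
 have sp [simp]: "space mu = UNIV" by (rule nice_space[OF n])
 have pU [simp]: "prob UNIV = 1" using prob_space by simp
 note [measurable] = perp_proj_measurable[OF e] A B
 let ?P = "perp_proj e"
 define s where "s x = e <.> (x - (LINT x|mu. x))" for x
 have zs: "z x = sqrt ka * s x" for x by (simp add: z_def s_def)
 have [measurable]: "z : BM" unfolding z_def by measurable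
 have iz2: "integrable mu (%x. (z x)^2)"
 proof (rule ccontr)
  assume "~ ?thesis" hence "(LINT x|mu. (z x)^2) = 0" by (rule not_integrable_integral_eq)
  thus False using ext by simp
 qed
 have qz: "sqint mu z" using iz2 by (simp add: sqint_def)
 have main: "(LINT x|mu. indicator A (z x) * g (?P x)) = measure std_normal_distribution A * (LINT x|mu. g (?P x))"
  if L: "L-lipschitz_on UNIV g" and g: "!!x. 0 <= g x" "!!x. g x <= 1" for g :: "'a => real" and L
 proof -
  have [measurable]: "g : BM" using lipschitz_on_continuous_on[OF L] by (auto intro: borel_measurable_continuous_onI)
  have bd: "integrable mu (%x. h x * g (?P x))" if "integrable mu h" for h :: "'a => real"
  proof (rule I_bound[OF that])
   show "AE x in mu. norm (h x * g (?P x)) <= norm (h x)" using g by (intro AE_I2) (simp add: abs_mult mult_left_le)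
   show "(%x. h x * g (?P x)) : bm mu" using borel_measurable_integrable[OF that] by measurable
  qed
  have bc: "integrable mu (%x. h x * g (?P x))" if "h : BM" "!!x. abs (h x) <= 1" for h
   by (rule bd, rule integrable_const_bound[of _ 1]) (use that in auto)
  define I where "I = (LINT x|mu. g (?P x))"
  \<comment> \<open>The phase \<open>p\<close> lets one differential equation treat the cosine
    (\<open>p = 0\<close>) and the sine (\<open>p = - pi / 2\<close>) together.\<close>
  define C where "C p a = (LINT x|mu. cos (a * z x + p) * g (?P x))" for p a
  have iC: "integrable mu (%x. cos (a * z x + p) * g (?P x))" for a p by (rule bc) auto
  have iS: "integrable mu (%x. z x * sin (a * z x + p) * g (?P x))" for a p
  proof (rule bd, rule I_bound[OF sqint_integrable[OF qz]])
   show "AE x in mu. norm (z x * sin (a * z x + p)) <= norm (z x)" by (intro AE_I2) (simp add: abs_mult mult_left_le)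
  qed measurable
  have stein: "(LINT x|mu. z x * sin (a * z x + p) * g (?P x)) = a * C p a" for a p
  proof -
   have "ka * (LINT x|mu. s x * (sin (a * sqrt ka * s x + p) * g (?P x)))
     = (LINT x|mu. (a * sqrt ka * cos (a * sqrt ka * s x + p)) * g (?P x))" unfolding s_def mu_def
   proof (rule stein_identity[OF k w n[unfolded mu_def] e])
    have "ka * (LINT x|mu. (s x)^2) = (LINT x|mu. (z x)^2)" using k by (simp add: zs power_mult_distrib)
    thus "1 <= ka * (LINT x|(dens rho). (e <.> (x - (LINT x|(dens rho). x)))^2)" using ext by (simp add: s_def mu_def)
    show "((%u. sin (a * sqrt ka * u + p)) has_real_derivative a * sqrt ka * cos (a * sqrt ka * u + p)) (at u)" for u
     by (auto intro!: derivative_eq_intros)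
    show "abs (sin (a * sqrt ka * u + p)) <= max 1 (abs (a * sqrt ka))" for u by (simp add: le_max_iff_disj)
    show "abs (a * sqrt ka * cos (a * sqrt ka * u + p)) <= max 1 (abs (a * sqrt ka))" for u
     unfolding abs_mult[of "a * sqrt ka"] using mult_left_le[OF abs_cos_le_one, of "abs (a * sqrt ka)"] by (simp add: le_max_iff_disj)
   qed (use g L in auto)
   also have "... = sqrt ka * (a * C p a)" by (simp add: C_def zs mult_ac)
   finally have "sqrt ka * (sqrt ka * (LINT x|mu. s x * (sin (a * sqrt ka * s x + p) * g (?P x)))) = sqrt ka * (a * C p a)"
    using k by (simp add: mult.assoc[symmetric])
   thus ?thesis using k by (simp add: zs mult.assoc)
  qed
  have der: "(C p has_real_derivative - (a * C p a)) (at a)" for p a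
  proof (rule DERIV_of_square_bound)
   fix b
   have "abs (C p b - C p a - (b - a) * - (a * C p a))
    = abs ((LINT x|mu. (cos (b * z x + p) * g (?P x) - cos (a * z x + p) * g (?P x)) + (b - a) * (z x * sin (a * z x + p) * g (?P x))))"
    using iC iS by (simp add: C_def stein[unfolded C_def])
   also have "... <= (LINT x|mu. abs ((cos (b * z x + p) * g (?P x) - cos (a * z x + p) * g (?P x)) + (b - a) * (z x * sin (a * z x + p) * g (?P x))))"
    by (rule integral_abs_bound)
   also have "... <= (LINT x|mu. (b - a)^2 * (z x)^2)"
   proof (rule integral_mono)
    fix x
    have eq: "(cos (b * z x + p) * g (?P x) - cos (a * z x + p) * g (?P x)) + (b - a) * (z x * sin (a * z x + p) * g (?P x))
     = (cos ((a * z x + p) + (b - a) * z x) - cos (a * z x + p) + (b - a) * z x * sin (a * z x + p)) * g (?P x)"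
     by (simp add: algebra_simps)
    have "abs (cos ((a * z x + p) + (b - a) * z x) - cos (a * z x + p) + (b - a) * z x * sin (a * z x + p)) * abs (g (?P x))
     <= ((b - a) * z x)^2 * 1" using cos_quadratic_bound g by (intro mult_mono) auto
    thus "abs ((cos (b * z x + p) * g (?P x) - cos (a * z x + p) * g (?P x)) + (b - a) * (z x * sin (a * z x + p) * g (?P x))) <= (b - a)^2 * (z x)^2"
     unfolding eq abs_mult by (simp add: power_mult_distrib)
   qed (use iC iS iz2 in auto)
   also have "... = (LINT x|mu. (z x)^2) * (b - a)^2" by simp
   finally show "abs (C p b - C p a - (b - a) * - (a * C p a)) <= (LINT x|mu. (z x)^2) * (b - a)^2" .
  qed
  have sol: "C p a = C p 0 * exp (- (a^2) / 2)" for p a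
  proof -
   have "((%a. C p a * exp (a^2 / 2)) has_real_derivative 0) (at b)" for b by (auto intro!: derivative_eq_intros der)
   hence "C p a * exp (a^2 / 2) = C p 0 * exp (0^2 / 2)" using DERIV_isconst_all by blast
   hence "C p a * exp (a^2 / 2) * exp (- (a^2) / 2) = C p 0 * exp (- (a^2) / 2)" by simp
   thus ?thesis by (simp add: mult.assoc exp_add[symmetric])
  qed
  have c: "(LINT x|mu. cos (a * z x) * g (?P x)) = exp (- (a^2) / 2) * I" "(LINT x|mu. sin (a * z x) * g (?P x)) = 0" for a
   using sol[of 0 a] sol[of "- pi / 2" a] by (simp_all add: C_def I_def cos_add cos_diff)
  have I0: "0 <= I" unfolding I_def using g by (intro integral_nonneg_AE) auto
  show ?thesis
  proof (cases "I = 0")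
   case True
   hence "AE x in mu. g (?P x) = 0"
    unfolding I_def using g bc[of "%_. 1"] by (subst (asm) integral_nonneg_eq_0_iff_AE) auto
   hence "(LINT x|mu. indicator A (z x) * g (?P x)) = (LINT x|mu. 0)" by (intro integral_cong_AE) auto
   thus ?thesis using True by (simp add: I_def)
  next
   case False
   with I0 have I: "I > 0" by simp
   \<comment> \<open>Reweighting by a normalised function of the projection: \<open>z\<close> keeps
     the characteristic function of a standard Gaussian whatever \<open>g\<close> is, which is
     independence of \<open>z\<close> from the projection.\<close>
   define h where "h x = g (?P x) / I" for x
   have [measurable]: "h : BM" unfolding h_def by measurable
   have h: "0 <= h x" for x using g I by (simp add: h_def)
   have ih: "integrable mu h" unfolding h_def using bc[of "%_. 1"] by simp
   let ?D = "density mu (%x. ennreal (h x))"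
   have "emeasure ?D UNIV = ennreal (LINT x|mu. h x)"
    using nn_integral_eq_integral[OF ih] h by (simp add: emeasure_density)
   also have "(LINT x|mu. h x) = 1" using I by (simp add: h_def I_def)
   finally interpret D: prob_space ?D by (intro prob_spaceI) simp
   let ?M = "distr ?D borel z"
   interpret M: real_distribution ?M by (rule D.real_distribution_distr) simp
   have "char ?M = char std_normal_distribution"
   proof
    fix a
    have "char ?M a = (LINT x|?D. iexp (a * z x))" unfolding char_def by (rule integral_distr) auto
    also have "... = (LINT x|mu. h x *. iexp (a * z x))" by (rule integral_density) (use h in auto)
    also have "... = (LINT x|mu. complex_of_real (cos (a * z x) * g (?P x) / I) + \<i> * complex_of_real (sin (a * z x) * g (?P x) / I))"
    proof -
     have ie: "iexp t = complex_of_real (cos t) + \<i> * complex_of_real (sin t)" for t :: real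
      unfolding cis_conv_exp[symmetric] by (simp add: complex_eq_iff)
     show ?thesis unfolding ie
      by (rule I_cong) (simp_all add: h_def scaleR_conv_of_real add_divide_distrib algebra_simps)
    qed
    also have "... = complex_of_real (LINT x|mu. cos (a * z x) * g (?P x) / I) + \<i> * complex_of_real (LINT x|mu. sin (a * z x) * g (?P x) / I)"
    proof -
     have "integrable mu (%x. cos (a * z x) * g (?P x) / I)" "integrable mu (%x. sin (a * z x) * g (?P x) / I)"
      using bc[of "%x. cos (a * z x)"] bc[of "%x. sin (a * z x)"] by simp_all
     thus ?thesis by (subst Bochner_Integration.integral_add) (simp_all only: integrable_of_real integrable_mult_right integral_of_real integral_mult_right_zero)
    qed
    also have "... = char std_normal_distribution a" using I by (simp add: c char_std_normal_distribution)
    finally show "char ?M a = char std_normal_distribution a" .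
   qed
   hence eq: "?M = std_normal_distribution" by (intro Levy_uniqueness real_dist_normal_dist M.real_distribution_axioms)
   have "measure std_normal_distribution A = (LINT x|?M. indicator A x)" unfolding eq by simp
   also have "... = (LINT x|?D. indicator A (z x))" by (rule integral_distr) auto
   also have "... = (LINT x|mu. h x *. indicator A (z x))" by (rule integral_density) (use h in auto)
   also have "... = (LINT x|mu. indicator A (z x) * g (?P x)) / I" by (simp add: h_def mult.commute)
   finally show ?thesis using I by (simp add: I_def[symmetric] field_simps)
  qed
 qed
 let ?c = "measure std_normal_distribution A"
 \<comment> \<open>The identity for Lipschitz \<open>g\<close> says that these two measures on the
   projected variable integrate such functions alike; hence they agree on the Borel set
   \<open>B\<close>.\<close>
 let ?M1 = "distr (density mu (%x. ennreal (indicator A (z x)))) borel ?P" and ?M2 = "distr (density mu (%x. ennreal ?c)) borel ?P"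
 have fm: "finite_measure (distr (density mu (%x. ennreal (h x))) borel ?P)"
  if [measurable]: "h : BM" and "!!x. h x <= 1" for h
 proof (rule finite_measure.finite_measure_distr)
  have "(NN mu (%x. ennreal (h x))) <= (NN mu (%x. 1))" using that(2) by (intro nn_integral_mono) simp
  thus "finite_measure (density mu (%x. ennreal (h x)))"
   using emeasure_space_1 by (intro finite_measureI) (auto simp: emeasure_density top_unique)
 qed simp
 have PB [measurable]: "?P -` B : sets borel" using measurable_sets[OF perp_proj_measurable[OF e] B] by simp
 have "?M1 = ?M2"
 proof (rule measure_eqI_bounded_lipschitz)
  show "finite_measure ?M1" by (rule fm) (auto split: split_indicator)
  show "finite_measure ?M2" by (rule fm) auto
  fix g :: "'a => real" and L assume L: "L-lipschitz_on UNIV g" and g: "!!x. 0 <= g x" "!!x. g x <= 1"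
  have [measurable]: "g : BM" using lipschitz_on_continuous_on[OF L] by (auto intro: borel_measurable_continuous_onI)
  have "(LINT x|?M1. g x) = (LINT x|mu. indicator A (z x) * g (?P x))"
   by (subst integral_distr, simp_all, subst integral_density) simp_all
  moreover have "(LINT x|?M2. g x) = (LINT x|mu. ?c * g (?P x))"
   by (subst integral_distr, simp_all del: integral_mult_right_zero, subst integral_density) simp_all
  ultimately show "(LINT x|?M1. g x) = (LINT x|?M2. g x)" using main[OF L g] by simp
 qed simp_all
 hence "emeasure ?M1 B = emeasure ?M2 B" by simp
 moreover have "emeasure ?M1 B = emeasure mu {x. z x : A & ?P x : B}"
 proof -
  have "emeasure ?M1 B = (NN mu (%x. ennreal (indicator A (z x)) * indicator (?P -` B) x))"
   by (subst emeasure_distr, simp_all, subst emeasure_density) simp_all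
  also have "... = (NN mu (%x. indicator {x. z x : A & ?P x : B} x))"
   by (rule nn_integral_cong) (auto split: split_indicator)
  finally show ?thesis by simp
 qed
 moreover have "emeasure ?M2 B = ennreal ?c * emeasure mu {x. ?P x : B}"
 proof -
  have "emeasure ?M2 B = (NN mu (%x. ennreal ?c * indicator (?P -` B) x))"
   by (subst emeasure_distr, simp_all, subst emeasure_density) simp_all
  also have "... = ennreal ?c * emeasure mu (?P -` B)" by (subst nn_integral_cmult) simp_all
  finally show ?thesis by (simp add: vimage_def)
 qed
 ultimately show ?thesis by (simp add: N.emeasure_eq_measure)
qed

section \<open>Uniqueness of the optimal plan\<close>

lemma coupling_cost:
 fixes mu nu :: "'a::euclidean_space measure"
 assumes c: "coupling mu nu pl" and q: "sqint mu (%x. x)" "sqint nu (%x. x)"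
 shows "sqint pl fst" "sqint pl snd"
  "quadratic_cost pl = ennreal ((l2 mu (%x. x))^2 + (l2 nu (%x. x))^2 - 2 * (LINT z|pl. fst z <.> snd z))"
  "0 <= (l2 mu (%x. x))^2 + (l2 nu (%x. x))^2 - 2 * (LINT z|pl. fst z <.> snd z)"
proof -
 have s: "sets pl = sets (mu >< nu)" and d: "distr pl mu fst = mu" "distr pl nu snd = nu"
  using c by (auto simp: coupling_def)
 have m: "fst : pl ->M mu" "snd : pl ->M nu" by (simp_all add: measurable_cong_sets[OF s refl])
 have tr: "sqint pl f" "l2 pl f = l2 eta (%x. x)"
  if f: "f : pl ->M eta" "distr pl eta f = eta" "sqint eta (%x. x)" for f and eta :: "'a measure"
 proof -
  have i: "integrable eta (%x. (norm x)^2)" and [measurable]: "(%x. x) : bm eta" using f(3) by (auto simp: sqint_def)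
  have n: "(%x. (norm x)^2) : bm eta" by measurable
  show "sqint pl f" using integrable_distr_eq[OF f(1) n] i f(2) measurable_comp[OF f(1), of "%x. x" borel]
   by (simp add: sqint_def o_def)
  show "l2 pl f = l2 eta (%x. x)" using integral_distr[OF f(1) n] f(2) by (simp add: l2_def)
 qed
 note F = tr[OF m(1) d(1) q(1)] and S = tr[OF m(2) d(2) q(2)]
 show qf: "sqint pl fst" "sqint pl snd" by (fact F(1) S(1))+
 have e: "(l2 pl (%z. fst z - snd z))^2 = (l2 mu (%x. x))^2 + (l2 nu (%x. x))^2 - 2 * (LINT z|pl. fst z <.> snd z)"
  using l2_diff_square[OF qf] F(2) S(2) by simp
 thus "0 <= (l2 mu (%x. x))^2 + (l2 nu (%x. x))^2 - 2 * (LINT z|pl. fst z <.> snd z)"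
  using zero_le_power2[of "l2 pl (%z. fst z - snd z)"] by simp
 have "quadratic_cost pl = ennreal ((l2 pl (%z. fst z - snd z))^2)" unfolding l2_square quadratic_cost_def dist_norm
  by (rule nn_integral_eq_integral) (use sqint_diff[OF qf] in "auto simp: sqint_def")
 with e show "quadratic_cost pl = ennreal ((l2 mu (%x. x))^2 + (l2 nu (%x. x))^2 - 2 * (LINT z|pl. fst z <.> snd z))" by simp
qed

text \<open>The second moments of the marginals are fixed, so the cost is a decreasing affine
  function of the correlation.\<close>

lemma coupling_cost_le_iff:
 fixes mu nu :: "'a::euclidean_space measure"
 assumes "coupling mu nu pl" "coupling mu nu pl'" "sqint mu (%x. x)" "sqint nu (%x. x)"
 shows "quadratic_cost pl <= quadratic_cost pl' \<longleftrightarrow> (LINT z|pl'. fst z <.> snd z) <= (LINT z|pl. fst z <.> snd z)"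
 unfolding coupling_cost(3)[OF assms(1,3,4)] coupling_cost(3)[OF assms(2-4)]
 using coupling_cost(4)[OF assms(1,3,4)] coupling_cost(4)[OF assms(2-4)] by (simp add: ennreal_le_iff)

context slc_pair begin

definition V :: real where "V = (LINT x|mu0. x <.> T x)"

text \<open>A coupling that attains the dual value satisfies slackness, so \<open>X w\<close> is a
  subgradient of \<open>phi\<close> at \<open>Z w\<close>; at almost every such point
  \<open>phi\<close> is differentiable with gradient \<open>T (Z w)\<close>.\<close>

lemma optimal_pairing:
 fixes Z X :: "'b => 'a"
 assumes m [measurable]: "Z : bm P" "X : bm P" and d: "distr P borel Z = mu0" "distr P borel X = mu1"
 shows "(LINT w|P. Z w <.> X w) <= V" and "V <= (LINT w|P. Z w <.> X w) ==> AE w in P. X w = T (Z w)"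
proof -
 have dp: "dual_pair Om0 mu0 mu1 phi psi" using T by (simp add: brenier_def)
 note c = dual_pair_coupling[OF n0 nice_sq[OF n1] dp m d] and Ve = brenier_value[OF T sets0, folded V_def]
 show "(LINT w|P. Z w <.> X w) <= V" using c(1) Ve by simp
 assume "V <= (LINT w|P. Z w <.> X w)"
 hence "AE w in P. phi (Z w) + psi (X w) = Z w <.> X w" using c(2) Ve by simp
 moreover have "AE w in P. Z w : Om0 & GDERIV phi (Z w) :> T (Z w)"
  by (rule AE_distrD[OF m(1)], unfold d, use brenier_subgradient[OF n0 T] in eventually_elim, blast)
 moreover have "AE w in P. ALL z:Om0. z <.> X w <= phi z + psi (X w)"
  by (rule AE_distrD[OF m(2)], unfold d) (use dp in "simp add: dual_pair_def")
 ultimately show "AE w in P. X w = T (Z w)"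
 proof eventually_elim
  case (elim w)
  show ?case
  proof (rule subgradient_unique[OF nice_open[OF n0]])
   fix z' assume "z' : Om0"
   with elim show "phi z' >= phi (Z w) + X w <.> (z' - Z w)" by (force simp: inner_diff_right inner_commute)
  qed (use elim in auto)
 qed
qed

lemma sqint_id1: "sqint mu1 (%x. x)" using nice_sq[OF n1] by (simp add: sqint_def)

lemma coupling_laws:
 assumes "coupling mu0 mu1 pl"
 shows "fst : bm pl" "snd : bm pl" "distr pl borel fst = mu0" "distr pl borel snd = mu1"
proof -
 have s: "sets pl = sets (mu0 >< mu1)" and d: "distr pl mu0 fst = mu0" "distr pl mu1 snd = mu1"
  using assms by (auto simp: coupling_def)
 show "fst : bm pl" "snd : bm pl" by (simp_all add: measurable_cong_sets[OF s refl])
 show "distr pl borel fst = mu0" "distr pl borel snd = mu1"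
  using distr_cong[of pl pl borel mu0 fst fst] distr_cong[of pl pl borel mu1 snd snd] d by auto
qed

definition plan :: "('a \<times> 'a) measure" where "plan = distr mu0 (mu0 >< mu1) (%x. (x, T x))"

lemma map_plan:
 assumes [measurable]: "R : BM" and R: "distr mu0 borel R = mu1"
 shows "coupling mu0 mu1 (distr mu0 (mu0 >< mu1) (%x. (x, R x)))"
  and "(LINT z|(distr mu0 (mu0 >< mu1) (%x. (x, R x))). fst z <.> snd z) = (LINT x|mu0. x <.> R x)"
proof -
 have "distr mu0 mu1 R = mu1" using distr_cong[of mu0 mu0 borel mu1 R R] R by simp
 thus "coupling mu0 mu1 (distr mu0 (mu0 >< mu1) (%x. (x, R x)))"
  unfolding coupling_def by (auto simp: distr_distr o_def distr_id2)
 show "(LINT z|(distr mu0 (mu0 >< mu1) (%x. (x, R x))). fst z <.> snd z) = (LINT x|mu0. x <.> R x)"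
  by (subst integral_distr) auto
qed

lemma optimal_plan_iff: "optimal_plan mu0 mu1 pl \<longleftrightarrow> pl = plan"
proof
 note p = map_plan[OF T_measurable T_distr, folded plan_def V_def]
 note le = coupling_cost_le_iff[OF _ _ sqint_id sqint_id1]
 show "optimal_plan mu0 mu1 pl" if "pl = plan"
  unfolding optimal_plan_def that using le[OF p(1)] p optimal_pairing(1)[OF coupling_laws] by auto
 assume o: "optimal_plan mu0 mu1 pl"
 hence c: "coupling mu0 mu1 pl" and "V <= (LINT z|pl. fst z <.> snd z)"
  using le[OF _ p(1)] p by (auto simp: optimal_plan_def)
 note l = coupling_laws[OF c]
 have s: "sets pl = sets (mu0 >< mu1)" using c by (simp add: coupling_def)
 have ae: "AE z in pl. snd z = T (fst z)" by (rule optimal_pairing(2)[OF l]) fact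
 have m: "(%z. (fst z, T (fst z))) : pl ->M mu0 >< mu1" unfolding measurable_cong_sets[OF s refl] by measurable
 have "pl = distr pl (mu0 >< mu1) (%z. z)" using distr_id2[OF s[symmetric]] by simp
 also have "... = distr pl (mu0 >< mu1) (%z. (fst z, T (fst z)))"
  by (rule distr_cong_AE[OF refl refl _ _ m]) (use ae s in "auto simp: prod_eq_iff measurable_ident_sets elim: eventually_mono")
 also have "... = distr (distr pl borel fst) (mu0 >< mu1) (%x. (x, T x))"
  by (subst distr_distr[OF _ l(1)]) (auto simp: o_def)
 finally show "pl = plan" by (simp add: l plan_def)
qed

text \<open>By uniqueness the plan of \<open>R\<close> is that of \<open>T\<close>, hence
  concentrated on the graph of \<open>T\<close>. This identifies the map hidden in
  \<open>wasserstein_geodesic\<close>.\<close>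

lemma optimal_map_AE:
 assumes "optimal_map mu0 mu1 R" shows "R : BM" "AE x in mu0. R x = T x"
proof -
 have "R : mu0 ->M mu1" and p: "distr mu0 (mu0 >< mu1) (%x. (x, R x)) = plan"
  using assms optimal_plan_iff by (auto simp: optimal_map_def)
 thus [measurable]: "R : BM" by (simp add: measurable_cong_sets[OF sets0 sets1])
 have "{z : space (borel >< borel). snd z = T (fst z)} : sets (borel >< borel)" by measurable
 hence s: "{z : space (mu0 >< mu1). snd z = T (fst z)} : sets (mu0 >< mu1)"
  using sets_pair_measure_cong[OF sets0 sets1] by (simp add: space_pair_measure nice_space[OF n1])
 have "AE z in plan. snd z = T (fst z)" unfolding plan_def by (subst AE_distr_iff[OF _ s]) auto
 thus "AE x in mu0. R x = T x" unfolding p[symmetric] by (subst (asm) AE_distr_iff[OF _ s]) auto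
qed

end

section \<open>From split measures to split transport\<close>

lemma gaussian_affine:
 assumes v: "v > 0" and a: "a > 0"
 shows "distr (gaussian m v) borel (%x. b + a * (x - m)) = gaussian b (a^2 * v)"
proof -
 let ?M = "gaussian m v"
 interpret prob_space ?M unfolding gaussian_def using v by (intro prob_space_normal_density) simp
 have "distributed ?M lborel (%x. x) (normal_density m (sqrt v))"
  unfolding distributed_def by (auto simp: gaussian_def distr_id2)
 from normal_density_affine[OF this _, of a "b - a * m"] a v
 have "distributed ?M lborel (%x. b - a * m + a * x) (normal_density b (a * sqrt v))" by simp
 moreover have "a * sqrt v = sqrt (a^2 * v)" using a v by (simp add: real_sqrt_mult)
 ultimately have "distr ?M lborel (%x. b - a * m + a * x) = gaussian b (a^2 * v)"
  unfolding distributed_def gaussian_def by simp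
 moreover have "distr ?M lborel (%x. b - a * m + a * x) = distr ?M borel (%x. b + a * (x - m))"
  by (rule distr_cong) (auto simp: algebra_simps)
 ultimately show ?thesis by simp
qed

lemma coord_measurable:
 assumes "norm e = 1" shows "coord e : borel ->M (borel >< perp_borel e)" "perp_proj e : borel ->M perp_borel e"
proof -
 show p: "perp_proj e : borel ->M perp_borel e"
  unfolding perp_borel_def using perp_proj_measurable[OF assms] perp_proj_in[OF assms]
  by (intro measurable_restrict_space2) auto
 show "coord e : borel ->M (borel >< perp_borel e)" unfolding coord_def[abs_def] using p by measurable
qed

text \<open>A product measure is determined on rectangles, where \<open>slc_extremal_split\<close>
  applies after standardising the coordinate along \<open>e\<close>; the second factor is the law of
  the projection.\<close>

lemma slc_extremal_splits_gaussian:
 fixes rho :: "'a::euclidean_space => real"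
 defines "mu \<equiv> dens rho"
 assumes k: "ka > 0" and w: "slc_weight ka rho" and n: "nice Om mu" and e: "norm e = 1"
  and ext: "1 <= sqrt ka * l2 mu (%x. e <.> (x - (LINT x|mu. x)))"
 shows "EX nu : space (prob_algebra (perp_borel e)). splits_gaussian e ka mu nu"
proof
 interpret prob_space mu by (rule nice_prob[OF n])
 interpret N: real_distribution std_normal_distribution by (rule real_dist_normal_dist)
 have sets [measurable_cong, simp]: "sets mu = sets borel" by (rule nice_sets[OF n])
 have sp [simp]: "space mu = UNIV" by (rule nice_space[OF n])
 note [measurable] = coord_measurable[OF e]
 let ?nu = "distr mu (perp_borel e) (perp_proj e)" and ?m = "(LINT x|mu. x)"
 interpret nu: prob_space ?nu by (rule prob_space_distr) measurable
 show "?nu : space (prob_algebra (perp_borel e))" by (simp add: space_prob_algebra nu.prob_space_axioms)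
 have ext': "1 <= (LINT x|mu. (sqrt ka * (e <.> (x - ?m)))^2)"
  using power_mono[OF ext, of 2] k by (simp add: l2_square power_mult_distrib)
 have g: "gaussian (e <.> ?m) (inverse ka) = distr std_normal_distribution borel (%x. e <.> ?m + inverse (sqrt ka) * x)"
  using gaussian_affine[of 1 "inverse (sqrt ka)" 0 "e <.> ?m"] k by (simp add: gaussian_def power_inverse)
 interpret G: prob_space "gaussian (e <.> ?m) (inverse ka)" unfolding g by (rule N.prob_space_distr) simp
 show "splits_gaussian e ka mu ?nu" unfolding splits_gaussian_def
 proof (rule pair_measure_eqI[symmetric])
  show "sets (gaussian (e <.> ?m) (inverse ka) >< ?nu) = sets (distr mu (borel >< perp_borel e) (coord e))"
   by (auto simp: gaussian_def intro!: sets_pair_measure_cong)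
  fix A B assume "A : sets (gaussian (e <.> ?m) (inverse ka))" "B : sets ?nu"
  hence A [measurable]: "A : sets borel" and B [measurable]: "B : sets (perp_borel e)" by (auto simp: gaussian_def)
  then obtain B' where B': "B' : sets borel" "B = B' Int {e}\<^sup>\<bottom>"
   unfolding perp_borel_def sets_restrict_space by auto
  let ?A = "(%y. e <.> ?m + inverse (sqrt ka) * y) -` A"
  have A': "?A : sets borel" using measurable_sets[OF _ A, of "%y. e <.> ?m + inverse (sqrt ka) * y" borel] by simp
  have "emeasure (distr mu (borel >< perp_borel e) (coord e)) (A \<times> B)
    = emeasure mu {x. sqrt ka * (e <.> (x - ?m)) : ?A & perp_proj e x : B'}"
  proof (subst emeasure_distr)
   have "sqrt ka * (e <.> (x - ?m)) : ?A \<longleftrightarrow> e <.> x : A" for x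
    using k by (simp add: inner_diff_right mult.assoc[symmetric])
   thus "emeasure mu (coord e -` (A \<times> B) Int space mu)
     = emeasure mu {x. sqrt ka * (e <.> (x - ?m)) : ?A & perp_proj e x : B'}"
    using perp_proj_in[OF e] B'(2) by (intro arg_cong[of _ _ "emeasure mu"]) (auto simp: coord_def)
  qed measurable
  also have "... = emeasure std_normal_distribution ?A * emeasure mu {x. perp_proj e x : B'}"
   unfolding mu_def by (rule slc_extremal_split[OF k w n[unfolded mu_def] e ext'[unfolded mu_def] A'[unfolded mu_def] B'(1)])
  also have "emeasure std_normal_distribution ?A = emeasure (gaussian (e <.> ?m) (inverse ka)) A"
   unfolding g by (subst emeasure_distr) auto
  also have "emeasure mu {x. perp_proj e x : B'} = emeasure ?nu B"
   using perp_proj_in[OF e] B'(2) by (subst emeasure_distr[OF _ B]) (auto intro!: arg_cong[of _ _ "emeasure mu"])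
  finally show "emeasure (gaussian (e <.> ?m) (inverse ka)) A * emeasure ?nu B
    = emeasure (distr mu (borel >< perp_borel e) (coord e)) (A \<times> B)" by simp
 qed (auto intro: prob_space_imp_sigma_finite G.prob_space_axioms nu.prob_space_axioms)
qed

lemma (in prob_space) distr_pair_snd: "prob_space N ==> distr (M >< N) N snd = N"
proof (rule measure_eqI)
 fix A assume N: "prob_space N" and A: "A : sets (distr (M >< N) N snd)"
 interpret N: prob_space N by fact
 have "emeasure (distr (M >< N) N snd) A = emeasure (M >< N) (space M \<times> A)"
  using A by (auto simp: emeasure_distr space_pair_measure dest: sets.sets_into_space intro!: arg_cong2[where f=emeasure])
 with A show "emeasure (distr (M >< N) N snd) A = emeasure N A"
  by (simp add: N.emeasure_pair_measure_Times emeasure_space_1)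
qed simp

lemma sqint_law:
 fixes f :: "'b => 'a::euclidean_space"
 assumes "f : M ->M N" "(%x. x) : bm N" "distr M N f = N" "sqint M f"
 shows "sqint N (%x. x)"
proof -
 have n: "(%x. (norm x)^2) : bm N" using assms(2) by measurable
 show ?thesis using integrable_distr_eq[OF assms(1) n] assms by (simp add: sqint_def)
qed

lemma inner_left_measurable [measurable]: "(<.>) v : bm (borel :: 'a::euclidean_space measure)"
 by (intro borel_measurable_continuous_onI continuous_intros)

lemma perp_borel_ident: "(%x. x) : perp_borel e ->M borel"
 unfolding perp_borel_def by (rule measurable_restrict_space1) simp

lemma perp_borel_borel: "f : M ->M perp_borel e ==> f : M ->M borel"
 using measurable_compose[OF _ perp_borel_ident] by auto

lemma perp_borel_pair_measurable [measurable]: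
 "(%w. fst w *. e + snd w) : bm (borel >< perp_borel e)"
 "(%z. fst z <.> snd z) : bm (perp_borel e >< perp_borel e)"
 by (intro borel_measurable_add borel_measurable_scaleR borel_measurable_inner
   perp_borel_borel[OF measurable_snd] perp_borel_borel[OF measurable_fst] measurable_fst borel_measurable_const)+

lemma splits_gaussian_laws:
 assumes e: "norm e = 1" and mu: "prob_space mu" "sets mu = sets borel" and nu: "prob_space nu" "sets nu = sets (perp_borel e)"
  and k: "ka > 0" and s: "splits_gaussian e ka mu nu"
 defines "gam \<equiv> gaussian (e <.> (LINT x|mu. x)) (inverse ka)"
 shows "prob_space gam" "distr (gam >< nu) borel (%w. fst w *. e + snd w) = mu"
  and "distr mu borel (%x. e <.> x) = gam" "distr mu nu (perp_proj e) = nu"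
proof -
 interpret M: prob_space mu by fact
 interpret N: prob_space nu by fact
 show "prob_space gam" unfolding gam_def gaussian_def using k by (intro prob_space_normal_density) simp
 then interpret G: prob_space gam .
 note [measurable_cong] = mu(2) nu(2)
 have [measurable_cong]: "sets gam = sets borel" by (simp add: gam_def gaussian_def)
 note [measurable] = coord_measurable[OF e]
 have C: "distr mu (borel >< perp_borel e) (coord e) = gam >< nu" using s by (simp add: splits_gaussian_def gam_def)
 have "distr (gam >< nu) borel (%w. fst w *. e + snd w) = distr mu borel (%x. x)"
  unfolding C[symmetric] by (subst distr_distr) (auto simp: o_def coord_def perp_proj_def)
 thus "distr (gam >< nu) borel (%w. fst w *. e + snd w) = mu" using distr_id2[OF mu(2)[symmetric]] by simp
 have "distr (gam >< nu) borel fst = distr mu borel (%x. e <.> x)"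
  unfolding C[symmetric] by (subst distr_distr) (auto simp: o_def coord_def)
 also have "distr (gam >< nu) borel fst = distr (gam >< nu) gam fst" by (rule distr_cong) (auto simp: gam_def gaussian_def)
 finally show "distr mu borel (%x. e <.> x) = gam" by (simp add: N.distr_pair_fst)
 have "distr (gam >< nu) nu snd = distr mu nu (perp_proj e)"
  unfolding C[symmetric] by (subst distr_distr) (auto simp: o_def coord_def)
 thus "distr mu nu (perp_proj e) = nu" by (simp add: G.distr_pair_snd[OF nu(1)])
qed

locale slc_split = slc_pair +
 fixes e :: 'a and nu0 nu1
 assumes e: "norm e = 1"
  and nu0: "prob_space nu0" "sets nu0 = sets (perp_borel e)" and nu1: "prob_space nu1" "sets nu1 = sets (perp_borel e)"
  and s0: "splits_gaussian e ka0 mu0 nu0" and s1: "splits_gaussian e ka1 mu1 nu1"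
begin

sublocale P1: prob_space mu1 using n1 by (rule nice_prob)
sublocale N0: prob_space nu0 by (rule nu0)
sublocale N1: prob_space nu1 by (rule nu1)

abbreviation "Q \<equiv> perp_proj e"
definition m0 :: real where "m0 = e <.> (LINT x|mu0. x)"
definition m1 :: real where "m1 = e <.> (LINT x|mu1. x)"
definition G0 :: "real measure" where "G0 = gaussian m0 (inverse ka0)"
definition G1 :: "real measure" where "G1 = gaussian m1 (inverse ka1)"
text \<open>Ratio of the standard deviations of \<open>G1\<close> and \<open>G0\<close>, which makes
  \<open>aff\<close> the increasing affine map between the two Gaussians.\<close>

definition r :: real where "r = sqrt (ka0 / ka1)"
definition aff :: "real => real" where "aff a = m1 + r * (a - m0)"

lemmas laws0 = splits_gaussian_laws[OF e nice_prob[OF n0] sets0 nu0 k0 s0, folded m0_def, folded G0_def]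
lemmas laws1 = splits_gaussian_laws[OF e nice_prob[OF n1] sets1 nu1 k1 s1, folded m1_def, folded G1_def]

sublocale Ga0: prob_space G0 by (rule laws0)
sublocale Ga1: prob_space G1 by (rule laws1)

declare coord_measurable[OF e, measurable] nu0(2)[measurable_cong] nu1(2)[measurable_cong]

lemma sets_G [measurable_cong, simp]: "sets G0 = sets borel" "sets G1 = sets borel"
 by (simp_all add: G0_def G1_def gaussian_def)

lemma space_nu [simp]: "space nu0 = {e}\<^sup>\<bottom>" "space nu1 = {e}\<^sup>\<bottom>"
 using sets_eq_imp_space_eq[OF nu0(2)] sets_eq_imp_space_eq[OF nu1(2)] by (simp_all add: perp_borel_def space_restrict_space)

lemma aff_measurable [measurable]: "aff : BM" unfolding aff_def by measurable

lemma r: "r > 0" "r / ka0 = sqrt (inverse ka0) * sqrt (inverse ka1)"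
 using k0 k1 by (auto simp: r_def real_sqrt_divide real_sqrt_inverse field_simps)

lemma sqint_factors: "sqint G0 (%x. x)" "sqint G1 (%x. x)" "sqint nu0 (%x. x)" "sqint nu1 (%x. x)"
proof -
 have i: "sqint M (%x. e <.> x)" "sqint M Q" if "sqint M (%x. x)" "sets M = sets borel" for M
  using perp_proj_props[OF e] that l2_mono(1)[OF _ that(1), of "%x. e <.> x"] l2_mono(1)[OF _ that(1), of Q]
  by (simp_all add: measurable_cong_sets[OF that(2) refl])
 have c: "distr mu0 G0 (%x. e <.> x) = G0" "distr mu1 G1 (%x. e <.> x) = G1"
  using distr_cong[of mu0 mu0 borel G0 "%x. e <.> x"] distr_cong[of mu1 mu1 borel G1 "%x. e <.> x"] laws0(3) laws1(3) by simp_all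
 show "sqint G0 (%x. x)" by (rule sqint_law[OF _ _ c(1) i(1)[OF sqint_id sets0]]) measurable
 show "sqint G1 (%x. x)" by (rule sqint_law[OF _ _ c(2) i(1)[OF sqint_id1 sets1]]) measurable
 have "(%x. x) : bm nu0" "(%x. x) : bm nu1"
  unfolding measurable_cong_sets[OF nu0(2) refl] measurable_cong_sets[OF nu1(2) refl] by (rule perp_borel_ident)+
 note m = this
 show "sqint nu0 (%x. x)" by (rule sqint_law[OF _ m(1) laws0(4) i(2)[OF sqint_id sets0]]) measurable
 show "sqint nu1 (%x. x)" by (rule sqint_law[OF _ m(2) laws1(4) i(2)[OF sqint_id1 sets1]]) measurable
qed

definition Z :: "(real \<times> real) \<times> 'a \<times> 'a => 'a" where "Z w = fst (fst w) *. e + fst (snd w)"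
definition X :: "(real \<times> real) \<times> 'a \<times> 'a => 'a" where "X w = snd (fst w) *. e + snd (snd w)"

text \<open>The components from the second factor are orthogonal to \<open>e\<close>, so
  \<open>Z w <.> X w\<close> has no cross terms and correlations add.\<close>

lemma product_coupling:
 assumes c: "coupling G0 G1 pl" "coupling nu0 nu1 sig"
 defines "W \<equiv> pl >< sig"
 shows "Z : bm W" "X : bm W" "distr W borel Z = mu0" "distr W borel X = mu1"
  and "w : space W ==> fst (snd w) : {e}\<^sup>\<bottom> & snd (snd w) : {e}\<^sup>\<bottom>"
  and "(LINT w|W. Z w <.> X w) = (LINT z|pl. fst z <.> snd z) + (LINT z|sig. fst z <.> snd z)"
proof -
 have S [measurable_cong]: "sets pl = sets (G0 >< G1)" "sets sig = sets (nu0 >< nu1)"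
  and d: "distr pl G0 fst = G0" "distr pl G1 snd = G1" "distr sig nu0 fst = nu0" "distr sig nu1 snd = nu1"
  using c by (auto simp: coupling_def)
 interpret pi: prob_space pl by (rule prob_space_distrD[of fst _ G0]) (simp_all add: d Ga0.prob_space_axioms)
 interpret si: prob_space sig by (rule prob_space_distrD[of fst _ nu0]) (simp_all add: d N0.prob_space_axioms)
 have sp: "fst (snd w) : {e}\<^sup>\<bottom> & snd (snd w) : {e}\<^sup>\<bottom>" if "w : space W" for w
 proof -
  have "snd w : space sig" using that by (cases w) (simp add: W_def space_pair_measure)
  also have "space sig = ({e}\<^sup>\<bottom>) \<times> ({e}\<^sup>\<bottom>)" using sets_eq_imp_space_eq[OF S(2)] by (simp add: space_pair_measure)
  finally show ?thesis by (simp add: mem_Times_iff)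
 qed
 thus "w : space W ==> fst (snd w) : {e}\<^sup>\<bottom> & snd (snd w) : {e}\<^sup>\<bottom>" by blast
 show [measurable]: "Z : bm W" "X : bm W"
  using measurable_compose[OF _ perp_borel_pair_measurable(1)[of e], of "%w. (fst (fst w), fst (snd w))" W]
   measurable_compose[OF _ perp_borel_pair_measurable(1)[of e], of "%w. (snd (fst w), snd (snd w))" W]
  unfolding Z_def[abs_def] X_def[abs_def] W_def by simp_all
 have p: "distr W (M >< N) (%(x, y). (f x, g y)) = M >< N"
  if "f : pl ->M M" "g : sig ->M N" "distr pl M f = M" "distr sig N g = N" "prob_space N" for f g and M :: "real measure" and N :: "'a measure"
  using pair_measure_distr[OF that(1,2)] that(3,4) prob_space_imp_sigma_finite[OF that(5)] by (simp add: W_def)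
 have "distr W borel Z = distr (distr W (G0 >< nu0) (%(x, y). (fst x, fst y))) borel (%w. fst w *. e + snd w)"
  unfolding W_def by (subst distr_distr) (auto simp: o_def Z_def[abs_def] case_prod_beta)
 thus "distr W borel Z = mu0" by (simp add: p d N0.prob_space_axioms laws0(2))
 have "distr W borel X = distr (distr W (G1 >< nu1) (%(x, y). (snd x, snd y))) borel (%w. fst w *. e + snd w)"
  unfolding W_def by (subst distr_distr) (auto simp: o_def X_def[abs_def] case_prod_beta)
 thus "distr W borel X = mu1" by (simp add: p d N1.prob_space_axioms laws1(2))
 have ee: "e <.> e = 1" using e by (simp add: dot_square_norm)
 have i: "integrable pl (%z. fst z <.> snd z)" "integrable sig (%z. fst z <.> snd z)"
  by (fact sqint_inner[OF coupling_cost(1,2)[OF c(1) sqint_factors(1,2)]] sqint_inner[OF coupling_cost(1,2)[OF c(2) sqint_factors(3,4)]])+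
 have f1: "distr W pl fst = pl" "distr W sig snd = sig"
  unfolding W_def by (rule si.distr_pair_fst pi.distr_pair_snd[OF si.prob_space_axioms])+
 have m: "fst : W ->M pl" "snd : W ->M sig" by (simp_all add: W_def)
 have iW: "integrable W (%w. fst (fst w) <.> snd (fst w))" "integrable W (%w. fst (snd w) <.> snd (snd w))"
  using integrable_distr_eq[OF m(1), of "%z. fst z <.> snd z"] integrable_distr_eq[OF m(2), of "%z. fst z <.> snd z"] i
  by (simp_all add: f1 borel_measurable_integrable)
 have "(LINT w|W. Z w <.> X w) = (LINT w|W. fst (fst w) <.> snd (fst w) + fst (snd w) <.> snd (snd w))"
  by (rule I_cong)
    (use sp in "auto simp: Z_def X_def inner_simps ee orthogonal_comp_def orthogonal_def inner_commute")
 also have "... = (LINT z|pl. fst z <.> snd z) + (LINT z|sig. fst z <.> snd z)"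
  using iW integral_distr[OF m(1), of "%z. fst z <.> snd z"] integral_distr[OF m(2), of "%z. fst z <.> snd z"] i
  by (simp add: f1 borel_measurable_integrable)
 finally show "(LINT w|W. Z w <.> X w) = (LINT z|pl. fst z <.> snd z) + (LINT z|sig. fst z <.> snd z)" .
qed

lemma gaussian_coordinate:
 "(LINT x|mu0. (e <.> x - m0)^2) = inverse ka0" "(LINT x|mu0. (e <.> T x - m1)^2) = inverse ka1"
 "(LINT x|mu0. e <.> x) = m0" "(LINT x|mu0. e <.> T x) = m1"
proof -
 have v: "(LINT x|M. (e <.> x - e <.> (LINT x|M. x))^2) = inverse ka" "(LINT x|M. e <.> x) = e <.> (LINT x|M. x)"
  if "prob_space M" "sets M = sets borel" "sqint M (%x. x)" "distr M borel (%x. e <.> x) = gaussian (e <.> (LINT x|M. x)) (inverse ka)" "ka > 0" for M ka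
 proof -
  interpret M: prob_space M by fact
  have [measurable_cong]: "sets M = sets borel" by fact
  show mm: "(LINT x|M. e <.> x) = e <.> (LINT x|M. x)" using M.sqint_integrable[OF that(3)] by simp
  have "distributed M lborel (%x. e <.> x) (normal_density (e <.> (LINT x|M. x)) (sqrt (inverse ka)))"
   unfolding distributed_def using that(4) distr_cong[of M M lborel borel "%x. e <.> x"] by (auto simp: gaussian_def)
  from M.normal_distributed_variance[OF _ this] that(5) mm
  show "(LINT x|M. (e <.> x - e <.> (LINT x|M. x))^2) = inverse ka" by simp
 qed
 note 0 = v[OF nice_prob[OF n0] sets0 sqint_id laws0(3)[unfolded G0_def m0_def] k0, folded m0_def]
  and 1 = v[OF nice_prob[OF n1] sets1 sqint_id1 laws1(3)[unfolded G1_def m1_def] k1, folded m1_def]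
 show "(LINT x|mu0. (e <.> x - m0)^2) = inverse ka0" "(LINT x|mu0. e <.> x) = m0" by (fact 0)+
 show "(LINT x|mu0. (e <.> T x - m1)^2) = inverse ka1" "(LINT x|mu0. e <.> T x) = m1"
  using 1 integral_distr[of T mu0 borel "%x. (e <.> x - m1)^2"] integral_distr[of T mu0 borel "%x. e <.> x"]
  by (simp_all add: T_distr)
qed

lemma sqint_coordinates: "sqint mu0 (%x. e <.> x - m0)" "sqint mu0 (%x. e <.> T x - m1)" "sqint mu0 Q" "sqint mu0 (%x. Q (T x))"
 using perp_proj_props[OF e]
 by (auto intro!: sqint_diff P0.sqint_const l2_mono(1)[OF _ sqint_id, of "%x. e <.> x"] l2_mono(1)[OF _ sqint_T, of "%x. e <.> T x"]
   l2_mono(1)[OF _ sqint_id, of Q] l2_mono(1)[OF _ sqint_T, of "%x. Q (T x)"])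

text \<open>Candidates for the two factors of the optimal plan: the monotone plan between the
  Gaussians, and the projection of the plan of \<open>T\<close> itself.\<close>

definition pl' :: "(real \<times> real) measure" where "pl' = distr G0 (G0 >< G1) (%a. (a, aff a))"
definition sig' :: "('a \<times> 'a) measure" where "sig' = distr mu0 (nu0 >< nu1) (%x. (Q x, Q (T x)))"

lemma factor_couplings: "coupling G0 G1 pl'" "coupling nu0 nu1 sig'"
proof -
 have "distr G0 G1 aff = distr G0 borel (%x. m1 + r * (x - m0))" by (rule distr_cong) (auto simp: aff_def)
 also have "... = G1" unfolding G0_def G1_def using gaussian_affine[of "inverse ka0" r m0 m1] k0 k1 r(1)
  by (simp add: r_def field_simps)
 finally show "coupling G0 G1 pl'" unfolding coupling_def pl'_def by (auto simp: distr_distr o_def distr_id2)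
 have "distr mu0 nu1 (%x. Q (T x)) = distr (distr mu0 borel T) nu1 Q" by (subst distr_distr) (auto simp: o_def)
 hence "distr mu0 nu1 (%x. Q (T x)) = nu1" by (simp add: T_distr laws1(4))
 thus "coupling nu0 nu1 sig'" unfolding coupling_def sig'_def by (auto simp: distr_distr o_def laws0(4))
qed

text \<open>Cauchy-Schwarz bounds the covariance of \<open>e <.> x\<close> and
  \<open>e <.> T x\<close> by the product of the standard deviations, and \<open>aff\<close> attains
  this bound; \<open>sig'\<close> reproduces the orthogonal part of the correlation exactly.\<close>

lemma V_split: "V <= (LINT z|pl'. fst z <.> snd z) + (LINT z|sig'. fst z <.> snd z)"
proof -
 have s: "(LINT z|sig'. fst z <.> snd z) = (LINT x|mu0. Q x <.> Q (T x))" unfolding sig'_def by (subst integral_distr) auto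
 have q: "sqint mu0 (%x. e <.> x)" "sqint mu0 (%x. e <.> T x)"
  using sqint_add[OF sqint_coordinates(1) P0.sqint_const[of m0]] sqint_add[OF sqint_coordinates(2) P0.sqint_const[of m1]] by simp_all
 note i = P0.sqint_integrable[OF q(1)] P0.sqint_integrable[OF q(2)]
 have "(LINT z|pl'. fst z <.> snd z) = (LINT a|G0. a * aff a)" unfolding pl'_def by (subst integral_distr) auto
 also have "... = (LINT x|mu0. (e <.> x) * aff (e <.> x))" unfolding laws0(3)[symmetric] by (rule integral_distr) auto
 also have "... = (LINT x|mu0. r * (e <.> x - m0)^2 + (m1 + r * m0) * (e <.> x) - r * m0^2)"
  by (rule I_cong) (auto simp: aff_def power2_eq_square algebra_simps)
 also have "... = r * inverse ka0 + (m1 + r * m0) * m0 - r * m0^2"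
  using sqint_coordinates(1) i gaussian_coordinate by (simp add: sqint_def)
 finally have p: "(LINT z|pl'. fst z <.> snd z) = r / ka0 + m0 * m1" by (simp add: power2_eq_square algebra_simps divide_inverse)
 have "(LINT x|mu0. (e <.> x - m0) <.> (e <.> T x - m1)) <= r / ka0"
  using l2_inner[OF sqint_coordinates(1,2)] unfolding r(2) l2_def using gaussian_coordinate(1,2) by simp
 moreover have "(LINT x|mu0. (e <.> x - m0) <.> (e <.> T x - m1)) = (LINT x|mu0. (e <.> x) * (e <.> T x) - m1 * (e <.> x) - m0 * (e <.> T x) + m0 * m1)"
  by (rule I_cong) (auto simp: algebra_simps)
 moreover have "... = (LINT x|mu0. (e <.> x) * (e <.> T x)) - m0 * m1"
  using sqint_inner[OF q] i gaussian_coordinate by simp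
 moreover have "V = (LINT x|mu0. (e <.> x) * (e <.> T x) + Q x <.> Q (T x))" unfolding V_def using e by (intro I_cong)
   (auto simp: perp_proj_def inner_simps inner_commute dot_square_norm)
 hence "V = (LINT x|mu0. (e <.> x) * (e <.> T x)) + (LINT z|sig'. fst z <.> snd z)"
  using sqint_inner[OF q] sqint_inner[OF sqint_coordinates(3,4)] by (simp add: s)
 ultimately show ?thesis using p by simp
qed

text \<open>The product of the candidates attains the optimal value, so uniqueness places it on the
  graph of \<open>T\<close>.\<close>

lemma product_map: "AE w in pl' >< sig'. X w = T (Z w)"
 using optimal_pairing(2)[OF product_coupling(1-4)[OF factor_couplings]] V_split product_coupling(6)[OF factor_couplings] by simp

lemma inner_coordinates:
 assumes "w : space (pl' >< sig')"
 shows "e <.> Z w = fst (fst w)" "e <.> X w = snd (fst w)" "Q (Z w) = fst (snd w)" "Q (X w) = snd (snd w)"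
 using product_coupling(5)[OF factor_couplings assms] e
 by (auto simp: Z_def X_def inner_simps perp_proj_def orthogonal_comp_def orthogonal_def dot_square_norm)

lemma inner_T_affine: "AE x in mu0. e <.> T x = aff (e <.> x)"
proof -
 note pc = product_coupling(1-4)[OF factor_couplings]
 have "AE w in pl' >< sig'. snd (fst w) = aff (fst (fst w))"
 proof -
  interpret si: prob_space sig' unfolding sig'_def by (rule P0.prob_space_distr) measurable
  have [measurable_cong]: "sets pl' = sets (borel >< borel)" "sets sig' = sets (perp_borel e >< perp_borel e)"
   by (auto simp: pl'_def sig'_def nu0 nu1 intro!: sets_pair_measure_cong)
  have "{z : space (borel >< borel). snd z = aff (fst z)} : sets (borel >< borel)" by measurable
  hence "{z : space (G0 >< G1). snd z = aff (fst z)} : sets (G0 >< G1)"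
   using sets_pair_measure_cong[OF sets_G] sets_eq_imp_space_eq[OF sets_pair_measure_cong[OF sets_G]] by simp
  hence "AE z in pl'. snd z = aff (fst z)" unfolding pl'_def by (subst AE_distr_iff) auto
  hence "AE z in distr (pl' >< sig') pl' fst. snd z = aff (fst z)" unfolding si.distr_pair_fst .
  thus ?thesis by (rule AE_distrD[rotated]) simp
 qed
 hence "AE w in pl' >< sig'. e <.> T (Z w) = aff (e <.> Z w)" using product_map AE_space
 proof eventually_elim
  case (elim w) thus ?case using inner_coordinates[OF elim(3)] by (metis)
 qed
 hence "AE x in distr (pl' >< sig') borel Z. e <.> T x = aff (e <.> x)" by (subst AE_distr_iff[OF pc(1)]) auto
 thus ?thesis by (simp only: pc(3))
qed

lemma plan_coordinates:
 "distr plan ((borel >< borel) >< (perp_borel e >< perp_borel e)) (coord2 e) = pl' >< sig'" (is "distr plan ?N _ = ?W")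
proof -
 note pc = product_coupling(1-4)[OF factor_couplings]
 have W: "sets ?W = sets ?N" by (auto simp: pl'_def sig'_def nu0 nu1 intro!: sets_pair_measure_cong)
 have [measurable]: "coord2 e : (borel >< borel) ->M ?N" unfolding coord2_def by measurable
 have "distr plan ?N (coord2 e) = distr (distr ?W borel Z) ?N (%x. coord2 e (x, T x))"
  unfolding plan_def pc(3) by (subst distr_distr) (auto simp: o_def)
 also have "... = distr ?W ?N (%w. coord2 e (Z w, T (Z w)))" by (subst distr_distr[OF _ pc(1)]) (auto simp: o_def)
 also have "... = distr ?W ?N (%w. w)"
 proof (rule distr_cong_AE)
  show "AE w in ?W. coord2 e (Z w, T (Z w)) = w" using product_map AE_space
  proof eventually_elim
   case (elim w) thus ?case using inner_coordinates[OF elim(2)] by (simp add: coord2_def prod_eq_iff)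
  qed
  note [measurable] = pc(1)
  show "(%w. coord2 e (Z w, T (Z w))) : ?W ->M ?N" by measurable
 qed (simp_all add: measurable_ident_sets[OF W])
 finally show ?thesis using distr_id2[OF W[symmetric]] by simp
qed

text \<open>Exchanging one factor while the other is fixed gives another coupling, whose correlation
  cannot exceed \<open>V\<close>; this makes each candidate optimal for its own marginals.\<close>

theorem transport_splits: "optimal_transport_splits e mu0 mu1 G0 G1 nu0 nu1"
proof -
 have V: "(LINT z|p. fst z <.> snd z) + (LINT z|q. fst z <.> snd z) <= V" if "coupling G0 G1 p" "coupling nu0 nu1 q" for p q
  using optimal_pairing(1)[OF product_coupling(1-4)[OF that]] product_coupling(6)[OF that] by simp
 note c = factor_couplings
 have "optimal_plan G0 G1 pl'"
  unfolding optimal_plan_def using c(1) coupling_cost_le_iff[OF c(1) _ sqint_factors(1,2)] V[OF _ c(2)] V_split by fastforce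
 moreover have "optimal_plan nu0 nu1 sig'"
  unfolding optimal_plan_def using c(2) coupling_cost_le_iff[OF c(2) _ sqint_factors(3,4)] V[OF c(1)] V_split by fastforce
 ultimately show ?thesis unfolding optimal_transport_splits_def optimal_plan_iff using plan_coordinates by blast
qed

text \<open>The coordinate \<open>e <.> F s x\<close> is affine in \<open>e <.> x\<close> with slope
  \<open>1 - s + s * r\<close>, and this slope divided by \<open>sqrt ka0\<close> is
  \<open>c s\<close>.\<close>

lemma variance_inner_F:
 assumes s: "0 <= s" "s <= 1"
 shows "sqint mu0 (%x. e <.> F s x)" "(LINT x|mu0. (e <.> F s x)^2) - (LINT x|mu0. e <.> F s x)^2 = (c s)^2"
proof -
 let ?h = "%x. (1 - s + s * r) * (e <.> x - m0)" and ?m = "(1 - s) * m0 + s * m1"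
 have ae: "AE x in mu0. e <.> F s x = ?h x + ?m" using inner_T_affine
 proof eventually_elim
  case (elim x)
  show ?case unfolding F_def inner_add_right inner_scaleR_right elim by (simp add: aff_def algebra_simps)
 qed
 have qh: "sqint mu0 ?h" using sqint_scale[OF sqint_coordinates(1), of "1 - s + s * r"] by simp
 have mF: "(%x. e <.> F s x) : bm mu0" by measurable
 have "integrable mu0 (%x. (e <.> F s x)^2) \<longleftrightarrow> integrable mu0 (%x. (?h x + ?m)^2)"
  by (rule integrable_cong_AE) (use ae in "auto elim: eventually_mono")
 thus "sqint mu0 (%x. e <.> F s x)" using sqint_add[OF qh P0.sqint_const[of ?m]] mF by (simp add: sqint_def)
 have h0: "(LINT x|mu0. ?h x) = 0" "(LINT x|mu0. (?h x)^2) = (1 - s + s * r)^2 * inverse ka0"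
  using gaussian_coordinate(1,3) integrable_inner_right[OF P0.sqint_integrable[OF sqint_id], of e] by (simp_all add: power_mult_distrib)
 note ih = P0.sqint_integrable[OF qh]
 have "(LINT x|mu0. e <.> F s x) = (LINT x|mu0. ?h x + ?m)" by (rule integral_cong_AE) (use ae in auto)
 also have "... = ?m" using ih h0(1) by (subst Bochner_Integration.integral_add) auto
 finally have 1: "(LINT x|mu0. e <.> F s x) = ?m" .
 have "(LINT x|mu0. (e <.> F s x)^2) = (LINT x|mu0. (?h x)^2 + 2 * ?m * ?h x + ?m^2)"
  by (rule integral_cong_AE) (use ae in "auto elim!: eventually_mono simp: power2_sum")
 also have "... = (LINT x|mu0. (?h x)^2) + 2 * ?m * (LINT x|mu0. ?h x) + ?m^2"
  using ih qh by (subst Bochner_Integration.integral_add Bochner_Integration.integral_add) (auto simp: sqint_def simp del: integral_mult_right_zero)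
 finally have 2: "(LINT x|mu0. (e <.> F s x)^2) = (1 - s + s * r)^2 * inverse ka0 + ?m^2" unfolding h0 by simp
 have "c s = (1 - s + s * r) * sqrt (inverse ka0)"
  using k0 k1 by (simp add: c_def r_def real_sqrt_divide real_sqrt_inverse field_simps)
 hence "(c s)^2 = (1 - s + s * r)^2 * inverse ka0" using k0 by (simp add: power_mult_distrib)
 with 1 2 show "(LINT x|mu0. (e <.> F s x)^2) - (LINT x|mu0. e <.> F s x)^2 = (c s)^2" by simp
qed

end

section \<open>Smooth cutoffs and the lower bound for the Poincare constant\<close>

text \<open>The family is closed under differentiation, which sends \<open>p\<close> to
  \<open>[:0, 0, 1:] * (p - pderiv p)\<close>; it thus contains all derivatives of the standard flat
  function.\<close>

definition flat_exp :: "real poly => real => real" where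
 "flat_exp p t = (if t > 0 then exp (- inverse t) * poly p (inverse t) else 0)"

lemma poly_exp_decay: "((%u::real. u ^ k * (exp (- u) * poly p u)) \<longlongrightarrow> 0) at_top"
proof (induction p arbitrary: k)
 case (pCons a p)
 have "((%u. a * (u ^ k / exp u) + u ^ Suc k * (exp (- u) * poly p u)) \<longlongrightarrow> a * 0 + 0) at_top"
  by (intro tendsto_intros tendsto_power_div_exp_0 pCons)
 thus ?case by (simp add: exp_minus field_simps)
qed simp

lemma flat_tendsto_0: "(flat_exp p \<longlongrightarrow> 0) (at 0)"
proof (rule filterlim_split_at)
 show "(flat_exp p \<longlongrightarrow> 0) (at_left 0)"
  by (rule tendsto_eventually) (auto simp: flat_exp_def eventually_at_left_field intro!: exI[of _ "-1"])
 have "((%t. exp (- inverse t) * poly p (inverse t)) \<longlongrightarrow> 0) (at_right 0)"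
  using filterlim_compose[OF poly_exp_decay[of 0 p] filterlim_inverse_at_top_right] by simp
 moreover have "\<forall>\<^sub>F t in at_right 0. exp (- inverse t) * poly p (inverse t) = flat_exp p t"
  by (auto simp: flat_exp_def eventually_at_right_field intro!: exI[of _ 1])
 ultimately show "(flat_exp p \<longlongrightarrow> 0) (at_right 0)" by (rule Lim_transform_eventually)
qed

lemma flat_deriv: "(flat_exp p has_real_derivative flat_exp ([:0, 0, 1:] * (p - pderiv p)) t) (at t)"
proof -
 consider "t < 0" | "t = 0" | "t > 0" by linarith
 thus ?thesis
 proof cases
  case 1
  have "((%_. 0) has_real_derivative 0) (at t)" by simp
  thus ?thesis
   by (rule DERIV_cong[OF has_field_derivative_transform_within_open[of _ _ _ "{..<0}"]]) (use 1 in "auto simp: flat_exp_def")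
 next
  case 2
  \<comment> \<open>Division by \<open>h\<close> multiplies the polynomial by its variable, so the
    difference quotients at 0 stay in the family and tend to 0.\<close>
  have "flat_exp (pCons 0 p) = (%h. flat_exp p h / h)" by (auto simp: flat_exp_def divide_inverse)
  hence "(%h. flat_exp p h / h) \<midarrow>0\<rightarrow> 0" using flat_tendsto_0[of "pCons 0 p"] by simp
  thus ?thesis using 2 by (simp add: DERIV_def) (simp add: flat_exp_def)
 next
  case 3
  have "((%t. exp (- inverse t) * poly p (inverse t)) has_real_derivative
    exp (- inverse t) * (inverse t)^2 * (poly p (inverse t) - poly (pderiv p) (inverse t))) (at t)"
   using 3 by (auto intro!: derivative_eq_intros DERIV_chain2[OF poly_DERIV] simp: power2_eq_square algebra_simps)
  thus ?thesis by (rule DERIV_cong[OF has_field_derivative_transform_within_open[of _ _ _ "{0<..}"]])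
     (use 3 in "auto simp: flat_exp_def power2_eq_square")
 qed
qed

text \<open>A syntactic class closed under directional derivatives (\<open>smooth_deriv\<close>), so
  that \<open>Ck k\<close> for every \<open>k\<close> is a plain induction.\<close>

inductive smooth :: "('a::euclidean_space => real) => bool" where
 const: "smooth (%x. a)"
| linear: "smooth (%x. x <.> v)"
| add: "smooth f ==> smooth g ==> smooth (%x. f x + g x)"
| mult: "smooth f ==> smooth g ==> smooth (%x. f x * g x)"
| bump: "smooth (%x. flat_exp p (1 - a * (x <.> x)))"

lemma bump_has_derivative:
 fixes x :: "'a::euclidean_space"
 shows "((%x. flat_exp p (1 - a * (x <.> x))) has_derivative
  (%h. flat_exp ([:0, 0, 1:] * (p - pderiv p)) (1 - a * (x <.> x)) * (- 2 * a * (x <.> h)))) (at x)"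
proof -
 have "((%x. 1 - a * (x <.> x)) has_derivative (%h. - 2 * a * (x <.> h))) (at x)"
  by (auto intro!: derivative_eq_intros simp: inner_commute)
 from has_derivative_compose[OF this flat_deriv[unfolded has_field_derivative_def]] show ?thesis .
qed

lemma smooth_deriv:
 "smooth f ==> EX f'. (ALL x. (f has_derivative f' x) (at x)) & (ALL v. smooth (%x. f' x v))"
proof (induction rule: smooth.induct)
 case (const a)
 show ?case by (intro exI[of _ "%_ _. 0"]) (auto intro: smooth.const)
next
 case (linear v)
 show ?case by (intro exI[of _ "%_ h. h <.> v"]) (auto intro!: smooth.const derivative_eq_intros)
next
 case (add f g)
 then obtain f' g' where "ALL x. (f has_derivative f' x) (at x)" "ALL v. smooth (%x. f' x v)"
  "ALL x. (g has_derivative g' x) (at x)" "ALL v. smooth (%x. g' x v)" by blast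
 thus ?case by (intro exI[of _ "%x h. f' x h + g' x h"]) (auto intro: smooth.add has_derivative_add)
next
 case (mult f g)
 then obtain f' g' where "ALL x. (f has_derivative f' x) (at x)" "ALL v. smooth (%x. f' x v)"
  "ALL x. (g has_derivative g' x) (at x)" "ALL v. smooth (%x. g' x v)" by blast
 thus ?case
  by (intro exI[of _ "%x h. f x * g' x h + f' x h * g x"] conjI allI smooth.add smooth.mult has_derivative_mult mult.hyps) blast+
next
 case (bump p a)
 let ?q = "[:0, 0, 1:] * (p - pderiv p)"
 show ?case
 proof (intro exI conjI allI)
  show "((%x. flat_exp p (1 - a * (x <.> x))) has_derivative (%h. flat_exp ?q (1 - a * (x <.> x)) * (- 2 * a * (x <.> h)))) (at x)" for x :: 'a
   by (rule bump_has_derivative)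
  show "smooth (%x. flat_exp ?q (1 - a * (x <.> x)) * (- 2 * a * (x <.> v)))" for v :: 'a
   by (intro smooth.mult smooth.bump smooth.const smooth.linear)
 qed
qed

lemma smooth_Ck: "smooth f ==> Ck k f"
proof (induction k arbitrary: f)
 case (0 f)
 then obtain f' where "!!x. (f has_derivative f' x) (at x)" using smooth_deriv by blast
 thus ?case using has_derivative_continuous by (simp, intro continuous_at_imp_continuous_on ballI) blast
next
 case (Suc k f)
 then obtain f' where f': "!!x. (f has_derivative f' x) (at x)" "!!v. smooth (%x. f' x v)" using smooth_deriv by blast
 have "frechet_derivative f (at x) = f' x" for x using frechet_derivative_at[OF f'(1)] by simp
 thus ?case using Suc.IH[OF f'(2)] f'(1) by (auto simp: differentiable_def)
qed

lemma flat_bounds: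
 "t <= 1 ==> abs (exp 1 * flat_exp 1 t) <= 1" "abs (flat_exp [:0, 0, 1:] t) <= 2"
proof -
 show "abs (exp 1 * flat_exp 1 t) <= 1" if "t <= 1"
 proof (cases "t > 0")
  case True
  hence "1 <= inverse t" using that by (simp add: field_simps)
  thus ?thesis using True by (simp add: flat_exp_def exp_add[symmetric])
 qed (simp add: flat_exp_def)
 show "abs (flat_exp [:0, 0, 1:] t) <= 2"
 proof (cases "t > 0")
  case True
  define z where "z = inverse t"
  have "z >= 0" using True by (simp add: z_def)
  hence "z^2 <= 2 * exp z" using exp_lower_Taylor_quadratic[of z] by simp
  hence "exp (- z) * z^2 <= 2" by (simp add: exp_minus field_simps)
  thus ?thesis using True by (simp add: flat_exp_def z_def power2_eq_square)
 qed (simp add: flat_exp_def)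
qed

text \<open>A linear function times a bump of radius \<open>1 / sqrt a\<close>, with
  \<open>exp 1\<close> normalising the bump to 1 at the origin. The gradient bound does not depend
  on \<open>a\<close>: differentiating the bump contributes a multiple of
  \<open>a * (x <.> x)\<close>, which is below 1 on the support.\<close>

lemma cutoff_test_function:
 fixes e :: "'a::euclidean_space"
 assumes e: "norm e = 1" and a: "a > 0"
 defines "f \<equiv> %x. (x <.> e) * (exp 1 * flat_exp 1 (1 - a * (x <.> x)))"
  and "g \<equiv> %x. (exp 1 * flat_exp 1 (1 - a * (x <.> x))) *. e + ((x <.> e) * (exp 1 * flat_exp [:0, 0, 1:] (1 - a * (x <.> x))) * (- 2 * a)) *. x"
 shows "test_function f" "gradient f x = g x" "abs (f x) <= norm x" "norm (g x) <= 1 + 4 * exp 1"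
proof -
 have "smooth f" unfolding f_def by (intro smooth.mult smooth.bump smooth.const smooth.linear)
 moreover have "{x. f x ~= 0} <= cball 0 (sqrt (1 / a))"
 proof
  fix x assume "x : {x. f x ~= 0}"
  hence "1 - a * (x <.> x) > 0" by (auto simp: f_def flat_exp_def split: if_splits)
  hence "(norm x)^2 <= 1 / a" using a by (simp add: power2_norm_eq_inner field_simps)
  thus "x : cball 0 (sqrt (1 / a))" by (simp add: real_le_rsqrt)
 qed
 hence "compact (closure {x. f x ~= 0})" using bounded_subset bounded_cball compact_closure by blast
 ultimately show "test_function f" unfolding test_function_def using smooth_Ck by blast
 have b: "((%x. flat_exp 1 (1 - a * (x <.> x))) has_derivative (%h. flat_exp [:0, 0, 1:] (1 - a * (x <.> x)) * (- 2 * a * (x <.> h)))) (at x)"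
  using bump_has_derivative[of 1 a x] by simp
 have "(f has_derivative (%h. h <.> g x)) (at x)"
  unfolding f_def g_def by (rule derivative_eq_intros b refl)+ (auto simp: inner_simps inner_commute algebra_simps)
 thus "gradient f x = g x" by (intro gradient_eqI) (simp add: gderiv_def)
 have u: "1 - a * (x <.> x) <= 1" using a by simp
 have xe: "abs (x <.> e) <= norm x" using Cauchy_Schwarz_ineq2[of x e] e by simp
 show "abs (f x) <= norm x" unfolding f_def abs_mult[of "x <.> e"] using mult_mono[OF xe flat_bounds(1)[OF u]] by simp
 have "abs ((x <.> e) * (exp 1 * flat_exp [:0, 0, 1:] (1 - a * (x <.> x))) * (- 2 * a)) * norm x <= 4 * exp 1"
 proof (cases "1 - a * (x <.> x) > 0")
  case True
  have "abs ((x <.> e) * (exp 1 * flat_exp [:0, 0, 1:] (1 - a * (x <.> x))) * (- 2 * a)) * norm x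
    = abs (x <.> e) * (abs (flat_exp [:0, 0, 1:] (1 - a * (x <.> x))) * (exp 1 * 2 * a * norm x))" using a by (simp add: abs_mult)
  also have "... <= norm x * (2 * (exp 1 * 2 * a * norm x))"
   using xe flat_bounds(2) a by (intro mult_mono mult_right_mono) auto
  also have "... = 4 * exp 1 * (a * (x <.> x))" by (simp add: dot_square_norm power2_eq_square)
  also have "... <= 4 * exp 1 * 1" using True by (intro mult_left_mono) auto
  finally show ?thesis by simp
 qed (simp add: flat_exp_def)
 thus "norm (g x) <= 1 + 4 * exp 1"
  unfolding g_def using flat_bounds(1)[OF u] e by (intro norm_triangle_le add_mono) auto
qed

text \<open>The linear function \<open>e <.> x\<close> has gradient of norm 1 but no compact
  support. The cutoffs with \<open>a k\<close> tending to 0 approximate it with uniformly bounded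
  gradients, and dominated convergence carries any admissible constant over.\<close>

lemma poincare_constant_lower:
 fixes M :: "'a::euclidean_space measure"
 assumes M: "prob_space M" "sets M = sets borel" and q: "sqint M (%x. e <.> x)" "sqint M (%x. x)" and e: "norm e = 1"
 shows "ennreal ((LINT x|M. (e <.> x)^2) - (LINT x|M. e <.> x)^2) <= poincare_constant M"
 unfolding poincare_constant_def
proof (rule Inf_greatest)
 interpret prob_space M by fact
 have [measurable_cong]: "sets M = sets borel" by fact
 fix C assume C: "C : {C. ALL f. test_function f --> ennreal (Var M f) <= C * (NN M (%x. ennreal ((norm (gradient f x))^2)))}"
 define a where "a k = inverse (real (Suc k))" for k
 have a: "a k > 0" and la: "a ----> 0" for k using LIMSEQ_inverse_real_of_nat by (auto simp: a_def[abs_def])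
 define f where "f k x = (x <.> e) * (exp 1 * flat_exp 1 (1 - a k * (x <.> x)))" for k x
 define g where "g k x = (exp 1 * flat_exp 1 (1 - a k * (x <.> x))) *. e
  + ((x <.> e) * (exp 1 * flat_exp [:0, 0, 1:] (1 - a k * (x <.> x))) * (- 2 * a k)) *. x" for k x
 note ct = cutoff_test_function[OF e a, folded f_def g_def]
 have "isCont (flat_exp p) t" for p t using flat_deriv by (rule DERIV_isCont)
 hence fl: "(%k. flat_exp p (1 - a k * (x <.> x))) ----> flat_exp p (1 - 0 * (x <.> x))" for p and x :: 'a
  by (intro isCont_tendsto_compose[of _ "flat_exp p"] tendsto_intros la)
 have fm [measurable]: "flat_exp p : BM" for p
  using flat_deriv by (intro borel_measurable_continuous_onI DERIV_continuous_on) (auto intro: has_field_derivative_at_within)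
 have [measurable]: "f k : BM" "g k : BM" for k unfolding f_def[abs_def] g_def[abs_def] by measurable
 have f1: "exp 1 * flat_exp 1 1 = 1" by (simp add: flat_exp_def exp_add[symmetric])
 have lf: "(%k. f k x) ----> e <.> x" for x
  using tendsto_mult[OF tendsto_const[of "x <.> e"] tendsto_mult[OF tendsto_const[of "exp 1"] fl[of 1 x]]] f1
  by (simp add: f_def inner_commute)
 have lg: "(%k. g k x) ----> e" for x
 proof -
  have "(%k. g k x) ----> (exp 1 * flat_exp 1 (1 - 0 * (x <.> x))) *. e
   + ((x <.> e) * (exp 1 * flat_exp [:0, 0, 1:] (1 - 0 * (x <.> x))) * (- 2 * 0)) *. x"
   unfolding g_def by (intro tendsto_intros fl la)
  thus ?thesis using f1 by simp
 qed
 have nx: "integrable M (%x. (norm x)^2)" "integrable M (%x. norm x)"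
  using q(2) sqint_integrable[OF q(2)] by (auto simp: sqint_def)
 have qf: "sqint M (f k)" for k by (rule l2_mono(1)[OF _ q(2)]) (use ct(3) in auto)
 have L1: "(%k. (LINT x|M. f k x)) ----> (LINT x|M. e <.> x)"
  by (rule integral_dominated_convergence[where w = norm]) (use nx ct(3) lf in auto)
 have L2: "(%k. (LINT x|M. (f k x)^2)) ----> (LINT x|M. (e <.> x)^2)"
 proof (rule integral_dominated_convergence[where w = "%x. (norm x)^2"])
  show "AE x in M. norm ((f k x)^2) <= (norm x)^2" for k
   using power_mono[OF ct(3)[of k] abs_ge_zero, of _ 2] by (intro AE_I2) simp
 qed (use nx lf in "auto intro!: tendsto_intros")
 have gb: "(norm (g k x))^2 <= (1 + 4 * exp 1)^2" for k x by (rule power_mono[OF ct(4)]) simp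
 have L3: "(%k. (LINT x|M. (norm (g k x))^2)) ----> (LINT x|M. (norm e)^2)"
  by (rule integral_dominated_convergence[where w = "%_. (1 + 4 * exp 1)^2"]) (use gb lg in "auto intro!: tendsto_intros")
 show "ennreal ((LINT x|M. (e <.> x)^2) - (LINT x|M. e <.> x)^2) <= C"
 proof (cases C)
  case (real r)
  have "(LINT x|M. (f k x)^2) - (LINT x|M. f k x)^2 <= r * (LINT x|M. (norm (g k x))^2)" for k
  proof -
   let ?m = "(LINT x|M. f k x)"
   have "(LINT x|M. (f k x)^2) - ?m^2 = (l2 M (%x. f k x - ?m))^2"
    unfolding l2_diff_square[OF qf sqint_const] using sqint_integrable[OF qf, of k] l2_square[of M "f k"]
    by (simp add: power2_eq_square)
   also have "... = Var M (f k)" by (simp add: l2_square Var_def)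
   moreover have "ennreal (Var M (f k)) <= C * (NN M (%x. ennreal ((norm (gradient (f k) x))^2)))"
    using C ct(1)[of k] by blast
   ultimately have "ennreal ((LINT x|M. (f k x)^2) - ?m^2) <= C * (NN M (%x. ennreal ((norm (g k x))^2)))"
    unfolding ct(2) by simp
   also have "(NN M (%x. ennreal ((norm (g k x))^2))) = ennreal (LINT x|M. (norm (g k x))^2)"
    by (rule nn_integral_eq_integral, rule integrable_const_bound[of _ "(1 + 4 * exp 1)^2"]) (use gb in auto)
   finally show ?thesis using real by (simp add: ennreal_mult'[symmetric] ennreal_le_iff)
  qed
  hence "(LINT x|M. (e <.> x)^2) - (LINT x|M. e <.> x)^2 <= r * (LINT x|M. (norm e)^2)"
   by (intro LIMSEQ_le[OF tendsto_diff[OF L2 tendsto_power[OF L1]] tendsto_mult_left[OF L3]]) blast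
  thus ?thesis using real e by (simp add: prob_space ennreal_leI)
 qed simp
qed

lemma Ck_scale: "Ck k f ==> Ck k (%x. a * f x)"
proof (induction k arbitrary: f)
 case (Suc k)
 have "frechet_derivative (%x. a * f x) (at x) = (%v. a * frechet_derivative f (at x) v)" for x
  using Suc.prems by (intro frechet_derivative_at[symmetric] has_derivative_mult_right) (simp add: frechet_derivative_works)
 thus ?case using Suc by simp
qed (simp add: continuous_on_mult_left)

lemma test_function_scale:
 assumes f: "test_function f" shows "test_function (%x. a * f x)"
proof -
 have "bounded {x. f x ~= 0}" using f by (simp add: test_function_def)
 hence "bounded {x. a * f x ~= 0}" by (rule bounded_subset) auto
 thus ?thesis using f Ck_scale by (auto simp: test_function_def)
qed

section \<open>The Poincare constant along the geodesic and both directions of the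
  equivalence\<close>

context slc_pair begin

abbreviation "interp s \<equiv> distr mu0 borel (F s)"

lemma interp_test_function:
 assumes f: "test_function f"
 shows "Var (interp s) f = var s f"
  and "(NN (interp s) (%x. ennreal ((norm (gradient f x))^2))) = ennreal ((l2 mu0 (%x. gradient f (F s x)))^2)"
proof -
 obtain K L where "tame f K L" using test_function_tame[OF f] by blast
 note KL = tameD[OF this]
 note [measurable] = KL(8,9)
 show "Var (interp s) f = var s f" unfolding Var_def var_def mean_def by (subst (1 2) integral_distr) auto
 show "(NN (interp s) (%x. ennreal ((norm (gradient f x))^2))) = ennreal ((l2 mu0 (%x. gradient f (F s x)))^2)"
  using nn_integral_eq_integral[of mu0 "%x. (norm (gradient f (F s x)))^2"] sqint_gradient[OF f, of s]
  by (subst nn_integral_distr) (auto simp: sqint_def l2_square)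
qed

lemma poincare_constant_upper:
 assumes s: "0 <= s" "s <= 1" shows "poincare_constant (interp s) <= ennreal ((c s)^2)"
 unfolding poincare_constant_def
proof (rule Inf_lower, intro CollectI allI impI)
 fix f :: "'a => real" assume f: "test_function f"
 show "ennreal (Var (interp s) f) <= ennreal ((c s)^2) * (NN (interp s) (%x. ennreal ((norm (gradient f x))^2)))"
  using variance_bound[OF s f] unfolding interp_test_function[OF f]
  by (simp add: power_mult_distrib ennreal_mult'[symmetric] ennreal_leI)
qed

lemma near_extremal_exists:
 assumes t: "0 < t" "t < 1" and C: "poincare_constant (interp t) = ennreal ((c t)^2)" and d: "dl > 0"
 shows "EX f. test_function f & var t f = 1 & (l2 mu0 (%x. c t *. gradient f (F t x)))^2 <= 1 + dl"
proof -
 have c0: "c t > 0" using t k0 k1 by (simp add: c_def add_pos_pos)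
 \<comment> \<open>A constant below \<open>(c t)^2\<close> fails for some test function; after
   scaling that function to variance 1, the factor \<open>1 + dl\<close> is its defect from
   extremality.\<close>
 let ?C = "(c t)^2 / (1 + dl)"
 have "?C < (c t)^2" using c0 d by (simp add: field_simps)
 hence "ennreal ?C < poincare_constant (interp t)" unfolding C using d by (intro ennreal_lessI) auto
 hence "ennreal ?C ~: {C. ALL f. test_function f --> ennreal (Var (interp t) f) <= C * (NN (interp t) (%x. ennreal ((norm (gradient f x))^2)))}"
  unfolding poincare_constant_def by (metis (no_types, lifting) Inf_lower leD)
 then obtain f where f: "test_function f"
  and "~ ennreal (Var (interp t) f) <= ennreal ?C * (NN (interp t) (%x. ennreal ((norm (gradient f x))^2)))" by blast
 hence lt: "?C * (l2 mu0 (%x. gradient f (F t x)))^2 < var t f"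
  using d unfolding interp_test_function[OF f] by (simp add: ennreal_mult'[symmetric] ennreal_leI not_le[symmetric])
 moreover have "0 <= ?C * (l2 mu0 (%x. gradient f (F t x)))^2" using d by simp
 ultimately have v: "var t f > 0" by linarith
 define a where "a = 1 / sqrt (var t f)"
 define h where "h x = a * f x" for x
 obtain K L where "tame f K L" using test_function_tame[OF f] by blast
 note KL = tameD[OF this]
 have gh: "gradient h x = a *. gradient f x" for x
 proof (rule gradient_eqI)
  have "((%x. a * f x) has_derivative (%k. a * (k <.> gradient f x))) (at x)"
   using KL(5)[of x] unfolding gderiv_def by (rule has_derivative_mult_right)
  thus "GDERIV h x :> a *. gradient f x" by (simp add: gderiv_def h_def[abs_def])
 qed
 have a2: "a^2 * var t f = 1" using v by (simp add: a_def power_divide)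
 have "var t h = a^2 * var t f" by (simp add: var_def mean_def h_def right_diff_distrib[symmetric] power_mult_distrib)
 hence "var t h = 1" using a2 by simp
 moreover have "(l2 mu0 (%x. c t *. gradient h (F t x)))^2 = a^2 * ((c t)^2 * (l2 mu0 (%x. gradient f (F t x)))^2)"
  unfolding gh l2_scale by (simp add: power_mult_distrib)
 moreover have "(c t)^2 * (l2 mu0 (%x. gradient f (F t x)))^2 <= (1 + dl) * var t f" using lt d by (simp add: field_simps)
 from mult_left_mono[OF this, of "a^2"] have "a^2 * ((c t)^2 * (l2 mu0 (%x. gradient f (F t x)))^2) <= 1 + dl"
  using a2 by (simp add: mult.left_commute)
 moreover have "test_function h" unfolding h_def[abs_def] by (rule test_function_scale[OF f])
 ultimately show ?thesis by (intro exI[of _ h]) simp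
qed

lemma extremal_imp_splits:
 assumes t: "0 < t" "t < 1" and C: "poincare_constant (interp t) = ennreal ((c t)^2)"
 shows "EX e. norm e = 1 & (EX nu0 : space (prob_algebra (perp_borel e)). EX nu1 : space (prob_algebra (perp_borel e)).
  splits_gaussian e ka0 mu0 nu0 & splits_gaussian e ka1 mu1 nu1)"
proof -
 obtain e where e: "norm e = 1" "1 <= sqrt ka0 * l2 mu0 (%x. e <.> (x - (LINT x|mu0. x)))"
  "1 <= sqrt ka1 * l2 mu0 (%x. e <.> (T x - (LINT x|mu0. T x)))"
  by (rule extremal_direction[OF t near_extremal_exists[OF t C]]) assumption+
 have m: "(LINT x|mu0. T x) = (LINT x|mu1. x)" 
  by (rule integral_distr[of T mu0 borel "%x. x", unfolded T_distr, symmetric]) measurable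
 have "l2 mu0 (%x. e <.> (T x - (LINT x|mu1. x))) = l2 mu1 (%x. e <.> (x - (LINT x|mu1. x)))" unfolding l2_def
  by (rule arg_cong[of _ _ sqrt], rule integral_distr[of T mu0 borel "%x. (norm (e <.> (x - (LINT x|mu1. x))))^2", unfolded T_distr, symmetric]) measurable
 hence "1 <= sqrt ka1 * l2 mu1 (%x. e <.> (x - (LINT x|mu1. x)))" using e(3) unfolding m by simp
 from slc_extremal_splits_gaussian[OF k1 w1 n1[unfolded mu1] e(1) this[unfolded mu1], folded mu1]
  slc_extremal_splits_gaussian[OF k0 w0 n0[unfolded mu0] e(1) e(2)[unfolded mu0], folded mu0] e(1)
 show ?thesis by blast
qed

end

context slc_split begin

lemma poincare_constant_interp:
 assumes s: "0 <= s" "s <= 1" shows "poincare_constant (interp s) = ennreal ((c s)^2)"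
proof (rule antisym[OF poincare_constant_upper[OF s]])
 note v = variance_inner_F[OF s]
 have m: "F s : mu0 ->M borel" by measurable
 have qF: "sqint mu0 (F s)" unfolding F_def[abs_def] by (intro sqint_add sqint_scale sqint_id sqint_T)
 have q: "sqint (interp s) (%x. e <.> x)" "sqint (interp s) (%x. x)"
  using v(1) qF integrable_distr_eq[OF m, of "%x. (norm (e <.> x))^2"] integrable_distr_eq[OF m, of "%x. (norm x)^2"]
  by (auto simp: sqint_def)
 have "ennreal ((LINT x|(interp s). (e <.> x)^2) - (LINT x|(interp s). e <.> x)^2) <= poincare_constant (interp s)"
  by (rule poincare_constant_lower[OF P0.prob_space_distr[OF m] _ q e]) simp
 thus "ennreal ((c s)^2) <= poincare_constant (interp s)"
  using v(2) integral_distr[OF m, of "%x. (e <.> x)^2"] integral_distr[OF m, of "%x. e <.> x"] by simp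
qed

end

no_notation scaleR (infixr "*." 75) and inner (infixl "<.>" 70)

theorem theorem1p4:
 fixes \<mu>\<^sub>0 \<mu>\<^sub>1 :: "(real ^ 'n) measure"
  and \<mu> :: "real \<Rightarrow> (real ^ 'n) measure"
  and \<kappa>\<^sub>0 \<kappa>\<^sub>1 t :: real
 assumes "\<kappa>\<^sub>0 > 0" and "\<kappa>\<^sub>1 > 0"
  and "strongly_log_concave \<kappa>\<^sub>0 \<mu>\<^sub>0" and "strongly_log_concave \<kappa>\<^sub>1 \<mu>\<^sub>1"
  and "wasserstein_geodesic \<mu>\<^sub>0 \<mu>\<^sub>1 \<mu>"
  and "0 < t" and "t < 1"
 shows
  "(poincare_constant (\<mu> t) = ennreal (((1 - t) / sqrt \<kappa>\<^sub>0 + t / sqrt \<kappa>\<^sub>1)\<^sup>2) \<longleftrightarrow>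
    (\<exists>e. norm e = 1 \<and>
     (\<exists>\<nu>\<^sub>0 \<in> space (prob_algebra (perp_borel e)). \<exists>\<nu>\<^sub>1 \<in> space (prob_algebra (perp_borel e)).
       splits_gaussian e \<kappa>\<^sub>0 \<mu>\<^sub>0 \<nu>\<^sub>0 \<and> splits_gaussian e \<kappa>\<^sub>1 \<mu>\<^sub>1 \<nu>\<^sub>1))) \<and>
   (\<forall>e. norm e = 1 \<longrightarrow>
    (\<forall>\<nu>\<^sub>0 \<in> space (prob_algebra (perp_borel e)). \<forall>\<nu>\<^sub>1 \<in> space (prob_algebra (perp_borel e)).
      splits_gaussian e \<kappa>\<^sub>0 \<mu>\<^sub>0 \<nu>\<^sub>0 \<and> splits_gaussian e \<kappa>\<^sub>1 \<mu>\<^sub>1 \<nu>\<^sub>1 \<longrightarrow>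
       optimal_transport_splits e \<mu>\<^sub>0 \<mu>\<^sub>1
        (gaussian (e \<bullet> (\<integral>x. x \<partial>\<mu>\<^sub>0)) (inverse \<kappa>\<^sub>0)) (gaussian (e \<bullet> (\<integral>x. x \<partial>\<mu>\<^sub>1)) (inverse \<kappa>\<^sub>1))
        \<nu>\<^sub>0 \<nu>\<^sub>1 \<and>
       (\<forall>s\<in>{0..1}. poincare_constant (\<mu> s) =
        ennreal (((1 - s) / sqrt \<kappa>\<^sub>0 + s / sqrt \<kappa>\<^sub>1)\<^sup>2))))"
proof -
 obtain \<rho>0 where w0: "slc_weight \<kappa>\<^sub>0 \<rho>0" and \<mu>0: "\<mu>\<^sub>0 = density lborel (\<lambda>x. ennreal (\<rho>0 x))" and p0: "prob_space \<mu>\<^sub>0"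
  using strongly_log_concave_weight[OF assms(3)] .
 obtain \<rho>1 where w1: "slc_weight \<kappa>\<^sub>1 \<rho>1" and \<mu>1: "\<mu>\<^sub>1 = density lborel (\<lambda>x. ennreal (\<rho>1 x))" and p1: "prob_space \<mu>\<^sub>1"
  using strongly_log_concave_weight[OF assms(4)] .
 note n0 = nice_slc[OF w0 assms(1) p0[unfolded \<mu>0], folded \<mu>0] and n1 = nice_slc[OF w1 assms(2) p1[unfolded \<mu>1], folded \<mu>1]
 obtain T \<phi> \<psi> where T: "brenier (interior {x. \<rho>0 x > 0}) \<mu>\<^sub>0 \<mu>\<^sub>1 T \<phi> \<psi>"
  by (rule brenier_exists[OF n0 p1 nice_sets[OF n1] nice_sq[OF n1]])
 interpret slc_pair \<kappa>\<^sub>0 \<kappa>\<^sub>1 \<rho>0 \<rho>1 \<mu>\<^sub>0 \<mu>\<^sub>1 "interior {x. \<rho>0 x > 0}" "interior {x. \<rho>1 x > 0}" T \<phi> \<psi>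
  by (rule slc_pair.intro[OF assms(1) w0 \<mu>0 n0 assms(2) w1 \<mu>1 n1 T])
 obtain R where R: "optimal_map \<mu>\<^sub>0 \<mu>\<^sub>1 R" and \<mu>: "\<And>s. s \<in> {0..1} \<Longrightarrow> \<mu> s = distr \<mu>\<^sub>0 borel (\<lambda>x. (1 - s) *\<^sub>R x + s *\<^sub>R R x)"
  using assms(5) unfolding wasserstein_geodesic_def by blast
 note Rm [measurable] = optimal_map_AE(1)[OF R]
 \<comment> \<open>The geodesic comes with its own optimal map \<open>R\<close>; this agrees with
   \<open>T\<close> almost everywhere, so the interpolations coincide.\<close>
 have \<mu>s: "\<mu> s = interp s" if "s \<in> {0..1}" for s
  unfolding \<mu>[OF that]
  by (rule distr_cong_AE) (use optimal_map_AE(2)[OF R] in \<open>auto simp: F_def elim: eventually_mono\<close>)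
 have conv: "optimal_transport_splits e \<mu>\<^sub>0 \<mu>\<^sub>1
    (gaussian (e \<bullet> (\<integral>x. x \<partial>\<mu>\<^sub>0)) (inverse \<kappa>\<^sub>0)) (gaussian (e \<bullet> (\<integral>x. x \<partial>\<mu>\<^sub>1)) (inverse \<kappa>\<^sub>1)) \<nu>\<^sub>0 \<nu>\<^sub>1
   \<and> (\<forall>s\<in>{0..1}. poincare_constant (\<mu> s) = ennreal ((c s)\<^sup>2))"
  if h: "norm e = 1" "\<nu>\<^sub>0 \<in> space (prob_algebra (perp_borel e))" "\<nu>\<^sub>1 \<in> space (prob_algebra (perp_borel e))"
   "splits_gaussian e \<kappa>\<^sub>0 \<mu>\<^sub>0 \<nu>\<^sub>0" "splits_gaussian e \<kappa>\<^sub>1 \<mu>\<^sub>1 \<nu>\<^sub>1" for e \<nu>\<^sub>0 \<nu>\<^sub>1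
 proof -
  interpret S: slc_split \<kappa>\<^sub>0 \<kappa>\<^sub>1 \<rho>0 \<rho>1 \<mu>\<^sub>0 \<mu>\<^sub>1 "interior {x. \<rho>0 x > 0}" "interior {x. \<rho>1 x > 0}" T \<phi> \<psi> e \<nu>\<^sub>0 \<nu>\<^sub>1
  proof (intro slc_split.intro slc_split_axioms.intro slc_pair_axioms h)
   show "prob_space \<nu>\<^sub>0" "sets \<nu>\<^sub>0 = sets (perp_borel e)" "prob_space \<nu>\<^sub>1" "sets \<nu>\<^sub>1 = sets (perp_borel e)"
    using h(2,3) by (auto simp: space_prob_algebra)
  qed
  show ?thesis using S.transport_splits[unfolded S.G0_def S.G1_def S.m0_def S.m1_def] S.poincare_constant_interp \<mu>s by simp
 qed
 have t: "t \<in> {0..1}" using assms by simp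
 show ?thesis
  unfolding c_def[symmetric]
 proof (intro conjI allI ballI impI iffI)
  assume "poincare_constant (\<mu> t) = ennreal ((c t)\<^sup>2)"
  thus "\<exists>e. norm e = 1 \<and> (\<exists>\<nu>\<^sub>0 \<in> space (prob_algebra (perp_borel e)). \<exists>\<nu>\<^sub>1 \<in> space (prob_algebra (perp_borel e)).
       splits_gaussian e \<kappa>\<^sub>0 \<mu>\<^sub>0 \<nu>\<^sub>0 \<and> splits_gaussian e \<kappa>\<^sub>1 \<mu>\<^sub>1 \<nu>\<^sub>1)"
   unfolding \<mu>s[OF t] by (rule extremal_imp_splits[OF assms(6,7)])
 qed (use conv t in blast)+
qed

end
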